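(* Let $K$ be a field, let $E$ be a finite graph without sinks, and let $\sigma$ be an automorphism of $E$, with induced graded automorphism of the Leavitt path algebra $L_K(E)$ also denoted $\sigma$; let $\bar\sigma$ denote the restriction of this algebra automorphism to the degree-zero component $L_K(E)_0$. Then $(L_K(E)^{\sigma})_0 \cong L_K(E)_0$, and $$\operatorname{proj} L_K(E_\sigma)\;\simeq\;\operatorname{proj} L_K(E)^\sigma\;\simeq\;\big(\mathsf{Mod}\text{-}L_K(E)_0,\ L_K(E)_0,\ \bar\sigma^{*}\circ(-\otimes_{L_K(E)_0}L_K(E)_1)\big).$$ In particular, $\operatorname{proj} L_K(E)\simeq(\mathsf{Mod}\text{-}L_K(E)_0,\ L_K(E)_0,\ -\otimes_{L_K(E)_0}L_K(E)_1)$ and $\operatorname{proj} L_K(E)^\sigma$ have the same underlying pair $(\mathcal C,\mathcal O)$ (category and distinguished object, up to equivalence), and they differ at most in the shift functor.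
   Context: A graph $E=(E^0,E^1,s,r)$ consists of disjoint sets $E^0$ (vertices) and $E^1$ (edges) and maps $s,r\colon E^1\to E^0$; it is finite if both sets are finite. A sink is a vertex $v$ with $s^{-1}(v)=\emptyset$; a regular vertex is one with $0<|s^{-1}(v)|<\infty$. An automorphism of $E$ is a pair $\sigma=(\sigma_0,\sigma_1)$ of bijections of $E^0$ and $E^1$ with $s\circ\sigma_1=\sigma_0\circ s$, $r\circ\sigma_1=\sigma_0\circ r$. The twisted graph is $E_\sigma=(E^0,E^1,s,r_\sigma)$ with $r_\sigma=\sigma_0^{-1}\circ r$. The Leavitt path algebra $L_K(E)$ is the $K$-algebra generated by $E^0\cup E^1\cup\{e^*\mid e\in E^1\}$ subject to: (1) $vw=\delta_{v,w}w$; (2) $s(e)e=e=er(e)$, $e^*s(e)=e^*=r(e)e^*$; (3) $e^*f=\delta_{e,f}r(e)$; (4) $v=\sum_{e\in s^{-1}(v)}ee^*$ for every regular vertex $v$; it is $\mathbb Z$-graded by $\deg v=0$, $\deg e=1$, $\deg e^*=-1$. The graph automorphism $\sigma$ induces the graded automorphism $v\mapsto\sigma_0(v)$, $e\mapsto\sigma_1(e)$, $e^*\mapsto\sigma_1(e)^*$ of $L_K(E)$. For a graded automorphism $\sigma$ of a $\mathbb Z$-graded algebra $A$, the Zhang twist $A^\sigma$ has the same underlying graded space and multiplication $a\star b=a\,\sigma^m(b)$ for $a\in A_m$. For an automorphism $\gamma$ of a ring $R$ and a right $R$-module $N$, $\gamma^*N$ is $N$ with the action $n\cdot b=n\gamma(b)$.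 All modules are right modules. $\mathsf{Gr}\text{-}A$ is the category of $\mathbb Z$-graded right $A$-modules with degree-preserving homomorphisms, $M(1)_n=M_{n+1}$. For a unital $\mathbb Z$-graded $K$-algebra $A$ put $I_A=A\big(\bigoplus_{n\ne0}A_n\big)A$. A full subcategory of a Grothendieck category is localizing if closed under subobjects, quotients, extensions and arbitrary direct sums. $\mathrm{Tors}_I(A)$ is the smallest localizing subcategory of $\mathsf{Gr}\text{-}A$ containing every graded $M$ with $MI_A=0$; $\mathsf{QGr}_I\text{-}A=\mathsf{Gr}\text{-}A/\mathrm{Tors}_I(A)$ with quotient functor $\pi$; and $\operatorname{proj}A=(\mathsf{QGr}_I\text{-}A,\pi(A_A),s)$ with $s$ induced by $M\mapsto M(1)$. Two triples $(\mathcal C,\mathcal O,s)$, $(\mathcal C',\mathcal O',s')$ are equivalent ($\simeq$) if there is an equivalence $G\colon\mathcal C\to\mathcal C'$ with $G(\mathcal O)\cong\mathcal O'$ and a natural isomorphism $G\circ s\cong s'\circ G$. *)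

theory Defs
  imports
    "Graph_Theory.Digraph"
    "HOL-Library.Equipollence"
    "HOL-Algebra.Generated_Groups"
    "HOL-Algebra.Free_Abelian_Groups"
    "HOL-Algebra.QuotRing"
    "HOL-Algebra.Module"
begin

section \<open>Categories\<close>

text \<open>
  Composition is written in the usual order and carries the objects:
  for \<open>f \<in> hom X Y\<close> and \<open>g \<in> hom Y Z\<close>, \<open>comp X Y Z g f \<in> hom X Z\<close>.
\<close>

record ('o, 'm) cat =
  cobj :: "'o set"
  chom :: "'o \<Rightarrow> 'o \<Rightarrow> 'm set"
  cid :: "'o \<Rightarrow> 'm"
  ccomp :: "'o \<Rightarrow> 'o \<Rightarrow> 'o \<Rightarrow> 'm \<Rightarrow> 'm \<Rightarrow> 'm"

locale category =
  fixes C :: "('o, 'm) cat"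
  assumes id_closed: "X \<in> cobj C \<Longrightarrow> cid C X \<in> chom C X X"
    and comp_closed:
      "\<lbrakk>X \<in> cobj C; Y \<in> cobj C; Z \<in> cobj C; f \<in> chom C X Y; g \<in> chom C Y Z\<rbrakk>
        \<Longrightarrow> ccomp C X Y Z g f \<in> chom C X Z"
    and comp_assoc:
      "\<lbrakk>W \<in> cobj C; X \<in> cobj C; Y \<in> cobj C; Z \<in> cobj C;
        f \<in> chom C W X; g \<in> chom C X Y; h \<in> chom C Y Z\<rbrakk>
        \<Longrightarrow> ccomp C W Y Z h (ccomp C W X Y g f) = ccomp C W X Z (ccomp C X Y Z h g) f"
    and id_left:
      "\<lbrakk>X \<in> cobj C; Y \<in> cobj C; f \<in> chom C X Y\<rbrakk> \<Longrightarrow> ccomp C X Y Y (cid C Y) f = f"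
    and id_right:
      "\<lbrakk>X \<in> cobj C; Y \<in> cobj C; f \<in> chom C X Y\<rbrakk> \<Longrightarrow> ccomp C X X Y f (cid C X) = f"

definition is_isomorphism :: "('o, 'm) cat \<Rightarrow> 'o \<Rightarrow> 'o \<Rightarrow> 'm \<Rightarrow> bool" where
  "is_isomorphism C X Y f \<longleftrightarrow> f \<in> chom C X Y \<and>
     (\<exists>g \<in> chom C Y X. ccomp C X Y X g f = cid C X \<and> ccomp C Y X Y f g = cid C Y)"

definition isomorphic_in :: "('o, 'm) cat \<Rightarrow> 'o \<Rightarrow> 'o \<Rightarrow> bool" where
  "isomorphic_in C X Y \<longleftrightarrow> (\<exists>f. is_isomorphism C X Y f)"

definition is_mono :: "('o, 'm) cat \<Rightarrow> 'o \<Rightarrow> 'o \<Rightarrow> 'm \<Rightarrow> bool" where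
  "is_mono C X Y f \<longleftrightarrow> f \<in> chom C X Y \<and>
     (\<forall>W \<in> cobj C. \<forall>a \<in> chom C W X. \<forall>b \<in> chom C W X.
        ccomp C W X Y f a = ccomp C W X Y f b \<longrightarrow> a = b)"

definition is_epi :: "('o, 'm) cat \<Rightarrow> 'o \<Rightarrow> 'o \<Rightarrow> 'm \<Rightarrow> bool" where
  "is_epi C X Y f \<longleftrightarrow> f \<in> chom C X Y \<and>
     (\<forall>Z \<in> cobj C. \<forall>a \<in> chom C Y Z. \<forall>b \<in> chom C Y Z.
        ccomp C X Y Z a f = ccomp C X Y Z b f \<longrightarrow> a = b)"

definition is_zero_object :: "('o, 'm) cat \<Rightarrow> 'o \<Rightarrow> bool" where
  "is_zero_object C Z \<longleftrightarrow> Z \<in> cobj C \<and>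
     (\<forall>X \<in> cobj C. (\<exists>!f. f \<in> chom C X Z) \<and> (\<exists>!f. f \<in> chom C Z X))"

definition is_zero_morphism :: "('o, 'm) cat \<Rightarrow> 'o \<Rightarrow> 'o \<Rightarrow> 'm \<Rightarrow> bool" where
  "is_zero_morphism C X Y f \<longleftrightarrow>
     (\<exists>Z a b. is_zero_object C Z \<and> a \<in> chom C X Z \<and> b \<in> chom C Z Y \<and> f = ccomp C X Z Y b a)"

definition is_kernel :: "('o, 'm) cat \<Rightarrow> 'o \<Rightarrow> 'o \<Rightarrow> 'o \<Rightarrow> 'm \<Rightarrow> 'm \<Rightarrow> bool" where
  "is_kernel C N X Y k f \<longleftrightarrow>
     N \<in> cobj C \<and> k \<in> chom C N X \<and> is_zero_morphism C N Y (ccomp C N X Y f k) \<and>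
     (\<forall>W \<in> cobj C. \<forall>a \<in> chom C W X. is_zero_morphism C W Y (ccomp C W X Y f a) \<longrightarrow>
        (\<exists>!b. b \<in> chom C W N \<and> ccomp C W N X k b = a))"

definition is_cokernel :: "('o, 'm) cat \<Rightarrow> 'o \<Rightarrow> 'o \<Rightarrow> 'o \<Rightarrow> 'm \<Rightarrow> 'm \<Rightarrow> bool" where
  "is_cokernel C X Y Q f q \<longleftrightarrow>
     Q \<in> cobj C \<and> q \<in> chom C Y Q \<and> is_zero_morphism C X Q (ccomp C X Y Q q f) \<and>
     (\<forall>W \<in> cobj C. \<forall>a \<in> chom C Y W. is_zero_morphism C X W (ccomp C X Y W a f) \<longrightarrow>
        (\<exists>!b. b \<in> chom C Q W \<and> ccomp C Y Q W b q = a))"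

definition is_short_exact :: "('o, 'm) cat \<Rightarrow> 'o \<Rightarrow> 'o \<Rightarrow> 'o \<Rightarrow> 'm \<Rightarrow> 'm \<Rightarrow> bool" where
  "is_short_exact C X Y Z f g \<longleftrightarrow> is_kernel C X Y Z f g \<and> is_cokernel C X Y Z f g"

definition is_coproduct ::
  "('o, 'm) cat \<Rightarrow> 'j set \<Rightarrow> ('j \<Rightarrow> 'o) \<Rightarrow> 'o \<Rightarrow> ('j \<Rightarrow> 'm) \<Rightarrow> bool" where
  "is_coproduct C J F X i \<longleftrightarrow> X \<in> cobj C \<and> (\<forall>j \<in> J. F j \<in> cobj C \<and> i j \<in> chom C (F j) X) \<and>
     (\<forall>W \<in> cobj C. \<forall>a. (\<forall>j \<in> J. a j \<in> chom C (F j) W) \<longrightarrow>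
        (\<exists>!b. b \<in> chom C X W \<and> (\<forall>j \<in> J. ccomp C (F j) X W b (i j) = a j)))"

record ('o, 'm, 'p, 'n) functr =
  fobj :: "'o \<Rightarrow> 'p"
  fmap :: "'o \<Rightarrow> 'o \<Rightarrow> 'm \<Rightarrow> 'n"

locale cat_functor = C: category C + D: category D
  for C :: "('o, 'm) cat" and D :: "('p, 'n) cat" +
  fixes F :: "('o, 'm, 'p, 'n) functr"
  assumes obj_closed: "X \<in> cobj C \<Longrightarrow> fobj F X \<in> cobj D"
    and map_closed:
      "\<lbrakk>X \<in> cobj C; Y \<in> cobj C; f \<in> chom C X Y\<rbrakk>
        \<Longrightarrow> fmap F X Y f \<in> chom D (fobj F X) (fobj F Y)"
    and map_id: "X \<in> cobj C \<Longrightarrow> fmap F X X (cid C X) = cid D (fobj F X)"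
    and map_comp:
      "\<lbrakk>X \<in> cobj C; Y \<in> cobj C; Z \<in> cobj C; f \<in> chom C X Y; g \<in> chom C Y Z\<rbrakk>
        \<Longrightarrow> fmap F X Z (ccomp C X Y Z g f)
          = ccomp D (fobj F X) (fobj F Y) (fobj F Z) (fmap F Y Z g) (fmap F X Y f)"

definition id_functr :: "('o, 'm, 'o, 'm) functr" where
  "id_functr = \<lparr>fobj = (\<lambda>X. X), fmap = (\<lambda>X Y f. f)\<rparr>"

definition comp_functr ::
  "('p, 'n, 'q, 'k) functr \<Rightarrow> ('o, 'm, 'p, 'n) functr \<Rightarrow> ('o, 'm, 'q, 'k) functr" where
  "comp_functr G F = \<lparr>fobj = (\<lambda>X. fobj G (fobj F X)),
     fmap = (\<lambda>X Y f. fmap G (fobj F X) (fobj F Y) (fmap F X Y f))\<rparr>"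

definition nat_isomorphic ::
  "('o, 'm) cat \<Rightarrow> ('p, 'n) cat \<Rightarrow> ('o, 'm, 'p, 'n) functr \<Rightarrow> ('o, 'm, 'p, 'n) functr \<Rightarrow> bool" where
  "nat_isomorphic C D F G \<longleftrightarrow> (\<exists>\<eta>.
     (\<forall>X \<in> cobj C. is_isomorphism D (fobj F X) (fobj G X) (\<eta> X)) \<and>
     (\<forall>X \<in> cobj C. \<forall>Y \<in> cobj C. \<forall>f \<in> chom C X Y.
        ccomp D (fobj F X) (fobj F Y) (fobj G Y) (\<eta> Y) (fmap F X Y f)
        = ccomp D (fobj F X) (fobj G X) (fobj G Y) (fmap G X Y f) (\<eta> X)))"

definition is_equivalence ::
  "('o, 'm) cat \<Rightarrow> ('p, 'n) cat \<Rightarrow> ('o, 'm, 'p, 'n) functr \<Rightarrow> bool" where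
  "is_equivalence C D G \<longleftrightarrow> cat_functor C D G \<and>
     (\<exists>H. cat_functor D C H \<and>
        nat_isomorphic C C (comp_functr H G) id_functr \<and>
        nat_isomorphic D D (comp_functr G H) id_functr)"

type_synonym ('o, 'm) triple = "('o, 'm) cat \<times> 'o \<times> ('o, 'm, 'o, 'm) functr"

definition is_triple :: "('o, 'm) triple \<Rightarrow> bool" where
  "is_triple = (\<lambda>(C, X, s). X \<in> cobj C \<and> cat_functor C C s)"

definition triple_equiv :: "('o, 'm) triple \<Rightarrow> ('p, 'n) triple \<Rightarrow> bool" where
  "triple_equiv = (\<lambda>(C, X, s) (C', X', s').
     is_triple (C, X, s) \<and> is_triple (C', X', s') \<and>
     (\<exists>G. is_equivalence C C' G \<and> isomorphic_in C' (fobj G X) X' \<and>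
        nat_isomorphic C C' (comp_functr G s) (comp_functr s' G)))"

definition pair_equiv :: "('o, 'm) cat \<times> 'o \<Rightarrow> ('p, 'n) cat \<times> 'p \<Rightarrow> bool" where
  "pair_equiv = (\<lambda>(C, X) (C', X').
     X \<in> cobj C \<and> X' \<in> cobj C' \<and>
     (\<exists>G. is_equivalence C C' G \<and> isomorphic_in C' (fobj G X) X'))"

definition underlying_pair :: "('o, 'm) triple \<Rightarrow> ('o, 'm) cat \<times> 'o" where
  "underlying_pair = (\<lambda>(C, X, s). (C, X))"

section \<open>Localizing subcategories and quotient categories\<close>

text \<open>
  Full subcategories are given by sets of objects.  Index sets of families are taken in the type
  of objects; for the categories of modules below this is no restriction, because a coproduct that
  exists has at most as many nonzero summands as there are elements in the universe type.
\<close>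

definition is_localizing :: "('o, 'm) cat \<Rightarrow> 'o set \<Rightarrow> bool" where
  "is_localizing C T \<longleftrightarrow> T \<subseteq> cobj C \<and>
     (\<forall>X \<in> cobj C. \<forall>Y \<in> T. \<forall>f. is_mono C X Y f \<longrightarrow> X \<in> T) \<and>
     (\<forall>X \<in> T. \<forall>Y \<in> cobj C. \<forall>f. is_epi C X Y f \<longrightarrow> Y \<in> T) \<and>
     (\<forall>X \<in> T. \<forall>Y \<in> cobj C. \<forall>Z \<in> T. \<forall>f g. is_short_exact C X Y Z f g \<longrightarrow> Y \<in> T) \<and>
     (\<forall>(J :: 'o set) F X i. (\<forall>j \<in> J. F j \<in> T) \<and> is_coproduct C J F X i \<longrightarrow> X \<in> T)"

text \<open>
  The quotient category is the localization at the morphisms with kernel and cokernel in \<open>T\<close>,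
  described by the calculus of right fractions: a morphism from \<open>X\<close> to \<open>Y\<close> is a class of
  roofs \<open>X \<leftarrow>s\<midarrow> U \<midarrow>f\<rightarrow> Y\<close>, written \<open>(U, s, f)\<close>, with \<open>s\<close> inverted.
\<close>

definition inverted_morphisms :: "('o, 'm) cat \<Rightarrow> 'o set \<Rightarrow> 'o \<Rightarrow> 'o \<Rightarrow> 'm set" where
  "inverted_morphisms C T X Y = {f \<in> chom C X Y.
     (\<exists>N \<in> T. \<exists>k. is_kernel C N X Y k f) \<and> (\<exists>Q \<in> T. \<exists>q. is_cokernel C X Y Q f q)}"

definition roofs :: "('o, 'm) cat \<Rightarrow> 'o set \<Rightarrow> 'o \<Rightarrow> 'o \<Rightarrow> ('o \<times> 'm \<times> 'm) set" where
  "roofs C T X Y =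
     {(U, s, f). U \<in> cobj C \<and> s \<in> inverted_morphisms C T U X \<and> f \<in> chom C U Y}"

definition roof_rel ::
  "('o, 'm) cat \<Rightarrow> 'o set \<Rightarrow> 'o \<Rightarrow> 'o \<Rightarrow> (('o \<times> 'm \<times> 'm) \<times> ('o \<times> 'm \<times> 'm)) set" where
  "roof_rel C T X Y =
     {((U, s, f), (V, t, g)) | U s f V t g.
        (U, s, f) \<in> roofs C T X Y \<and> (V, t, g) \<in> roofs C T X Y \<and>
        (\<exists>W \<in> cobj C. \<exists>a \<in> chom C W U. \<exists>b \<in> chom C W V.
           ccomp C W U X s a = ccomp C W V X t b \<and>
           ccomp C W U X s a \<in> inverted_morphisms C T W X \<and>
           ccomp C W U Y f a = ccomp C W V Y g b)}"

definition quotient_category ::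
  "('o, 'm) cat \<Rightarrow> 'o set \<Rightarrow> ('o, ('o \<times> 'm \<times> 'm) set) cat" where
  "quotient_category C T =
     \<lparr>cobj = cobj C,
      chom = (\<lambda>X Y. roofs C T X Y // roof_rel C T X Y),
      cid = (\<lambda>X. roof_rel C T X X `` {(X, cid C X, cid C X)}),
      ccomp = (\<lambda>X Y Z d c. roof_rel C T X Z ``
        {(W, ccomp C W U X s a, ccomp C W V Z g b) | W U V s f t g a b.
           (U, s, f) \<in> c \<and> (V, t, g) \<in> d \<and> W \<in> cobj C \<and>
           a \<in> inverted_morphisms C T W U \<and> b \<in> chom C W V \<and>
           ccomp C W U Y f a = ccomp C W V Y t b})\<rparr>"

definition quotient_functor ::
  "('o, 'm) cat \<Rightarrow> 'o set \<Rightarrow> ('o, 'm, 'o, ('o \<times> 'm \<times> 'm) set) functr" where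
  "quotient_functor C T =
     \<lparr>fobj = (\<lambda>X. X), fmap = (\<lambda>X Y f. roof_rel C T X Y `` {(X, cid C X, f)})\<rparr>"

definition induced_endofunctor ::
  "('o, 'm) cat \<Rightarrow> 'o set \<Rightarrow> ('o, 'm, 'o, 'm) functr
    \<Rightarrow> ('o, ('o \<times> 'm \<times> 'm) set, 'o, ('o \<times> 'm \<times> 'm) set) functr" where
  "induced_endofunctor C T S =
     \<lparr>fobj = fobj S,
      fmap = (\<lambda>X Y c. roof_rel C T (fobj S X) (fobj S Y) ``
        {(fobj S U, fmap S U X s, fmap S U Y f) | U s f. (U, s, f) \<in> c})\<rparr>"

section \<open>Right modules\<close>

text \<open>
  As for \<^typ>\<open>('a, 'b) module\<close>, the fields \<open>mult\<close> and \<open>one\<close> inherited from \<open>ring\<close> are unused.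
\<close>

record ('a, 'm) rmodule = "'m ring" +
  ract :: "'m \<Rightarrow> 'a \<Rightarrow> 'm"

locale right_module = R: ring R + M: abelian_group M
  for R :: "('a, 'r) ring_scheme" and M :: "('a, 'm, 'q) rmodule_scheme" +
  assumes ract_closed:
      "\<lbrakk>x \<in> carrier M; a \<in> carrier R\<rbrakk> \<Longrightarrow> ract M x a \<in> carrier M"
    and ract_add_left:
      "\<lbrakk>x \<in> carrier M; y \<in> carrier M; a \<in> carrier R\<rbrakk>
        \<Longrightarrow> ract M (x \<oplus>\<^bsub>M\<^esub> y) a = ract M x a \<oplus>\<^bsub>M\<^esub> ract M y a"
    and ract_add_right:
      "\<lbrakk>x \<in> carrier M; a \<in> carrier R; b \<in> carrier R\<rbrakk>
        \<Longrightarrow> ract M x (a \<oplus>\<^bsub>R\<^esub> b) = ract M x a \<oplus>\<^bsub>M\<^esub> ract M x b"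
    and ract_mult:
      "\<lbrakk>x \<in> carrier M; a \<in> carrier R; b \<in> carrier R\<rbrakk>
        \<Longrightarrow> ract M x (a \<otimes>\<^bsub>R\<^esub> b) = ract M (ract M x a) b"
    and ract_one: "x \<in> carrier M \<Longrightarrow> ract M x \<one>\<^bsub>R\<^esub> = x"

definition rmodule_hom ::
  "('a, 'r) ring_scheme \<Rightarrow> ('a, 'm, 'q) rmodule_scheme \<Rightarrow> ('a, 'm, 'q) rmodule_scheme
    \<Rightarrow> ('m \<Rightarrow> 'm) set" where
  "rmodule_hom R M N = {f \<in> carrier M \<rightarrow>\<^sub>E carrier N.
     (\<forall>x \<in> carrier M. \<forall>y \<in> carrier M. f (x \<oplus>\<^bsub>M\<^esub> y) = f x \<oplus>\<^bsub>N\<^esub> f y) \<and>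
     (\<forall>x \<in> carrier M. \<forall>a \<in> carrier R. f (ract M x a) = ract N (f x) a)}"

text \<open>
  The type \<open>'u\<close> of elements plays the role of the universe: the small modules are those
  whose underlying set is a set of elements of \<open>'u\<close>.
\<close>

definition Mod_cat :: "('a, 'r) ring_scheme \<Rightarrow> (('a, 'u) rmodule, 'u \<Rightarrow> 'u) cat" where
  "Mod_cat R =
     \<lparr>cobj = {M. right_module R M},
      chom = rmodule_hom R,
      cid = (\<lambda>M. \<lambda>x \<in> carrier M. x),
      ccomp = (\<lambda>L M N g f. compose (carrier L) g f)\<rparr>"

text \<open>
  An injection of a set into the universe, and the copy of a module along it.  These serve to
  regard modules whose elements have another type as small modules; they depend on the choice of
  the injection only up to isomorphism.
\<close>

definition small_inj :: "'x set \<Rightarrow> 'x \<Rightarrow> 'u" where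
  "small_inj X = (SOME j. inj_on j X)"

definition small_copy :: "('a, 'x) rmodule \<Rightarrow> ('a, 'u) rmodule" where
  "small_copy M =
     (let j = small_inj (carrier M); i = inv_into (carrier M) j in
      \<lparr>carrier = j ` carrier M, mult = undefined, one = undefined, zero = j \<zero>\<^bsub>M\<^esub>,
       add = (\<lambda>x y. j (i x \<oplus>\<^bsub>M\<^esub> i y)), ract = (\<lambda>x a. j (ract M (i x) a))\<rparr>)"

definition regular_rmodule :: "('a, 'r) ring_scheme \<Rightarrow> ('a, 'a) rmodule" where
  "regular_rmodule R =
     \<lparr>carrier = carrier R, mult = undefined, one = undefined, zero = \<zero>\<^bsub>R\<^esub>,
      add = add R, ract = mult R\<rparr>"

definition pullback_functor ::
  "('a \<Rightarrow> 'a) \<Rightarrow> (('a, 'u) rmodule, 'u \<Rightarrow> 'u, ('a, 'u) rmodule, 'u \<Rightarrow> 'u) functr" where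
  "pullback_functor \<gamma> =
     \<lparr>fobj = (\<lambda>N. N\<lparr>ract := (\<lambda>x b. ract N x (\<gamma> b))\<rparr>), fmap = (\<lambda>M N f. f)\<rparr>"

subsection \<open>Tensor products\<close>

record ('r, 's, 'b) bimodule = "('s, 'b) rmodule" +
  lact :: "'r \<Rightarrow> 'b \<Rightarrow> 'b"

definition tensor_relations ::
  "('r, 'z) ring_scheme \<Rightarrow> ('r, 'n) rmodule \<Rightarrow> ('r, 's, 'b) bimodule \<Rightarrow> ('n \<times> 'b \<Rightarrow>\<^sub>0 int) set" where
  "tensor_relations R N B =
     {frag_of (x \<oplus>\<^bsub>N\<^esub> y, b) - frag_of (x, b) - frag_of (y, b) | x y b.
        x \<in> carrier N \<and> y \<in> carrier N \<and> b \<in> carrier B} \<union>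
     {frag_of (x, b \<oplus>\<^bsub>B\<^esub> c) - frag_of (x, b) - frag_of (x, c) | x b c.
        x \<in> carrier N \<and> b \<in> carrier B \<and> c \<in> carrier B} \<union>
     {frag_of (ract N x r, b) - frag_of (x, lact B r b) | x r b.
        x \<in> carrier N \<and> r \<in> carrier R \<and> b \<in> carrier B}"

text \<open>Note that \<^const>\<open>free_Abelian_group\<close> and its quotient groups are written multiplicatively.\<close>

definition tensor_free ::
  "('r, 'n) rmodule \<Rightarrow> ('r, 's, 'b) bimodule \<Rightarrow> ('n \<times> 'b \<Rightarrow>\<^sub>0 int) monoid" where
  "tensor_free N B = free_Abelian_group (carrier N \<times> carrier B)"

definition tensor_kernel ::
  "('r, 'z) ring_scheme \<Rightarrow> ('r, 'n) rmodule \<Rightarrow> ('r, 's, 'b) bimodule \<Rightarrow> ('n \<times> 'b \<Rightarrow>\<^sub>0 int) set" where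
  "tensor_kernel R N B = generate (tensor_free N B) (tensor_relations R N B)"

definition tensor_class ::
  "('r, 'z) ring_scheme \<Rightarrow> ('r, 'n) rmodule \<Rightarrow> ('r, 's, 'b) bimodule
    \<Rightarrow> ('n \<times> 'b \<Rightarrow>\<^sub>0 int) \<Rightarrow> ('n \<times> 'b \<Rightarrow>\<^sub>0 int) set" where
  "tensor_class R N B x = tensor_kernel R N B #>\<^bsub>tensor_free N B\<^esub> x"

definition tensor_product ::
  "('r, 'z) ring_scheme \<Rightarrow> ('r, 'n) rmodule \<Rightarrow> ('r, 's, 'b) bimodule
    \<Rightarrow> ('s, ('n \<times> 'b \<Rightarrow>\<^sub>0 int) set) rmodule" where
  "tensor_product R N B =
     (let Q = tensor_free N B Mod tensor_kernel R N B in
      \<lparr>carrier = carrier Q, mult = undefined, one = undefined, zero = \<one>\<^bsub>Q\<^esub>, add = mult Q,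
       ract = (\<lambda>c s. \<Union>x \<in> c. tensor_class R N B
         (frag_extend (\<lambda>(n, b). frag_of (n, ract B b s)) x))\<rparr>)"

definition tensor_map ::
  "('r, 'z) ring_scheme \<Rightarrow> ('r, 's, 'b) bimodule \<Rightarrow> ('r, 'n) rmodule \<Rightarrow> ('n \<Rightarrow> 'n)
    \<Rightarrow> ('n \<times> 'b \<Rightarrow>\<^sub>0 int) set \<Rightarrow> ('n \<times> 'b \<Rightarrow>\<^sub>0 int) set" where
  "tensor_map R B N' f c =
     (\<Union>x \<in> c. tensor_class R N' B (frag_extend (\<lambda>(n, b). frag_of (f n, b)) x))"

definition tensor_functor ::
  "('r, 'z) ring_scheme \<Rightarrow> ('r, 's, 'b) bimodule
    \<Rightarrow> (('r, 'u) rmodule, 'u \<Rightarrow> 'u, ('s, 'u) rmodule, 'u \<Rightarrow> 'u) functr" where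
  "tensor_functor R B =
     \<lparr>fobj = (\<lambda>N. small_copy (tensor_product R N B)),
      fmap = (\<lambda>N N' f.
        (let X = carrier (tensor_product R N B); X' = carrier (tensor_product R N' B) in
         (\<lambda>y \<in> small_inj X ` X.
           small_inj X' (tensor_map R B N' f (inv_into X (small_inj X) y)))))\<rparr>"

section \<open>Graded algebras and graded modules\<close>

record ('k, 'a) galgebra = "('k, 'a) module" +
  homog :: "int \<Rightarrow> 'a set"

record ('a, 'm) grmodule = "('a, 'm) rmodule" +
  mhomog :: "int \<Rightarrow> 'm set"

definition is_decomposition ::
  "('m, 'q) ring_scheme \<Rightarrow> (int \<Rightarrow> 'm set) \<Rightarrow> 'm \<Rightarrow> (int \<Rightarrow> 'm) \<Rightarrow> bool" where
  "is_decomposition M D x f \<longleftrightarrow> (\<forall>n. f n \<in> D n) \<and> finite {n. f n \<noteq> \<zero>\<^bsub>M\<^esub>} \<and>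
     x = (\<Oplus>\<^bsub>M\<^esub>n \<in> {n. f n \<noteq> \<zero>\<^bsub>M\<^esub>}. f n)"

definition component :: "('m, 'q) ring_scheme \<Rightarrow> (int \<Rightarrow> 'm set) \<Rightarrow> 'm \<Rightarrow> int \<Rightarrow> 'm" where
  "component M D x = (THE f. is_decomposition M D x f)"

locale graded_right_module = right_module A M
  for A :: "('k, 'a) galgebra" and M :: "('a, 'm) grmodule" +
  assumes homog_subgroup: "subgroup (mhomog M n) (add_monoid M)"
    and homog_decomposition: "x \<in> carrier M \<Longrightarrow> \<exists>!f. is_decomposition M (mhomog M) x f"
    and homog_act:
      "\<lbrakk>x \<in> mhomog M n; a \<in> homog A k\<rbrakk> \<Longrightarrow> ract M x a \<in> mhomog M (n + k)"

definition Gr_cat :: "('k, 'a) galgebra \<Rightarrow> (('a, 'u) grmodule, 'u \<Rightarrow> 'u) cat" where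
  "Gr_cat A =
     \<lparr>cobj = {M. graded_right_module A M},
      chom = (\<lambda>M N. {f \<in> rmodule_hom A M N. \<forall>n. f ` mhomog M n \<subseteq> mhomog N n}),
      cid = (\<lambda>M. \<lambda>x \<in> carrier M. x),
      ccomp = (\<lambda>L M N g f. compose (carrier L) g f)\<rparr>"

definition shift_functor ::
  "(('a, 'u) grmodule, 'u \<Rightarrow> 'u, ('a, 'u) grmodule, 'u \<Rightarrow> 'u) functr" where
  "shift_functor =
     \<lparr>fobj = (\<lambda>M. M\<lparr>mhomog := (\<lambda>n. mhomog M (n + 1))\<rparr>), fmap = (\<lambda>M N f. f)\<rparr>"

definition small_regular :: "('k, 'a) galgebra \<Rightarrow> ('a, 'u) grmodule" where
  "small_regular A =
     rmodule.extend (small_copy (regular_rmodule A))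
       (grmodule.fields (\<lambda>n. small_inj (carrier A) ` homog A n))"

definition nonzero_degree_part :: "('k, 'a) galgebra \<Rightarrow> 'a set" where
  "nonzero_degree_part A = generate (add_monoid A) (\<Union>n \<in> - {0}. homog A n)"

definition ideal_I :: "('k, 'a) galgebra \<Rightarrow> 'a set" where
  "ideal_I A = generate (add_monoid A)
     {a \<otimes>\<^bsub>A\<^esub> x \<otimes>\<^bsub>A\<^esub> b | a x b. a \<in> carrier A \<and> x \<in> nonzero_degree_part A \<and> b \<in> carrier A}"

definition Tors :: "('k, 'a) galgebra \<Rightarrow> ('a, 'u) grmodule set" where
  "Tors A = \<Inter> {T. is_localizing (Gr_cat A) T \<and>
     {M \<in> cobj (Gr_cat A). \<forall>x \<in> carrier M. \<forall>a \<in> ideal_I A. ract M x a = \<zero>\<^bsub>M\<^esub>} \<subseteq> T}"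

definition QGr ::
  "('k, 'a) galgebra \<Rightarrow> (('a, 'u) grmodule,
     (('a, 'u) grmodule \<times> ('u \<Rightarrow> 'u) \<times> ('u \<Rightarrow> 'u)) set) cat" where
  "QGr A = quotient_category (Gr_cat A) (Tors A)"

definition proj ::
  "'u itself \<Rightarrow> ('k, 'a) galgebra \<Rightarrow> (('a, 'u) grmodule,
     (('a, 'u) grmodule \<times> ('u \<Rightarrow> 'u) \<times> ('u \<Rightarrow> 'u)) set) triple" where
  "proj U A =
     (QGr A,
      fobj (quotient_functor (Gr_cat A) (Tors A)) (small_regular A),
      induced_endofunctor (Gr_cat A) (Tors A) shift_functor)"

definition degree_zero :: "('k, 'a) galgebra \<Rightarrow> ('k, 'a) module" where
  "degree_zero A = module.truncate (A\<lparr>carrier := homog A 0\<rparr>)"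

definition homog_bimodule :: "('k, 'a) galgebra \<Rightarrow> int \<Rightarrow> ('a, 'a, 'a) bimodule" where
  "homog_bimodule A n =
     \<lparr>carrier = homog A n, mult = undefined, one = undefined, zero = \<zero>\<^bsub>A\<^esub>, add = add A,
      ract = mult A, lact = mult A\<rparr>"

definition algebra_isomorphic :: "('k, 'a) module \<Rightarrow> ('k, 'b) module \<Rightarrow> bool" where
  "algebra_isomorphic A B \<longleftrightarrow>
     (\<exists>h \<in> ring_iso A B. \<forall>k. \<forall>a \<in> carrier A. h (k \<odot>\<^bsub>A\<^esub> a) = k \<odot>\<^bsub>B\<^esub> h a)"

subsection \<open>Zhang twists\<close>

definition aut_power :: "'a set \<Rightarrow> ('a \<Rightarrow> 'a) \<Rightarrow> int \<Rightarrow> 'a \<Rightarrow> 'a" where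
  "aut_power X \<tau> m =
     (if 0 \<le> m then \<tau> ^^ nat m else inv_into X \<tau> ^^ nat (- m))"

text \<open>The rule \<open>a \<star> b = a \<tau>\<^sup>m(b)\<close> for \<open>a\<close> of degree \<open>m\<close>, extended additively in \<open>a\<close>.\<close>

definition zhang_twist :: "('k, 'a) galgebra \<Rightarrow> ('a \<Rightarrow> 'a) \<Rightarrow> ('k, 'a) galgebra" where
  "zhang_twist A \<tau> = A\<lparr>mult := (\<lambda>a b.
     \<Oplus>\<^bsub>A\<^esub>m \<in> {m. component A (homog A) a m \<noteq> \<zero>\<^bsub>A\<^esub>}.
       component A (homog A) a m \<otimes>\<^bsub>A\<^esub> aut_power (carrier A) \<tau> m b)\<rparr>"

section \<open>Leavitt path algebras\<close>

definition graph_automorphism :: "('v, 'e) pre_digraph \<Rightarrow> ('v \<Rightarrow> 'v) \<Rightarrow> ('e \<Rightarrow> 'e) \<Rightarrow> bool" where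
  "graph_automorphism E \<sigma>\<^sub>0 \<sigma>\<^sub>1 \<longleftrightarrow>
     bij_betw \<sigma>\<^sub>0 (verts E) (verts E) \<and> bij_betw \<sigma>\<^sub>1 (arcs E) (arcs E) \<and>
     (\<forall>e \<in> arcs E. tail E (\<sigma>\<^sub>1 e) = \<sigma>\<^sub>0 (tail E e) \<and> head E (\<sigma>\<^sub>1 e) = \<sigma>\<^sub>0 (head E e))"

definition twisted_graph :: "('v, 'e) pre_digraph \<Rightarrow> ('v \<Rightarrow> 'v) \<Rightarrow> ('v, 'e) pre_digraph" where
  "twisted_graph E \<sigma>\<^sub>0 = E\<lparr>head := (\<lambda>e. inv_into (verts E) \<sigma>\<^sub>0 (head E e))\<rparr>"

definition is_sink :: "('v, 'e) pre_digraph \<Rightarrow> 'v \<Rightarrow> bool" where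
  "is_sink E v \<longleftrightarrow> v \<in> verts E \<and> out_arcs E v = {}"

definition is_regular :: "('v, 'e) pre_digraph \<Rightarrow> 'v \<Rightarrow> bool" where
  "is_regular E v \<longleftrightarrow> v \<in> verts E \<and> out_arcs E v \<noteq> {} \<and> finite (out_arcs E v)"

datatype ('v, 'e) gen = Vert 'v | Edge 'e | Ghost 'e

text \<open>
  Words form the free monoid, so that \<open>('v, 'e) gen word \<Rightarrow>\<^sub>0 'k\<close> is the free unital algebra on
  the generators.
\<close>

datatype 'g word = Word (letters: "'g list")

instantiation word :: (type) monoid_add
begin

definition zero_word :: "'g word" where
  "zero_word = Word []"

definition plus_word :: "'g word \<Rightarrow> 'g word \<Rightarrow> 'g word" where
  "plus_word u v = Word (letters u @ letters v)"

instance
  by standard (simp_all add: zero_word_def plus_word_def)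

end

type_synonym ('v, 'e, 'k) free_elem = "('v, 'e) gen word \<Rightarrow>\<^sub>0 'k"

definition generators :: "('v, 'e) pre_digraph \<Rightarrow> ('v, 'e) gen set" where
  "generators E = Vert ` verts E \<union> Edge ` arcs E \<union> Ghost ` arcs E"

text \<open>
  Path algebras of graphs with infinitely many vertices have no unit, so one starts from the free
  nonunital algebra on the generators, spanned by the nonempty words.
\<close>

definition free_alg :: "('v, 'e) pre_digraph \<Rightarrow> ('v, 'e, 'k::field) free_elem set" where
  "free_alg E = {p. \<forall>w \<in> Poly_Mapping.keys p. letters w \<noteq> [] \<and> set (letters w) \<subseteq> generators E}"

definition gen_elem :: "('v, 'e) gen \<Rightarrow> ('v, 'e, 'k::field) free_elem" where
  "gen_elem g = Poly_Mapping.single (Word [g]) 1"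

abbreviation vx :: "'v \<Rightarrow> ('v, 'e, 'k::field) free_elem" where "vx v \<equiv> gen_elem (Vert v)"
abbreviation ex :: "'e \<Rightarrow> ('v, 'e, 'k::field) free_elem" where "ex e \<equiv> gen_elem (Edge e)"
abbreviation gx :: "'e \<Rightarrow> ('v, 'e, 'k::field) free_elem" where "gx e \<equiv> gen_elem (Ghost e)"

definition scale_elem :: "'k \<Rightarrow> ('v, 'e, 'k::field) free_elem \<Rightarrow> ('v, 'e, 'k) free_elem" where
  "scale_elem k p = Poly_Mapping.map ((*) k) p"

definition leavitt_relations :: "('v, 'e) pre_digraph \<Rightarrow> ('v, 'e, 'k::field) free_elem set" where
  "leavitt_relations E =
     {vx v * vx w - (if v = w then vx v else 0) | v w. v \<in> verts E \<and> w \<in> verts E} \<union>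
     (\<Union>e \<in> arcs E.
       {vx (tail E e) * ex e - ex e, ex e * vx (head E e) - ex e,
        gx e * vx (tail E e) - gx e, vx (head E e) * gx e - gx e}) \<union>
     {gx e * ex f - (if e = f then vx (head E e) else 0) | e f. e \<in> arcs E \<and> f \<in> arcs E} \<union>
     {vx v - (\<Sum>e \<in> out_arcs E v. ex e * gx e) | v. is_regular E v}"

inductive_set leavitt_ideal :: "('v, 'e) pre_digraph \<Rightarrow> ('v, 'e, 'k::field) free_elem set"
  for E :: "('v, 'e) pre_digraph" where
  zero: "0 \<in> leavitt_ideal E"
| rel: "p \<in> leavitt_relations E \<Longrightarrow> p \<in> leavitt_ideal E"
| add: "\<lbrakk>p \<in> leavitt_ideal E; q \<in> leavitt_ideal E\<rbrakk> \<Longrightarrow> p + q \<in> leavitt_ideal E"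
| scale: "p \<in> leavitt_ideal E \<Longrightarrow> scale_elem k p \<in> leavitt_ideal E"
| left: "\<lbrakk>a \<in> free_alg E; p \<in> leavitt_ideal E\<rbrakk> \<Longrightarrow> a * p \<in> leavitt_ideal E"
| right: "\<lbrakk>p \<in> leavitt_ideal E; a \<in> free_alg E\<rbrakk> \<Longrightarrow> p * a \<in> leavitt_ideal E"

definition leavitt_rel ::
  "('v, 'e) pre_digraph \<Rightarrow> (('v, 'e, 'k::field) free_elem \<times> ('v, 'e, 'k) free_elem) set" where
  "leavitt_rel E = {(p, q). p \<in> free_alg E \<and> q \<in> free_alg E \<and> p - q \<in> leavitt_ideal E}"

fun gen_degree :: "('v, 'e) gen \<Rightarrow> int" where
  "gen_degree (Vert v) = 0"
| "gen_degree (Edge e) = 1"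
| "gen_degree (Ghost e) = - 1"

definition word_degree :: "('v, 'e) gen word \<Rightarrow> int" where
  "word_degree w = (\<Sum>g \<leftarrow> letters w. gen_degree g)"

text \<open>
  The unit is the sum of the vertices; it is meaningful only when there are finitely many of them.
\<close>

definition leavitt ::
  "'k itself \<Rightarrow> ('v, 'e) pre_digraph \<Rightarrow> ('k::field, ('v, 'e, 'k) free_elem set) galgebra" where
  "leavitt K E =
     \<lparr>carrier = free_alg E // leavitt_rel E,
      mult = (\<lambda>c d. \<Union>p \<in> c. \<Union>q \<in> d. leavitt_rel E `` {p * q}),
      one = leavitt_rel E `` {\<Sum>v \<in> verts E. vx v},
      zero = leavitt_rel E `` {0},
      add = (\<lambda>c d. \<Union>p \<in> c. \<Union>q \<in> d. leavitt_rel E `` {p + q}),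
      smult = (\<lambda>k c. \<Union>p \<in> c. leavitt_rel E `` {scale_elem k p}),
      homog = (\<lambda>n. {leavitt_rel E `` {p} | p.
        p \<in> free_alg E \<and> (\<forall>w \<in> Poly_Mapping.keys p. word_degree w = n)})\<rparr>"

definition free_map ::
  "('v \<Rightarrow> 'v) \<Rightarrow> ('e \<Rightarrow> 'e) \<Rightarrow> ('v, 'e, 'k::field) free_elem \<Rightarrow> ('v, 'e, 'k) free_elem" where
  "free_map \<sigma>\<^sub>0 \<sigma>\<^sub>1 p = (\<Sum>w \<in> Poly_Mapping.keys p.
     Poly_Mapping.single (map_word (map_gen \<sigma>\<^sub>0 \<sigma>\<^sub>1) w) (Poly_Mapping.lookup p w))"

definition leavitt_aut ::
  "('v, 'e) pre_digraph \<Rightarrow> ('v \<Rightarrow> 'v) \<Rightarrow> ('e \<Rightarrow> 'e)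
    \<Rightarrow> ('v, 'e, 'k::field) free_elem set \<Rightarrow> ('v, 'e, 'k) free_elem set" where
  "leavitt_aut E \<sigma>\<^sub>0 \<sigma>\<^sub>1 c = (\<Union>p \<in> c. leavitt_rel E `` {free_map \<sigma>\<^sub>0 \<sigma>\<^sub>1 p})"

end

theory Submission
  imports Defs
begin

text \<open>
  For a finite graph without sinks \<open>L = L\<^sub>K(E)\<close> is strongly graded.  If \<open>A\<close> is strongly graded then
  \<open>I\<^sub>A = A\<close>, so only zero modules are torsion and \<open>QGr\<^sub>I-A\<close> is \<open>Gr-A\<close>; by Dade's theorem \<open>M \<mapsto> M\<^sub>0\<close>
  is an equivalence from \<open>Gr-A\<close> to \<open>Mod-A\<^sub>0\<close>, which carries the shift to \<open>- \<otimes> A\<^sub>1\<close> because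
  \<open>M\<^sub>1 \<cong> M\<^sub>0 \<otimes> A\<^sub>1\<close>.  The Zhang twist \<open>L\<^sup>\<sigma>\<close> has the same components as \<open>L\<close> and is again strongly
  graded; its degree-zero ring is \<open>L\<^sub>0\<close> and its component of degree \<open>1\<close> is \<open>L\<^sub>1\<close> with the right action
  twisted by \<open>\<sigma>\<close>, which gives the functor \<open>\<sigma>\<^sup>*(- \<otimes> L\<^sub>1)\<close>.  Finally the rule that moves each letter of a
  word by a power of \<open>\<sigma>\<close> determined by the degree of its prefix (up to and including the letter, if
  this is a ghost edge) is a graded isomorphism \<open>L\<^sup>\<sigma> \<cong> L\<^sub>K(E\<^sub>\<sigma>)\<close>.
\<close>

section \<open>Isomorphisms, functors and equivalences\<close>

text \<open>Two obstacles shape the proof. The inverted morphisms are defined through categorical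
  kernels and cokernels in \<open>Gr-A\<close>, so a morphism whose kernel and cokernel are zero
  modules still has to be shown bijective; this is done after passing to \<open>Mod-A_0\<close>,
  where kernels and cokernels can be formed on the given type of elements. Moreover every module
  must live on the universe type \<open>'u\<close>, so each construction of a module (coinduced
  modules, tensor products, the regular module) comes with a cardinality bound; here it matters that
  \<open>'u\<close> is infinite and as large as the field. The three categories \<open>proj\<close>
  are not compared with each other directly: each is compared with modules over \<open>L_0\<close>,
  through a map that needs to be known in degrees 0 and 1 only. A single theorem then serves
  \<open>L\<close>, its Zhang twist and the algebra of the twisted graph, and \<sigma> appears as
  the discrepancy between two right actions in degree 1. The graded isomorphism between the last two
  algebras also supplies the associativity of the Zhang product.\<close>

context category
begin

lemma iso_hom: "is_isomorphism C X Y f \<Longrightarrow> f \<in> chom C X Y"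
  by (simp add: is_isomorphism_def)

lemma iso_id: "X \<in> cobj C \<Longrightarrow> is_isomorphism C X X (cid C X)"
  unfolding is_isomorphism_def by (meson id_closed id_left)

lemma isoE:
  assumes "is_isomorphism C X Y f" and "X \<in> cobj C" and "Y \<in> cobj C"
  obtains g where "g \<in> chom C Y X" and "ccomp C X Y X g f = cid C X"
    and "ccomp C Y X Y f g = cid C Y" and "is_isomorphism C Y X g"
  using assms unfolding is_isomorphism_def by blast

lemma iso_comp:
  assumes ob: "X \<in> cobj C" "Y \<in> cobj C" "Z \<in> cobj C"
    and f: "is_isomorphism C X Y f" and g: "is_isomorphism C Y Z g"
  shows "is_isomorphism C X Z (ccomp C X Y Z g f)"
proof -
  obtain f' where f': "f' \<in> chom C Y X" "ccomp C X Y X f' f = cid C X" "ccomp C Y X Y f f' = cid C Y"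
    by (rule isoE[OF f ob(1,2)]) blast
  obtain g' where g': "g' \<in> chom C Z Y" "ccomp C Y Z Y g' g = cid C Y" "ccomp C Z Y Z g g' = cid C Z"
    by (rule isoE[OF g ob(2,3)]) blast
  have fg: "f \<in> chom C X Y" "g \<in> chom C Y Z" using f g by (auto dest: iso_hom)
  have 1: "ccomp C X Z Y g' (ccomp C X Y Z g f) = f"
    using comp_assoc[OF ob(1,2,3) ob(2) fg g'(1)] g' id_left[OF ob(1,2) fg(1)] by metis
  have 2: "ccomp C Z X Y f (ccomp C Z Y X f' g') = g'"
    using comp_assoc[OF ob(3,2,1,2) g'(1) f'(1) fg(1)] f' id_left[OF ob(3,2) g'(1)] by metis
  have "ccomp C X Z X (ccomp C Z Y X f' g') (ccomp C X Y Z g f) = cid C X"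
    using comp_assoc[OF ob(1,3,2,1) comp_closed[OF ob fg] g'(1) f'(1)] 1 f' by metis
  moreover have "ccomp C Z X Z (ccomp C X Y Z g f) (ccomp C Z Y X f' g') = cid C Z"
    using comp_assoc[OF ob(3,1,2,3) comp_closed[OF ob(3,2,1) g'(1) f'(1)] fg] 2 g' by metis
  ultimately show ?thesis
    unfolding is_isomorphism_def using comp_closed[OF ob fg] comp_closed[OF ob(3,2,1) g'(1) f'(1)] by blast
qed

lemma iso_cancel_left:
  assumes ob: "W \<in> cobj C" "X \<in> cobj C" "Y \<in> cobj C" and f: "is_isomorphism C X Y f"
    and ab: "a \<in> chom C W X" "b \<in> chom C W X" and eq: "ccomp C W X Y f a = ccomp C W X Y f b"
  shows "a = b"
proof -
  obtain g where g: "g \<in> chom C Y X" "ccomp C X Y X g f = cid C X" by (rule isoE[OF f ob(2,3)]) blast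
  show ?thesis
    using comp_assoc[OF ob(1,2,3,2) ab(1) iso_hom[OF f] g(1)] comp_assoc[OF ob(1,2,3,2) ab(2) iso_hom[OF f] g(1)]
      eq g id_left[OF ob(1,2)] ab by metis
qed

lemma iso_cancel_right:
  assumes ob: "X \<in> cobj C" "Y \<in> cobj C" "Z \<in> cobj C" and f: "is_isomorphism C X Y f"
    and ab: "a \<in> chom C Y Z" "b \<in> chom C Y Z" and eq: "ccomp C X Y Z a f = ccomp C X Y Z b f"
  shows "a = b"
proof -
  obtain g where g: "g \<in> chom C Y X" "ccomp C Y X Y f g = cid C Y" by (rule isoE[OF f ob(1,2)]) blast
  show ?thesis
    using comp_assoc[OF ob(2,1,2,3) g(1) iso_hom[OF f] ab(1)] comp_assoc[OF ob(2,1,2,3) g(1) iso_hom[OF f] ab(2)]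
      eq g id_right[OF ob(2,3)] ab by metis
qed

lemma isomorphic_sym:
  "\<lbrakk>X \<in> cobj C; Y \<in> cobj C; isomorphic_in C X Y\<rbrakk> \<Longrightarrow> isomorphic_in C Y X"
  unfolding isomorphic_in_def by (meson isoE)

lemma isomorphic_trans:
  "\<lbrakk>X \<in> cobj C; Y \<in> cobj C; Z \<in> cobj C; isomorphic_in C X Y; isomorphic_in C Y Z\<rbrakk>
    \<Longrightarrow> isomorphic_in C X Z"
  unfolding isomorphic_in_def by (meson iso_comp)

end

context cat_functor
begin

lemma map_iso:
  assumes ob: "X \<in> cobj C" "Y \<in> cobj C" and f: "is_isomorphism C X Y f"
  shows "is_isomorphism D (fobj F X) (fobj F Y) (fmap F X Y f)"
proof -
  obtain g where g: "g \<in> chom C Y X" "ccomp C X Y X g f = cid C X" "ccomp C Y X Y f g = cid C Y"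
    by (rule C.isoE[OF f ob]) blast
  have fh: "f \<in> chom C X Y" using f by (rule C.iso_hom)
  show ?thesis
    unfolding is_isomorphism_def
    using map_comp[OF ob ob(1) fh g(1)] map_comp[OF ob(2,1,2) g(1) fh] g map_id ob map_closed fh
    by (metis (no_types, lifting))
qed

lemma map_isomorphic:
  "\<lbrakk>X \<in> cobj C; Y \<in> cobj C; isomorphic_in C X Y\<rbrakk> \<Longrightarrow> isomorphic_in D (fobj F X) (fobj F Y)"
  unfolding isomorphic_in_def by (meson map_iso)

end

lemma fobj_comp_functr [simp]: "fobj (comp_functr G F) X = fobj G (fobj F X)"
  and fmap_comp_functr [simp]:
    "fmap (comp_functr G F) X Y f = fmap G (fobj F X) (fobj F Y) (fmap F X Y f)"
  by (simp_all add: comp_functr_def)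

lemma comp_functr_assoc: "comp_functr (comp_functr H G) F = comp_functr H (comp_functr G F)"
  by (simp add: comp_functr_def)

lemma comp_id_functr [simp]: "comp_functr id_functr F = F" "comp_functr F id_functr = F"
  by (simp_all add: comp_functr_def id_functr_def)

lemma cat_functor_id: "category C \<Longrightarrow> cat_functor C C id_functr"
  by (simp add: cat_functor_def cat_functor_axioms_def id_functr_def)

lemma cat_functor_comp:
  assumes "cat_functor C D F" "cat_functor D E G"
  shows "cat_functor C E (comp_functr G F)"
proof -
  interpret F: cat_functor C D F by fact
  interpret G: cat_functor D E G by fact
  show ?thesis
    by unfold_locales
      (simp_all add: F.obj_closed G.obj_closed F.map_closed G.map_closed F.map_id G.map_id
        F.map_comp G.map_comp)
qed

lemma nat_iso_refl:
  assumes "cat_functor C D F" shows "nat_isomorphic C D F F"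
proof -
  interpret F: cat_functor C D F by fact
  show ?thesis
    unfolding nat_isomorphic_def
    by (rule exI[of _ "\<lambda>X. cid D (fobj F X)"])
      (auto simp: F.D.iso_id F.obj_closed F.D.id_left F.D.id_right F.map_closed)
qed

lemma nat_iso_sym:
  assumes "cat_functor C D F" "cat_functor C D G" "nat_isomorphic C D F G"
  shows "nat_isomorphic C D G F"
proof -
  interpret F: cat_functor C D F by fact
  interpret G: cat_functor C D G by fact
  note D = F.D.category_axioms
  obtain \<eta> where \<eta>: "\<And>X. X \<in> cobj C \<Longrightarrow> is_isomorphism D (fobj F X) (fobj G X) (\<eta> X)"
    and nat: "\<And>X Y f. \<lbrakk>X \<in> cobj C; Y \<in> cobj C; f \<in> chom C X Y\<rbrakk> \<Longrightarrow>
       ccomp D (fobj F X) (fobj F Y) (fobj G Y) (\<eta> Y) (fmap F X Y f)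
        = ccomp D (fobj F X) (fobj G X) (fobj G Y) (fmap G X Y f) (\<eta> X)"
    using assms(3) unfolding nat_isomorphic_def by blast
  have "\<forall>X \<in> cobj C. \<exists>g. g \<in> chom D (fobj G X) (fobj F X) \<and>
      ccomp D (fobj F X) (fobj G X) (fobj F X) g (\<eta> X) = cid D (fobj F X) \<and>
      ccomp D (fobj G X) (fobj F X) (fobj G X) (\<eta> X) g = cid D (fobj G X) \<and>
      is_isomorphism D (fobj G X) (fobj F X) g"
    using \<eta> F.obj_closed G.obj_closed F.D.isoE by metis
  then obtain \<theta> where \<theta>: "\<And>X. X \<in> cobj C \<Longrightarrow> \<theta> X \<in> chom D (fobj G X) (fobj F X) \<and>
      ccomp D (fobj F X) (fobj G X) (fobj F X) (\<theta> X) (\<eta> X) = cid D (fobj F X) \<and>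
      ccomp D (fobj G X) (fobj F X) (fobj G X) (\<eta> X) (\<theta> X) = cid D (fobj G X) \<and>
      is_isomorphism D (fobj G X) (fobj F X) (\<theta> X)"
    by metis
  have "ccomp D (fobj G X) (fobj G Y) (fobj F Y) (\<theta> Y) (fmap G X Y f)
      = ccomp D (fobj G X) (fobj F X) (fobj F Y) (fmap F X Y f) (\<theta> X)"
    if X: "X \<in> cobj C" and Y: "Y \<in> cobj C" and f: "f \<in> chom C X Y" for X Y f
  \<comment> \<open>After precomposition with the invertible \<open>\<eta> X\<close> both sides
    become \<open>fmap F X Y f\<close>.\<close>
  proof (rule F.D.iso_cancel_right[OF _ _ _ \<eta>[OF X]])
    note o = F.obj_closed[OF X] G.obj_closed[OF X] F.obj_closed[OF Y] G.obj_closed[OF Y]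
    note h = F.map_closed[OF X Y f] G.map_closed[OF X Y f] F.D.iso_hom[OF \<eta>[OF X]] F.D.iso_hom[OF \<eta>[OF Y]]
    note t = \<theta>[OF X] \<theta>[OF Y]
    show "fobj F X \<in> cobj D" "fobj G X \<in> cobj D" "fobj F Y \<in> cobj D" by fact+
    show "ccomp D (fobj G X) (fobj G Y) (fobj F Y) (\<theta> Y) (fmap G X Y f) \<in> chom D (fobj G X) (fobj F Y)"
      "ccomp D (fobj G X) (fobj F X) (fobj F Y) (fmap F X Y f) (\<theta> X) \<in> chom D (fobj G X) (fobj F Y)"
      using o h t by (auto intro: F.D.comp_closed)
    show "ccomp D (fobj F X) (fobj G X) (fobj F Y) (ccomp D (fobj G X) (fobj G Y) (fobj F Y) (\<theta> Y) (fmap G X Y f)) (\<eta> X)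
      = ccomp D (fobj F X) (fobj G X) (fobj F Y) (ccomp D (fobj G X) (fobj F X) (fobj F Y) (fmap F X Y f) (\<theta> X)) (\<eta> X)"
      using F.D.comp_assoc[OF o(1,2,4,3) h(3,2), of "\<theta> Y"] F.D.comp_assoc[OF o(1,2,1,3) h(3) _ h(1), of "\<theta> X"]
        F.D.comp_assoc[OF o(1,3,4,3) h(1,4), of "\<theta> Y"] nat[OF X Y f] t
        F.D.id_left[OF o(1,3) h(1)] F.D.id_right[OF o(1,3) h(1)]
      by metis
  qed
  then show ?thesis
    unfolding nat_isomorphic_def using \<theta> by blast
qed

lemma nat_iso_trans:
  assumes "cat_functor C D F" "cat_functor C D G" "cat_functor C D H"
    and "nat_isomorphic C D F G" "nat_isomorphic C D G H"
  shows "nat_isomorphic C D F H"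
proof -
  interpret F: cat_functor C D F by fact
  interpret G: cat_functor C D G by fact
  interpret H: cat_functor C D H by fact
  obtain \<eta> where \<eta>: "\<And>X. X \<in> cobj C \<Longrightarrow> is_isomorphism D (fobj F X) (fobj G X) (\<eta> X)"
    and n1: "\<And>X Y f. \<lbrakk>X \<in> cobj C; Y \<in> cobj C; f \<in> chom C X Y\<rbrakk> \<Longrightarrow>
       ccomp D (fobj F X) (fobj F Y) (fobj G Y) (\<eta> Y) (fmap F X Y f)
        = ccomp D (fobj F X) (fobj G X) (fobj G Y) (fmap G X Y f) (\<eta> X)"
    using assms(4) unfolding nat_isomorphic_def by blast
  obtain \<theta> where \<theta>: "\<And>X. X \<in> cobj C \<Longrightarrow> is_isomorphism D (fobj G X) (fobj H X) (\<theta> X)"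
    and n2: "\<And>X Y f. \<lbrakk>X \<in> cobj C; Y \<in> cobj C; f \<in> chom C X Y\<rbrakk> \<Longrightarrow>
       ccomp D (fobj G X) (fobj G Y) (fobj H Y) (\<theta> Y) (fmap G X Y f)
        = ccomp D (fobj G X) (fobj H X) (fobj H Y) (fmap H X Y f) (\<theta> X)"
    using assms(5) unfolding nat_isomorphic_def by blast
  let ?k = "\<lambda>X. ccomp D (fobj F X) (fobj G X) (fobj H X) (\<theta> X) (\<eta> X)"
  have "is_isomorphism D (fobj F X) (fobj H X) (?k X)" if "X \<in> cobj C" for X
    using that by (intro F.D.iso_comp) (auto intro: F.obj_closed G.obj_closed H.obj_closed \<eta> \<theta>)
  moreover have "ccomp D (fobj F X) (fobj F Y) (fobj H Y) (?k Y) (fmap F X Y f)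
        = ccomp D (fobj F X) (fobj H X) (fobj H Y) (fmap H X Y f) (?k X)"
    if X: "X \<in> cobj C" and Y: "Y \<in> cobj C" and f: "f \<in> chom C X Y" for X Y f
  proof -
    note o = F.obj_closed[OF X] G.obj_closed[OF X] H.obj_closed[OF X]
      F.obj_closed[OF Y] G.obj_closed[OF Y] H.obj_closed[OF Y]
    note h = F.map_closed[OF X Y f] G.map_closed[OF X Y f] H.map_closed[OF X Y f]
    note e = F.D.iso_hom[OF \<eta>[OF X]] F.D.iso_hom[OF \<eta>[OF Y]] F.D.iso_hom[OF \<theta>[OF X]] F.D.iso_hom[OF \<theta>[OF Y]]
    show ?thesis
      using F.D.comp_assoc[OF o(1,4,5,6) h(1) e(2,4)] n1[OF X Y f] F.D.comp_assoc[OF o(1,2,5,6) e(1) h(2) e(4)]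
        n2[OF X Y f] F.D.comp_assoc[OF o(1,2,3,6) e(1,3) h(3)] by metis
  qed
  ultimately show ?thesis
    unfolding nat_isomorphic_def by (intro exI[of _ ?k]) blast
qed

lemma nat_iso_whisker_left:
  assumes "cat_functor C D F" "cat_functor C D G" "cat_functor D E H" and "nat_isomorphic C D F G"
  shows "nat_isomorphic C E (comp_functr H F) (comp_functr H G)"
proof -
  interpret F: cat_functor C D F by fact
  interpret G: cat_functor C D G by fact
  interpret H: cat_functor D E H by fact
  obtain \<eta> where \<eta>: "\<And>X. X \<in> cobj C \<Longrightarrow> is_isomorphism D (fobj F X) (fobj G X) (\<eta> X)"
    and n1: "\<And>X Y f. \<lbrakk>X \<in> cobj C; Y \<in> cobj C; f \<in> chom C X Y\<rbrakk> \<Longrightarrow>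
       ccomp D (fobj F X) (fobj F Y) (fobj G Y) (\<eta> Y) (fmap F X Y f)
        = ccomp D (fobj F X) (fobj G X) (fobj G Y) (fmap G X Y f) (\<eta> X)"
    using assms(4) unfolding nat_isomorphic_def by blast
  show ?thesis
    unfolding nat_isomorphic_def
  proof (rule exI[of _ "\<lambda>X. fmap H (fobj F X) (fobj G X) (\<eta> X)"], intro conjI ballI)
    fix X assume X: "X \<in> cobj C"
    then show "is_isomorphism E (fobj (comp_functr H F) X) (fobj (comp_functr H G) X) (fmap H (fobj F X) (fobj G X) (\<eta> X))"
      by (simp add: H.map_iso F.obj_closed G.obj_closed \<eta>)
    fix Y f assume Y: "Y \<in> cobj C" and f: "f \<in> chom C X Y"
    note o = F.obj_closed[OF X] G.obj_closed[OF X] F.obj_closed[OF Y] G.obj_closed[OF Y]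
    note h = F.map_closed[OF X Y f] G.map_closed[OF X Y f] F.D.iso_hom[OF \<eta>[OF X]] F.D.iso_hom[OF \<eta>[OF Y]]
    show "ccomp E (fobj (comp_functr H F) X) (fobj (comp_functr H F) Y) (fobj (comp_functr H G) Y)
           (fmap H (fobj F Y) (fobj G Y) (\<eta> Y)) (fmap (comp_functr H F) X Y f)
         = ccomp E (fobj (comp_functr H F) X) (fobj (comp_functr H G) X) (fobj (comp_functr H G) Y)
           (fmap (comp_functr H G) X Y f) (fmap H (fobj F X) (fobj G X) (\<eta> X))"
      using H.map_comp[OF o(1,3,4) h(1,4)] H.map_comp[OF o(1,2,4) h(3,2)] n1[OF X Y f] by simp
  qed
qed

lemma nat_iso_whisker_right:
  assumes "cat_functor B C H" and "nat_isomorphic C D F G"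
  shows "nat_isomorphic B D (comp_functr F H) (comp_functr G H)"
proof -
  interpret H: cat_functor B C H by fact
  obtain \<eta> where \<eta>: "\<And>X. X \<in> cobj C \<Longrightarrow> is_isomorphism D (fobj F X) (fobj G X) (\<eta> X)"
    and n1: "\<And>X Y f. \<lbrakk>X \<in> cobj C; Y \<in> cobj C; f \<in> chom C X Y\<rbrakk> \<Longrightarrow>
       ccomp D (fobj F X) (fobj F Y) (fobj G Y) (\<eta> Y) (fmap F X Y f)
        = ccomp D (fobj F X) (fobj G X) (fobj G Y) (fmap G X Y f) (\<eta> X)"
    using assms(2) unfolding nat_isomorphic_def by blast
  show ?thesis
    unfolding nat_isomorphic_def
    by (rule exI[of _ "\<lambda>X. \<eta> (fobj H X)"]) (simp add: \<eta> n1 H.obj_closed H.map_closed)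
qed

lemma is_equivalence_sym:
  assumes "is_equivalence C D G"
  obtains H where "is_equivalence D C H" and "cat_functor D C H"
    and "nat_isomorphic C C (comp_functr H G) id_functr"
    and "nat_isomorphic D D (comp_functr G H) id_functr"
  using assms unfolding is_equivalence_def by blast

text \<open>The quasi-inverses are composed in the opposite order; whiskering cancels the inner pair
  of functors, and then the outer pair cancels.\<close>

lemma is_equivalence_trans:
  assumes F: "is_equivalence C D F" and G: "is_equivalence D E G"
  shows "is_equivalence C E (comp_functr G F)"
proof -
  obtain F' where F': "cat_functor D C F'" "nat_isomorphic C C (comp_functr F' F) id_functr"
    "nat_isomorphic D D (comp_functr F F') id_functr" by (rule is_equivalence_sym[OF F]) blast
  obtain G' where G': "cat_functor E D G'" "nat_isomorphic D D (comp_functr G' G) id_functr"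
    "nat_isomorphic E E (comp_functr G G') id_functr" by (rule is_equivalence_sym[OF G]) blast
  have cF: "cat_functor C D F" and cG: "cat_functor D E G" using F G by (auto simp: is_equivalence_def)
  have ids: "cat_functor C C id_functr" "cat_functor D D id_functr" "cat_functor E E id_functr"
    using cat_functor.axioms(1,2)[OF cF] cat_functor.axioms(2)[OF cG] by (auto intro: cat_functor_id)
  note cc = cF cG F'(1) G'(1) ids cat_functor_comp
  have 1: "nat_isomorphic C D (comp_functr (comp_functr G' G) F) (comp_functr id_functr F)"
    using nat_iso_whisker_right[OF cF G'(2)] .
  have "nat_isomorphic C C (comp_functr F' (comp_functr (comp_functr G' G) F)) (comp_functr F' (comp_functr id_functr F))"
    by (rule nat_iso_whisker_left[OF _ _ F'(1) 1]) (auto intro: cc)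
  then have 1: "nat_isomorphic C C (comp_functr (comp_functr F' G') (comp_functr G F)) (comp_functr F' F)"
    by (simp add: comp_functr_assoc)
  have A: "nat_isomorphic C C (comp_functr (comp_functr F' G') (comp_functr G F)) id_functr"
    by (rule nat_iso_trans[OF _ _ _ 1 F'(2)]) (auto intro: cc)
  have 2: "nat_isomorphic E D (comp_functr (comp_functr F F') G') (comp_functr id_functr G')"
    using nat_iso_whisker_right[OF G'(1) F'(3)] .
  have "nat_isomorphic E E (comp_functr G (comp_functr (comp_functr F F') G')) (comp_functr G (comp_functr id_functr G'))"
    by (rule nat_iso_whisker_left[OF _ _ cG 2]) (auto intro: cc)
  then have 2: "nat_isomorphic E E (comp_functr (comp_functr G F) (comp_functr F' G')) (comp_functr G G')"
    by (simp add: comp_functr_assoc)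
  have "nat_isomorphic E E (comp_functr (comp_functr G F) (comp_functr F' G')) id_functr"
    by (rule nat_iso_trans[OF _ _ _ 2 G'(3)]) (auto intro: cc)
  with A show ?thesis
    unfolding is_equivalence_def by (meson cc)
qed

lemma pair_equiv_trans:
  assumes "pair_equiv P Q" "pair_equiv Q R" shows "pair_equiv P R"
proof -
  obtain C X D Y E Z where PQ: "P = (C, X)" "Q = (D, Y)" "R = (E, Z)" by (cases P, cases Q, cases R)
  obtain F where X: "X \<in> cobj C" and Y: "Y \<in> cobj D" and F: "is_equivalence C D F"
    and iF: "isomorphic_in D (fobj F X) Y"
    using assms by (auto simp: PQ pair_equiv_def)
  obtain G where Z: "Z \<in> cobj E" and G: "is_equivalence D E G" and iG: "isomorphic_in E (fobj G Y) Z"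
    using assms by (auto simp: PQ pair_equiv_def)
  interpret F: cat_functor C D F using F by (simp add: is_equivalence_def)
  interpret G: cat_functor D E G using G by (simp add: is_equivalence_def)
  have "isomorphic_in E (fobj G (fobj F X)) Z"
    using X Y Z iF iG
    by (meson G.D.isomorphic_trans G.map_isomorphic F.obj_closed G.obj_closed)
  then show ?thesis
    using X Z is_equivalence_trans[OF F G] by (auto simp: PQ pair_equiv_def)
qed

lemma triple_equiv_pair_equiv:
  "triple_equiv T T' \<Longrightarrow> pair_equiv (underlying_pair T) (underlying_pair T')"
  by (auto simp: triple_equiv_def pair_equiv_def underlying_pair_def is_triple_def split: prod.splits)

text \<open>For a quasi-inverse \<open>H\<close> of \<open>G\<close> the shift is carried across by
  the chain \<open>H t \<cong> H t G H \<cong> H G s H \<cong> s H\<close>.\<close>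

lemma triple_equiv_sym:
  assumes "triple_equiv T T'" shows "triple_equiv T' T"
proof -
  obtain C X s D Y t where T: "T = (C, X, s)" "T' = (D, Y, t)" by (cases T, cases T')
  obtain G where G: "is_equivalence C D G" and iso: "isomorphic_in D (fobj G X) Y"
    and nat: "nat_isomorphic C D (comp_functr G s) (comp_functr t G)"
    and X: "X \<in> cobj C" and Y: "Y \<in> cobj D" and s: "cat_functor C C s" and t: "cat_functor D D t"
    using assms by (auto simp: T triple_equiv_def is_triple_def)
  obtain H where H: "is_equivalence D C H" "cat_functor D C H"
    "nat_isomorphic C C (comp_functr H G) id_functr" "nat_isomorphic D D (comp_functr G H) id_functr"
    by (rule is_equivalence_sym[OF G]) blast
  have cG: "cat_functor C D G" using G by (simp add: is_equivalence_def)
  interpret G: cat_functor C D G by fact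
  interpret H: cat_functor D C H by fact
  note cc = cG H(2) s t cat_functor_id[OF G.C.category_axioms] cat_functor_id[OF G.D.category_axioms] cat_functor_comp
  have i: "isomorphic_in C (fobj H (fobj G X)) X"
    using H(3) X by (auto simp: nat_isomorphic_def isomorphic_in_def id_functr_def)
  have "isomorphic_in C (fobj H (fobj G X)) (fobj H Y)"
    using iso X Y by (intro H.map_isomorphic) (auto intro: G.obj_closed)
  with i have 1: "isomorphic_in C (fobj H Y) X"
    using X Y by (meson G.C.isomorphic_sym G.C.isomorphic_trans H.obj_closed G.obj_closed)
  have "nat_isomorphic D C (comp_functr (comp_functr H t) (comp_functr G H)) (comp_functr (comp_functr H t) id_functr)"
    by (rule nat_iso_whisker_left[OF _ _ _ H(4)]) (auto intro: cc)
  then have a: "nat_isomorphic D C (comp_functr (comp_functr H t) id_functr) (comp_functr (comp_functr H t) (comp_functr G H))"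
    by (rule nat_iso_sym[rotated 2]) (auto intro: cc)
  have "nat_isomorphic C C (comp_functr H (comp_functr G s)) (comp_functr H (comp_functr t G))"
    by (rule nat_iso_whisker_left[OF _ _ _ nat]) (auto intro: cc)
  then have "nat_isomorphic D C (comp_functr (comp_functr H (comp_functr G s)) H) (comp_functr (comp_functr H (comp_functr t G)) H)"
    by (rule nat_iso_whisker_right[OF H(2)])
  then have b: "nat_isomorphic D C (comp_functr (comp_functr H (comp_functr t G)) H) (comp_functr (comp_functr H (comp_functr G s)) H)"
    by (rule nat_iso_sym[rotated 2]) (auto intro: cc)
  have c: "nat_isomorphic D C (comp_functr (comp_functr H G) (comp_functr s H)) (comp_functr id_functr (comp_functr s H))"
    by (rule nat_iso_whisker_right[OF _ H(3)]) (auto intro: cc)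
  have ab: "nat_isomorphic D C (comp_functr H t) (comp_functr (comp_functr H (comp_functr G s)) H)"
    unfolding comp_functr_assoc
    by (rule nat_iso_trans[OF _ _ _ a[unfolded comp_functr_assoc comp_id_functr] b[unfolded comp_functr_assoc]])
      (auto simp: comp_functr_assoc intro: cc)
  have "nat_isomorphic D C (comp_functr H t) (comp_functr s H)"
    by (rule nat_iso_trans[OF _ _ _ ab[unfolded comp_functr_assoc] c[unfolded comp_functr_assoc comp_id_functr]])
      (auto intro: cc)
  then show ?thesis
    using X Y s t H(1) 1 by (auto simp: T triple_equiv_def is_triple_def)
qed

lemma triple_equiv_trans:
  assumes "triple_equiv T T'" "triple_equiv T' T''" shows "triple_equiv T T''"
proof -
  obtain C X s D Y t E Z u where T: "T = (C, X, s)" "T' = (D, Y, t)" "T'' = (E, Z, u)"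
    by (cases T, cases T', cases T'')
  obtain F where F: "is_equivalence C D F" and iF: "isomorphic_in D (fobj F X) Y"
    and nF: "nat_isomorphic C D (comp_functr F s) (comp_functr t F)"
    and X: "X \<in> cobj C" and Y: "Y \<in> cobj D" and s: "cat_functor C C s" and t: "cat_functor D D t"
    using assms(1) by (auto simp: T triple_equiv_def is_triple_def)
  obtain G where G: "is_equivalence D E G" and iG: "isomorphic_in E (fobj G Y) Z"
    and nG: "nat_isomorphic D E (comp_functr G t) (comp_functr u G)"
    and Z: "Z \<in> cobj E" and u: "cat_functor E E u"
    using assms(2) by (auto simp: T triple_equiv_def is_triple_def)
  have cF: "cat_functor C D F" and cG: "cat_functor D E G" using F G by (simp_all add: is_equivalence_def)
  interpret F: cat_functor C D F by fact
  interpret G: cat_functor D E G by fact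
  note cc = cF cG s t u cat_functor_comp
  have 1: "isomorphic_in E (fobj (comp_functr G F) X) Z"
    using X Y Z iF iG by (auto intro: G.D.isomorphic_trans[OF _ _ _ _ iG] G.map_isomorphic F.obj_closed G.obj_closed)
  have a: "nat_isomorphic C E (comp_functr G (comp_functr F s)) (comp_functr G (comp_functr t F))"
    by (rule nat_iso_whisker_left[OF _ _ _ nF]) (auto intro: cc)
  have b: "nat_isomorphic C E (comp_functr (comp_functr G t) F) (comp_functr (comp_functr u G) F)"
    by (rule nat_iso_whisker_right[OF cF nG])
  have "nat_isomorphic C E (comp_functr (comp_functr G F) s) (comp_functr u (comp_functr G F))"
    unfolding comp_functr_assoc
    by (rule nat_iso_trans[OF _ _ _ a b[unfolded comp_functr_assoc]]) (auto intro: cc)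
  then show ?thesis
    using X Z s u 1 is_equivalence_trans[OF F G] by (auto simp: T triple_equiv_def is_triple_def)
qed

section \<open>Fully faithful and essentially surjective functors\<close>

locale fully_faithful = cat_functor C D F
  for C :: "('o, 'm) cat" and D :: "('p, 'n) cat" and F :: "('o, 'm, 'p, 'n) functr" +
  assumes full: "\<lbrakk>X \<in> cobj C; Y \<in> cobj C; g \<in> chom D (fobj F X) (fobj F Y)\<rbrakk>
      \<Longrightarrow> \<exists>f \<in> chom C X Y. fmap F X Y f = g"
    and faithful: "\<lbrakk>X \<in> cobj C; Y \<in> cobj C; f \<in> chom C X Y; f' \<in> chom C X Y;
      fmap F X Y f = fmap F X Y f'\<rbrakk> \<Longrightarrow> f = f'"
begin

lemma reflects_iso:
  assumes ob: "X \<in> cobj C" "Y \<in> cobj C" and f: "f \<in> chom C X Y"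
    and iso: "is_isomorphism D (fobj F X) (fobj F Y) (fmap F X Y f)"
  shows "is_isomorphism C X Y f"
proof -
  obtain g where g: "g \<in> chom D (fobj F Y) (fobj F X)"
    "ccomp D (fobj F X) (fobj F Y) (fobj F X) g (fmap F X Y f) = cid D (fobj F X)"
    "ccomp D (fobj F Y) (fobj F X) (fobj F Y) (fmap F X Y f) g = cid D (fobj F Y)"
    by (rule D.isoE[OF iso]) (use ob obj_closed in blast)+
  obtain h where h: "h \<in> chom C Y X" "fmap F Y X h = g" using full g(1) ob by blast
  have "ccomp C X Y X h f = cid C X"
    by (rule faithful[OF ob(1,1)]) (use ob f h g in \<open>simp_all add: C.comp_closed C.id_closed map_comp map_id\<close>)
  moreover have "ccomp C Y X Y f h = cid C Y"
    by (rule faithful[OF ob(2,2)]) (use ob f h g in \<open>simp_all add: C.comp_closed C.id_closed map_comp map_id\<close>)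
  ultimately show ?thesis using f h by (auto simp: is_isomorphism_def)
qed

text \<open>The quasi-inverse sends \<open>Y\<close> to a chosen object \<open>P Y\<close> with an
  isomorphism \<open>e Y\<close> from \<open>F (P Y)\<close> to \<open>Y\<close>, and a morphism
  \<open>g\<close> to the lift along \<open>e\<close> of \<open>g\<close> composed with
  \<open>e Y\<close>. Lifts exist because \<open>F\<close> is full.\<close>

lemma is_equivalence:
  assumes es: "\<And>Y. Y \<in> cobj D \<Longrightarrow> \<exists>X \<in> cobj C. isomorphic_in D (fobj F X) Y"
  shows "is_equivalence C D F"
proof -
  have "\<forall>Y \<in> cobj D. \<exists>X e. X \<in> cobj C \<and> is_isomorphism D (fobj F X) Y e"
    using es unfolding isomorphic_in_def by blast
  then obtain P e where P: "\<And>Y. Y \<in> cobj D \<Longrightarrow> P Y \<in> cobj C"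
    and e: "\<And>Y. Y \<in> cobj D \<Longrightarrow> is_isomorphism D (fobj F (P Y)) Y (e Y)" by metis
  have eh: "e Y \<in> chom D (fobj F (P Y)) Y" if "Y \<in> cobj D" for Y using e[OF that] by (rule D.iso_hom)
  have lift: "\<exists>g \<in> chom D (fobj F X) (fobj F (P Y)). ccomp D (fobj F X) (fobj F (P Y)) Y (e Y) g = h"
    if X: "X \<in> cobj C" and Y: "Y \<in> cobj D" and h: "h \<in> chom D (fobj F X) Y" for X Y h
  proof -
    obtain d where d: "d \<in> chom D Y (fobj F (P Y))" "ccomp D Y (fobj F (P Y)) Y (e Y) d = cid D Y"
      using e[OF Y] Y P by (meson D.isoE obj_closed)
    note o = obj_closed[OF X] Y obj_closed[OF P[OF Y]] Y
    show ?thesis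
      using D.comp_assoc[OF o h d(1) eh[OF Y]] d D.id_left[OF o(1,2) h] D.comp_closed[OF o(1-3) h d(1)] by auto
  qed
  have "\<exists>f \<in> chom C X (P Y). ccomp D (fobj F X) (fobj F (P Y)) Y (e Y) (fmap F X (P Y) f) = h"
    if X: "X \<in> cobj C" and Y: "Y \<in> cobj D" and h: "h \<in> chom D (fobj F X) Y" for X Y h
    using lift[OF that] full[OF X P[OF Y]] by metis
  then obtain L where L: "\<And>X Y h. \<lbrakk>X \<in> cobj C; Y \<in> cobj D; h \<in> chom D (fobj F X) Y\<rbrakk> \<Longrightarrow>
      L X Y h \<in> chom C X (P Y) \<and> ccomp D (fobj F X) (fobj F (P Y)) Y (e Y) (fmap F X (P Y) (L X Y h)) = h"
    by metis
  \<comment> \<open>Lifts along \<open>e Y\<close> are unique: \<open>e Y\<close> can be cancelled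
    and \<open>F\<close> is faithful. The functor laws for \<open>H\<close> below are instances of
    this uniqueness.\<close>
  have L_unique: "a = b" if "X \<in> cobj C" "Y \<in> cobj D" "a \<in> chom C X (P Y)" "b \<in> chom C X (P Y)"
    "ccomp D (fobj F X) (fobj F (P Y)) Y (e Y) (fmap F X (P Y) a) = ccomp D (fobj F X) (fobj F (P Y)) Y (e Y) (fmap F X (P Y) b)"
    for X Y a b
  proof -
    note PY = P[OF that(2)]
    show ?thesis
      by (rule faithful[OF that(1) PY that(3,4)],
          rule D.iso_cancel_left[OF obj_closed[OF that(1)] obj_closed[OF PY] that(2) e[OF that(2)]
            map_closed[OF that(1) PY that(3)] map_closed[OF that(1) PY that(4)] that(5)])
  qed
  define H where "H = \<lparr>fobj = P, fmap = (\<lambda>Y Z g. L (P Y) Z (ccomp D (fobj F (P Y)) Y Z g (e Y)))\<rparr>"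
  have ge: "ccomp D (fobj F (P Y)) Y Z g (e Y) \<in> chom D (fobj F (P Y)) Z"
    if "Y \<in> cobj D" "Z \<in> cobj D" "g \<in> chom D Y Z" for Y Z g
    using that by (intro D.comp_closed eh) (auto intro: P obj_closed)
  have Hmap: "fmap H Y Z g \<in> chom C (P Y) (P Z)"
    and He: "ccomp D (fobj F (P Y)) (fobj F (P Z)) Z (e Z) (fmap F (P Y) (P Z) (fmap H Y Z g))
      = ccomp D (fobj F (P Y)) Y Z g (e Y)"
    if "Y \<in> cobj D" "Z \<in> cobj D" "g \<in> chom D Y Z" for Y Z g
    using L[OF P[OF that(1)] that(2) ge[OF that]] by (auto simp: H_def)
  have Hobj: "fobj H = P" by (simp add: H_def)
  have cH: "cat_functor D C H"
  proof (unfold_locales, unfold Hobj)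
    show "P X \<in> cobj C" if "X \<in> cobj D" for X by (rule P[OF that])
    show "fmap H X Y f \<in> chom C (P X) (P Y)" if "X \<in> cobj D" "Y \<in> cobj D" "f \<in> chom D X Y" for X Y f
      by (rule Hmap[OF that])
    show "fmap H X X (cid D X) = cid C (P X)" if X: "X \<in> cobj D" for X
    proof (rule L_unique[OF P[OF X] X Hmap[OF X X D.id_closed[OF X]] C.id_closed[OF P[OF X]]])
      have "fobj F (P X) \<in> cobj D" using X P obj_closed by blast
      then show "ccomp D (fobj F (P X)) (fobj F (P X)) X (e X) (fmap F (P X) (P X) (fmap H X X (cid D X))) =
         ccomp D (fobj F (P X)) (fobj F (P X)) X (e X) (fmap F (P X) (P X) (cid C (P X)))"
        using X eh[OF X] by (simp add: He D.id_closed map_id P D.id_left D.id_right)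
    qed
    show "fmap H X Z (ccomp D X Y Z g f) = ccomp C (P X) (P Y) (P Z) (fmap H Y Z g) (fmap H X Y f)"
      if X: "X \<in> cobj D" and Y: "Y \<in> cobj D" and Z: "Z \<in> cobj D" and f: "f \<in> chom D X Y" and g: "g \<in> chom D Y Z" for X Y Z f g
    proof (rule L_unique[OF P[OF X] Z])
      note gf = D.comp_closed[OF X Y Z f g]
      note hf = Hmap[OF X Y f] and hg = Hmap[OF Y Z g]
      show "fmap H X Z (ccomp D X Y Z g f) \<in> chom C (P X) (P Z)" by (rule Hmap[OF X Z gf])
      show "ccomp C (P X) (P Y) (P Z) (fmap H Y Z g) (fmap H X Y f) \<in> chom C (P X) (P Z)"
        by (rule C.comp_closed[OF P[OF X] P[OF Y] P[OF Z] hf hg])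
      note o = obj_closed[OF P[OF X]] obj_closed[OF P[OF Y]] obj_closed[OF P[OF Z]]
      note mf = map_closed[OF P[OF X] P[OF Y] hf] and mg = map_closed[OF P[OF Y] P[OF Z] hg]
      show "ccomp D (fobj F (P X)) (fobj F (P Z)) Z (e Z) (fmap F (P X) (P Z) (fmap H X Z (ccomp D X Y Z g f))) =
        ccomp D (fobj F (P X)) (fobj F (P Z)) Z (e Z) (fmap F (P X) (P Z) (ccomp C (P X) (P Y) (P Z) (fmap H Y Z g) (fmap H X Y f)))"
        using He[OF X Z gf] map_comp[OF P[OF X] P[OF Y] P[OF Z] hf hg]
          D.comp_assoc[OF o Z mf mg eh[OF Z]] He[OF Y Z g] D.comp_assoc[OF o(1,2) Y Z mf eh[OF Y] g]
          He[OF X Y f] D.comp_assoc[OF o(1) X Y Z eh[OF X] f g] by metis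
    qed
  qed
  have FH: "nat_isomorphic D D (comp_functr F H) id_functr"
    unfolding nat_isomorphic_def
    by (rule exI[of _ e]) (auto simp: id_functr_def Hobj e He)
  let ?n = "\<lambda>X. L (P (fobj F X)) (fobj F X) (e (fobj F X))"
  have "nat_isomorphic C C (comp_functr H F) id_functr"
  proof -
    \<comment> \<open>The component at \<open>X\<close> is a preimage of \<open>e (F X)\<close>
      under the full functor \<open>F\<close>. It is invertible since \<open>F\<close> reflects
      isomorphisms, and natural since \<open>F\<close> is faithful.\<close>
    have "\<forall>X \<in> cobj C. \<exists>f \<in> chom C (P (fobj F X)) X. fmap F (P (fobj F X)) X f = e (fobj F X)"
      using full P obj_closed eh by blast
    then obtain n where n: "\<And>X. X \<in> cobj C \<Longrightarrow> n X \<in> chom C (P (fobj F X)) X"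
      and nF: "\<And>X. X \<in> cobj C \<Longrightarrow> fmap F (P (fobj F X)) X (n X) = e (fobj F X)" by metis
    show ?thesis unfolding nat_isomorphic_def
    proof (rule exI[of _ n], intro conjI ballI)
      fix X assume X: "X \<in> cobj C"
      then show "is_isomorphism C (fobj (comp_functr H F) X) (fobj id_functr X) (n X)"
        by (auto simp: Hobj id_functr_def nF intro!: reflects_iso P obj_closed n e)
      fix Y f assume Y: "Y \<in> cobj C" and f: "f \<in> chom C X Y"
      note o = obj_closed[OF X] obj_closed[OF Y]
      note h = Hmap[OF o map_closed[OF X Y f]]
      have "ccomp C (P (fobj F X)) (P (fobj F Y)) Y (n Y) (fmap H (fobj F X) (fobj F Y) (fmap F X Y f)) =
        ccomp C (P (fobj F X)) X Y f (n X)"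
      proof (rule faithful[OF P[OF o(1)] Y])
        show "ccomp C (P (fobj F X)) (P (fobj F Y)) Y (n Y) (fmap H (fobj F X) (fobj F Y) (fmap F X Y f)) \<in> chom C (P (fobj F X)) Y"
          by (rule C.comp_closed[OF P[OF o(1)] P[OF o(2)] Y h n[OF Y]])
        show "ccomp C (P (fobj F X)) X Y f (n X) \<in> chom C (P (fobj F X)) Y"
          by (rule C.comp_closed[OF P[OF o(1)] X Y n[OF X] f])
        show "fmap F (P (fobj F X)) Y (ccomp C (P (fobj F X)) (P (fobj F Y)) Y (n Y) (fmap H (fobj F X) (fobj F Y) (fmap F X Y f))) =
          fmap F (P (fobj F X)) Y (ccomp C (P (fobj F X)) X Y f (n X))"
          using map_comp[OF P[OF o(1)] P[OF o(2)] Y h n[OF Y]] map_comp[OF P[OF o(1)] X Y n[OF X] f]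
            nF[OF X] nF[OF Y] He[OF o map_closed[OF X Y f]] by metis
      qed
      then show "ccomp C (fobj (comp_functr H F) X) (fobj (comp_functr H F) Y) (fobj id_functr Y) (n Y) (fmap (comp_functr H F) X Y f) =
          ccomp C (fobj (comp_functr H F) X) (fobj id_functr X) (fobj id_functr Y) (fmap id_functr X Y f) (n X)"
        by (simp add: Hobj id_functr_def)
    qed
  qed
  then show ?thesis
    unfolding is_equivalence_def using cH FH cat_functor_axioms by blast
qed

end

section \<open>Quotient categories in which only isomorphisms are inverted\<close>

text \<open>Two functors can agree on the objects and morphisms of \<open>C\<close> and still be
  different records, because their values elsewhere are arbitrary. Natural isomorphism is blind to
  those values.\<close>

lemma nat_isomorphic_cong:
  assumes F: "cat_functor C D F" and ob: "\<And>X. X \<in> cobj C \<Longrightarrow> fobj G X = fobj F X"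
    and map: "\<And>X Y f. \<lbrakk>X \<in> cobj C; Y \<in> cobj C; f \<in> chom C X Y\<rbrakk> \<Longrightarrow> fmap G X Y f = fmap F X Y f"
  shows "nat_isomorphic C D F G"
proof -
  obtain \<eta> where
    "\<forall>X \<in> cobj C. is_isomorphism D (fobj F X) (fobj F X) (\<eta> X)"
    "\<forall>X \<in> cobj C. \<forall>Y \<in> cobj C. \<forall>f \<in> chom C X Y.
       ccomp D (fobj F X) (fobj F Y) (fobj F Y) (\<eta> Y) (fmap F X Y f)
        = ccomp D (fobj F X) (fobj F X) (fobj F Y) (fmap F X Y f) (\<eta> X)"
    using nat_iso_refl[OF F] unfolding nat_isomorphic_def by blast
  then show ?thesis
    unfolding nat_isomorphic_def by (intro exI[of _ \<eta>]) (auto simp: ob map)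
qed

text \<open>The situation for a torsion subcategory of zero modules: only morphisms that are already
  invertible get inverted, so nothing is gained by localizing.\<close>

locale iso_quotient = category C for C :: "('o, 'm) cat" +
  fixes T :: "'o set"
  assumes inverted: "\<lbrakk>X \<in> cobj C; Y \<in> cobj C\<rbrakk>
    \<Longrightarrow> inverted_morphisms C T X Y = {f. is_isomorphism C X Y f}"
begin

text \<open>The equivalence class of the fraction \<open>h / 1\<close>. A roof
  \<open>(U, s, f)\<close> with invertible \<open>s\<close> has \<open>f = h s\<close> for exactly
  one \<open>h\<close>, so these classes index the morphisms of the quotient by the morphisms of
  \<open>C\<close>.\<close>

definition fractions :: "'o \<Rightarrow> 'o \<Rightarrow> 'm \<Rightarrow> ('o \<times> 'm \<times> 'm) set" where
  "fractions X Y h = {(U, s, f). U \<in> cobj C \<and> is_isomorphism C U X s \<and> f = ccomp C U X Y h s}"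

abbreviation "Q \<equiv> quotient_category C T"

lemma roofs_iff: "X \<in> cobj C \<Longrightarrow>
    (U, s, f) \<in> roofs C T X Y \<longleftrightarrow> U \<in> cobj C \<and> is_isomorphism C U X s \<and> f \<in> chom C U Y"
  by (auto simp: roofs_def inverted)

lemma fractions_roofs:
  "\<lbrakk>X \<in> cobj C; Y \<in> cobj C; h \<in> chom C X Y\<rbrakk> \<Longrightarrow> fractions X Y h \<subseteq> roofs C T X Y"
  by (auto simp: roofs_iff fractions_def comp_closed iso_hom)

lemma id_fraction: "\<lbrakk>X \<in> cobj C; Y \<in> cobj C; h \<in> chom C X Y\<rbrakk> \<Longrightarrow> (X, cid C X, h) \<in> fractions X Y h"
  by (auto simp: fractions_def iso_id id_right)

lemma roof_fraction:
  assumes X: "X \<in> cobj C" and Y: "Y \<in> cobj C" and r: "(U, s, f) \<in> roofs C T X Y"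
  shows "\<exists>h \<in> chom C X Y. (U, s, f) \<in> fractions X Y h"
proof -
  have U: "U \<in> cobj C" and s: "is_isomorphism C U X s" and f: "f \<in> chom C U Y" using r X by (auto simp: roofs_iff)
  obtain t where t: "t \<in> chom C X U" "ccomp C U X U t s = cid C U"
    by (rule isoE[OF s U X]) blast
  have "ccomp C U X Y (ccomp C X U Y f t) s = f"
    using comp_assoc[OF U X U Y iso_hom[OF s] t(1) f] t(2) id_right[OF U Y f] by metis
  then show ?thesis
    using U s comp_closed[OF X U Y t(1) f]
    by (intro bexI[of _ "ccomp C X U Y f t"]) (simp_all add: fractions_def)
qed

text \<open>Composing \<open>f a\<close> with the inverse of \<open>f\<close> gives back
  \<open>a\<close>. It shows that the leg of a common refinement of two roofs towards the second
  roof is invertible.\<close>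

lemma iso_factor:
  assumes ob: "W \<in> cobj C" "X \<in> cobj C" "Y \<in> cobj C" and f: "is_isomorphism C X Y f"
    and a: "a \<in> chom C W X" and fa: "is_isomorphism C W Y (ccomp C W X Y f a)"
  shows "is_isomorphism C W X a"
proof -
  obtain g where g: "g \<in> chom C Y X" "ccomp C X Y X g f = cid C X" "is_isomorphism C Y X g"
    by (rule isoE[OF f ob(2,3)]) blast
  have "a = ccomp C W Y X g (ccomp C W X Y f a)"
    using comp_assoc[OF ob(1,2,3,2) a iso_hom[OF f] g(1)] g(2) id_left[OF ob(1,2) a] by metis
  then show ?thesis using iso_comp[OF ob(1,3,2) fa g(3)] by metis
qed

text \<open>The leg of a common refinement is an isomorphism and cancels, so equivalent roofs carry
  the same \<open>h\<close>. Conversely, two roofs \<open>(U, s, f)\<close> and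
  \<open>(V, t, g)\<close> with the same \<open>h\<close> are refined by \<open>U\<close> itself,
  through the identity and the inverse of \<open>t\<close> composed with \<open>s\<close>.\<close>

lemma roof_rel_fractions:
  assumes X: "X \<in> cobj C" and Y: "Y \<in> cobj C" and h: "h \<in> chom C X Y"
    and r: "(U, s, f) \<in> fractions X Y h"
  shows "roof_rel C T X Y `` {(U, s, f)} = fractions X Y h"
proof (intro equalityI subsetI)
  have U: "U \<in> cobj C" and s: "is_isomorphism C U X s" and f: "f = ccomp C U X Y h s"
    using r by (auto simp: fractions_def)
  fix v assume "v \<in> roof_rel C T X Y `` {(U, s, f)}"
  then obtain V t g W a b where v: "v = (V, t, g)" and Vtg: "(V, t, g) \<in> roofs C T X Y"
    and W: "W \<in> cobj C" and a: "a \<in> chom C W U" and b: "b \<in> chom C W V"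
    and eq: "ccomp C W U X s a = ccomp C W V X t b" and inv: "ccomp C W U X s a \<in> inverted_morphisms C T W X"
    and fg: "ccomp C W U Y f a = ccomp C W V Y g b"
    by (auto simp: roof_rel_def)
  have V: "V \<in> cobj C" and t: "is_isomorphism C V X t" and g: "g \<in> chom C V Y"
    using Vtg X by (auto simp: roofs_iff)
  have "is_isomorphism C W V b"
    using inv W X eq by (intro iso_factor[OF W V X t b]) (auto simp: inverted)
  moreover have "ccomp C W V Y g b = ccomp C W V Y (ccomp C V X Y h t) b"
    using comp_assoc[OF W U X Y a iso_hom[OF s] h] comp_assoc[OF W V X Y b iso_hom[OF t] h] eq f fg by metis
  ultimately have "g = ccomp C V X Y h t"
    using iso_cancel_right[OF W V Y _ g comp_closed[OF V X Y iso_hom[OF t] h]] by blast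
  then show "v \<in> fractions X Y h" using V t by (simp add: fractions_def v)
next
  have U: "U \<in> cobj C" and s: "is_isomorphism C U X s" and f: "f = ccomp C U X Y h s"
    using r by (auto simp: fractions_def)
  fix v assume v: "v \<in> fractions X Y h"
  then obtain V t g where v': "v = (V, t, g)" and V: "V \<in> cobj C" and t: "is_isomorphism C V X t"
    and g: "g = ccomp C V X Y h t" by (auto simp: fractions_def)
  obtain t' where t': "t' \<in> chom C X V" "ccomp C X V X t t' = cid C X" by (rule isoE[OF t V X]) blast
  let ?b = "ccomp C U X V t' s"
  have b: "?b \<in> chom C U V" by (rule comp_closed[OF U X V iso_hom[OF s] t'(1)])
  have tb: "ccomp C U V X t ?b = s"
    using comp_assoc[OF U X V X iso_hom[OF s] t'(1) iso_hom[OF t]] t'(2) id_left[OF U X iso_hom[OF s]] by metis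
  have gb: "ccomp C U V Y g ?b = f"
    using comp_assoc[OF U V X Y b iso_hom[OF t] h] tb g f by metis
  have fh: "f \<in> chom C U Y" using comp_closed[OF U X Y iso_hom[OF s] h] f by simp
  have "\<exists>W \<in> cobj C. \<exists>a \<in> chom C W U. \<exists>b \<in> chom C W V.
           ccomp C W U X s a = ccomp C W V X t b \<and>
           ccomp C W U X s a \<in> inverted_morphisms C T W X \<and>
           ccomp C W U Y f a = ccomp C W V Y g b"
    using U id_closed[OF U] b tb gb s
    by (intro bexI[of _ U] bexI[of _ "cid C U"] bexI[of _ ?b])
      (simp_all add: id_right[OF U X iso_hom[OF s]] id_right[OF U Y fh] inverted X)
  moreover have "(U, s, f) \<in> roofs C T X Y" "(V, t, g) \<in> roofs C T X Y"
    using fractions_roofs[OF X Y h] r v v' by auto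
  ultimately show "v \<in> roof_rel C T X Y `` {(U, s, f)}" by (auto simp: roof_rel_def v')
qed

text \<open>Composition and induced functors are defined as images under \<open>roof_rel\<close> of
  a whole set of roofs, one for each choice of representatives and of a refinement. Such a set
  yields a single class as soon as it is nonempty and contained in one class.\<close>

lemma roof_rel_subset_fractions:
  assumes "X \<in> cobj C" "Y \<in> cobj C" "h \<in> chom C X Y" "S \<subseteq> fractions X Y h" "r \<in> S"
  shows "roof_rel C T X Y `` S = fractions X Y h"
proof -
  have "roof_rel C T X Y `` {x} = fractions X Y h" if "x \<in> S" for x
    using roof_rel_fractions[OF assms(1-3), of "fst x" "fst (snd x)" "snd (snd x)"] that assms(4) by auto
  then have "(\<Union>x\<in>S. roof_rel C T X Y `` {x}) = fractions X Y h" using assms(5) by auto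
  then show ?thesis by (subst Image_eq_UN)
qed

lemma chom_quotient:
  assumes X: "X \<in> cobj C" and Y: "Y \<in> cobj C"
  shows "chom Q X Y = fractions X Y ` chom C X Y"
proof (intro equalityI subsetI)
  fix c assume "c \<in> chom Q X Y"
  then obtain U s f where r: "(U, s, f) \<in> roofs C T X Y" "c = roof_rel C T X Y `` {(U, s, f)}"
    by (auto simp: quotient_category_def quotient_def)
  obtain h where "h \<in> chom C X Y" "(U, s, f) \<in> fractions X Y h" using roof_fraction[OF X Y r(1)] by blast
  with roof_rel_fractions[OF X Y] r show "c \<in> fractions X Y ` chom C X Y" by blast
next
  fix c assume "c \<in> fractions X Y ` chom C X Y"
  then obtain h where h: "h \<in> chom C X Y" "c = fractions X Y h" by blast
  then have "c = roof_rel C T X Y `` {(X, cid C X, h)}" "(X, cid C X, h) \<in> roofs C T X Y"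
    using roof_rel_fractions[OF X Y h(1) id_fraction[OF X Y h(1)]] id_fraction[OF X Y h(1)]
      fractions_roofs[OF X Y h(1)] by auto
  then show "c \<in> chom Q X Y" by (auto simp: quotient_category_def quotient_def)
qed

lemma fractions_inject:
  assumes X: "X \<in> cobj C" and Y: "Y \<in> cobj C" and h: "h \<in> chom C X Y" "k \<in> chom C X Y"
    and eq: "fractions X Y h = fractions X Y k"
  shows "h = k"
  using id_fraction[OF X Y h(1)] unfolding eq by (simp add: fractions_def id_right[OF X Y h(2)])

lemma ccomp_quotient:
  assumes X: "X \<in> cobj C" and Y: "Y \<in> cobj C" and Z: "Z \<in> cobj C" and h: "h \<in> chom C X Y" and k: "k \<in> chom C Y Z"
  shows "ccomp Q X Y Z (fractions Y Z k) (fractions X Y h) = fractions X Z (ccomp C X Y Z k h)"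
proof -
  define S where "S = {(W, ccomp C W U X s a, ccomp C W V Z g b) | W U V s f t g a b.
           (U, s, f) \<in> fractions X Y h \<and> (V, t, g) \<in> fractions Y Z k \<and> W \<in> cobj C \<and>
           a \<in> inverted_morphisms C T W U \<and> b \<in> chom C W V \<and>
           ccomp C W U Y f a = ccomp C W V Y t b}"
  have "roof_rel C T X Z `` S = fractions X Z (ccomp C X Y Z k h)"
  proof (rule roof_rel_subset_fractions[OF X Z comp_closed[OF X Y Z h k]])
    \<comment> \<open>For any refinement \<open>g b = k t b = k f a = (k h) (s a)\<close>.\<close>
    show "S \<subseteq> fractions X Z (ccomp C X Y Z k h)"
    proof
      fix x assume "x \<in> S"
      then obtain W U V s f t g a b where x: "x = (W, ccomp C W U X s a, ccomp C W V Z g b)"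
        and r: "(U, s, f) \<in> fractions X Y h" "(V, t, g) \<in> fractions Y Z k" and W: "W \<in> cobj C"
        and a: "a \<in> inverted_morphisms C T W U" and b: "b \<in> chom C W V"
        and eq: "ccomp C W U Y f a = ccomp C W V Y t b"
        by (auto simp: S_def)
      have U: "U \<in> cobj C" and V: "V \<in> cobj C" and s: "is_isomorphism C U X s" and t: "is_isomorphism C V Y t"
        and f: "f = ccomp C U X Y h s" and g: "g = ccomp C V Y Z k t" using r by (auto simp: fractions_def)
      have a: "is_isomorphism C W U a" using a W U by (simp add: inverted)
      have sa: "is_isomorphism C W X (ccomp C W U X s a)" by (rule iso_comp[OF W U X a s])
      have "ccomp C W V Z g b = ccomp C W Y Z k (ccomp C W V Y t b)"
        using comp_assoc[OF W V Y Z b iso_hom[OF t] k] g by metis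
      also have "\<dots> = ccomp C W Y Z k (ccomp C W X Y h (ccomp C W U X s a))"
        using comp_assoc[OF W U X Y iso_hom[OF a] iso_hom[OF s] h] eq f by metis
      also have "\<dots> = ccomp C W X Z (ccomp C X Y Z k h) (ccomp C W U X s a)"
        by (rule comp_assoc[OF W X Y Z iso_hom[OF sa] h k])
      finally show "x \<in> fractions X Z (ccomp C X Y Z k h)"
        using W sa by (simp add: fractions_def x)
    qed
    have "ccomp C X X Y h (cid C X) = ccomp C X Y Y (cid C Y) h"
      by (simp add: id_left[OF X Y h] id_right[OF X Y h])
    \<comment> \<open>The set is nonempty: \<open>(X, 1, h)\<close> and \<open>(Y, 1, k)\<close> are
      refined by \<open>X\<close>, with legs the identity and \<open>h\<close>.\<close>
    then show "(X, ccomp C X X X (cid C X) (cid C X), ccomp C X Y Z k h) \<in> S"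
      unfolding S_def mem_Collect_eq using id_fraction[OF X Y h] id_fraction[OF Y Z k] X h iso_id[OF X]
      by (intro exI[of _ X] exI[of _ Y] exI[of _ "cid C X"] exI[of _ h] exI[of _ "cid C Y"] exI[of _ k])
        (simp add: inverted)
  qed
  then show ?thesis by (simp add: quotient_category_def S_def)
qed

lemma cobj_quotient [simp]: "cobj Q = cobj C"
  by (simp add: quotient_category_def)

lemma cid_quotient: "X \<in> cobj C \<Longrightarrow> cid Q X = fractions X X (cid C X)"
  by (simp add: quotient_category_def roof_rel_fractions id_fraction id_closed)

lemma category_quotient: "category Q"
  by unfold_locales
    (auto simp: chom_quotient cid_quotient id_closed ccomp_quotient comp_closed comp_assoc id_left id_right)

lemma fmap_quotient_functor:
  "\<lbrakk>X \<in> cobj C; Y \<in> cobj C; h \<in> chom C X Y\<rbrakk> \<Longrightarrow> fmap (quotient_functor C T) X Y h = fractions X Y h"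
  by (simp add: quotient_functor_def roof_rel_fractions id_fraction)

lemma fobj_quotient_functor [simp]: "fobj (quotient_functor C T) X = X"
  by (simp add: quotient_functor_def)

lemma fully_faithful_quotient_functor: "fully_faithful C Q (quotient_functor C T)"
proof -
  interpret Q: category Q by (rule category_quotient)
  show ?thesis
    by unfold_locales
      (auto simp: fmap_quotient_functor chom_quotient cid_quotient id_closed ccomp_quotient comp_closed
        dest: fractions_inject)
qed

lemma is_equivalence_quotient_functor: "is_equivalence C Q (quotient_functor C T)"
proof -
  interpret Q: category Q by (rule category_quotient)
  interpret ff: fully_faithful C Q "quotient_functor C T" by (rule fully_faithful_quotient_functor)
  show ?thesis
  proof (rule ff.is_equivalence)
    fix Y assume "Y \<in> cobj Q"
    then show "\<exists>X \<in> cobj C. isomorphic_in Q (fobj (quotient_functor C T) X) Y"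
      using Q.iso_id by (intro bexI[of _ Y]) (auto simp: isomorphic_in_def)
  qed
qed

lemma fmap_induced_endofunctor:
  assumes S: "cat_functor C C S" and X: "X \<in> cobj C" and Y: "Y \<in> cobj C" and h: "h \<in> chom C X Y"
  shows "fmap (induced_endofunctor C T S) X Y (fractions X Y h)
    = fractions (fobj S X) (fobj S Y) (fmap S X Y h)"
proof -
  interpret S: cat_functor C C S by fact
  let ?A = "{(fobj S U, fmap S U X s, fmap S U Y f) | U s f. (U, s, f) \<in> fractions X Y h}"
  have "?A \<subseteq> fractions (fobj S X) (fobj S Y) (fmap S X Y h)"
    by (auto simp: fractions_def S.obj_closed X Y h S.map_iso S.map_comp iso_hom)
  moreover have "(fobj S X, fmap S X X (cid C X), fmap S X Y h) \<in> ?A"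
    using id_fraction[OF X Y h] by blast
  ultimately have "roof_rel C T (fobj S X) (fobj S Y) `` ?A
      = fractions (fobj S X) (fobj S Y) (fmap S X Y h)"
    by (rule roof_rel_subset_fractions[OF S.obj_closed[OF X] S.obj_closed[OF Y] S.map_closed[OF X Y h]])
  then show ?thesis by (simp add: induced_endofunctor_def)
qed

lemma fobj_induced_endofunctor [simp]: "fobj (induced_endofunctor C T S) = fobj S"
  by (simp add: induced_endofunctor_def)

lemma triple_equiv_quotient:
  assumes S: "cat_functor C C S" and O: "P \<in> cobj C"
  shows "triple_equiv (C, P, S) (Q, fobj (quotient_functor C T) P, induced_endofunctor C T S)"
proof -
  interpret S: cat_functor C C S by fact
  interpret Q: category Q by (rule category_quotient)
  interpret ff: fully_faithful C Q "quotient_functor C T" by (rule fully_faithful_quotient_functor)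
  let ?I = "induced_endofunctor C T S"
  have I: "cat_functor Q Q ?I"
    by unfold_locales
      (auto simp: fmap_induced_endofunctor[OF S] S.obj_closed chom_quotient cid_quotient S.map_id
        S.map_closed S.map_comp id_closed ccomp_quotient comp_closed)
  have "nat_isomorphic C Q (comp_functr (quotient_functor C T) S) (comp_functr ?I (quotient_functor C T))"
    by (rule nat_isomorphic_cong[OF cat_functor_comp[OF S ff.cat_functor_axioms]])
      (auto simp: fmap_quotient_functor fmap_induced_endofunctor[OF S] S.obj_closed S.map_closed)
  moreover have "isomorphic_in Q P P" using Q.iso_id O by (auto simp: isomorphic_in_def)
  ultimately show ?thesis
    using S O I is_equivalence_quotient_functor by (auto simp: triple_equiv_def is_triple_def)
qed

end

section \<open>Right modules\<close>

lemma cobj_Mod_cat [simp]: "cobj (Mod_cat R) = {M. right_module R M}"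
  and chom_Mod_cat [simp]: "chom (Mod_cat R) = rmodule_hom R"
  and cid_Mod_cat [simp]: "cid (Mod_cat R) M = (\<lambda>x \<in> carrier M. x)"
  and ccomp_Mod_cat [simp]: "ccomp (Mod_cat R) L M N g f = compose (carrier L) g f"
  by (simp_all add: Mod_cat_def)

lemma rmodule_hom_closed: "\<lbrakk>f \<in> rmodule_hom R M N; x \<in> carrier M\<rbrakk> \<Longrightarrow> f x \<in> carrier N"
  and rmodule_hom_add: "\<lbrakk>f \<in> rmodule_hom R M N; x \<in> carrier M; y \<in> carrier M\<rbrakk>
    \<Longrightarrow> f (x \<oplus>\<^bsub>M\<^esub> y) = f x \<oplus>\<^bsub>N\<^esub> f y"
  and rmodule_hom_act: "\<lbrakk>f \<in> rmodule_hom R M N; x \<in> carrier M; a \<in> carrier R\<rbrakk>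
    \<Longrightarrow> f (ract M x a) = ract N (f x) a"
  and rmodule_hom_extensional: "f \<in> rmodule_hom R M N \<Longrightarrow> f \<in> extensional (carrier M)"
  by (auto simp: rmodule_hom_def PiE_def Pi_def)

lemma rmodule_hom_undefined: "\<lbrakk>f \<in> rmodule_hom R M N; x \<notin> carrier M\<rbrakk> \<Longrightarrow> f x = undefined"
  by (meson extensional_arb rmodule_hom_extensional)

lemma rmodule_homI:
  assumes "\<And>x. x \<in> carrier M \<Longrightarrow> f x \<in> carrier N"
    and "\<And>x y. \<lbrakk>x \<in> carrier M; y \<in> carrier M\<rbrakk> \<Longrightarrow> f (x \<oplus>\<^bsub>M\<^esub> y) = f x \<oplus>\<^bsub>N\<^esub> f y"
    and "\<And>x a. \<lbrakk>x \<in> carrier M; a \<in> carrier R\<rbrakk> \<Longrightarrow> f (ract M x a) = ract N (f x) a"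
    and "f \<in> extensional (carrier M)"
  shows "f \<in> rmodule_hom R M N"
  using assms by (auto simp: rmodule_hom_def PiE_def Pi_def)

lemma rmodule_hom_eqI:
  "\<lbrakk>f \<in> rmodule_hom R M N; g \<in> rmodule_hom R M N'; \<And>x. x \<in> carrier M \<Longrightarrow> f x = g x\<rbrakk> \<Longrightarrow> f = g"
  by (meson extensionalityI rmodule_hom_extensional)

lemma rmodule_hom_id: "right_module R M \<Longrightarrow> (\<lambda>x \<in> carrier M. x) \<in> rmodule_hom R M M"
proof -
  assume "right_module R M"
  then interpret right_module R M .
  show ?thesis by (rule rmodule_homI) (auto simp: ract_closed)
qed

lemma rmodule_hom_compose:
  assumes "right_module R L" "f \<in> rmodule_hom R L M" "g \<in> rmodule_hom R M N"
  shows "compose (carrier L) g f \<in> rmodule_hom R L N"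
proof -
  interpret right_module R L by fact
  show ?thesis
    using assms(2,3)
    by (intro rmodule_homI)
      (auto simp: compose_eq ract_closed rmodule_hom_add rmodule_hom_act rmodule_hom_closed)
qed

lemma category_Mod_cat: "category (Mod_cat R)"
proof
  show "ccomp (Mod_cat R) W Y Z h (ccomp (Mod_cat R) W X Y g f)
      = ccomp (Mod_cat R) W X Z (ccomp (Mod_cat R) X Y Z h g) f"
    if "f \<in> chom (Mod_cat R) W X" for W X Y Z f g h
    using that by (auto simp: compose_def fun_eq_iff rmodule_hom_closed)
  show "ccomp (Mod_cat R) X Y Y (cid (Mod_cat R) Y) f = f" if "f \<in> chom (Mod_cat R) X Y" for X Y f
    using that by (auto simp: compose_def fun_eq_iff rmodule_hom_closed rmodule_hom_undefined)
  show "ccomp (Mod_cat R) X X Y f (cid (Mod_cat R) X) = f" if "f \<in> chom (Mod_cat R) X Y" for X Y f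
    using that by (auto simp: compose_def fun_eq_iff rmodule_hom_undefined)
qed (auto simp: rmodule_hom_id rmodule_hom_compose)

lemma rmodule_hom_group_hom:
  assumes "right_module R M" "right_module R N" "f \<in> rmodule_hom R M N"
  shows "abelian_group_hom M N f"
proof -
  interpret M: right_module R M by fact
  interpret N: right_module R N by fact
  show ?thesis
    by (rule abelian_group_homI[OF M.M.abelian_group_axioms N.M.abelian_group_axioms])
      (use assms(3) in \<open>auto simp: group_hom_def group_hom_axioms_def hom_def M.M.a_group N.M.a_group
        rmodule_hom_closed rmodule_hom_add\<close>)
qed

lemma rmodule_hom_zero:
  assumes "right_module R M" "right_module R N" "f \<in> rmodule_hom R M N"
  shows "f \<zero>\<^bsub>M\<^esub> = \<zero>\<^bsub>N\<^esub>"
  using abelian_group_hom.hom_zero[OF rmodule_hom_group_hom[OF assms]] .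

lemma rmodule_hom_inv:
  assumes M: "right_module R M" and f: "f \<in> rmodule_hom R M N" and bij: "bij_betw f (carrier M) (carrier N)"
  shows "restrict (inv_into (carrier M) f) (carrier N) \<in> rmodule_hom R N M"
proof -
  interpret M: right_module R M by fact
  have inv: "inv_into (carrier M) f (f x) = x" if "x \<in> carrier M" for x
    using bij that by (simp add: bij_betw_def)
  have surj: "carrier N = f ` carrier M" using bij by (simp add: bij_betw_def)
  show ?thesis
  proof (rule rmodule_homI)
    fix x y assume "x \<in> carrier N" "y \<in> carrier N"
    then obtain u v where "u \<in> carrier M" "v \<in> carrier M" "x = f u" "y = f v" by (auto simp: surj)
    then show "restrict (inv_into (carrier M) f) (carrier N) (x \<oplus>\<^bsub>N\<^esub> y) =
        restrict (inv_into (carrier M) f) (carrier N) x \<oplus>\<^bsub>M\<^esub> restrict (inv_into (carrier M) f) (carrier N) y"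
      using rmodule_hom_add[OF f, of u v] rmodule_hom_closed[OF f] inv by (metis M.M.a_closed restrict_apply')
  next
    fix x a assume "x \<in> carrier N" and a: "a \<in> carrier R"
    then obtain u where u: "u \<in> carrier M" "x = f u" by (auto simp: surj)
    then show "restrict (inv_into (carrier M) f) (carrier N) (ract N x a) =
        ract M (restrict (inv_into (carrier M) f) (carrier N) x) a"
      using rmodule_hom_act[OF f u(1) a] rmodule_hom_closed[OF f] inv a by (metis M.ract_closed restrict_apply')
  qed (auto simp: surj inv)
qed

lemma Mod_cat_isoI:
  assumes M: "right_module R M" and f: "f \<in> rmodule_hom R M N" and bij: "bij_betw f (carrier M) (carrier N)"
  shows "is_isomorphism (Mod_cat R) M N f"
  unfolding is_isomorphism_def
proof (intro conjI bexI)
  show "restrict (inv_into (carrier M) f) (carrier N) \<in> chom (Mod_cat R) N M"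
    using rmodule_hom_inv[OF assms] by simp
  show "ccomp (Mod_cat R) M N M (restrict (inv_into (carrier M) f) (carrier N)) f = cid (Mod_cat R) M"
    "ccomp (Mod_cat R) N M N f (restrict (inv_into (carrier M) f) (carrier N)) = cid (Mod_cat R) N"
    using bij by (auto simp: compose_def fun_eq_iff bij_betw_def f_inv_into_f)
qed (use f in simp)

text \<open>The same formula as for \<open>small_copy\<close>, for a map \<open>q\<close> that may
  identify elements. For injective \<open>q\<close> it is a copy; for \<open>q\<close> picking a
  representative of each coset it is a quotient module that stays on the given type.\<close>

definition image_copy :: "('x \<Rightarrow> 'u) \<Rightarrow> ('a, 'x) rmodule \<Rightarrow> ('a, 'u) rmodule" where
  "image_copy q M = (let i = inv_into (carrier M) q in
      \<lparr>carrier = q ` carrier M, mult = undefined, one = undefined, zero = q \<zero>\<^bsub>M\<^esub>,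
       add = (\<lambda>x y. q (i x \<oplus>\<^bsub>M\<^esub> i y)), ract = (\<lambda>x a. q (ract M (i x) a))\<rparr>)"

lemma small_copy_eq: "small_copy M = image_copy (small_inj (carrier M)) M"
  by (simp add: small_copy_def image_copy_def Let_def)

lemma small_inj: "X \<lesssim> (UNIV :: 'u set) \<Longrightarrow> inj_on (small_inj X :: 'x \<Rightarrow> 'u) X"
proof -
  assume "X \<lesssim> (UNIV :: 'u set)"
  then have "\<exists>j :: 'x \<Rightarrow> 'u. inj_on j X" by (auto simp: lepoll_def)
  then show ?thesis unfolding small_inj_def by (rule someI_ex)
qed

lemma carrier_image_copy [simp]: "carrier (image_copy q M) = q ` carrier M"
  and zero_image_copy [simp]: "zero (image_copy q M) = q \<zero>\<^bsub>M\<^esub>"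
  by (simp_all add: image_copy_def Let_def)

text \<open>The two conditions say that the fibres of \<open>q\<close> form a congruence, so the
  operations of \<open>image_copy\<close> do not depend on the preimages that
  \<open>inv_into\<close> picks.\<close>

locale image_module = right_module R M for R :: "('a, 'r) ring_scheme" and M :: "('a, 'x) rmodule" +
  fixes q :: "'x \<Rightarrow> 'u"
  assumes cong_add: "\<lbrakk>x \<in> carrier M; x' \<in> carrier M; y \<in> carrier M; y' \<in> carrier M; q x = q x'; q y = q y'\<rbrakk>
      \<Longrightarrow> q (x \<oplus>\<^bsub>M\<^esub> y) = q (x' \<oplus>\<^bsub>M\<^esub> y')"
    and cong_act: "\<lbrakk>x \<in> carrier M; x' \<in> carrier M; q x = q x'; a \<in> carrier R\<rbrakk>
      \<Longrightarrow> q (ract M x a) = q (ract M x' a)"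
begin

lemma inv_into_image: "x \<in> carrier M \<Longrightarrow> inv_into (carrier M) q (q x) \<in> carrier M"
  "x \<in> carrier M \<Longrightarrow> q (inv_into (carrier M) q (q x)) = q x"
  by (auto simp: inv_into_into f_inv_into_f)

lemma add_image_copy: "\<lbrakk>x \<in> carrier M; y \<in> carrier M\<rbrakk> \<Longrightarrow> q x \<oplus>\<^bsub>image_copy q M\<^esub> q y = q (x \<oplus>\<^bsub>M\<^esub> y)"
  by (simp add: image_copy_def Let_def) (rule cong_add; simp add: inv_into_image)

lemma ract_image_copy: "\<lbrakk>x \<in> carrier M; a \<in> carrier R\<rbrakk> \<Longrightarrow> ract (image_copy q M) (q x) a = q (ract M x a)"
  by (simp add: image_copy_def Let_def) (rule cong_act; simp add: inv_into_image)

lemma right_module_image_copy: "right_module R (image_copy q M)"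
proof (intro right_module.intro right_module_axioms.intro)
  show "ring R" by (rule R.ring_axioms)
  show "abelian_group (image_copy q M)"
  proof (rule abelian_groupI)
    fix x assume "x \<in> carrier (image_copy q M)"
    then obtain u where u: "u \<in> carrier M" "x = q u" by auto
    then have "q (\<ominus>\<^bsub>M\<^esub> u) \<oplus>\<^bsub>image_copy q M\<^esub> x = \<zero>\<^bsub>image_copy q M\<^esub>"
      by (simp add: add_image_copy M.l_neg)
    with u show "\<exists>y\<in>carrier (image_copy q M). y \<oplus>\<^bsub>image_copy q M\<^esub> x = \<zero>\<^bsub>image_copy q M\<^esub>"
      by auto
  qed (auto simp: add_image_copy M.a_ac)
qed (auto simp: add_image_copy ract_image_copy ract_closed ract_add_left ract_add_right ract_mult ract_one)

end

lemma image_module_inj: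
  assumes "right_module R M" "inj_on q (carrier M)" shows "image_module R M q"
proof -
  interpret right_module R M by fact
  show ?thesis
    by unfold_locales (use assms(2) in \<open>auto dest: inj_onD\<close>)
qed

lemma image_module_small:
  assumes "right_module R M" "carrier M \<lesssim> (UNIV :: 'u set)"
  shows "image_module R M (small_inj (carrier M) :: _ \<Rightarrow> 'u)"
  using image_module_inj[OF assms(1) small_inj[OF assms(2)]] .

lemma right_module_regular: "ring R \<Longrightarrow> right_module R (regular_rmodule R)"
proof -
  assume "ring R" then interpret ring R .
  show ?thesis
  proof (intro right_module.intro right_module_axioms.intro ring_axioms)
    show "abelian_group (regular_rmodule R)"
      by (rule abelian_groupI) (auto simp: regular_rmodule_def a_ac intro: l_neg)
  qed (auto simp: regular_rmodule_def l_distr r_distr m_assoc)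
qed

text \<open>The test is applied to the inclusion of the kernel of \<open>f\<close>, a module carried
  by a subset of \<open>M\<close> and therefore in the same universe. Maps that \<open>f\<close>
  sends to zero are what a categorical kernel controls.\<close>

lemma rmodule_hom_injI:
  fixes M N :: "('a, 'u) rmodule"
  assumes M: "right_module R M" and N: "right_module R N" and f: "f \<in> rmodule_hom R M N"
    and test: "\<And>W a. \<lbrakk>right_module R (W :: ('a, 'u) rmodule); a \<in> rmodule_hom R W M;
      \<And>x. x \<in> carrier W \<Longrightarrow> f (a x) = \<zero>\<^bsub>N\<^esub>\<rbrakk> \<Longrightarrow> \<forall>x \<in> carrier W. a x = \<zero>\<^bsub>M\<^esub>"
  shows "inj_on f (carrier M)"
proof -
  interpret M: right_module R M by fact
  interpret N: right_module R N by fact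
  interpret f: abelian_group_hom M N f by (rule rmodule_hom_group_hom[OF M N f])
  define W where "W = M\<lparr>carrier := {x \<in> carrier M. f x = \<zero>\<^bsub>N\<^esub>}\<rparr>"
  have act0: "ract N \<zero>\<^bsub>N\<^esub> a = \<zero>\<^bsub>N\<^esub>" if "a \<in> carrier R" for a
    using N.ract_add_left[of "\<zero>\<^bsub>N\<^esub>" "\<zero>\<^bsub>N\<^esub>" a] that N.ract_closed[of "\<zero>\<^bsub>N\<^esub>" a] by simp
  have W: "right_module R W"
  proof (intro right_module.intro right_module_axioms.intro)
    show "abelian_group W"
    proof (rule abelian_groupI)
      fix x assume "x \<in> carrier W"
      then show "\<exists>y\<in>carrier W. y \<oplus>\<^bsub>W\<^esub> x = \<zero>\<^bsub>W\<^esub>"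
        by (intro bexI[of _ "\<ominus>\<^bsub>M\<^esub> x"]) (auto simp: W_def M.M.l_neg)
    qed (auto simp: W_def M.M.a_ac)
  qed (auto simp: W_def M.R.ring_axioms M.ract_closed rmodule_hom_act[OF f] act0
      M.ract_add_left M.ract_add_right M.ract_mult M.ract_one)
  have "\<forall>x \<in> carrier W. (\<lambda>x \<in> carrier W. x) x = \<zero>\<^bsub>M\<^esub>"
    by (rule test[OF W]) (auto intro!: rmodule_homI simp: W_def rmodule_hom_act[OF f] act0 M.ract_closed extensional_def)
  then have ker: "x = \<zero>\<^bsub>M\<^esub>" if "x \<in> carrier M" "f x = \<zero>\<^bsub>N\<^esub>" for x
    using that by (auto simp: W_def)
  show ?thesis
  proof (rule inj_onI)
    fix x y assume x: "x \<in> carrier M" and y: "y \<in> carrier M" and eq: "f x = f y"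
    have "x \<ominus>\<^bsub>M\<^esub> y = \<zero>\<^bsub>M\<^esub>"
      by (rule ker) (use x y eq in \<open>simp_all add: M.M.minus_eq N.M.r_neg\<close>)
    moreover have "x = (x \<ominus>\<^bsub>M\<^esub> y) \<oplus>\<^bsub>M\<^esub> y" using x y by (simp add: M.M.minus_eq M.M.a_assoc M.M.l_neg)
    ultimately show "x = y" using y by simp
  qed
qed

text \<open>The test is applied to the projection onto the cokernel of \<open>f\<close>. To keep the
  cokernel on the type of \<open>N\<close>, it is carried by chosen representatives of the cosets of
  the image rather than by the cosets.\<close>

lemma rmodule_hom_surjI:
  fixes M N :: "('a, 'u) rmodule"
  assumes M: "right_module R M" and N: "right_module R N" and f: "f \<in> rmodule_hom R M N"
    and test: "\<And>W a. \<lbrakk>right_module R (W :: ('a, 'u) rmodule); a \<in> rmodule_hom R N W;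
      \<And>x. x \<in> carrier M \<Longrightarrow> a (f x) = \<zero>\<^bsub>W\<^esub>\<rbrakk> \<Longrightarrow> \<forall>x \<in> carrier N. a x = \<zero>\<^bsub>W\<^esub>"
  shows "f ` carrier M = carrier N"
proof -
  interpret M: right_module R M by fact
  interpret N: right_module R N by fact
  interpret f: abelian_group_hom M N f by (rule rmodule_hom_group_hom[OF M N f])
  define K where "K y = {y \<oplus>\<^bsub>N\<^esub> f x | x. x \<in> carrier M}" for y
  define q where "q y = (SOME z. z \<in> K y)" for y
  have self: "y \<in> K y" if "y \<in> carrier N" for y
    using that f.hom_zero by (force simp: K_def intro: exI[of _ "\<zero>\<^bsub>M\<^esub>"])
  then have q: "q y \<in> K y" if "y \<in> carrier N" for y
    unfolding q_def using that by (metis someI)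
  have K_subset: "K z \<subseteq> K y" if yz: "y \<in> carrier N" "z \<in> K y" for y z
  proof
    fix w assume "w \<in> K z"
    then obtain x' where "x' \<in> carrier M" "w = z \<oplus>\<^bsub>N\<^esub> f x'" by (auto simp: K_def)
    moreover obtain x where "x \<in> carrier M" "z = y \<oplus>\<^bsub>N\<^esub> f x" using yz by (auto simp: K_def)
    ultimately show "w \<in> K y" using yz(1)
      by (auto simp: K_def N.M.a_assoc intro!: exI[of _ "x \<oplus>\<^bsub>M\<^esub> x'"])
  qed
  have K_sym: "y \<in> K z" if yz: "y \<in> carrier N" "z \<in> K y" for y z
  proof -
    obtain x where "x \<in> carrier M" "z = y \<oplus>\<^bsub>N\<^esub> f x" using yz by (auto simp: K_def)
    then show ?thesis using yz(1)
      by (auto simp: K_def N.M.a_assoc N.M.r_neg intro!: exI[of _ "\<ominus>\<^bsub>M\<^esub> x"])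
  qed
  have K_carrier: "K y \<subseteq> carrier N" if "y \<in> carrier N" for y using that by (auto simp: K_def)
  \<comment> \<open>Cosets that meet coincide, so \<open>q\<close> identifies exactly the elements
    that are congruent modulo the image of \<open>f\<close>.\<close>
  have q_eq: "q y = q z \<longleftrightarrow> z \<in> K y" if y: "y \<in> carrier N" and z: "z \<in> carrier N" for y z
  proof
    assume "q y = q z"
    then have "q z \<in> K y" "q z \<in> K z" using q[OF y] q[OF z] by auto
    then have "z \<in> K (q z)" "K (q z) \<subseteq> K y" using K_sym[OF z] K_subset[OF y] by auto
    then show "z \<in> K y" by blast
  next
    assume "z \<in> K y"
    then have "K z = K y" using K_subset[OF y] K_subset[OF z] K_sym[OF y] by blast
    then show "q y = q z" by (simp add: q_def)
  qed
  interpret q: image_module R N q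
  proof
    fix x x' y y' assume c: "x \<in> carrier N" "x' \<in> carrier N" "y \<in> carrier N" "y' \<in> carrier N"
      and "q x = q x'" "q y = q y'"
    then obtain u v where "u \<in> carrier M" "v \<in> carrier M" "x' = x \<oplus>\<^bsub>N\<^esub> f u" "y' = y \<oplus>\<^bsub>N\<^esub> f v"
      by (auto simp: q_eq) (auto simp: K_def)
    then have "x' \<oplus>\<^bsub>N\<^esub> y' = (x \<oplus>\<^bsub>N\<^esub> y) \<oplus>\<^bsub>N\<^esub> f (u \<oplus>\<^bsub>M\<^esub> v)" "u \<oplus>\<^bsub>M\<^esub> v \<in> carrier M"
      using c by (simp_all add: N.M.a_ac)
    then show "q (x \<oplus>\<^bsub>N\<^esub> y) = q (x' \<oplus>\<^bsub>N\<^esub> y')" using c by (subst q_eq) (auto simp: K_def)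
  next
    fix x x' a assume c: "x \<in> carrier N" "x' \<in> carrier N" "a \<in> carrier R" and "q x = q x'"
    then obtain u where u: "u \<in> carrier M" "x' = x \<oplus>\<^bsub>N\<^esub> f u"
      by (auto simp: q_eq) (auto simp: K_def)
    then have "ract N x' a = ract N x a \<oplus>\<^bsub>N\<^esub> f (ract M u a)"
      using c by (simp add: N.ract_add_left rmodule_hom_act[OF f])
    then show "q (ract N x a) = q (ract N x' a)" using c u M.ract_closed[of u a]
      by (subst q_eq) (auto simp: K_def N.ract_closed)
  qed
  have a: "restrict q (carrier N) \<in> rmodule_hom R N (image_copy q N)"
    by (rule rmodule_homI) (auto simp: q.add_image_copy q.ract_image_copy N.ract_closed)
  have "restrict q (carrier N) (f x) = \<zero>\<^bsub>image_copy q N\<^esub>" if "x \<in> carrier M" for x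
  proof -
    have "f x \<in> K \<zero>\<^bsub>N\<^esub>" using that by (auto simp: K_def intro!: exI[of _ x])
    then show ?thesis using that by (simp add: q_eq[symmetric])
  qed
  note t = test[OF q.right_module_image_copy a this]
  have "y \<in> f ` carrier M" if y: "y \<in> carrier N" for y
  proof -
    \<comment> \<open>The projection vanishes, which puts \<open>y\<close> into the coset of zero,
      and that coset is the image of \<open>f\<close>.\<close>
    have "q y = q \<zero>\<^bsub>N\<^esub>" using bspec[OF t y] y by simp
    then have "y \<in> K \<zero>\<^bsub>N\<^esub>" using q_eq[of "\<zero>\<^bsub>N\<^esub>" y] y by simp
    then show ?thesis by (auto simp: K_def)
  qed
  then show ?thesis by auto
qed

section \<open>Restriction of scalars along ring homomorphisms\<close>

lemma right_module_pullback:
  assumes N: "right_module R' N" and R: "ring R" and h: "\<psi> \<in> ring_hom R R'"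
  shows "right_module R (N\<lparr>ract := (\<lambda>x b. ract N x (\<psi> b))\<rparr>)"
proof -
  interpret N: right_module R' N by fact
  show ?thesis
  proof (intro right_module.intro right_module_axioms.intro R)
    show "abelian_group (N\<lparr>ract := (\<lambda>x b. ract N x (\<psi> b))\<rparr>)"
      by (rule abelian_groupI) (auto simp: N.M.a_ac intro: N.M.l_neg)
  qed (use ring_hom_closed[OF h] ring_hom_add[OF h] ring_hom_mult[OF h] ring_hom_one[OF h] in
      \<open>simp_all add: N.ract_closed N.ract_add_left N.ract_add_right N.ract_mult N.ract_one\<close>)
qed

lemma fobj_pullback [simp]: "fobj (pullback_functor \<psi>) N = N\<lparr>ract := (\<lambda>x b. ract N x (\<psi> b))\<rparr>"
  and fmap_pullback [simp]: "fmap (pullback_functor \<psi>) M N f = f"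
  by (simp_all add: pullback_functor_def)

lemma cat_functor_pullback:
  assumes R: "ring R" and h: "\<psi> \<in> ring_hom R R'"
  shows "cat_functor (Mod_cat R') (Mod_cat R) (pullback_functor \<psi>)"
proof -
  interpret C: category "Mod_cat R'" by (rule category_Mod_cat)
  interpret D: category "Mod_cat R" by (rule category_Mod_cat)
  show ?thesis
    by unfold_locales
      (auto simp: right_module_pullback[OF _ R h] ring_hom_closed[OF h] rmodule_hom_def)
qed

text \<open>As \<open>\<psi>\<close> is onto, linearity over \<open>R\<close> through
  \<open>\<psi>\<close> and linearity over \<open>R'\<close> are the same condition, so the functor
  is full. Any \<open>R\<close>-module is the restriction of itself with \<open>R'\<close> acting
  through the inverse of \<open>\<psi>\<close>.\<close>

lemma is_equivalence_pullback:
  assumes R: "ring R" and R': "ring R'" and h: "\<psi> \<in> ring_hom R R'"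
    and bij: "bij_betw \<psi> (carrier R) (carrier R')"
  shows "is_equivalence (Mod_cat R' :: (('a, 'u) rmodule, _) cat) (Mod_cat R) (pullback_functor \<psi>)"
proof -
  interpret F: cat_functor "Mod_cat R'" "Mod_cat R" "pullback_functor \<psi>"
    by (rule cat_functor_pullback[OF R h])
  have surj: "carrier R' = \<psi> ` carrier R" using bij by (simp add: bij_betw_def)
  interpret F: fully_faithful "Mod_cat R'" "Mod_cat R" "pullback_functor \<psi>"
    by unfold_locales (auto simp: rmodule_hom_def surj)
  have inv: "inv_into (carrier R) \<psi> \<in> ring_hom R' R"
    using ring_iso_set_sym[OF R] h bij by (auto simp: ring_iso_def)
  show ?thesis
  proof (rule F.is_equivalence)
    fix N :: "('a, 'u) rmodule" assume "N \<in> cobj (Mod_cat R)"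
    then have N: "right_module R N" by simp
    let ?M = "N\<lparr>ract := (\<lambda>x b. ract N x (inv_into (carrier R) \<psi> b))\<rparr>"
    have M: "right_module R' ?M" by (rule right_module_pullback[OF N R' inv])
    have "is_isomorphism (Mod_cat R) (fobj (pullback_functor \<psi>) ?M) N (\<lambda>x \<in> carrier N. x)"
    proof (rule Mod_cat_isoI)
      interpret N: right_module R N by fact
      show "(\<lambda>x\<in>carrier N. x) \<in> rmodule_hom R (fobj (pullback_functor \<psi>) ?M) N"
        by (rule rmodule_homI) (use bij in \<open>auto simp: bij_betw_def N.ract_closed\<close>)
      show "bij_betw (\<lambda>x\<in>carrier N. x) (carrier (fobj (pullback_functor \<psi>) ?M)) (carrier N)"
        by (auto simp: bij_betw_def inj_on_def)
    qed (use right_module_pullback[OF M R h] in simp)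
    then show "\<exists>X\<in>cobj (Mod_cat R'). isomorphic_in (Mod_cat R) (fobj (pullback_functor \<psi>) X) N"
      using M unfolding isomorphic_in_def by (intro bexI[of _ ?M] exI) simp_all
  qed
qed

section \<open>Graded abelian groups\<close>

text \<open>Kept apart from products and actions so that one theory of components serves graded
  rings, graded modules and modules whose grading is not part of the record.\<close>

locale graded_group = abelian_group M for M :: "('m, 'q) ring_scheme" +
  fixes D :: "int \<Rightarrow> 'm set"
  assumes D_subgroup: "subgroup (D n) (add_monoid M)"
    and D_decomposition: "x \<in> carrier M \<Longrightarrow> \<exists>!f. is_decomposition M D x f"
begin

lemma D_carrier: "x \<in> D n \<Longrightarrow> x \<in> carrier M"
  using subgroup.mem_carrier[OF D_subgroup] by simp

lemma D_zero: "\<zero>\<^bsub>M\<^esub> \<in> D n"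
  using subgroup.one_closed[OF D_subgroup] by simp

lemma D_add: "\<lbrakk>x \<in> D n; y \<in> D n\<rbrakk> \<Longrightarrow> x \<oplus>\<^bsub>M\<^esub> y \<in> D n"
  using subgroup.m_closed[OF D_subgroup] by simp

lemma D_minus: "x \<in> D n \<Longrightarrow> \<ominus>\<^bsub>M\<^esub> x \<in> D n"
  using subgroup.m_inv_closed[OF D_subgroup] by (simp add: a_inv_def)

lemma finsum_support:
  assumes "finite S" "\<And>n. f n \<in> carrier M" "{n. f n \<noteq> \<zero>\<^bsub>M\<^esub>} \<subseteq> S"
  shows "(\<Oplus>\<^bsub>M\<^esub>n \<in> {n. f n \<noteq> \<zero>\<^bsub>M\<^esub>}. f n) = (\<Oplus>\<^bsub>M\<^esub>n \<in> S. f n)"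
  using assms by (intro add.finprod_mono_neutral_cong_left) auto

lemma decompositionI:
  assumes "finite S" "\<And>n. f n \<in> D n" "\<And>n. n \<notin> S \<Longrightarrow> f n = \<zero>\<^bsub>M\<^esub>" "x = (\<Oplus>\<^bsub>M\<^esub>n \<in> S. f n)"
  shows "is_decomposition M D x f"
proof -
  have sub: "{n. f n \<noteq> \<zero>\<^bsub>M\<^esub>} \<subseteq> S" using assms(3) by auto
  have "\<And>n. f n \<in> carrier M" using assms(2) by (rule D_carrier)
  from finsum_support[OF assms(1) this sub] show ?thesis
    using assms finite_subset[OF sub assms(1)] by (simp add: is_decomposition_def)
qed

lemma decompositionD:
  assumes "is_decomposition M D x f"
  shows "f n \<in> D n" "finite {n. f n \<noteq> \<zero>\<^bsub>M\<^esub>}" "x = (\<Oplus>\<^bsub>M\<^esub>n \<in> {n. f n \<noteq> \<zero>\<^bsub>M\<^esub>}. f n)" "x \<in> carrier M"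
proof -
  show 1: "f n \<in> D n" "finite {n. f n \<noteq> \<zero>\<^bsub>M\<^esub>}" for n using assms by (auto simp: is_decomposition_def)
  show 2: "x = (\<Oplus>\<^bsub>M\<^esub>n \<in> {n. f n \<noteq> \<zero>\<^bsub>M\<^esub>}. f n)" using assms by (simp add: is_decomposition_def)
  show "x \<in> carrier M" by (subst 2) (use D_carrier[OF 1(1)] in auto)
qed

lemma component_decomposition: "x \<in> carrier M \<Longrightarrow> is_decomposition M D x (component M D x)"
  using theI'[OF D_decomposition] by (simp add: component_def)

lemma component_eqI: "is_decomposition M D x f \<Longrightarrow> component M D x = f"
  using D_decomposition component_decomposition decompositionD(4) by metis

lemma component_homog: "x \<in> carrier M \<Longrightarrow> component M D x n \<in> D n"
  by (rule decompositionD(1)[OF component_decomposition])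

lemma component_closed: "x \<in> carrier M \<Longrightarrow> component M D x n \<in> carrier M"
  by (rule D_carrier[OF component_homog])

lemma component_of_homog:
  assumes "x \<in> D m" shows "component M D x n = (if n = m then x else \<zero>\<^bsub>M\<^esub>)"
proof -
  have "is_decomposition M D x (\<lambda>n. if n = m then x else \<zero>\<^bsub>M\<^esub>)"
    by (rule decompositionI[of "{m}"]) (use assms D_zero D_carrier[OF assms] in auto)
  from component_eqI[OF this] show ?thesis by simp
qed

lemma component_zero: "component M D \<zero>\<^bsub>M\<^esub> n = \<zero>\<^bsub>M\<^esub>"
  using component_of_homog[OF D_zero, of n n] by simp

lemma component_add:
  assumes x: "x \<in> carrier M" and y: "y \<in> carrier M"
  shows "component M D (x \<oplus>\<^bsub>M\<^esub> y) n = component M D x n \<oplus>\<^bsub>M\<^esub> component M D y n"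
proof -
  let ?f = "component M D x" and ?g = "component M D y"
  let ?S = "{n. ?f n \<noteq> \<zero>\<^bsub>M\<^esub>} \<union> {n. ?g n \<noteq> \<zero>\<^bsub>M\<^esub>}"
  note dx = decompositionD[OF component_decomposition[OF x]]
    and dy = decompositionD[OF component_decomposition[OF y]]
  have fin: "finite ?S" using dx(2) dy(2) by simp
  note c = component_closed[OF x] component_closed[OF y]
  have "x = (\<Oplus>\<^bsub>M\<^esub>n \<in> ?S. ?f n)" "y = (\<Oplus>\<^bsub>M\<^esub>n \<in> ?S. ?g n)"
    using dx(3) dy(3) finsum_support[OF fin c(1)] finsum_support[OF fin c(2)] by auto
  then have "x \<oplus>\<^bsub>M\<^esub> y = (\<Oplus>\<^bsub>M\<^esub>n \<in> ?S. ?f n) \<oplus>\<^bsub>M\<^esub> (\<Oplus>\<^bsub>M\<^esub>n \<in> ?S. ?g n)" by simp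
  also have "\<dots> = (\<Oplus>\<^bsub>M\<^esub>n \<in> ?S. ?f n \<oplus>\<^bsub>M\<^esub> ?g n)"
    using c by (intro finsum_addf[symmetric]) auto
  finally have "is_decomposition M D (x \<oplus>\<^bsub>M\<^esub> y) (\<lambda>n. ?f n \<oplus>\<^bsub>M\<^esub> ?g n)"
    by (intro decompositionI[OF fin]) (use dx(1) dy(1) D_add in auto)
  from component_eqI[OF this] show ?thesis by simp
qed

lemma graded_induct [consumes 1, case_names homog add]:
  assumes x: "x \<in> carrier M" and homog: "\<And>n x. x \<in> D n \<Longrightarrow> P x"
    and add: "\<And>x y. \<lbrakk>x \<in> carrier M; y \<in> carrier M; P x; P y\<rbrakk> \<Longrightarrow> P (x \<oplus>\<^bsub>M\<^esub> y)"
  shows "P x"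
proof -
  have "P (\<Oplus>\<^bsub>M\<^esub>n \<in> S. component M D x n)" if "finite S" for S
    using that
  proof induction
    case empty then show ?case using homog[OF D_zero] by simp
  next
    case (insert n S)
    then show ?case using component_closed[OF x] homog[OF component_homog[OF x]]
      by (simp add: finsum_closed add)
  qed
  from this[OF decompositionD(2)[OF component_decomposition[OF x]]]
  show ?thesis using decompositionD(3)[OF component_decomposition[OF x]] by simp
qed

lemma component_eq_zero:
  assumes "x \<in> carrier M" "\<And>n. component M D x n = \<zero>\<^bsub>M\<^esub>" shows "x = \<zero>\<^bsub>M\<^esub>"
  by (subst decompositionD(3)[OF component_decomposition[OF assms(1)]]) (simp add: assms(2))

lemma component_minus:
  assumes "x \<in> carrier M" shows "component M D (\<ominus>\<^bsub>M\<^esub> x) n = \<ominus>\<^bsub>M\<^esub> component M D x n"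
proof (rule minus_equality[symmetric])
  show "component M D (\<ominus>\<^bsub>M\<^esub> x) n \<oplus>\<^bsub>M\<^esub> component M D x n = \<zero>\<^bsub>M\<^esub>"
    using component_add[of "\<ominus>\<^bsub>M\<^esub> x" x n] assms by (simp add: l_neg component_zero)
qed (auto simp: component_closed assms)

end

text \<open>Additive projections \<open>p n\<close> yield the decomposition. Since homogeneous
  elements generate, every \<open>x\<close> is the sum of the \<open>p n x\<close>; and applying
  \<open>p n\<close> to any decomposition returns its entry of degree \<open>n\<close>, which gives
  uniqueness.\<close>

lemma graded_groupI:
  assumes M: "abelian_group M" and D: "\<And>n. subgroup (D n) (add_monoid M)"
    and p: "\<And>n x. x \<in> carrier M \<Longrightarrow> p n x \<in> D n"
    and p_add: "\<And>n x y. \<lbrakk>x \<in> carrier M; y \<in> carrier M\<rbrakk> \<Longrightarrow> p n (x \<oplus>\<^bsub>M\<^esub> y) = p n x \<oplus>\<^bsub>M\<^esub> p n y"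
    and p_homog: "\<And>n m x. x \<in> D m \<Longrightarrow> p n x = (if n = m then x else \<zero>\<^bsub>M\<^esub>)"
    and gen: "\<And>x. x \<in> carrier M \<Longrightarrow> x \<in> generate (add_monoid M) (\<Union>n. D n)"
  shows "graded_group M D"
proof -
  interpret abelian_group M by (rule M)
  have Dc: "x \<in> carrier M" if "x \<in> D n" for x n using subgroup.mem_carrier[OF D that] by simp
  have D0: "\<zero>\<^bsub>M\<^esub> \<in> D n" for n using subgroup.one_closed[OF D, of n] by simp
  have pc: "p n x \<in> carrier M" if "x \<in> carrier M" for n x using Dc[OF p[OF that]] .
  have p0: "p n \<zero>\<^bsub>M\<^esub> = \<zero>\<^bsub>M\<^esub>" for n using p_homog[OF D0, of n n] by simp
  have p_sum: "p n (\<Oplus>\<^bsub>M\<^esub>k \<in> S. f k) = (\<Oplus>\<^bsub>M\<^esub>k \<in> S. p n (f k))"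
    if "finite S" "\<And>k. f k \<in> carrier M" for S n and f :: "int \<Rightarrow> _"
    using that by induction (auto simp: p0 p_add pc Pi_def)
  \<comment> \<open>The induction carries along a finite set that contains the support instead of
    the support itself, because supports can shrink under addition while such sets can simply be
    joined.\<close>
  have dec: "finite {n. p n x \<noteq> \<zero>\<^bsub>M\<^esub>} \<and> (\<exists>S. finite S \<and> {n. p n x \<noteq> \<zero>\<^bsub>M\<^esub>} \<subseteq> S \<and> x = (\<Oplus>\<^bsub>M\<^esub>k \<in> S. p k x))"
    if "x \<in> generate (add_monoid M) (\<Union>n. D n)" for x
  proof -
    have h: "\<exists>S. finite S \<and> {n. p n x \<noteq> \<zero>\<^bsub>M\<^esub>} \<subseteq> S \<and> x = (\<Oplus>\<^bsub>M\<^esub>k \<in> S. p k x)" if "x \<in> D m" for x m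
      using that Dc[OF that] by (intro exI[of _ "{m}"]) (auto simp: p_homog)
    have ext: "(\<Oplus>\<^bsub>M\<^esub>k \<in> S. p k x) = (\<Oplus>\<^bsub>M\<^esub>k \<in> S'. p k x)"
      if "finite S'" "S \<subseteq> S'" "{n. p n x \<noteq> \<zero>\<^bsub>M\<^esub>} \<subseteq> S" "x \<in> carrier M" for S S' x
      using that by (intro add.finprod_mono_neutral_cong_left) (auto simp: pc)
    have "x \<in> carrier M \<and> (\<exists>S. finite S \<and> {n. p n x \<noteq> \<zero>\<^bsub>M\<^esub>} \<subseteq> S \<and> x = (\<Oplus>\<^bsub>M\<^esub>k \<in> S. p k x))"
      using that
    proof induction
      case one then show ?case using h[OF D0[of 0]] by simp
    next
      case (incl x) then show ?case using h Dc by blast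
    next
      case (inv x)
      then obtain n where "x \<in> D n" by blast
      then have "\<ominus>\<^bsub>M\<^esub> x \<in> D n" using subgroup.m_inv_closed[OF D] by (simp add: a_inv_def)
      then show ?case using h Dc by (metis a_inv_def)
    next
      case (eng x y)
      then obtain S S' where S: "finite S" "{n. p n x \<noteq> \<zero>\<^bsub>M\<^esub>} \<subseteq> S" "x = (\<Oplus>\<^bsub>M\<^esub>k \<in> S. p k x)" "x \<in> carrier M"
        and S': "finite S'" "{n. p n y \<noteq> \<zero>\<^bsub>M\<^esub>} \<subseteq> S'" "y = (\<Oplus>\<^bsub>M\<^esub>k \<in> S'. p k y)" "y \<in> carrier M" by blast
      let ?T = "S \<union> S'"
      have "x = (\<Oplus>\<^bsub>M\<^esub>k \<in> ?T. p k x)" "y = (\<Oplus>\<^bsub>M\<^esub>k \<in> ?T. p k y)"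
        using ext[of ?T S x] ext[of ?T S' y] S S' by auto
      then have "x \<oplus>\<^bsub>M\<^esub> y = (\<Oplus>\<^bsub>M\<^esub>k \<in> ?T. p k x) \<oplus>\<^bsub>M\<^esub> (\<Oplus>\<^bsub>M\<^esub>k \<in> ?T. p k y)" by simp
      also have "\<dots> = (\<Oplus>\<^bsub>M\<^esub>k \<in> ?T. p k x \<oplus>\<^bsub>M\<^esub> p k y)"
        using S S' by (intro finsum_addf[symmetric]) (auto simp: pc)
      also have "\<dots> = (\<Oplus>\<^bsub>M\<^esub>k \<in> ?T. p k (x \<oplus>\<^bsub>M\<^esub> y))"
        using S S' by (simp add: p_add)
      finally have "x \<oplus>\<^bsub>M\<^esub> y = (\<Oplus>\<^bsub>M\<^esub>k \<in> ?T. p k (x \<oplus>\<^bsub>M\<^esub> y))" .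
      moreover have "{n. p n (x \<oplus>\<^bsub>M\<^esub> y) \<noteq> \<zero>\<^bsub>M\<^esub>} \<subseteq> ?T"
      proof
        fix n assume n: "n \<in> {n. p n (x \<oplus>\<^bsub>M\<^esub> y) \<noteq> \<zero>\<^bsub>M\<^esub>}"
        show "n \<in> ?T"
        proof (rule ccontr)
          assume "n \<notin> ?T"
          then have "p n x = \<zero>\<^bsub>M\<^esub>" "p n y = \<zero>\<^bsub>M\<^esub>" using S(2) S'(2) by auto
          then show False using n S(4) S'(4) by (simp add: p_add)
        qed
      qed
      ultimately show ?case using S(1,4) S'(1,4) by (auto intro!: exI[of _ ?T])
    qed
    then show ?thesis by (auto intro: finite_subset)
  qed
  show ?thesis
  proof (intro graded_group.intro graded_group_axioms.intro M D)
    fix x assume x: "x \<in> carrier M"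
    obtain S where S: "finite S" "{n. p n x \<noteq> \<zero>\<^bsub>M\<^esub>} \<subseteq> S" "x = (\<Oplus>\<^bsub>M\<^esub>k \<in> S. p k x)"
      and fin: "finite {n. p n x \<noteq> \<zero>\<^bsub>M\<^esub>}"
      using dec[OF gen[OF x]] by blast
    have "(\<Oplus>\<^bsub>M\<^esub>k \<in> {n. p n x \<noteq> \<zero>\<^bsub>M\<^esub>}. p k x) = (\<Oplus>\<^bsub>M\<^esub>k \<in> S. p k x)"
      using S x by (intro add.finprod_mono_neutral_cong_left) (auto simp: pc)
    then have "is_decomposition M D x (\<lambda>n. p n x)"
      using p[OF x] fin S(3) by (simp add: is_decomposition_def)
    moreover have "f = (\<lambda>n. p n x)" if f: "is_decomposition M D x f" for f
    proof
      fix n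
      let ?S = "{n. f n \<noteq> \<zero>\<^bsub>M\<^esub>}"
      have fin: "finite ?S" and xs: "x = (\<Oplus>\<^bsub>M\<^esub>k \<in> ?S. f k)" and fD: "f k \<in> D k" for k
        using f by (auto simp: is_decomposition_def)
      have fc: "f k \<in> carrier M" for k by (rule Dc[OF fD])
      have "p n x = (\<Oplus>\<^bsub>M\<^esub>k \<in> ?S. p n (f k))" using p_sum[OF fin fc, of n] xs by simp
      also have "\<dots> = (\<Oplus>\<^bsub>M\<^esub>k \<in> ?S. if n = k then f k else \<zero>\<^bsub>M\<^esub>)"
        using p_homog[OF fD] by simp
      also have "\<dots> = f n"
      proof (cases "n \<in> ?S")
        case True then show ?thesis using fin fc by (simp add: finsum_singleton)
      next
        case False
        have "(\<Oplus>\<^bsub>M\<^esub>k \<in> ?S. if n = k then f k else \<zero>\<^bsub>M\<^esub>) = (\<Oplus>\<^bsub>M\<^esub>k \<in> ?S. \<zero>\<^bsub>M\<^esub>)"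
          using False fc by (intro finsum_cong') auto
        then show ?thesis using False by simp
      qed
      finally show "f n = p n x" by simp
    qed
    ultimately show "\<exists>!f. is_decomposition M D x f" by blast
  qed
qed

section \<open>Graded modules and their degree-zero parts\<close>

sublocale graded_right_module \<subseteq> G: graded_group M "mhomog M"
  by (intro graded_group.intro graded_group_axioms.intro M.abelian_group_axioms homog_subgroup homog_decomposition)

lemma graded_right_moduleI:
  assumes "right_module A M" "graded_group M (mhomog M)"
    and "\<And>x a n k. \<lbrakk>x \<in> mhomog M n; a \<in> homog A k\<rbrakk> \<Longrightarrow> ract M x a \<in> mhomog M (n + k)"
  shows "graded_right_module A M"
  using assms by (simp add: graded_right_module_def graded_right_module_axioms_def graded_group_def graded_group_axioms_def)

definition homog_span :: "('k, 'a) galgebra \<Rightarrow> int \<Rightarrow> 'a set" where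
  "homog_span A n = generate (add_monoid A) {x \<otimes>\<^bsub>A\<^esub> y | x y. x \<in> homog A n \<and> y \<in> homog A (- n)}"

locale graded_ring = R: ring A + graded_group A "homog A" for A :: "('k, 'a) galgebra" +
  assumes homog_mult: "\<lbrakk>a \<in> homog A m; b \<in> homog A n\<rbrakk> \<Longrightarrow> a \<otimes>\<^bsub>A\<^esub> b \<in> homog A (m + n)"
    and homog_one: "\<one>\<^bsub>A\<^esub> \<in> homog A 0"

text \<open>The usual condition \<open>A_m A_n = A_(m+n)\<close> for all degrees is a consequence of
  these two statements about the unit, which are what one can verify for a path algebra.\<close>

locale strongly_graded = graded_ring +
  assumes one_span: "\<one>\<^bsub>A\<^esub> \<in> homog_span A 1" "\<one>\<^bsub>A\<^esub> \<in> homog_span A (- 1)"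

lemma degree_zero_simps [simp]:
  "carrier (degree_zero A) = homog A 0" "mult (degree_zero A) = mult A" "one (degree_zero A) = one A"
  "zero (degree_zero A) = zero A" "add (degree_zero A) = add A" "smult (degree_zero A) = smult A"
  by (simp_all add: degree_zero_def module.defs)

context graded_ring
begin

lemma ring_degree_zero: "ring (degree_zero A)"
proof (rule ringI)
  show "abelian_group (degree_zero A)"
  proof (rule abelian_groupI)
    fix x assume x: "x \<in> carrier (degree_zero A)"
    show "\<exists>y\<in>carrier (degree_zero A). y \<oplus>\<^bsub>degree_zero A\<^esub> x = \<zero>\<^bsub>degree_zero A\<^esub>"
      using x D_minus[of x 0] D_carrier[of x 0] by (intro bexI[of _ "\<ominus>\<^bsub>A\<^esub> x"]) (auto simp: R.l_neg)
  qed (auto simp: D_zero D_add D_carrier R.a_ac)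
  show "monoid (degree_zero A)"
    using homog_mult[of _ 0 _ 0] by unfold_locales (auto simp: homog_one D_carrier R.m_assoc)
qed (auto simp: D_carrier R.l_distr R.r_distr)

lemma component_mult:
  assumes a: "a \<in> carrier A" and b: "b \<in> homog A k"
  shows "component A (homog A) (a \<otimes>\<^bsub>A\<^esub> b) n = component A (homog A) a (n - k) \<otimes>\<^bsub>A\<^esub> b"
  using a
proof (induction rule: graded_induct)
  case (homog m a)
  show ?case
    using component_of_homog[OF homog_mult[OF homog b]] component_of_homog[OF homog] D_carrier[OF b] by auto
next
  case (add x y)
  then show ?case using D_carrier[OF b] by (simp add: R.l_distr component_add component_closed)
qed

end

context strongly_graded
begin

text \<open>Negatives and zero are themselves products, \<open>- (x y) = (- x) y\<close> and
  \<open>0 = 0 0\<close>, so closure under sums carries \<open>P\<close> from the products to their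
  whole additive span.\<close>

lemma span_induct:
  assumes one: "\<one>\<^bsub>A\<^esub> \<in> homog_span A n"
    and prod: "\<And>x y. \<lbrakk>x \<in> homog A n; y \<in> homog A (- n)\<rbrakk> \<Longrightarrow> P (x \<otimes>\<^bsub>A\<^esub> y)"
    and add: "\<And>u v. \<lbrakk>u \<in> homog A 0; v \<in> homog A 0; P u; P v\<rbrakk> \<Longrightarrow> P (u \<oplus>\<^bsub>A\<^esub> v)"
  shows "P \<one>\<^bsub>A\<^esub>"
proof -
  have *: "x \<otimes>\<^bsub>A\<^esub> y \<in> homog A 0" if "x \<in> homog A n" "y \<in> homog A (- n)" for x y
    using homog_mult[OF that] by simp
  have "u \<in> homog A 0 \<and> P u" if "u \<in> homog_span A n" for u
    using that unfolding homog_span_def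
  proof induction
    case one
    have "P (\<zero>\<^bsub>A\<^esub> \<otimes>\<^bsub>A\<^esub> \<zero>\<^bsub>A\<^esub>)" by (rule prod[OF D_zero D_zero])
    then show ?case by (simp add: D_zero)
  next
    case (incl u) then show ?case using prod * by blast
  next
    case (inv u)
    then obtain x y where xy: "x \<in> homog A n" "y \<in> homog A (- n)" "u = x \<otimes>\<^bsub>A\<^esub> y" by blast
    then have "\<ominus>\<^bsub>A\<^esub> u = (\<ominus>\<^bsub>A\<^esub> x) \<otimes>\<^bsub>A\<^esub> y" by (simp add: R.l_minus D_carrier)
    then show ?case using prod[OF D_minus[OF xy(1)] xy(2)] *[OF D_minus[OF xy(1)] xy(2)]
      by (simp add: a_inv_def)
  next
    case (eng u v) then show ?case by (simp add: add D_add)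
  qed
  with one show ?thesis by blast
qed

text \<open>Degrees for which the unit splits are closed under addition: given
  \<open>1 = \<Sum> x y\<close> in degree \<open>m\<close> and \<open>1 = \<Sum> a b\<close> in
  degree \<open>k\<close>, insert the second between the factors of the first to get
  \<open>1 = \<Sum> (x a) (b y)\<close>.\<close>

lemma homog_span_one: "\<one>\<^bsub>A\<^esub> \<in> homog_span A n"
proof -
  have step: "\<one>\<^bsub>A\<^esub> \<in> homog_span A (m + k)" if m: "\<one>\<^bsub>A\<^esub> \<in> homog_span A m" and k: "\<one>\<^bsub>A\<^esub> \<in> homog_span A k" for m k
  proof (rule span_induct[OF m])
    show "u \<oplus>\<^bsub>A\<^esub> v \<in> homog_span A (m + k)"
      if "u \<in> homog_span A (m + k)" "v \<in> homog_span A (m + k)" for u v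
      using generate.eng[OF that[unfolded homog_span_def]] by (simp add: homog_span_def)
    fix x y assume x: "x \<in> homog A m" and y: "y \<in> homog A (- m)"
    have "x \<otimes>\<^bsub>A\<^esub> \<one>\<^bsub>A\<^esub> \<otimes>\<^bsub>A\<^esub> y \<in> homog_span A (m + k)"
    proof (rule span_induct[OF k])
      fix a b assume a: "a \<in> homog A k" and b: "b \<in> homog A (- k)"
      have "x \<otimes>\<^bsub>A\<^esub> (a \<otimes>\<^bsub>A\<^esub> b) \<otimes>\<^bsub>A\<^esub> y = (x \<otimes>\<^bsub>A\<^esub> a) \<otimes>\<^bsub>A\<^esub> (b \<otimes>\<^bsub>A\<^esub> y)"
        using a b x y by (simp add: R.m_assoc D_carrier)
      moreover have "- k + - m = - (m + k)" by simp
      then have "x \<otimes>\<^bsub>A\<^esub> a \<in> homog A (m + k)" "b \<otimes>\<^bsub>A\<^esub> y \<in> homog A (- (m + k))"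
        using homog_mult[OF x a] homog_mult[OF b y] by metis+
      ultimately show "x \<otimes>\<^bsub>A\<^esub> (a \<otimes>\<^bsub>A\<^esub> b) \<otimes>\<^bsub>A\<^esub> y \<in> homog_span A (m + k)"
        unfolding homog_span_def by (intro generate.incl) blast
    next
      fix u v assume u: "u \<in> homog A 0" and v: "v \<in> homog A 0"
        and "x \<otimes>\<^bsub>A\<^esub> u \<otimes>\<^bsub>A\<^esub> y \<in> homog_span A (m + k)" "x \<otimes>\<^bsub>A\<^esub> v \<otimes>\<^bsub>A\<^esub> y \<in> homog_span A (m + k)"
      then have "x \<otimes>\<^bsub>A\<^esub> u \<otimes>\<^bsub>A\<^esub> y \<oplus>\<^bsub>A\<^esub> x \<otimes>\<^bsub>A\<^esub> v \<otimes>\<^bsub>A\<^esub> y \<in> homog_span A (m + k)"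
        unfolding homog_span_def using generate.eng by fastforce
      then show "x \<otimes>\<^bsub>A\<^esub> (u \<oplus>\<^bsub>A\<^esub> v) \<otimes>\<^bsub>A\<^esub> y \<in> homog_span A (m + k)"
        using u v x y by (simp add: R.l_distr R.r_distr D_carrier)
    qed
    then show "x \<otimes>\<^bsub>A\<^esub> y \<in> homog_span A (m + k)" using x by (simp add: D_carrier)
  qed
  \<comment> \<open>Degree 0 is reached as \<open>1 + (- 1)\<close>; from there steps of 1 and -1
    reach every integer.\<close>
  have zero: "\<one>\<^bsub>A\<^esub> \<in> homog_span A 0" using step[OF one_span] by simp
  show ?thesis
  proof (induction n rule: int_induct[where k = 0])
    case base show ?case by (rule zero)
  next
    case (step1 i) then show ?case using step[OF _ one_span(1)] by blast
  next
    case (step2 i) then show ?case using step[OF _ one_span(2), of i] by simp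
  qed
qed

text \<open>This is how strong grading is used throughout. \<open>P\<close> arises from the desired
  statement by replacing the unit with a variable, and \<open>n\<close> is chosen so that the first
  factor of the product brings a given homogeneous element into a convenient degree, mostly degree
  0.\<close>

lemma unit_induct [case_names prod add]:
  assumes "\<And>x y. \<lbrakk>x \<in> homog A n; y \<in> homog A (- n)\<rbrakk> \<Longrightarrow> P (x \<otimes>\<^bsub>A\<^esub> y)"
    and "\<And>u v. \<lbrakk>u \<in> homog A 0; v \<in> homog A 0; P u; P v\<rbrakk> \<Longrightarrow> P (u \<oplus>\<^bsub>A\<^esub> v)"
  shows "P \<one>\<^bsub>A\<^esub>"
  using assms by (rule span_induct[OF homog_span_one])

end

section \<open>The category of graded modules\<close>

lemma Gr_cat_simps [simp]:
  "cobj (Gr_cat A) = {M. graded_right_module A M}"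
  "chom (Gr_cat A) M N = {f \<in> rmodule_hom A M N. \<forall>n. f ` mhomog M n \<subseteq> mhomog N n}"
  "cid (Gr_cat A) M = (\<lambda>x \<in> carrier M. x)"
  "ccomp (Gr_cat A) L M N g f = compose (carrier L) g f"
  by (simp_all add: Gr_cat_def)

lemma gr_mod: "graded_right_module A M \<Longrightarrow> right_module A M"
  by (simp add: graded_right_module_def)

lemma category_Gr_cat: "category (Gr_cat A)"
proof
  note [simp] = fun_eq_iff compose_def
  fix W X Y Z f g h
  { assume X: "X \<in> cobj (Gr_cat A)"
    then interpret X: graded_right_module A X by simp
    show "cid (Gr_cat A) X \<in> chom (Gr_cat A) X X"
      using rmodule_hom_id[OF X.right_module_axioms] by (auto simp: X.G.D_carrier) }
  { assume X: "X \<in> cobj (Gr_cat A)" and f: "f \<in> chom (Gr_cat A) X Y" and g: "g \<in> chom (Gr_cat A) Y Z"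
    then interpret X: graded_right_module A X by simp
    show "ccomp (Gr_cat A) X Y Z g f \<in> chom (Gr_cat A) X Z"
      using f g rmodule_hom_compose[OF X.right_module_axioms] by (auto simp del: fun_eq_iff compose_def simp: compose_eq X.G.D_carrier image_subset_iff) }
  show "ccomp (Gr_cat A) W Y Z h (ccomp (Gr_cat A) W X Y g f)
      = ccomp (Gr_cat A) W X Z (ccomp (Gr_cat A) X Y Z h g) f"
    if "f \<in> chom (Gr_cat A) W X"
    using that by (auto simp: rmodule_hom_closed)
  show "ccomp (Gr_cat A) X Y Y (cid (Gr_cat A) Y) f = f" if "f \<in> chom (Gr_cat A) X Y"
  proof
    have fh: "f \<in> rmodule_hom A X Y" using that by simp
    fix x show "ccomp (Gr_cat A) X Y Y (cid (Gr_cat A) Y) f x = f x"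
      using rmodule_hom_closed[OF fh] rmodule_hom_undefined[OF fh] by (cases "x \<in> carrier X") auto
  qed
  show "ccomp (Gr_cat A) X X Y f (cid (Gr_cat A) X) = f" if "f \<in> chom (Gr_cat A) X Y"
    using that by (auto simp: rmodule_hom_undefined)
qed

context graded_right_module
begin

lemma act_zero: "a \<in> carrier A \<Longrightarrow> ract M \<zero>\<^bsub>M\<^esub> a = \<zero>\<^bsub>M\<^esub>"
  using ract_add_left[of "\<zero>\<^bsub>M\<^esub>" "\<zero>\<^bsub>M\<^esub>" a] ract_closed[of "\<zero>\<^bsub>M\<^esub>" a] by simp

lemma component_act:
  assumes a: "x \<in> carrier M" and b: "b \<in> homog A k" and bc: "b \<in> carrier A"
  shows "component M (mhomog M) (ract M x b) n = ract M (component M (mhomog M) x (n - k)) b"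
  using a
proof (induction rule: G.graded_induct)
  case (homog m a)
  show ?case
    using G.component_of_homog[OF homog_act[OF homog b]] G.component_of_homog[OF homog] act_zero[OF bc] by auto
next
  case (add x y)
  then show ?case using bc by (simp add: ract_add_left G.component_add G.component_closed ract_closed)
qed

end

section \<open>The functor that takes a graded module to its degree-zero part\<close>

definition degree_part :: "('a, 'u) grmodule \<Rightarrow> ('a, 'u) rmodule" where
  "degree_part M = \<lparr>carrier = mhomog M 0, mult = undefined, one = undefined, zero = \<zero>\<^bsub>M\<^esub>,
     add = add M, ract = ract M\<rparr>"

lemma degree_part_simps [simp]: "carrier (degree_part M) = mhomog M 0" "zero (degree_part M) = zero M"
  "add (degree_part M) = add M" "ract (degree_part M) = ract M"
  by (simp_all add: degree_part_def)

definition degree_part_functor ::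
    "(('a, 'u) grmodule, 'u \<Rightarrow> 'u, ('a, 'u) rmodule, 'u \<Rightarrow> 'u) functr" where
  "degree_part_functor = \<lparr>fobj = degree_part, fmap = (\<lambda>M N f. restrict f (mhomog M 0))\<rparr>"

lemma degree_part_functor_simps [simp]: "fobj degree_part_functor = degree_part"
  "fmap degree_part_functor M N f = restrict f (mhomog M 0)"
  by (simp_all add: degree_part_functor_def)

context graded_ring
begin

lemma right_module_degree_part:
  assumes "graded_right_module A M" shows "right_module (degree_zero A) (degree_part M)"
proof -
  interpret M: graded_right_module A M by fact
  show ?thesis
  proof (intro right_module.intro right_module_axioms.intro ring_degree_zero)
    show "abelian_group (degree_part M)"
    proof (rule abelian_groupI)
      fix x assume x: "x \<in> carrier (degree_part M)"
      show "\<exists>y\<in>carrier (degree_part M). y \<oplus>\<^bsub>degree_part M\<^esub> x = \<zero>\<^bsub>degree_part M\<^esub>"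
        using x M.G.D_minus[of x 0] M.G.D_carrier[of x 0] by (intro bexI[of _ "\<ominus>\<^bsub>M\<^esub> x"]) (auto simp: M.M.l_neg)
    qed (auto simp: M.G.D_zero M.G.D_add M.G.D_carrier M.M.a_ac)
    show "ract (degree_part M) x a \<in> carrier (degree_part M)"
      if "x \<in> carrier (degree_part M)" "a \<in> carrier (degree_zero A)" for x a
      using M.homog_act[of x 0 a 0] that by simp
  qed (auto simp: M.G.D_carrier D_carrier M.ract_add_left M.ract_add_right M.ract_mult M.ract_one)
qed

lemma degree_part_hom:
  assumes "graded_right_module A M" and f: "f \<in> chom (Gr_cat A) M N"
  shows "restrict f (mhomog M 0) \<in> rmodule_hom (degree_zero A) (degree_part M) (degree_part N)"
proof -
  interpret M: graded_right_module A M by fact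
  have act: "ract M x a \<in> mhomog M 0" if "x \<in> mhomog M 0" "a \<in> homog A 0" for x a
    using M.homog_act[OF that] by simp
  show ?thesis
    using f by (intro rmodule_homI)
      (auto simp: M.G.D_carrier M.G.D_add D_carrier act rmodule_hom_add rmodule_hom_act)
qed

lemma cat_functor_degree_part: "cat_functor (Gr_cat A) (Mod_cat (degree_zero A)) degree_part_functor"
proof -
  interpret C: category "Gr_cat A" by (rule category_Gr_cat)
  interpret D: category "Mod_cat (degree_zero A)" by (rule category_Mod_cat)
  show ?thesis
  proof
    show "fmap degree_part_functor X X (cid (Gr_cat A) X) = cid (Mod_cat (degree_zero A)) (fobj degree_part_functor X)"
      if "X \<in> cobj (Gr_cat A)" for X
    proof -
      interpret X: graded_right_module A X using that by simp
      show ?thesis by (auto simp: X.G.D_carrier)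
    qed
    show "fmap degree_part_functor X Z (ccomp (Gr_cat A) X Y Z g f)
      = ccomp (Mod_cat (degree_zero A)) (fobj degree_part_functor X) (fobj degree_part_functor Y) (fobj degree_part_functor Z)
         (fmap degree_part_functor Y Z g) (fmap degree_part_functor X Y f)"
      if "X \<in> cobj (Gr_cat A)" "f \<in> chom (Gr_cat A) X Y" for X Y Z f g
    proof -
      interpret X: graded_right_module A X using that by simp
      show ?thesis using that(2) by (auto simp: X.G.D_carrier compose_def fun_eq_iff image_subset_iff)
    qed
  qed (use right_module_degree_part degree_part_hom in auto)
qed

end

context strongly_graded
begin

text \<open>For \<open>x\<close> of degree \<open>n\<close> write \<open>x = \<Sum> (x y) z\<close>
  with \<open>y\<close> of degree \<open>-n\<close>. The elements \<open>x y\<close> have degree 0,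
  where the two maps agree, and linearity does the rest.\<close>

lemma degree_part_faithful:
  assumes M: "graded_right_module A M" and N: "graded_right_module A N"
    and f: "f \<in> chom (Gr_cat A) M N" and g: "g \<in> chom (Gr_cat A) M N"
    and eq: "\<And>x. x \<in> mhomog M 0 \<Longrightarrow> f x = g x"
  shows "f = g"
proof -
  interpret M: graded_right_module A M by fact
  interpret N: graded_right_module A N by fact
  have fh: "f \<in> rmodule_hom A M N" and gh: "g \<in> rmodule_hom A M N" using f g by auto
  note simps = rmodule_hom_add[OF fh] rmodule_hom_add[OF gh] rmodule_hom_act[OF fh] rmodule_hom_act[OF gh]
  have "f x = g x" if "x \<in> carrier M" for x
    using that
  proof (induction rule: M.G.graded_induct)
    case (homog n x)
    note x = M.G.D_carrier[OF homog]
    have "f (ract M x \<one>\<^bsub>A\<^esub>) = g (ract M x \<one>\<^bsub>A\<^esub>)"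
    proof (rule unit_induct[where n = "- n"])
      fix y z assume y: "y \<in> homog A (- n)" and z: "z \<in> homog A (- (- n))"
      have xy: "ract M x y \<in> mhomog M 0" using M.homog_act[OF homog y] by simp
      then show "f (ract M x (y \<otimes>\<^bsub>A\<^esub> z)) = g (ract M x (y \<otimes>\<^bsub>A\<^esub> z))"
        using eq[OF xy] x D_carrier[OF y] D_carrier[OF z] by (simp add: M.ract_mult simps M.ract_closed)
    next
      fix u v assume "u \<in> homog A 0" "v \<in> homog A 0" "f (ract M x u) = g (ract M x u)" "f (ract M x v) = g (ract M x v)"
      then show "f (ract M x (u \<oplus>\<^bsub>A\<^esub> v)) = g (ract M x (u \<oplus>\<^bsub>A\<^esub> v))"
        using x by (simp add: M.ract_add_right D_carrier simps M.ract_closed)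
    qed
    then show ?case using x by (simp add: M.ract_one)
  next
    case (add x y) then show ?case by (simp add: simps)
  qed
  then show ?thesis by (rule rmodule_hom_eqI[OF fh gh])
qed

text \<open>The component \<open>z_n\<close> can be recovered as \<open>\<Sum> (z_n x) y\<close>
  with \<open>x\<close> of degree \<open>-n\<close>, and \<open>z_n x\<close> is the degree-zero
  component of \<open>z x\<close>.\<close>

lemma act_degree_zero_inject:
  assumes N: "graded_right_module A N" and z: "z \<in> carrier N" "z' \<in> carrier N"
    and eq: "\<And>b. b \<in> carrier A \<Longrightarrow> component N (mhomog N) (ract N z b) 0 = component N (mhomog N) (ract N z' b) 0"
  shows "z = z'"
proof -
  interpret N: graded_right_module A N by fact
  let ?c = "component N (mhomog N)"
  have "?c z n = ?c z' n" for n
  proof -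
    have "ract N (?c z n) \<one>\<^bsub>A\<^esub> = ract N (?c z' n) \<one>\<^bsub>A\<^esub>"
    proof (rule unit_induct[where n = "- n"])
      fix x y assume x: "x \<in> homog A (- n)" and y: "y \<in> homog A (- (- n))"
      have "ract N (?c z n) x = ract N (?c z' n) x"
        using eq[OF D_carrier[OF x]] N.component_act[OF z(1) x D_carrier[OF x], of 0]
          N.component_act[OF z(2) x D_carrier[OF x], of 0] by simp
      then show "ract N (?c z n) (x \<otimes>\<^bsub>A\<^esub> y) = ract N (?c z' n) (x \<otimes>\<^bsub>A\<^esub> y)"
        using z D_carrier[OF x] D_carrier[OF y] by (simp add: N.ract_mult N.G.component_closed)
    qed (use z in \<open>simp add: N.ract_add_right D_carrier N.G.component_closed\<close>)
    then show ?thesis using z by (simp add: N.ract_one N.G.component_closed)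
  qed
  note c = this
  have "?c (z \<oplus>\<^bsub>N\<^esub> \<ominus>\<^bsub>N\<^esub> z') n = \<zero>\<^bsub>N\<^esub>" for n
    using z by (simp add: N.G.component_add N.G.component_minus c N.M.r_neg N.G.component_closed)
  from N.G.component_eq_zero[OF _ this]
  have "z \<oplus>\<^bsub>N\<^esub> \<ominus>\<^bsub>N\<^esub> z' = \<zero>\<^bsub>N\<^esub>" using z by simp
  moreover have "z = (z \<oplus>\<^bsub>N\<^esub> \<ominus>\<^bsub>N\<^esub> z') \<oplus>\<^bsub>N\<^esub> z'" using z by (simp add: N.M.a_assoc N.M.l_neg)
  ultimately show ?thesis using z by simp
qed

text \<open>
  The extension of \<open>h\<close> is determined by \<open>(f x \<cdot> b)\<^sub>0 = h ((x \<cdot> b)\<^sub>0)\<close> for all \<open>b\<close>, since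
  \<open>z \<mapsto> (b \<mapsto> (z \<cdot> b)\<^sub>0)\<close> is injective.
\<close>

lemma degree_part_full:
  assumes M: "graded_right_module A M" and N: "graded_right_module A N"
    and h: "h \<in> rmodule_hom (degree_zero A) (degree_part M) (degree_part N)"
  shows "\<exists>f \<in> chom (Gr_cat A) M N. restrict f (mhomog M 0) = h"
proof -
  interpret M: graded_right_module A M by fact
  interpret N: graded_right_module A N by fact
  let ?c = "component M (mhomog M)" and ?d = "component N (mhomog N)"
  note h0 = rmodule_hom_zero[OF right_module_degree_part[OF M] right_module_degree_part[OF N] h]
  have hN: "h x \<in> mhomog N 0" if "x \<in> mhomog M 0" for x using rmodule_hom_closed[OF h] that by simp
  have h_add: "h (x \<oplus>\<^bsub>M\<^esub> y) = h x \<oplus>\<^bsub>N\<^esub> h y" if "x \<in> mhomog M 0" "y \<in> mhomog M 0" for x y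
    using rmodule_hom_add[OF h] that by simp
  have h_act: "h (ract M x a) = ract N (h x) a" if "x \<in> mhomog M 0" "a \<in> homog A 0" for x a
    using rmodule_hom_act[OF h] that by simp
  have hom_ex: "\<exists>z \<in> mhomog N n. \<forall>b \<in> carrier A. ?d (ract N z b) 0 = h (?c (ract M x b) 0)"
    if x: "x \<in> mhomog M n" for x n
  proof -
    note xc = M.G.D_carrier[OF x]
    \<comment> \<open>With a variable \<open>u\<close> in place of the unit, the product
      \<open>u = y w\<close> is served by \<open>z = h (x y) w\<close>: since \<open>w b\<close> has
      degree 0 and \<open>h\<close> is linear over \<open>A_0\<close>,
      \<open>h (x y) (w b) = h (x y w b)\<close>. Sums of such \<open>u\<close> are served by the
      sums of the \<open>z\<close>.\<close>
    have "\<exists>z \<in> mhomog N n. \<forall>b \<in> homog A (- n). ract N z b = h (ract M x (\<one>\<^bsub>A\<^esub> \<otimes>\<^bsub>A\<^esub> b))"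
    proof (rule unit_induct[where n = "- n"])
      fix y w assume y: "y \<in> homog A (- n)" and w: "w \<in> homog A (- (- n))"
      have xy: "ract M x y \<in> mhomog M 0" using M.homog_act[OF x y] by simp
      have z: "ract N (h (ract M x y)) w \<in> mhomog N n" using N.homog_act[OF hN[OF xy] w] by simp
      have "ract N (ract N (h (ract M x y)) w) b = h (ract M x (y \<otimes>\<^bsub>A\<^esub> w \<otimes>\<^bsub>A\<^esub> b))" if b: "b \<in> homog A (- n)" for b
      proof -
        have wb: "w \<otimes>\<^bsub>A\<^esub> b \<in> homog A 0" using homog_mult[OF w b] by simp
        show ?thesis
          using h_act[OF xy wb] xc N.G.D_carrier[OF hN[OF xy]] D_carrier[OF w] D_carrier[OF b] D_carrier[OF y]
          by (simp add: M.ract_mult N.ract_mult M.ract_closed R.m_assoc)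
      qed
      with z show "\<exists>z \<in> mhomog N n. \<forall>b \<in> homog A (- n). ract N z b = h (ract M x (y \<otimes>\<^bsub>A\<^esub> w \<otimes>\<^bsub>A\<^esub> b))" by blast
    next
      fix u v assume u: "u \<in> homog A 0" and v: "v \<in> homog A 0"
        and "\<exists>z \<in> mhomog N n. \<forall>b \<in> homog A (- n). ract N z b = h (ract M x (u \<otimes>\<^bsub>A\<^esub> b))"
          "\<exists>z \<in> mhomog N n. \<forall>b \<in> homog A (- n). ract N z b = h (ract M x (v \<otimes>\<^bsub>A\<^esub> b))"
      then obtain z z' where z: "z \<in> mhomog N n" "\<And>b. b \<in> homog A (- n) \<Longrightarrow> ract N z b = h (ract M x (u \<otimes>\<^bsub>A\<^esub> b))"
        and z': "z' \<in> mhomog N n" "\<And>b. b \<in> homog A (- n) \<Longrightarrow> ract N z' b = h (ract M x (v \<otimes>\<^bsub>A\<^esub> b))" by blast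
      have "ract N (z \<oplus>\<^bsub>N\<^esub> z') b = h (ract M x ((u \<oplus>\<^bsub>A\<^esub> v) \<otimes>\<^bsub>A\<^esub> b))" if b: "b \<in> homog A (- n)" for b
      proof -
        have "u \<otimes>\<^bsub>A\<^esub> b \<in> homog A (- n)" "v \<otimes>\<^bsub>A\<^esub> b \<in> homog A (- n)"
          using homog_mult[OF u b] homog_mult[OF v b] by simp_all
        then have "ract M x (u \<otimes>\<^bsub>A\<^esub> b) \<in> mhomog M 0" "ract M x (v \<otimes>\<^bsub>A\<^esub> b) \<in> mhomog M 0"
          using M.homog_act[OF x] by fastforce+
        then show ?thesis
          using z(2)[OF b] z'(2)[OF b] z(1) z'(1) u v b xc
          by (simp add: N.ract_add_left M.ract_add_right N.G.D_carrier D_carrier R.l_distr h_add)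
      qed
      then show "\<exists>z \<in> mhomog N n. \<forall>b \<in> homog A (- n). ract N z b = h (ract M x ((u \<oplus>\<^bsub>A\<^esub> v) \<otimes>\<^bsub>A\<^esub> b))"
        using N.G.D_add[OF z(1) z'(1)] by blast
    qed
    then obtain z where z: "z \<in> mhomog N n" and zb: "\<And>b. b \<in> homog A (- n) \<Longrightarrow> ract N z b = h (ract M x b)"
      by (auto simp: D_carrier)
    have "?d (ract N z b) 0 = h (?c (ract M x b) 0)" if "b \<in> carrier A" for b
      using that
    proof (induction rule: graded_induct)
      case (homog k b)
      show ?case
      proof (cases "k = - n")
        case True
        then have "ract M x b \<in> mhomog M 0" "ract N z b \<in> mhomog N 0"
          using M.homog_act[OF x homog] N.homog_act[OF z homog] by auto
        then show ?thesis using zb homog True by (simp add: M.G.component_of_homog N.G.component_of_homog)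
      next
        case False
        \<comment> \<open>Neither \<open>x b\<close> nor \<open>z b\<close> has a component of
          degree 0 here, so both sides vanish.\<close>
        then have "n + k \<noteq> 0" by simp
        then show ?thesis
          using M.G.component_of_homog[OF M.homog_act[OF x homog], of 0]
            N.G.component_of_homog[OF N.homog_act[OF z homog], of 0] h0 by simp
      qed
    next
      case (add a b)
      then show ?case
        using xc N.G.D_carrier[OF z]
        by (simp add: M.ract_add_right N.ract_add_right M.G.component_add N.G.component_add
            M.ract_closed N.ract_closed h_add M.G.component_homog)
    qed
    with z show ?thesis by blast
  qed
  have ex: "\<exists>z \<in> carrier N. \<forall>b \<in> carrier A. ?d (ract N z b) 0 = h (?c (ract M x b) 0)" if "x \<in> carrier M" for x
    using that
  proof (induction rule: M.G.graded_induct)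
    case (homog n x) then show ?case using hom_ex[OF homog] N.G.D_carrier by blast
  next
    case (add x y)
    then obtain z z' where "z \<in> carrier N" "\<forall>b \<in> carrier A. ?d (ract N z b) 0 = h (?c (ract M x b) 0)"
      "z' \<in> carrier N" "\<forall>b \<in> carrier A. ?d (ract N z' b) 0 = h (?c (ract M y b) 0)" by blast
    with add.hyps show ?case
      by (intro bexI[of _ "z \<oplus>\<^bsub>N\<^esub> z'"])
        (auto simp: M.ract_add_left N.ract_add_left M.G.component_add N.G.component_add
            M.ract_closed N.ract_closed h_add M.G.component_homog)
  qed
  then obtain f0 where f0: "\<And>x. x \<in> carrier M \<Longrightarrow> f0 x \<in> carrier N"
    "\<And>x b. \<lbrakk>x \<in> carrier M; b \<in> carrier A\<rbrakk> \<Longrightarrow> ?d (ract N (f0 x) b) 0 = h (?c (ract M x b) 0)" by metis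
  have f0_eq: "f0 x = z" if "x \<in> carrier M" "z \<in> carrier N"
    "\<And>b. b \<in> carrier A \<Longrightarrow> ?d (ract N z b) 0 = h (?c (ract M x b) 0)" for x z
    by (rule act_degree_zero_inject[OF N f0(1)[OF that(1)] that(2)]) (simp add: f0(2)[OF that(1)] that(3))
  define f where "f = restrict f0 (carrier M)"
  have "f \<in> rmodule_hom A M N"
  proof (rule rmodule_homI)
    fix x y assume "x \<in> carrier M" "y \<in> carrier M"
    then show "f (x \<oplus>\<^bsub>M\<^esub> y) = f x \<oplus>\<^bsub>N\<^esub> f y"
      by (auto simp: f_def f0 M.ract_add_left N.ract_add_left M.G.component_add N.G.component_add
            M.ract_closed N.ract_closed h_add M.G.component_homog intro!: f0_eq)
  next
    fix x a assume x: "x \<in> carrier M" and a: "a \<in> carrier A"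
    have "f0 (ract M x a) = ract N (f0 x) a"
      using x a by (intro f0_eq) (auto simp: M.ract_closed N.ract_closed f0 M.ract_mult[symmetric] N.ract_mult[symmetric])
    then show "f (ract M x a) = ract N (f x) a" using x a by (simp add: f_def M.ract_closed)
  qed (auto simp: f_def f0)
  moreover have "f x \<in> mhomog N n" if x: "x \<in> mhomog M n" for x n
  proof -
    obtain z where z: "z \<in> mhomog N n" "\<forall>b \<in> carrier A. ?d (ract N z b) 0 = h (?c (ract M x b) 0)"
      using hom_ex[OF x] by blast
    then have "f0 x = z" using M.G.D_carrier[OF x] N.G.D_carrier[OF z(1)] by (intro f0_eq) auto
    then show ?thesis using z M.G.D_carrier[OF x] by (simp add: f_def)
  qed
  moreover have "restrict f (mhomog M 0) = h"
  proof
    fix x show "restrict f (mhomog M 0) x = h x"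
    proof (cases "x \<in> mhomog M 0")
      case True
      note fx = calculation(2)[OF True]
      have "?d (ract N (f0 x) \<one>\<^bsub>A\<^esub>) 0 = h (?c (ract M x \<one>\<^bsub>A\<^esub>) 0)" using True by (simp add: f0 M.G.D_carrier)
      then show ?thesis
        using True fx f0(1)[OF M.G.D_carrier[OF True]] M.G.D_carrier[OF True]
        by (simp add: f_def M.ract_one N.ract_one M.G.component_of_homog N.G.component_of_homog)
    next
      case False
      then show ?thesis using rmodule_hom_undefined[OF h] by simp
    qed
  qed
  ultimately show ?thesis by (intro bexI[of _ f]) auto
qed

lemma fully_faithful_degree_part:
  "fully_faithful (Gr_cat A) (Mod_cat (degree_zero A)) degree_part_functor"
proof -
  interpret F: cat_functor "Gr_cat A" "Mod_cat (degree_zero A)" degree_part_functor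
    by (rule cat_functor_degree_part)
  show ?thesis
  proof
    show "\<exists>f\<in>chom (Gr_cat A) X Y. fmap degree_part_functor X Y f = g"
      if "X \<in> cobj (Gr_cat A)" "Y \<in> cobj (Gr_cat A)"
        "g \<in> chom (Mod_cat (degree_zero A)) (fobj degree_part_functor X) (fobj degree_part_functor Y)" for X Y g
      using degree_part_full[of X Y g] that by simp
    show "f = f'" if "X \<in> cobj (Gr_cat A)" "Y \<in> cobj (Gr_cat A)" "f \<in> chom (Gr_cat A) X Y" "f' \<in> chom (Gr_cat A) X Y"
        and eq: "fmap degree_part_functor X Y f = fmap degree_part_functor X Y f'" for X Y f f'
    proof (rule degree_part_faithful[OF _ _ that(3,4)])
      fix x assume "x \<in> mhomog X 0" then show "f x = f' x" using fun_cong[OF eq, of x] by simp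
    qed (use that in auto)
  qed
qed

end

section \<open>Cardinalities\<close>

lemma infinite_times_lepoll: "infinite A \<Longrightarrow> A \<times> A \<lesssim> A"
  using card_of_Times_same_infinite[of A] by (auto simp: eqpoll_iff_card_of_ordIso[symmetric] intro: eqpoll_imp_lepoll)

text \<open>A list is coded by its length together with its entries nested by a pairing function on
  \<open>A\<close>. The nested pairs are shown to separate lists of equal length, and the first
  coordinate takes care of the length.\<close>

lemma infinite_lists_lepoll:
  assumes "infinite A" shows "lists A \<lesssim> A"
proof -
  obtain p where p: "inj_on p (A \<times> A)" "p ` (A \<times> A) \<subseteq> A"
    using infinite_times_lepoll[OF assms] by (auto simp: lepoll_def)
  obtain \<nu> :: "nat \<Rightarrow> _" where \<nu>: "inj \<nu>" "range \<nu> \<subseteq> A"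
    using assms by (auto simp: infinite_le_lepoll lepoll_def)
  define enc where "enc xs = foldr (\<lambda>x y. p (x, y)) xs (\<nu> 0)" for xs
  have enc_in: "enc xs \<in> A" if "xs \<in> lists A" for xs
    using that p(2) \<nu>(2) by induction (auto simp: enc_def)
  have enc_inj: "xs = ys" if "xs \<in> lists A" "ys \<in> lists A" "length xs = length ys" "enc xs = enc ys" for xs ys
    using that(3,1,2,4)
  proof (induction rule: list_induct2)
    case (Cons x xs y ys)
    then have "p (x, enc xs) = p (y, enc ys)" by (simp add: enc_def)
    then have "(x, enc xs) = (y, enc ys)"
      using Cons.prems enc_in by (intro inj_onD[OF p(1)]) auto
    then show ?case using Cons by auto
  qed simp
  have "inj_on (\<lambda>xs. (\<nu> (length xs), enc xs)) (lists A)"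
    using enc_inj \<nu>(1) by (auto simp: inj_on_def)
  moreover have "(\<lambda>xs. (\<nu> (length xs), enc xs)) ` lists A \<subseteq> A \<times> A"
    using enc_in \<nu>(2) by auto
  ultimately have "lists A \<lesssim> A \<times> A" by (auto simp: lepoll_def)
  then show ?thesis using infinite_times_lepoll[OF assms] by (rule lepoll_trans)
qed

lemma times_lepoll_infinite: "\<lbrakk>A \<lesssim> U; B \<lesssim> U; infinite U\<rbrakk> \<Longrightarrow> A \<times> B \<lesssim> U"
  using times_lepoll_mono infinite_times_lepoll lepoll_trans by blast

text \<open>Every element of the generated subgroup is the value of a word in the generators and
  their inverses, and over an alphabet no larger than \<open>U\<close> there are at most as many
  words as elements of \<open>U\<close>.\<close>

lemma (in group) generate_lepoll:
  assumes X: "X \<subseteq> carrier G" and small: "X \<lesssim> U" and U: "infinite U"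
  shows "generate G X \<lesssim> U"
proof -
  let ?L = "X \<union> m_inv G ` X"
  define ev where "ev xs = foldr (\<otimes>) xs \<one>" for xs
  have L: "?L \<subseteq> carrier G" using X by auto
  have ev_closed: "ev xs \<in> carrier G" if "xs \<in> lists ?L" for xs
    using that L by induction (auto simp: ev_def)
  have ev_append: "ev (xs @ ys) = ev xs \<otimes> ev ys" if "xs \<in> lists ?L" "ys \<in> lists ?L" for xs ys
    using that
  proof induction
    case Nil then show ?case using ev_closed by (simp add: ev_def)
  next
    case (Cons x xs)
    then show ?case using ev_closed[of xs] ev_closed[of ys] L by (auto simp: ev_def m_assoc)
  qed
  have "x \<in> ev ` lists ?L" if "x \<in> generate G X" for x
    using that
  proof induction
    case one then show ?case by (intro image_eqI[of _ _ "[]"]) (auto simp: ev_def)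
  next
    case (incl h) then show ?case using X by (intro image_eqI[of _ _ "[h]"]) (auto simp: ev_def)
  next
    case (inv h) then show ?case using X by (intro image_eqI[of _ _ "[inv h]"]) (auto simp: ev_def)
  next
    case (eng h k)
    then obtain xs ys where "xs \<in> lists ?L" "ys \<in> lists ?L" "h = ev xs" "k = ev ys" by blast
    then show ?case using ev_append by (intro image_eqI[of _ _ "xs @ ys"]) auto
  qed
  then have "generate G X \<lesssim> lists ?L" by (intro subset_image_lepoll[of _ ev]) auto
  also have "lists ?L \<lesssim> lists U"
  proof (rule lists_lepoll_mono)
    have "?L \<subseteq> (\<lambda>(b, x). if b then x else inv x) ` ((UNIV :: bool set) \<times> X)" by force
    then have "?L \<lesssim> (UNIV :: bool set) \<times> X" by (rule subset_image_lepoll)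
    also have "\<dots> \<lesssim> U"
      using small U by (intro times_lepoll_infinite) (auto intro: finite_lepoll_infinite)
    finally show "?L \<lesssim> U" .
  qed
  also have "lists U \<lesssim> U" by (rule infinite_lists_lepoll[OF U])
  finally show ?thesis .
qed

section \<open>Copies of graded modules\<close>

lemma right_module_cong:
  assumes "right_module R M" "carrier M' = carrier M" "zero M' = zero M" "add M' = add M" "ract M' = ract M"
  shows "right_module R M'"
proof -
  interpret right_module R M by fact
  have "abelian_group M'"
    by (rule abelian_groupI) (auto simp: assms(2-4) M.a_ac intro: M.l_neg)
  then show ?thesis
    by (intro right_module.intro right_module_axioms.intro R.ring_axioms)
      (auto simp: assms ract_closed ract_add_left ract_add_right ract_mult ract_one)
qed

text \<open>For modules whose elements are functions or ring elements the grading is a separate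
  parameter; it becomes a field of the record when the module is copied into the universe
  type.\<close>

locale graded_action = right_module A M + G: graded_group M D
  for A :: "('k, 'a) galgebra" and M :: "('a, 'x) rmodule" and D +
  assumes act_homog: "\<lbrakk>x \<in> D n; a \<in> homog A k\<rbrakk> \<Longrightarrow> ract M x a \<in> D (n + k)"
    and homog_carrier: "a \<in> homog A k \<Longrightarrow> a \<in> carrier A"

lemma extend_simps [simp]:
  "carrier (rmodule.extend M (grmodule.fields D)) = carrier M"
  "zero (rmodule.extend M (grmodule.fields D)) = zero M"
  "add (rmodule.extend M (grmodule.fields D)) = add M"
  "ract (rmodule.extend M (grmodule.fields D)) = ract M"
  "mhomog (rmodule.extend M (grmodule.fields D)) = D"
  by (simp_all add: rmodule.defs grmodule.defs)

context graded_action
begin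

lemma graded_right_module_copy:
  assumes inj: "inj_on q (carrier M)"
  shows "graded_right_module A (rmodule.extend (image_copy q M) (grmodule.fields (\<lambda>n. q ` D n)))"
    (is "graded_right_module A ?Q")
proof (rule graded_right_moduleI)
  interpret q: image_module A M q by (rule image_module_inj[OF right_module_axioms inj])
  show Q: "right_module A ?Q" by (rule right_module_cong[OF q.right_module_image_copy]) simp_all
  interpret Q: right_module A ?Q by (rule Q)
  have neg: "\<ominus>\<^bsub>?Q\<^esub> q x = q (\<ominus>\<^bsub>M\<^esub> x)" if "x \<in> carrier M" for x
    by (rule Q.M.minus_equality) (use that in \<open>simp_all add: q.add_image_copy M.l_neg\<close>)
  have inv: "inv_into (carrier M) q (q x) = x" if "x \<in> carrier M" for x
    using inj that by simp
  show "graded_group ?Q (mhomog ?Q)"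
  proof (rule graded_groupI[where p = "\<lambda>n y. q (component M D (inv_into (carrier M) q y) n)"])
    show "abelian_group ?Q" by (rule Q.M.abelian_group_axioms)
    show "subgroup (mhomog ?Q n) (add_monoid ?Q)" for n
    proof
      show "inv\<^bsub>add_monoid ?Q\<^esub> x \<in> mhomog ?Q n" if x: "x \<in> mhomog ?Q n" for x
      proof -
        obtain y where "y \<in> D n" "x = q y" using x by auto
        then show ?thesis using neg[of y] G.D_carrier G.D_minus by (auto simp: a_inv_def)
      qed
    qed (auto simp: G.D_carrier q.add_image_copy G.D_add G.D_zero)
    show "x \<in> generate (add_monoid ?Q) (\<Union>n. mhomog ?Q n)" if x: "x \<in> carrier ?Q" for x
    proof -
      obtain y where y: "y \<in> carrier M" "x = q y" using x by auto
      have "q y \<in> generate (add_monoid ?Q) (\<Union>n. mhomog ?Q n)" using y(1)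
      proof (induction rule: G.graded_induct)
        case (homog n y) then show ?case by (auto intro: generate.incl)
      next
        case (add u v)
        then show ?case using generate.eng[of "q u" "add_monoid ?Q" _ "q v"] by (simp add: q.add_image_copy)
      qed
      then show ?thesis using y by simp
    qed
  next
    fix n m x assume "x \<in> mhomog ?Q m"
    then obtain y where "y \<in> D m" "x = q y" by auto
    then show "q (component M D (inv_into (carrier M) q x) n) = (if n = m then x else \<zero>\<^bsub>?Q\<^esub>)"
      using G.D_carrier inv by (simp add: G.component_of_homog)
  qed (auto simp: q.add_image_copy inv G.component_homog G.component_add G.component_closed)
  show "ract ?Q x a \<in> mhomog ?Q (n + k)" if "x \<in> mhomog ?Q n" "a \<in> homog A k" for x a n k
    using that by (auto simp: q.ract_image_copy G.D_carrier act_homog homog_carrier)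
qed

end

text \<open>Again \<open>x = \<Sum> (x y) z\<close> with \<open>x y\<close> of degree 0. The purpose
  is cardinality: the size of a graded module is bounded in terms of its degree-zero part and the
  ring.\<close>

lemma (in strongly_graded) generate_degree_zero:
  assumes "graded_action A M D" and x: "x \<in> carrier M"
  shows "x \<in> generate (add_monoid M) {ract M y a | y a. y \<in> D 0 \<and> a \<in> carrier A}"
proof -
  interpret M: graded_action A M D by fact
  let ?X = "{ract M y a | y a. y \<in> D 0 \<and> a \<in> carrier A}"
  have eng: "u \<oplus>\<^bsub>M\<^esub> v \<in> generate (add_monoid M) ?X"
    if "u \<in> generate (add_monoid M) ?X" "v \<in> generate (add_monoid M) ?X" for u v
    using generate.eng[OF that] by simp
  show ?thesis
    using x
  proof (induction rule: M.G.graded_induct)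
    case (homog n x)
    note xc = M.G.D_carrier[OF homog]
    have "ract M x \<one>\<^bsub>A\<^esub> \<in> generate (add_monoid M) ?X"
    proof (rule unit_induct[where n = "- n"])
      fix y z assume y: "y \<in> homog A (- n)" and z: "z \<in> homog A (- (- n))"
      have "ract M x y \<in> D 0" using M.act_homog[OF homog y] by simp
      then show "ract M x (y \<otimes>\<^bsub>A\<^esub> z) \<in> generate (add_monoid M) ?X"
        using xc D_carrier[OF y] D_carrier[OF z] by (auto simp: M.ract_mult intro!: generate.incl)
    qed (use eng xc in \<open>simp add: M.ract_add_right D_carrier\<close>)
    then show ?case using xc by (simp add: M.ract_one)
  qed (rule eng)
qed

section \<open>Coinduced modules\<close>

text \<open>The last clause makes the module the direct sum of its homogeneous parts; without it,
  the functions would form their product.\<close>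

definition coind_carrier :: "('k, 'a) galgebra \<Rightarrow> ('a, 'u) rmodule \<Rightarrow> ('a \<Rightarrow> 'u) set" where
  "coind_carrier A N = {\<phi> \<in> carrier A \<rightarrow>\<^sub>E carrier N.
     (\<forall>a \<in> carrier A. \<forall>b \<in> carrier A. \<phi> (a \<oplus>\<^bsub>A\<^esub> b) = \<phi> a \<oplus>\<^bsub>N\<^esub> \<phi> b) \<and>
     (\<forall>a \<in> carrier A. \<forall>r \<in> homog A 0. \<phi> (a \<otimes>\<^bsub>A\<^esub> r) = ract N (\<phi> a) r) \<and>
     (\<exists>S. finite S \<and> (\<forall>n. n \<notin> S \<longrightarrow> (\<forall>a \<in> homog A n. \<phi> a = \<zero>\<^bsub>N\<^esub>)))}"

text \<open>
  For a strongly graded \<open>A\<close> the graded module with degree-zero part \<open>N\<close> is realized as the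
  homomorphisms \<open>A \<rightarrow> N\<close> of right \<open>A\<^sub>0\<close>-modules which vanish in almost all degrees; this avoids
  tensor products \<open>N \<otimes> A\<^sub>n\<close>.
\<close>

definition coind :: "('k, 'a) galgebra \<Rightarrow> ('a, 'u) rmodule \<Rightarrow> ('a, 'a \<Rightarrow> 'u) rmodule" where
  "coind A N = \<lparr>carrier = coind_carrier A N, mult = undefined, one = undefined,
     zero = (\<lambda>a \<in> carrier A. \<zero>\<^bsub>N\<^esub>), add = (\<lambda>\<phi> \<chi>. \<lambda>a \<in> carrier A. \<phi> a \<oplus>\<^bsub>N\<^esub> \<chi> a),
     ract = (\<lambda>\<phi> c. \<lambda>a \<in> carrier A. \<phi> (c \<otimes>\<^bsub>A\<^esub> a))\<rparr>"

text \<open>The sign comes from the action \<open>(\<phi> c) a = \<phi> (c a)\<close>: a map that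
  lives on \<open>A_{-n}\<close> is taken by \<open>c\<close> of degree \<open>k\<close> to one that
  lives on \<open>A_{-n-k}\<close>, so the action adds degrees.\<close>

definition coind_homog :: "('k, 'a) galgebra \<Rightarrow> ('a, 'u) rmodule \<Rightarrow> int \<Rightarrow> ('a \<Rightarrow> 'u) set" where
  "coind_homog A N n =
     {\<phi> \<in> coind_carrier A N. \<forall>m. m \<noteq> - n \<longrightarrow> (\<forall>a \<in> homog A m. \<phi> a = \<zero>\<^bsub>N\<^esub>)}"

lemma coind_simps [simp]: "carrier (coind A N) = coind_carrier A N"
  "zero (coind A N) = (\<lambda>a \<in> carrier A. \<zero>\<^bsub>N\<^esub>)"
  "\<phi> \<oplus>\<^bsub>coind A N\<^esub> \<chi> = (\<lambda>a \<in> carrier A. \<phi> a \<oplus>\<^bsub>N\<^esub> \<chi> a)"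
  "ract (coind A N) \<phi> c = (\<lambda>a \<in> carrier A. \<phi> (c \<otimes>\<^bsub>A\<^esub> a))"
  by (simp_all add: coind_def)

locale coinduced = graded_ring A + N: right_module "degree_zero A" N
  for A :: "('k, 'a) galgebra" and N :: "('a, 'u) rmodule"
begin

abbreviation "C \<equiv> coind_carrier A N"

lemma coindI:
  assumes "\<And>a. a \<in> carrier A \<Longrightarrow> \<phi> a \<in> carrier N"
    and "\<And>a b. \<lbrakk>a \<in> carrier A; b \<in> carrier A\<rbrakk> \<Longrightarrow> \<phi> (a \<oplus>\<^bsub>A\<^esub> b) = \<phi> a \<oplus>\<^bsub>N\<^esub> \<phi> b"
    and "\<And>a r. \<lbrakk>a \<in> carrier A; r \<in> homog A 0\<rbrakk> \<Longrightarrow> \<phi> (a \<otimes>\<^bsub>A\<^esub> r) = ract N (\<phi> a) r"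
    and "finite S" "\<And>n a. \<lbrakk>n \<notin> S; a \<in> homog A n\<rbrakk> \<Longrightarrow> \<phi> a = \<zero>\<^bsub>N\<^esub>"
  shows "restrict \<phi> (carrier A) \<in> C"
  using assms(1-3) exI[of "\<lambda>S. finite S \<and> (\<forall>n. n \<notin> S \<longrightarrow> (\<forall>a \<in> homog A n. restrict \<phi> (carrier A) a = \<zero>\<^bsub>N\<^esub>))" S] assms(4,5)
  by (auto simp: coind_carrier_def D_carrier)

lemma coindD:
  assumes "\<phi> \<in> C"
  shows "\<And>a. a \<in> carrier A \<Longrightarrow> \<phi> a \<in> carrier N"
    and "\<And>a b. \<lbrakk>a \<in> carrier A; b \<in> carrier A\<rbrakk> \<Longrightarrow> \<phi> (a \<oplus>\<^bsub>A\<^esub> b) = \<phi> a \<oplus>\<^bsub>N\<^esub> \<phi> b"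
    and "\<And>a r. \<lbrakk>a \<in> carrier A; r \<in> homog A 0\<rbrakk> \<Longrightarrow> \<phi> (a \<otimes>\<^bsub>A\<^esub> r) = ract N (\<phi> a) r"
    and "\<exists>S. finite S \<and> (\<forall>n a. n \<notin> S \<longrightarrow> a \<in> homog A n \<longrightarrow> \<phi> a = \<zero>\<^bsub>N\<^esub>)"
    and "\<phi> \<in> extensional (carrier A)"
  using assms by (auto simp: coind_carrier_def PiE_def Pi_def)

lemma coind_zero: "\<phi> \<in> C \<Longrightarrow> \<phi> \<zero>\<^bsub>A\<^esub> = \<zero>\<^bsub>N\<^esub>"
  using coindD(2)[of \<phi> "\<zero>\<^bsub>A\<^esub>" "\<zero>\<^bsub>A\<^esub>"] coindD(1)[of \<phi> "\<zero>\<^bsub>A\<^esub>"] by simp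

lemma act_zero: "r \<in> homog A 0 \<Longrightarrow> ract N \<zero>\<^bsub>N\<^esub> r = \<zero>\<^bsub>N\<^esub>"
  using N.ract_add_left[of "\<zero>\<^bsub>N\<^esub>" "\<zero>\<^bsub>N\<^esub>" r] N.ract_closed[of "\<zero>\<^bsub>N\<^esub>" r] by simp

lemma act_minus: "\<lbrakk>x \<in> carrier N; r \<in> homog A 0\<rbrakk> \<Longrightarrow> ract N (\<ominus>\<^bsub>N\<^esub> x) r = \<ominus>\<^bsub>N\<^esub> ract N x r"
  using N.ract_add_left[of "\<ominus>\<^bsub>N\<^esub> x" x r] N.ract_closed[of x r] N.ract_closed[of "\<ominus>\<^bsub>N\<^esub> x" r]
  by (intro N.M.minus_equality[symmetric]) (auto simp: N.M.l_neg act_zero)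

lemma zero_coind: "(\<lambda>a \<in> carrier A. \<zero>\<^bsub>N\<^esub>) \<in> C"
  by (rule coindI[where S = "{}"]) (auto simp: act_zero)

lemma add_coind:
  assumes p: "\<phi> \<in> C" and c: "\<chi> \<in> C" shows "(\<lambda>a \<in> carrier A. \<phi> a \<oplus>\<^bsub>N\<^esub> \<chi> a) \<in> C"
proof -
  obtain S T where "finite S" "\<And>n a. n \<notin> S \<Longrightarrow> a \<in> homog A n \<Longrightarrow> \<phi> a = \<zero>\<^bsub>N\<^esub>"
    "finite T" "\<And>n a. n \<notin> T \<Longrightarrow> a \<in> homog A n \<Longrightarrow> \<chi> a = \<zero>\<^bsub>N\<^esub>"
    using coindD(4)[OF p] coindD(4)[OF c] by metis
  then show ?thesis
    by (intro coindI[where S = "S \<union> T"])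
      (auto simp: coindD(1-3)[OF p] coindD(1-3)[OF c] N.M.a_ac N.ract_add_left N.ract_closed)
qed

lemma neg_coind:
  assumes p: "\<phi> \<in> C" shows "(\<lambda>a \<in> carrier A. \<ominus>\<^bsub>N\<^esub> \<phi> a) \<in> C"
proof -
  obtain S where "finite S" "\<And>n a. n \<notin> S \<Longrightarrow> a \<in> homog A n \<Longrightarrow> \<phi> a = \<zero>\<^bsub>N\<^esub>"
    using coindD(4)[OF p] by metis
  then show ?thesis
    by (intro coindI[where S = S]) (auto simp: coindD(1-3)[OF p] N.M.minus_add act_minus)
qed

lemma act_coind:
  assumes p: "\<phi> \<in> C" and c: "c \<in> carrier A" shows "(\<lambda>a \<in> carrier A. \<phi> (c \<otimes>\<^bsub>A\<^esub> a)) \<in> C"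
proof -
  have "\<exists>S. finite S \<and> (\<forall>n a. n \<notin> S \<longrightarrow> a \<in> homog A n \<longrightarrow> \<phi> (c \<otimes>\<^bsub>A\<^esub> a) = \<zero>\<^bsub>N\<^esub>)"
    using c
  proof (induction rule: graded_induct)
    case (homog k c)
    obtain S where S: "finite S" "\<And>n a. n \<notin> S \<Longrightarrow> a \<in> homog A n \<Longrightarrow> \<phi> a = \<zero>\<^bsub>N\<^esub>"
      using coindD(4)[OF p] by metis
    \<comment> \<open>Left multiplication by \<open>c\<close> takes \<open>A_n\<close> to
      \<open>A_{k+n}\<close>, so the set of degrees that supports the map is moved by
      \<open>-k\<close>.\<close>
    have "\<phi> (c \<otimes>\<^bsub>A\<^esub> a) = \<zero>\<^bsub>N\<^esub>" if n: "n \<notin> (\<lambda>n. n - k) ` S" and a: "a \<in> homog A n" for n a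
    proof (rule S(2)[OF _ homog_mult[OF homog a]])
      show "k + n \<notin> S" using n by (metis add_diff_cancel_left' image_eqI)
    qed
    then show ?case using S(1) by (intro exI[of _ "(\<lambda>n. n - k) ` S"]) auto
  next
    case (add c d)
    then obtain S T where "finite S" "\<And>n a. n \<notin> S \<Longrightarrow> a \<in> homog A n \<Longrightarrow> \<phi> (c \<otimes>\<^bsub>A\<^esub> a) = \<zero>\<^bsub>N\<^esub>"
      "finite T" "\<And>n a. n \<notin> T \<Longrightarrow> a \<in> homog A n \<Longrightarrow> \<phi> (d \<otimes>\<^bsub>A\<^esub> a) = \<zero>\<^bsub>N\<^esub>" by metis
    with add.hyps show ?case
      by (intro exI[of _ "S \<union> T"]) (auto simp: R.l_distr D_carrier coindD(2)[OF p])
  qed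
  then obtain S where "finite S" "\<And>n a. n \<notin> S \<Longrightarrow> a \<in> homog A n \<Longrightarrow> \<phi> (c \<otimes>\<^bsub>A\<^esub> a) = \<zero>\<^bsub>N\<^esub>" by metis
  with c show ?thesis
    by (intro coindI[where S = S])
      (auto simp: coindD(1,2)[OF p] R.r_distr R.m_assoc[symmetric] coindD(3)[OF p] D_carrier)
qed

lemma right_module_coind: "right_module A (coind A N)"
proof (intro right_module.intro right_module_axioms.intro R.ring_axioms)
  show "abelian_group (coind A N)"
  proof (rule abelian_groupI)
    fix \<phi> assume "\<phi> \<in> carrier (coind A N)"
    then show "\<exists>\<chi>\<in>carrier (coind A N). \<chi> \<oplus>\<^bsub>coind A N\<^esub> \<phi> = \<zero>\<^bsub>coind A N\<^esub>"
      using neg_coind coindD(1)[of \<phi>]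
      by (intro bexI[of _ "\<lambda>a \<in> carrier A. \<ominus>\<^bsub>N\<^esub> \<phi> a"]) (auto simp: fun_eq_iff N.M.l_neg)
  next
    fix \<phi> assume "\<phi> \<in> carrier (coind A N)"
    then show "\<zero>\<^bsub>coind A N\<^esub> \<oplus>\<^bsub>coind A N\<^esub> \<phi> = \<phi>"
      using coindD(1,5)[of \<phi>] by (auto simp: fun_eq_iff extensional_def)
  next
    fix x y z assume "x \<in> carrier (coind A N)" "y \<in> carrier (coind A N)" "z \<in> carrier (coind A N)"
    then show "x \<oplus>\<^bsub>coind A N\<^esub> y \<oplus>\<^bsub>coind A N\<^esub> z = x \<oplus>\<^bsub>coind A N\<^esub> (y \<oplus>\<^bsub>coind A N\<^esub> z)"
      "x \<oplus>\<^bsub>coind A N\<^esub> y = y \<oplus>\<^bsub>coind A N\<^esub> x"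
      using coindD(1)[of x] coindD(1)[of y] coindD(1)[of z]
      by (auto simp: fun_eq_iff N.M.a_ac)
  qed (auto simp: zero_coind add_coind)
next
  fix \<phi> assume p: "\<phi> \<in> carrier (coind A N)"
  show "ract (coind A N) \<phi> \<one>\<^bsub>A\<^esub> = \<phi>"
    using p coindD(5)[of \<phi>] by (auto simp: fun_eq_iff extensional_def)
  fix a b assume "a \<in> carrier A" "b \<in> carrier A"
  then show "ract (coind A N) \<phi> (a \<oplus>\<^bsub>A\<^esub> b) = ract (coind A N) \<phi> a \<oplus>\<^bsub>coind A N\<^esub> ract (coind A N) \<phi> b"
    "ract (coind A N) \<phi> (a \<otimes>\<^bsub>A\<^esub> b) = ract (coind A N) (ract (coind A N) \<phi> a) b"
    using p coindD(2)[of \<phi>] by (auto simp: fun_eq_iff R.l_distr R.m_assoc)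
qed (auto simp: act_coind)

lemma component_coind:
  assumes p: "\<phi> \<in> C" shows "(\<lambda>a \<in> carrier A. \<phi> (component A (homog A) a m)) \<in> C"
proof (rule coindI[where S = "{m}"])
  fix n a assume "n \<notin> {m}" "a \<in> homog A n"
  then show "\<phi> (component A (homog A) a m) = \<zero>\<^bsub>N\<^esub>" by (auto simp: component_of_homog coind_zero[OF p])
qed (auto simp: coindD(1-3)[OF p] component_closed component_add component_mult)

lemma coind_component_homog:
  assumes p: "\<phi> \<in> C" and z: "\<And>k a. \<lbrakk>k \<noteq> m; a \<in> homog A k\<rbrakk> \<Longrightarrow> \<phi> a = \<zero>\<^bsub>N\<^esub>" and a: "a \<in> carrier A"
  shows "\<phi> (component A (homog A) a m) = \<phi> a"
  using a
proof (induction rule: graded_induct)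
  case (homog k a)
  show ?case
    by (cases "k = m") (simp_all add: component_of_homog[OF homog] coind_zero[OF p] z[OF _ homog])
next
  case (add x y) then show ?case by (simp add: component_add coindD(2)[OF p] component_closed)
qed

lemma subgroup_coind_homog: "subgroup (coind_homog A N n) (add_monoid (coind A N))"
proof -
  interpret M: right_module A "coind A N" by (rule right_module_coind)
  have neg: "\<ominus>\<^bsub>coind A N\<^esub> \<phi> = (\<lambda>a \<in> carrier A. \<ominus>\<^bsub>N\<^esub> \<phi> a)" if "\<phi> \<in> C" for \<phi>
    using that coindD(1)[OF that] by (intro M.M.minus_equality) (auto simp: neg_coind fun_eq_iff N.M.l_neg)
  show ?thesis
  proof
    show "inv\<^bsub>add_monoid (coind A N)\<^esub> \<phi> \<in> coind_homog A N n" if "\<phi> \<in> coind_homog A N n" for \<phi>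
    proof -
      have "\<ominus>\<^bsub>coind A N\<^esub> \<phi> \<in> coind_homog A N n"
        using that neg[of \<phi>] by (auto simp: coind_homog_def neg_coind D_carrier)
      then show ?thesis by (simp only: a_inv_def)
    qed
  qed (auto simp: coind_homog_def add_coind zero_coind D_carrier)
qed

lemma graded_action_coind: "graded_action A (coind A N) (coind_homog A N)"
proof -
  interpret M: right_module A "coind A N" by (rule right_module_coind)
  \<comment> \<open>The component of degree \<open>n\<close> is the restriction of
    \<open>\<phi>\<close> to \<open>A_{-n}\<close>, extended by zero to the other degrees.\<close>
  let ?p = "\<lambda>n \<phi>. \<lambda>a \<in> carrier A. \<phi> (component A (homog A) a (- n))"
  have p_homog: "?p n \<phi> \<in> coind_homog A N n" if "\<phi> \<in> C" for n \<phi>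
    using that by (auto simp: coind_homog_def component_coind component_of_homog coind_zero D_carrier)
  \<comment> \<open>Induction over a finite set of degrees outside which \<open>\<phi>\<close>
    vanishes. One degree \<open>s\<close> of the ring is split off at a time; the part of
    \<open>\<phi>\<close> on \<open>A_s\<close> is homogeneous of degree \<open>-s\<close>.\<close>
  have gen: "\<phi> \<in> generate (add_monoid (coind A N)) (\<Union>n. coind_homog A N n)"
    if "finite S" "\<phi> \<in> C" "\<And>n a. \<lbrakk>n \<notin> S; a \<in> homog A n\<rbrakk> \<Longrightarrow> \<phi> a = \<zero>\<^bsub>N\<^esub>" for S \<phi>
    using that
  proof (induction arbitrary: \<phi>)
    case empty
    then have "\<phi> \<in> coind_homog A N 0" by (auto simp: coind_homog_def)
    then show ?case by (auto intro: generate.incl)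
  next
    case (insert s S)
    let ?c = "?p (- s) \<phi>"
    let ?d = "\<lambda>a \<in> carrier A. \<phi> a \<oplus>\<^bsub>N\<^esub> (\<lambda>a \<in> carrier A. \<ominus>\<^bsub>N\<^esub> ?c a) a"
    have c: "?c \<in> C" using component_coind[OF insert.prems(1)] by simp
    have d: "?d \<in> C" by (rule add_coind[OF insert.prems(1) neg_coind[OF c]])
    have "?d a = \<zero>\<^bsub>N\<^esub>" if "n \<notin> S" "a \<in> homog A n" for n a
      using that insert.prems(2)[of n a] coindD(1)[OF insert.prems(1), of a]
      by (cases "n = s") (auto simp: D_carrier component_of_homog coind_zero[OF insert.prems(1)] N.M.r_neg)
    then have "?d \<in> generate (add_monoid (coind A N)) (\<Union>n. coind_homog A N n)"
      by (rule insert.IH[OF d])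
    moreover have "?c \<in> generate (add_monoid (coind A N)) (\<Union>n. coind_homog A N n)"
      using p_homog[OF insert.prems(1)] by (intro generate.incl) blast
    ultimately have "?d \<oplus>\<^bsub>coind A N\<^esub> ?c \<in> generate (add_monoid (coind A N)) (\<Union>n. coind_homog A N n)"
      using generate.eng[of ?d "add_monoid (coind A N)" _ ?c] by simp
    moreover have "?d \<oplus>\<^bsub>coind A N\<^esub> ?c = \<phi>"
      using coindD(1,5)[OF insert.prems(1)]
      by (auto simp: fun_eq_iff extensional_def N.M.a_assoc N.M.l_neg component_closed)
    ultimately show ?case by metis
  qed
  have "graded_group (coind A N) (coind_homog A N)"
  proof (rule graded_groupI[where p = ?p])
    show "subgroup (coind_homog A N n) (add_monoid (coind A N))" for n by (rule subgroup_coind_homog)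
    show "abelian_group (coind A N)" by (rule M.M.abelian_group_axioms)
  next
    fix \<phi> assume "\<phi> \<in> carrier (coind A N)"
    then show "\<phi> \<in> generate (add_monoid (coind A N)) (\<Union>n. coind_homog A N n)"
      using gen coindD(4)[of \<phi>] by auto
  next
    fix n m \<phi> assume p: "\<phi> \<in> coind_homog A N m"
    then have c: "\<phi> \<in> C" and z: "\<And>k a. \<lbrakk>k \<noteq> - m; a \<in> homog A k\<rbrakk> \<Longrightarrow> \<phi> a = \<zero>\<^bsub>N\<^esub>" by (auto simp: coind_homog_def)
    show "?p n \<phi> = (if n = m then \<phi> else \<zero>\<^bsub>coind A N\<^esub>)"
    proof (cases "n = m")
      case True
      then show ?thesis using coind_component_homog[OF c z] coindD(5)[OF c] by (auto simp: fun_eq_iff extensional_def)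
    next
      case False
      then show ?thesis using z[OF _ component_homog] by (auto simp: fun_eq_iff)
    qed
  qed (auto simp: p_homog component_closed fun_eq_iff)
  then show ?thesis
  proof (intro graded_action.intro graded_action_axioms.intro right_module_coind)
    fix \<phi> n c k assume "\<phi> \<in> coind_homog A N n" and c: "c \<in> homog A k"
    then have p: "\<phi> \<in> C" and z: "\<And>k a. \<lbrakk>k \<noteq> - n; a \<in> homog A k\<rbrakk> \<Longrightarrow> \<phi> a = \<zero>\<^bsub>N\<^esub>" by (auto simp: coind_homog_def)
    have "\<phi> (c \<otimes>\<^bsub>A\<^esub> a) = \<zero>\<^bsub>N\<^esub>" if "m \<noteq> - (n + k)" "a \<in> homog A m" for m a
      using that by (intro z[OF _ homog_mult[OF c that(2)]]) auto
    then show "ract (coind A N) \<phi> c \<in> coind_homog A N (n + k)"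
      using act_coind[OF p D_carrier[OF c]] by (auto simp: coind_homog_def D_carrier)
  qed (use D_carrier in auto)
qed

text \<open>A map of degree 0 lives on \<open>A_0\<close>, where linearity gives
  \<open>\<phi> a = (\<phi> 1) a\<close>. Hence the inverse sends \<open>x\<close> to the map that
  takes \<open>a\<close> to \<open>x a_0\<close>, with \<open>a_0\<close> the degree-zero component
  of \<open>a\<close>.\<close>

lemma bij_eval_one: "bij_betw (\<lambda>\<phi>. \<phi> \<one>\<^bsub>A\<^esub>) (coind_homog A N 0) (carrier N)"
proof (rule bij_betw_byWitness[where f' = "\<lambda>x. \<lambda>a \<in> carrier A. ract N x (component A (homog A) a 0)"])
  have val: "\<phi> (component A (homog A) a 0) = ract N (\<phi> \<one>\<^bsub>A\<^esub>) (component A (homog A) a 0)"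
    if "\<phi> \<in> C" "a \<in> carrier A" for \<phi> a
    using coindD(3)[OF that(1) R.one_closed component_homog[OF that(2)]] by (simp add: component_closed that)
  show "\<forall>\<phi>\<in>coind_homog A N 0. (\<lambda>a\<in>carrier A. ract N (\<phi> \<one>\<^bsub>A\<^esub>) (component A (homog A) a 0)) = \<phi>"
  proof
    fix \<phi> assume "\<phi> \<in> coind_homog A N 0"
    then have c: "\<phi> \<in> C" and z: "\<And>k a. \<lbrakk>k \<noteq> 0; a \<in> homog A k\<rbrakk> \<Longrightarrow> \<phi> a = \<zero>\<^bsub>N\<^esub>" by (auto simp: coind_homog_def)
    have "ract N (\<phi> \<one>\<^bsub>A\<^esub>) (component A (homog A) a 0) = \<phi> a" if "a \<in> carrier A" for a
      by (rule trans[OF sym[OF val[OF c that]] coind_component_homog[OF c z that]])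
    then show "(\<lambda>a\<in>carrier A. ract N (\<phi> \<one>\<^bsub>A\<^esub>) (component A (homog A) a 0)) = \<phi>"
      using coindD(5)[OF c] by (auto simp: fun_eq_iff extensional_def)
  qed
  show "\<forall>x\<in>carrier N. (\<lambda>a\<in>carrier A. ract N x (component A (homog A) a 0)) \<one>\<^bsub>A\<^esub> = x"
    using N.ract_one by (simp add: component_of_homog[OF homog_one])
  have "(\<lambda>a\<in>carrier A. ract N x (component A (homog A) a 0)) \<in> coind_homog A N 0" if x: "x \<in> carrier N" for x
  proof -
    have z: "ract N x \<zero>\<^bsub>A\<^esub> = \<zero>\<^bsub>N\<^esub>"
      using N.ract_add_right[OF x, of "\<zero>\<^bsub>A\<^esub>" "\<zero>\<^bsub>A\<^esub>"] N.ract_closed[OF x, of "\<zero>\<^bsub>A\<^esub>"] by (simp add: D_zero)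
    have "(\<lambda>a\<in>carrier A. ract N x (component A (homog A) a 0)) \<in> C"
    proof (rule coindI[where S = "{0}"])
      show "ract N x (component A (homog A) (a \<oplus>\<^bsub>A\<^esub> b) 0)
        = ract N x (component A (homog A) a 0) \<oplus>\<^bsub>N\<^esub> ract N x (component A (homog A) b 0)"
        if "a \<in> carrier A" "b \<in> carrier A" for a b
        using N.ract_add_right[OF x] that by (simp add: component_add component_homog)
      show "ract N x (component A (homog A) (a \<otimes>\<^bsub>A\<^esub> r) 0) = ract N (ract N x (component A (homog A) a 0)) r"
        if "a \<in> carrier A" "r \<in> homog A 0" for a r
        using N.ract_mult[OF x] that by (simp add: component_mult component_homog)
    qed (use x z N.ract_closed component_homog component_of_homog in auto)
    then show ?thesis by (auto simp: coind_homog_def component_of_homog z D_carrier)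
  qed
  then show "(\<lambda>x. \<lambda>a\<in>carrier A. ract N x (component A (homog A) a 0)) ` carrier N \<subseteq> coind_homog A N 0" by blast
qed (auto simp: coind_homog_def coindD(1))

end

text \<open>The coinduced module has \<open>N\<close> as its degree-zero part, but its elements are
  functions. As it is generated over \<open>A\<close> by a set in bijection with \<open>N\<close>,
  and \<open>A\<close> is small, it has an injection into the infinite universe and is copied along
  it.\<close>

lemma (in strongly_graded) degree_part_surj:
  fixes N :: "('a, 'u) rmodule"
  assumes N: "right_module (degree_zero A) N" and U: "infinite (UNIV :: 'u set)"
    and small: "carrier A \<lesssim> (UNIV :: 'u set)"
  shows "\<exists>M :: ('a, 'u) grmodule. graded_right_module A M \<and>
    isomorphic_in (Mod_cat (degree_zero A)) (degree_part M) N"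
proof -
  interpret N: coinduced A N by (intro coinduced.intro graded_ring_axioms N)
  interpret C: graded_action A "coind A N" "coind_homog A N" by (rule N.graded_action_coind)
  have "coind_homog A N 0 \<lesssim> (UNIV :: 'u set)"
    using N.bij_eval_one unfolding bij_betw_def lepoll_def by blast
  then have "coind_homog A N 0 \<times> carrier A \<lesssim> (UNIV :: 'u set)"
    using small U by (rule times_lepoll_infinite)
  moreover let ?X = "{ract (coind A N) y a | y a. y \<in> coind_homog A N 0 \<and> a \<in> carrier A}"
  have "?X \<subseteq> (\<lambda>(y, a). ract (coind A N) y a) ` (coind_homog A N 0 \<times> carrier A)" by auto
  ultimately have "?X \<lesssim> (UNIV :: 'u set)" using subset_image_lepoll lepoll_trans by meson
  moreover have "?X \<subseteq> carrier (coind A N)" using C.G.D_carrier C.ract_closed by blast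
  ultimately have "generate (add_monoid (coind A N)) ?X \<lesssim> (UNIV :: 'u set)"
    using group.generate_lepoll[OF C.M.a_group, of ?X] U by simp
  moreover have "carrier (coind A N) \<subseteq> generate (add_monoid (coind A N)) ?X"
    using generate_degree_zero[OF C.graded_action_axioms] by blast
  ultimately have "carrier (coind A N) \<lesssim> (UNIV :: 'u set)"
    using subset_imp_lepoll lepoll_trans by meson
  then obtain j :: "_ \<Rightarrow> 'u" where j: "inj_on j (carrier (coind A N))" by (auto simp: lepoll_def)
  define M where "M = rmodule.extend (image_copy j (coind A N)) (grmodule.fields (\<lambda>n. j ` coind_homog A N n))"
  have M: "graded_right_module A M" unfolding M_def by (rule C.graded_right_module_copy[OF j])
  interpret j: image_module A "coind A N" j by (rule image_module_inj[OF C.right_module_axioms j])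
  let ?i = "inv_into (carrier (coind A N)) j"
  let ?e = "\<lambda>x \<in> j ` coind_homog A N 0. ?i x \<one>\<^bsub>A\<^esub>"
  have ij: "?i (j \<phi>) = \<phi>" if "\<phi> \<in> carrier (coind A N)" for \<phi> using that j by simp
  have h0: "\<phi> \<in> carrier (coind A N)" if "\<phi> \<in> coind_homog A N 0" for \<phi> using C.G.D_carrier[OF that] .
  have "is_isomorphism (Mod_cat (degree_zero A)) (degree_part M) N ?e"
  proof (rule Mod_cat_isoI[OF right_module_degree_part[OF M]])
    show "?e \<in> rmodule_hom (degree_zero A) (degree_part M) N"
    proof (rule rmodule_homI)
      fix x y assume "x \<in> carrier (degree_part M)" "y \<in> carrier (degree_part M)"
      then obtain \<phi> \<chi> where "\<phi> \<in> coind_homog A N 0" "x = j \<phi>" "\<chi> \<in> coind_homog A N 0" "y = j \<chi>"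
        by (auto simp: M_def)
      then show "?e (x \<oplus>\<^bsub>degree_part M\<^esub> y) = ?e x \<oplus>\<^bsub>N\<^esub> ?e y"
        using j.add_image_copy[of \<phi> \<chi>] ij[of \<phi>] ij[of \<chi>] ij[of "\<phi> \<oplus>\<^bsub>coind A N\<^esub> \<chi>"] h0 C.G.D_add[of \<phi> 0 \<chi>] R.one_closed
        by (simp add: M_def)
    next
      fix x a assume "x \<in> carrier (degree_part M)" and a: "a \<in> carrier (degree_zero A)"
      then obtain \<phi> where p: "\<phi> \<in> coind_homog A N 0" "x = j \<phi>" by (auto simp: M_def)
      have ra: "ract (coind A N) \<phi> a \<in> coind_homog A N 0" using C.act_homog[OF p(1)] a by fastforce
      have "ract (coind A N) \<phi> a \<one>\<^bsub>A\<^esub> = ract N (\<phi> \<one>\<^bsub>A\<^esub>) a"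
        using a h0[OF p(1)] N.coindD(3)[of \<phi> "\<one>\<^bsub>A\<^esub>" a] D_carrier[of a 0] by simp
      then show "?e (ract (degree_part M) x a) = ract N (?e x) a"
        using j.ract_image_copy[OF h0[OF p(1)], of a] a D_carrier[of a 0] ij[OF h0[OF ra]] ij[OF h0[OF p(1)]] p ra
        by (simp add: M_def del: coind_simps)
    next
      fix x assume "x \<in> carrier (degree_part M)"
      then obtain \<phi> where p: "\<phi> \<in> coind_homog A N 0" "x = j \<phi>" by (auto simp: M_def)
      then show "?e x \<in> carrier N"
        using ij[OF h0[OF p(1)]] h0[OF p(1)] N.coindD(1)[OF _ R.one_closed] by simp
    qed (auto simp: M_def)
    have "bij_betw ?i (j ` coind_homog A N 0) (coind_homog A N 0)"
      by (rule bij_betw_inv_into_subset[where f = j and A = "carrier (coind A N)" and A' = "j ` carrier (coind A N)"])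
        (use j h0 in \<open>auto simp: bij_betw_def\<close>)
    then have "bij_betw ((\<lambda>\<phi>. \<phi> \<one>\<^bsub>A\<^esub>) \<circ> ?i) (j ` coind_homog A N 0) (carrier N)"
      using N.bij_eval_one by (rule bij_betw_trans)
    then show "bij_betw ?e (carrier (degree_part M)) (carrier N)"
      by (subst bij_betw_cong[where g = "(\<lambda>\<phi>. \<phi> \<one>\<^bsub>A\<^esub>) \<circ> ?i"]) (auto simp: M_def)
  qed
  then show ?thesis using M by (auto simp: isomorphic_in_def)
qed

section \<open>The torsion subcategory of a strongly graded algebra\<close>

text \<open>Zero morphisms are those that factor through a zero object, so every universe type has
  to contain one; \<open>undefined\<close> provides its only element.\<close>

definition zero_grmodule :: "('a, 'u) grmodule" where
  "zero_grmodule = \<lparr>carrier = {undefined}, mult = undefined, one = undefined, zero = undefined,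
     add = (\<lambda>x y. undefined), ract = (\<lambda>x a. undefined), mhomog = (\<lambda>n. {undefined})\<rparr>"

definition zero_map :: "('a, 'u, 'q) rmodule_scheme \<Rightarrow> ('a, 'u, 'q) rmodule_scheme \<Rightarrow> 'u \<Rightarrow> 'u" where
  "zero_map M N = (\<lambda>x \<in> carrier M. \<zero>\<^bsub>N\<^esub>)"

definition zero_modules :: "('k, 'a) galgebra \<Rightarrow> ('a, 'u) grmodule set" where
  "zero_modules A = {M. graded_right_module A M \<and> carrier M = {\<zero>\<^bsub>M\<^esub>}}"

lemma zero_grmodule_in_zero_modules:
  fixes A :: "('k, 'a) galgebra"
  assumes "ring A" shows "(zero_grmodule :: ('a, 'u) grmodule) \<in> zero_modules A"
proof -
  let ?Z = "zero_grmodule :: ('a, 'u) grmodule"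
  have ag: "abelian_group ?Z" by (rule abelian_groupI) (auto simp: zero_grmodule_def)
  interpret abelian_group ?Z by (rule ag)
  have "mhomog ?Z n = carrier (add_monoid ?Z)" for n by (simp add: zero_grmodule_def)
  then have "subgroup (mhomog ?Z n) (add_monoid ?Z)" for n
    by (simp only: group.subgroup_self[OF a_group])
  then have "graded_group ?Z (mhomog ?Z)"
    by (intro graded_groupI[where p = "\<lambda>n x. x"] ag)
      (auto simp: zero_grmodule_def intro: generate.incl)
  moreover have "right_module A ?Z"
    by (intro right_module.intro right_module_axioms.intro assms ag) (auto simp: zero_grmodule_def)
  ultimately have "graded_right_module A ?Z"
    by (intro graded_right_moduleI) (auto simp: zero_grmodule_def)
  then show ?thesis by (simp add: zero_modules_def) (simp add: zero_grmodule_def)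
qed

lemma gr_hom_zero:
  assumes "graded_right_module A M" "graded_right_module A N" "f \<in> chom (Gr_cat A) M N"
  shows "f \<zero>\<^bsub>M\<^esub> = \<zero>\<^bsub>N\<^esub>"
  using rmodule_hom_zero[OF gr_mod[OF assms(1)] gr_mod[OF assms(2)]] assms(3) by simp

lemma gr_hom_closed: "\<lbrakk>f \<in> chom (Gr_cat A) M N; x \<in> carrier M\<rbrakk> \<Longrightarrow> f x \<in> carrier N"
  by (auto intro: rmodule_hom_closed)

lemma gr_hom_eqI:
  "\<lbrakk>f \<in> chom (Gr_cat A) M N; g \<in> chom (Gr_cat A) M N; \<And>x. x \<in> carrier M \<Longrightarrow> f x = g x\<rbrakk> \<Longrightarrow> f = g"
  using rmodule_hom_eqI[of f A M N g N] by simp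

lemma gr_zero_closed: "graded_right_module A M \<Longrightarrow> \<zero>\<^bsub>M\<^esub> \<in> carrier M"
  by (simp add: graded_right_module_def right_module_def abelian_group_def abelian_monoid.zero_closed)

lemma zero_map_hom:
  assumes M: "graded_right_module A M" and N: "graded_right_module A N"
  shows "zero_map M N \<in> chom (Gr_cat A) M N"
proof -
  interpret M: graded_right_module A M by fact
  interpret N: graded_right_module A N by fact
  show ?thesis
    by (auto simp: zero_map_def M.ract_closed N.act_zero M.G.D_carrier N.G.D_zero intro!: rmodule_homI)
qed

lemma id_hom: "graded_right_module A M \<Longrightarrow> (\<lambda>x \<in> carrier M. x) \<in> chom (Gr_cat A) M M"
  using category.id_closed[OF category_Gr_cat[of A], of M] by simp

lemma zero_modules_carrierI:
  assumes "graded_right_module A M" "\<And>x. x \<in> carrier M \<Longrightarrow> x = \<zero>\<^bsub>M\<^esub>"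
  shows "M \<in> zero_modules A"
proof -
  have "carrier M = {\<zero>\<^bsub>M\<^esub>}" using assms(2) gr_zero_closed[OF assms(1)] by blast
  with assms(1) show ?thesis by (simp add: zero_modules_def)
qed

lemma is_zero_object_iff: "is_zero_object (Gr_cat A) Z \<longleftrightarrow> Z \<in> zero_modules A"
proof
  assume z: "is_zero_object (Gr_cat A) Z"
  then have Z: "graded_right_module A Z" by (simp add: is_zero_object_def)
  then have "\<exists>!f. f \<in> chom (Gr_cat A) Z Z" using z unfolding is_zero_object_def by auto
  then have eq: "zero_map Z Z = (\<lambda>x \<in> carrier Z. x)" using zero_map_hom[OF Z Z] id_hom[OF Z] by blast
  show "Z \<in> zero_modules A"
  proof (rule zero_modules_carrierI[OF Z])
    fix x assume "x \<in> carrier Z" then show "x = \<zero>\<^bsub>Z\<^esub>" using fun_cong[OF eq, of x] by (simp add: zero_map_def)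
  qed
next
  assume "Z \<in> zero_modules A"
  then have Z: "graded_right_module A Z" and c: "carrier Z = {\<zero>\<^bsub>Z\<^esub>}" by (auto simp: zero_modules_def)
  have "(\<exists>!f. f \<in> chom (Gr_cat A) X Z) \<and> (\<exists>!f. f \<in> chom (Gr_cat A) Z X)"
    if "X \<in> cobj (Gr_cat A)" for X
  proof -
    have X: "graded_right_module A X" using that by simp
    have "f = g" if "f \<in> chom (Gr_cat A) X Z" "g \<in> chom (Gr_cat A) X Z" for f g
      using gr_hom_closed[OF that(1)] gr_hom_closed[OF that(2)] c by (intro gr_hom_eqI[OF that]) auto
    moreover have "f = g" if "f \<in> chom (Gr_cat A) Z X" "g \<in> chom (Gr_cat A) Z X" for f g
      using gr_hom_zero[OF Z X that(1)] gr_hom_zero[OF Z X that(2)] c by (intro gr_hom_eqI[OF that]) auto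
    ultimately show ?thesis using zero_map_hom[OF X Z] zero_map_hom[OF Z X] by blast
  qed
  then show "is_zero_object (Gr_cat A) Z" using Z by (simp add: is_zero_object_def del: Gr_cat_simps(2))
qed

text \<open>This turns the categorical vanishing in the definitions of kernel and cokernel into
  vanishing on elements.\<close>

lemma is_zero_morphism_iff:
  fixes A :: "('k, 'a) galgebra" and X Y :: "('a, 'u) grmodule"
  assumes A: "ring A" and X: "graded_right_module A X" and Y: "graded_right_module A Y"
  shows "is_zero_morphism (Gr_cat A) X Y f \<longleftrightarrow> f = zero_map X Y"
proof
  assume "is_zero_morphism (Gr_cat A) X Y f"
  then obtain Z a b where Z: "Z \<in> zero_modules A" and a: "a \<in> chom (Gr_cat A) X Z" and b: "b \<in> chom (Gr_cat A) Z Y"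
    and f: "f = compose (carrier X) b a"
    by (auto simp: is_zero_morphism_def is_zero_object_iff simp del: Gr_cat_simps(2))
  have Z': "graded_right_module A Z" "carrier Z = {\<zero>\<^bsub>Z\<^esub>}" using Z by (auto simp: zero_modules_def)
  show "f = zero_map X Y"
    using gr_hom_closed[OF a] gr_hom_zero[OF Z'(1) Y b] Z'(2) by (auto simp: f zero_map_def compose_def fun_eq_iff)
next
  let ?Z = "zero_grmodule :: ('a, 'u) grmodule"
  have Z: "?Z \<in> zero_modules A" by (rule zero_grmodule_in_zero_modules[OF A])
  then have Z': "graded_right_module A ?Z" by (auto simp: zero_modules_def)
  have "zero_map X Y = compose (carrier X) (zero_map ?Z Y) (zero_map X ?Z)"
    using gr_zero_closed[OF Z'] by (auto simp: zero_map_def compose_def fun_eq_iff)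
  then show "is_zero_morphism (Gr_cat A) X Y f" if "f = zero_map X Y"
    using that Z zero_map_hom[OF X Z'] zero_map_hom[OF Z' Y]
    by (auto simp: is_zero_morphism_def is_zero_object_iff simp del: Gr_cat_simps(2))
qed

text \<open>A module is zero once its identity equals its zero map. For subobjects, quotients and
  coproducts this equality comes from cancellation or from uniqueness of induced maps, and for
  extensions the identity is factored through a zero module.\<close>

lemma is_localizing_zero_modules:
  fixes A :: "('k, 'a) galgebra"
  assumes A: "ring A" shows "is_localizing (Gr_cat A) (zero_modules A :: ('a, 'u) grmodule set)"
  unfolding is_localizing_def
proof (intro conjI ballI allI impI)
  let ?Z = "zero_modules A :: ('a, 'u) grmodule set"
  have gr: "graded_right_module A M" and zero: "x = \<zero>\<^bsub>M\<^esub>" if "M \<in> ?Z" "x \<in> carrier M" for M x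
    using that by (auto simp: zero_modules_def)
  have gr: "graded_right_module A M" if "M \<in> ?Z" for M using that by (simp add: zero_modules_def)
  show "?Z \<subseteq> cobj (Gr_cat A)" using gr by auto
  have zero_if: "X \<in> ?Z" if X: "graded_right_module A X" and eq: "(\<lambda>x \<in> carrier X. x) = zero_map X X" for X
  proof (rule zero_modules_carrierI[OF X])
    fix x assume "x \<in> carrier X" then show "x = \<zero>\<^bsub>X\<^esub>" using fun_cong[OF eq, of x] by (simp add: zero_map_def)
  qed
  {
    fix X Y f assume "X \<in> cobj (Gr_cat A)" and Y: "Y \<in> ?Z" and m: "is_mono (Gr_cat A) X Y f"
    then have X: "graded_right_module A X" by simp
    have f: "f \<in> chom (Gr_cat A) X Y" using m by (simp add: is_mono_def)
    have "ccomp (Gr_cat A) X X Y f (\<lambda>x \<in> carrier X. x) = ccomp (Gr_cat A) X X Y f (zero_map X X)"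
      using zero[OF Y gr_hom_closed[OF f]] gr_zero_closed[OF X] by (auto simp: compose_def zero_map_def fun_eq_iff)
    then have "(\<lambda>x \<in> carrier X. x) = zero_map X X"
      using m X id_hom[OF X] zero_map_hom[OF X X] unfolding is_mono_def by (simp del: Gr_cat_simps(2,4))
    then show "X \<in> ?Z" by (rule zero_if[OF X])
  next
    fix X Y f assume X: "X \<in> ?Z" and "Y \<in> cobj (Gr_cat A)" and e: "is_epi (Gr_cat A) X Y f"
    then have Y: "graded_right_module A Y" by simp
    have f: "f \<in> chom (Gr_cat A) X Y" using e by (simp add: is_epi_def)
    have "f x = \<zero>\<^bsub>Y\<^esub>" if "x \<in> carrier X" for x
      using zero[OF X that] gr_hom_zero[OF gr[OF X] Y f] by simp
    then have "ccomp (Gr_cat A) X Y Y (\<lambda>x \<in> carrier Y. x) f = ccomp (Gr_cat A) X Y Y (zero_map Y Y) f"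
      using gr_zero_closed[OF Y] by (auto simp: compose_def zero_map_def fun_eq_iff)
    then have "(\<lambda>x \<in> carrier Y. x) = zero_map Y Y"
      using e Y id_hom[OF Y] zero_map_hom[OF Y Y] unfolding is_epi_def by (simp del: Gr_cat_simps(2,4))
    then show "Y \<in> ?Z" by (rule zero_if[OF Y])
  next
    fix X Y Z f g assume X: "X \<in> ?Z" and "Y \<in> cobj (Gr_cat A)" and Z: "Z \<in> ?Z"
      and s: "is_short_exact (Gr_cat A) X Y Z f g"
    then have Y: "graded_right_module A Y" and f: "f \<in> chom (Gr_cat A) X Y" and g: "g \<in> chom (Gr_cat A) Y Z"
      by (auto simp: is_short_exact_def is_kernel_def is_cokernel_def)
    \<comment> \<open>Since \<open>Z\<close> is zero, \<open>g\<close> kills the identity of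
      \<open>Y\<close>, which therefore factors through the kernel \<open>X\<close>, and
      \<open>X\<close> is zero as well.\<close>
    have "compose (carrier Y) g (\<lambda>x \<in> carrier Y. x) = zero_map Y Z"
      using zero[OF Z gr_hom_closed[OF g]] by (auto simp: compose_def zero_map_def fun_eq_iff)
    then have "is_zero_morphism (Gr_cat A) Y Z (ccomp (Gr_cat A) Y Y Z g (\<lambda>x \<in> carrier Y. x))"
      using is_zero_morphism_iff[OF A Y gr[OF Z]] by simp
    then have "\<exists>!b. b \<in> chom (Gr_cat A) Y X \<and> ccomp (Gr_cat A) Y X Y f b = (\<lambda>x \<in> carrier Y. x)"
      using s Y id_hom[OF Y] unfolding is_short_exact_def is_kernel_def by (simp del: Gr_cat_simps(2,4))
    then obtain b where b: "b \<in> chom (Gr_cat A) Y X" and fb: "compose (carrier Y) f b = (\<lambda>x \<in> carrier Y. x)"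
      by (auto simp del: Gr_cat_simps(2))
    show "Y \<in> ?Z"
    proof (rule zero_modules_carrierI[OF Y])
      fix y assume y: "y \<in> carrier Y"
      have "f (b y) = y" using fun_cong[OF fb, of y] y by (simp add: compose_eq)
      then show "y = \<zero>\<^bsub>Y\<^esub>"
        using zero[OF X gr_hom_closed[OF b y]] gr_hom_zero[OF gr[OF X] Y f] by simp
    qed
  next
    fix J :: "('a, 'u) grmodule set" and F X i
    assume "(\<forall>j \<in> J. F j \<in> ?Z) \<and> is_coproduct (Gr_cat A) J F X i"
    then have F: "\<And>j. j \<in> J \<Longrightarrow> F j \<in> ?Z" and c: "is_coproduct (Gr_cat A) J F X i" by auto
    have X: "graded_right_module A X" and i: "\<And>j. j \<in> J \<Longrightarrow> i j \<in> chom (Gr_cat A) (F j) X"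
      using c by (auto simp: is_coproduct_def)
    have iz: "i j x = \<zero>\<^bsub>X\<^esub>" if "j \<in> J" "x \<in> carrier (F j)" for j x
      using zero[OF F that(2)] gr_hom_zero[OF gr[OF F] X i] that(1) by simp
    \<comment> \<open>All the maps \<open>i j\<close> are zero, so both the identity and the zero
      map of \<open>X\<close> solve the extension problem posed by the family \<open>i\<close>, and
      the solution is unique.\<close>
    have "\<exists>!b. b \<in> chom (Gr_cat A) X X \<and> (\<forall>j \<in> J. ccomp (Gr_cat A) (F j) X X b (i j) = i j)"
      using c i X unfolding is_coproduct_def by simp
    moreover have "(\<lambda>x \<in> carrier X. x) \<in> chom (Gr_cat A) X X \<and>
        (\<forall>j \<in> J. ccomp (Gr_cat A) (F j) X X (\<lambda>x \<in> carrier X. x) (i j) = i j)"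
      using id_hom[OF X] category.id_left[OF category_Gr_cat[of A], of _ X] i gr[OF F] X
      by (simp del: Gr_cat_simps(2,4))
    moreover have "ccomp (Gr_cat A) (F j) X X (zero_map X X) (i j) = i j" if j: "j \<in> J" for j
    proof
      fix x
      have u: "i j x = undefined" if "x \<notin> carrier (F j)" using i[OF j] rmodule_hom_undefined[OF _ that] by auto
      show "ccomp (Gr_cat A) (F j) X X (zero_map X X) (i j) x = i j x"
        using iz[OF j] u gr_zero_closed[OF X] by (cases "x \<in> carrier (F j)") (auto simp: zero_map_def compose_def)
    qed
    ultimately have "(\<lambda>x \<in> carrier X. x) = zero_map X X" using zero_map_hom[OF X X] by blast
    then show "X \<in> ?Z" by (rule zero_if[OF X])
  }
qed

section \<open>Torsion modules and inverted morphisms over a strongly graded ring\<close>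

context strongly_graded
begin

text \<open>In \<open>1 = \<Sum> x y\<close> with \<open>x\<close> of degree 1 each summand is
  \<open>1 x y\<close>, one of the generators of the ideal.\<close>

lemma one_in_ideal_I: "\<one>\<^bsub>A\<^esub> \<in> ideal_I A"
proof -
  have "\<one>\<^bsub>A\<^esub> \<in> homog_span A 1" by (rule homog_span_one)
  moreover have "homog_span A 1 \<subseteq> ideal_I A"
    unfolding homog_span_def ideal_I_def
  proof (rule group.mono_generate[OF R.a_group], rule subsetI)
    fix z assume "z \<in> {x \<otimes>\<^bsub>A\<^esub> y |x y. x \<in> homog A 1 \<and> y \<in> homog A (- 1)}"
    then obtain x y where xy: "x \<in> homog A 1" "y \<in> homog A (- 1)" "z = x \<otimes>\<^bsub>A\<^esub> y" by blast
    then have "z = \<one>\<^bsub>A\<^esub> \<otimes>\<^bsub>A\<^esub> x \<otimes>\<^bsub>A\<^esub> y" by (simp add: D_carrier)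
    moreover have "x \<in> nonzero_degree_part A"
      unfolding nonzero_degree_part_def using xy(1) by (intro generate.incl) auto
    ultimately show "z \<in> {a \<otimes>\<^bsub>A\<^esub> x \<otimes>\<^bsub>A\<^esub> b |a x b. a \<in> carrier A \<and> x \<in> nonzero_degree_part A \<and> b \<in> carrier A}"
      using xy(2) D_carrier by blast
  qed
  ultimately show ?thesis by blast
qed

text \<open>A module killed by the ideal is killed by the unit, hence zero, and the zero modules are
  themselves localizing. In the other direction every zero module is killed by the ideal, so it
  belongs to each of the subcategories that are intersected.\<close>

lemma Tors_eq: "Tors A = (zero_modules A :: ('a, 'u) grmodule set)"
proof
  have ann: "M \<in> zero_modules A"
    if "M \<in> cobj (Gr_cat A)" "\<forall>x \<in> carrier M. \<forall>a \<in> ideal_I A. ract M x a = \<zero>\<^bsub>M\<^esub>" for M :: "('a, 'u) grmodule"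
  proof (rule zero_modules_carrierI)
    show M: "graded_right_module A M" using that by simp
    interpret M: graded_right_module A M by (rule M)
    fix x assume x: "x \<in> carrier M"
    then show "x = \<zero>\<^bsub>M\<^esub>" using that(2) one_in_ideal_I M.ract_one[OF x] by auto
  qed
  have "{M \<in> cobj (Gr_cat A). \<forall>x \<in> carrier M. \<forall>a \<in> ideal_I A. ract M x a = \<zero>\<^bsub>M\<^esub>}
      \<subseteq> (zero_modules A :: ('a, 'u) grmodule set)"
    using ann by blast
  then show "(Tors A :: ('a, 'u) grmodule set) \<subseteq> zero_modules A"
    unfolding Tors_def using is_localizing_zero_modules[OF R.ring_axioms] by (intro Inter_lower) blast
  have "M \<in> {M \<in> cobj (Gr_cat A). \<forall>x \<in> carrier M. \<forall>a \<in> ideal_I A. ract M x a = \<zero>\<^bsub>M\<^esub>}"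
    if "M \<in> zero_modules A" for M :: "('a, 'u) grmodule"
  proof -
    have M: "graded_right_module A M" and c: "carrier M = {\<zero>\<^bsub>M\<^esub>}" using that by (auto simp: zero_modules_def)
    interpret M: graded_right_module A M by (rule M)
    have sub: "(\<Union>n \<in> - {0}. homog A n) \<subseteq> carrier (add_monoid A)" using D_carrier by auto
    have nz: "nonzero_degree_part A \<subseteq> carrier A"
      unfolding nonzero_degree_part_def using group.generate_incl[OF R.a_group sub] by simp
    have sub': "{a \<otimes>\<^bsub>A\<^esub> x \<otimes>\<^bsub>A\<^esub> b |a x b. a \<in> carrier A \<and> x \<in> nonzero_degree_part A \<and> b \<in> carrier A} \<subseteq> carrier (add_monoid A)"
      using nz by auto
    have "ideal_I A \<subseteq> carrier A"
      unfolding ideal_I_def using group.generate_incl[OF R.a_group sub'] by simp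
    then have "ract M x a = \<zero>\<^bsub>M\<^esub>" if "x \<in> carrier M" "a \<in> ideal_I A" for x a
      using M.ract_closed[of x a] that c by auto
    then show ?thesis using M by simp
  qed
  then show "(zero_modules A :: ('a, 'u) grmodule set) \<subseteq> Tors A" unfolding Tors_def by blast
qed

lemma Gr_iso_bij:
  assumes X: "graded_right_module A X" and Y: "graded_right_module A Y"
    and f: "is_isomorphism (Gr_cat A) X Y f"
  shows "bij_betw f (carrier X) (carrier Y)"
proof -
  have fh: "f \<in> chom (Gr_cat A) X Y" using f by (simp add: is_isomorphism_def)
  obtain g where g: "g \<in> chom (Gr_cat A) Y X" "ccomp (Gr_cat A) X Y X g f = cid (Gr_cat A) X"
    "ccomp (Gr_cat A) Y X Y f g = cid (Gr_cat A) Y" using f unfolding is_isomorphism_def by blast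
  have "g (f x) = x" if "x \<in> carrier X" for x using fun_cong[OF g(2), of x] that by (simp add: compose_eq)
  moreover have "f (g y) = y" if "y \<in> carrier Y" for y using fun_cong[OF g(3), of y] that by (simp add: compose_eq)
  ultimately show ?thesis
    using gr_hom_closed[OF fh] gr_hom_closed[OF g(1)] by (intro bij_betw_byWitness[where f' = g]) auto
qed

text \<open>The zero module serves both as kernel and as cokernel. A map into \<open>X\<close>
  killed by \<open>f\<close> vanishes because \<open>f\<close> is injective, and a map out of
  \<open>Y\<close> that kills the image of \<open>f\<close> vanishes because \<open>f\<close> is
  onto.\<close>

lemma iso_inverted:
  fixes X Y :: "('a, 'u) grmodule"
  assumes X: "graded_right_module A X" and Y: "graded_right_module A Y"
    and f: "is_isomorphism (Gr_cat A) X Y f"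
  shows "f \<in> inverted_morphisms (Gr_cat A) (zero_modules A) X Y"
proof -
  let ?Z = "zero_grmodule :: ('a, 'u) grmodule"
  note bij = Gr_iso_bij[OF assms]
  have fh: "f \<in> chom (Gr_cat A) X Y" using f by (simp add: is_isomorphism_def)
  have Zz: "?Z \<in> zero_modules A" by (rule zero_grmodule_in_zero_modules[OF R.ring_axioms])
  then have Z: "graded_right_module A ?Z" by (simp add: zero_modules_def)
  note zm = is_zero_morphism_iff[OF R.ring_axioms]
  have uniq_to: "\<exists>!f. f \<in> chom (Gr_cat A) W ?Z" and uniq_from: "\<exists>!f. f \<in> chom (Gr_cat A) ?Z W"
    if "graded_right_module A W" for W
    using that Zz is_zero_object_iff[of A ?Z] by (auto simp: is_zero_object_def simp del: Gr_cat_simps(2))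
  note [simp del] = Gr_cat_simps(2)
  have "is_kernel (Gr_cat A) ?Z X Y (zero_map ?Z X) f"
    unfolding is_kernel_def
  proof (intro conjI ballI impI)
    show "?Z \<in> cobj (Gr_cat A)" "zero_map ?Z X \<in> chom (Gr_cat A) ?Z X" using Z zero_map_hom[OF Z X] by simp_all
    show "is_zero_morphism (Gr_cat A) ?Z Y (ccomp (Gr_cat A) ?Z X Y f (zero_map ?Z X))"
      using zm[OF Z Y] gr_hom_zero[OF X Y fh] by (simp add: zero_map_def compose_def fun_eq_iff)
    fix W a assume "W \<in> cobj (Gr_cat A)" and a: "a \<in> chom (Gr_cat A) W X"
      and "is_zero_morphism (Gr_cat A) W Y (ccomp (Gr_cat A) W X Y f a)"
    then have W: "graded_right_module A W" and fa: "compose (carrier W) f a = zero_map W Y" using zm Y by auto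
    have "a w = \<zero>\<^bsub>X\<^esub>" if w: "w \<in> carrier W" for w
    proof (rule inj_onD[of f "carrier X"])
      show "f (a w) = f \<zero>\<^bsub>X\<^esub>"
        using fun_cong[OF fa, of w] w gr_hom_zero[OF X Y fh] by (simp add: compose_eq zero_map_def)
    qed (use bij gr_hom_closed[OF a w] gr_zero_closed[OF X] in \<open>auto simp: bij_betw_def\<close>)
    moreover have cc: "ccomp (Gr_cat A) W ?Z X (zero_map ?Z X) (zero_map W ?Z) \<in> chom (Gr_cat A) W X"
      by (rule category.comp_closed[OF category_Gr_cat]) (use W X Z zero_map_hom in simp_all)
    ultimately have "ccomp (Gr_cat A) W ?Z X (zero_map ?Z X) (zero_map W ?Z) = a"
      using gr_zero_closed[OF Z] by (intro gr_hom_eqI[OF cc a]) (simp add: zero_map_def compose_eq)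
    then show "\<exists>!b. b \<in> chom (Gr_cat A) W ?Z \<and> ccomp (Gr_cat A) W ?Z X (zero_map ?Z X) b = a"
      using uniq_to[OF W] zero_map_hom[OF W Z] by blast
  qed
  moreover have "is_cokernel (Gr_cat A) X Y ?Z f (zero_map Y ?Z)"
    unfolding is_cokernel_def
  proof (intro conjI ballI impI)
    show "?Z \<in> cobj (Gr_cat A)" "zero_map Y ?Z \<in> chom (Gr_cat A) Y ?Z" using Z zero_map_hom[OF Y Z] by simp_all
    show "is_zero_morphism (Gr_cat A) X ?Z (ccomp (Gr_cat A) X Y ?Z (zero_map Y ?Z) f)"
      using zm[OF X Z] gr_hom_closed[OF fh] by (simp add: zero_map_def compose_def fun_eq_iff)
    fix W a assume "W \<in> cobj (Gr_cat A)" and a: "a \<in> chom (Gr_cat A) Y W"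
      and "is_zero_morphism (Gr_cat A) X W (ccomp (Gr_cat A) X Y W a f)"
    then have W: "graded_right_module A W" and af: "compose (carrier X) a f = zero_map X W" using zm X by auto
    have az: "a y = \<zero>\<^bsub>W\<^esub>" if y: "y \<in> carrier Y" for y
    proof -
      obtain x where "x \<in> carrier X" "y = f x" using y bij by (auto simp: bij_betw_def)
      then show ?thesis using fun_cong[OF af, of x] by (simp add: compose_eq zero_map_def)
    qed
    have cc: "ccomp (Gr_cat A) Y ?Z W (zero_map ?Z W) (zero_map Y ?Z) \<in> chom (Gr_cat A) Y W"
      by (rule category.comp_closed[OF category_Gr_cat]) (use W Y Z zero_map_hom in simp_all)
    have "ccomp (Gr_cat A) Y ?Z W (zero_map ?Z W) (zero_map Y ?Z) = a"
      using gr_zero_closed[OF Z] az by (intro gr_hom_eqI[OF cc a]) (simp add: zero_map_def compose_eq)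
    then show "\<exists>!b. b \<in> chom (Gr_cat A) ?Z W \<and> ccomp (Gr_cat A) Y ?Z W b (zero_map Y ?Z) = a"
      using uniq_from[OF W] zero_map_hom[OF Z W] by blast
  qed
  ultimately show ?thesis using fh Zz unfolding inverted_morphisms_def by blast
qed

text \<open>That the kernel and cokernel are zero is information about graded test maps only. Since
  every \<open>A_0\<close>-module is the degree-zero part of a graded module and every
  \<open>A_0\<close>-linear map extends, this information suffices to test the degree-zero part of
  \<open>f\<close> for injectivity and surjectivity. The fully faithful functor then reflects the
  resulting isomorphism.\<close>

lemma inverted_iso:
  fixes X :: "('a, 'u) grmodule"
  assumes U: "infinite (UNIV :: 'u set)" and small: "carrier A \<lesssim> (UNIV :: 'u set)"
    and X: "graded_right_module A X" and Y: "graded_right_module A Y"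
    and f: "f \<in> inverted_morphisms (Gr_cat A) (zero_modules A) X Y"
  shows "is_isomorphism (Gr_cat A) X Y f"
proof -
  interpret F: fully_faithful "Gr_cat A" "Mod_cat (degree_zero A)" degree_part_functor
    by (rule fully_faithful_degree_part)
  have fh: "f \<in> chom (Gr_cat A) X Y" using f by (simp add: inverted_morphisms_def)
  obtain N k Q q where N: "N \<in> zero_modules A" "is_kernel (Gr_cat A) N X Y k f"
    and Q: "Q \<in> zero_modules A" "is_cokernel (Gr_cat A) X Y Q f q"
    using f unfolding inverted_morphisms_def by blast
  note zm = is_zero_morphism_iff[OF R.ring_axioms]
  let ?f = "restrict f (mhomog X 0)"
  interpret X: graded_right_module A X by (rule X)
  interpret Y: graded_right_module A Y by (rule Y)
  have f0: "?f \<in> rmodule_hom (degree_zero A) (degree_part X) (degree_part Y)"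
    by (rule degree_part_hom[OF X fh])
  \<comment> \<open>A graded map killed by \<open>f\<close> factors through the kernel
    \<open>N\<close>, which has only the element zero.\<close>
  have ker: "a w = \<zero>\<^bsub>X\<^esub>" if W: "graded_right_module A W" and a: "a \<in> chom (Gr_cat A) W X"
    and fa: "compose (carrier W) f a = zero_map W Y" and w: "w \<in> carrier W" for W a w
  proof -
    have N': "graded_right_module A N" "carrier N = {\<zero>\<^bsub>N\<^esub>}" using N by (auto simp: zero_modules_def)
    have "\<exists>!b. b \<in> chom (Gr_cat A) W N \<and> ccomp (Gr_cat A) W N X k b = a"
      using N(2) W a zm[OF W Y] fa unfolding is_kernel_def by (simp del: Gr_cat_simps(2))
    then obtain b where b: "b \<in> chom (Gr_cat A) W N" "compose (carrier W) k b = a"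
      by (auto simp del: Gr_cat_simps(2))
    have k: "k \<in> chom (Gr_cat A) N X" using N(2) by (simp add: is_kernel_def)
    show ?thesis
      using b(2) w gr_hom_closed[OF b(1) w] N'(2) gr_hom_zero[OF N'(1) X k] by (auto simp: compose_eq)
  qed
  have cok: "a y = \<zero>\<^bsub>W\<^esub>" if W: "graded_right_module A W" and a: "a \<in> chom (Gr_cat A) Y W"
    and af: "compose (carrier X) a f = zero_map X W" and y: "y \<in> carrier Y" for W a y
  proof -
    have Q': "graded_right_module A Q" "carrier Q = {\<zero>\<^bsub>Q\<^esub>}" using Q by (auto simp: zero_modules_def)
    have "\<exists>!b. b \<in> chom (Gr_cat A) Q W \<and> ccomp (Gr_cat A) Y Q W b q = a"
      using Q(2) W a zm[OF X W] af unfolding is_cokernel_def by (simp del: Gr_cat_simps(2))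
    then obtain b where b: "b \<in> chom (Gr_cat A) Q W" "compose (carrier Y) b q = a"
      by (auto simp del: Gr_cat_simps(2))
    have q: "q \<in> chom (Gr_cat A) Y Q" using Q(2) by (simp add: is_cokernel_def)
    show ?thesis
      using b(2) y gr_hom_closed[OF q y] Q'(2) gr_hom_zero[OF Q'(1) W b(1)] by (auto simp: compose_eq)
  qed
  have iso_bij: "e ` mhomog M 0 = carrier W"
    if iso: "is_isomorphism (Mod_cat (degree_zero A)) (degree_part M) W e" for M :: "('a, 'u) grmodule" and W e
  proof -
    obtain g where e: "e \<in> rmodule_hom (degree_zero A) (degree_part M) W" and g: "g \<in> rmodule_hom (degree_zero A) W (degree_part M)"
      and eg: "compose (carrier W) e g = (\<lambda>x \<in> carrier W. x)"
      using iso unfolding is_isomorphism_def by auto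
    have "w = e (g w)" "g w \<in> mhomog M 0" if "w \<in> carrier W" for w
      using fun_cong[OF eg, of w] rmodule_hom_closed[OF g] that by (simp_all add: compose_eq)
    then show ?thesis using rmodule_hom_closed[OF e] by auto
  qed
  have inj: "inj_on ?f (mhomog X 0)"
  proof (rule rmodule_hom_injI[OF right_module_degree_part[OF X] right_module_degree_part[OF Y] f0, unfolded degree_part_simps])
    fix W a assume W: "right_module (degree_zero A) (W :: ('a, 'u) rmodule)"
      and a: "a \<in> rmodule_hom (degree_zero A) W (degree_part X)"
      and z: "\<And>x. x \<in> carrier W \<Longrightarrow> ?f (a x) = \<zero>\<^bsub>Y\<^esub>"
    \<comment> \<open>The test module \<open>W\<close> is replaced by the degree-zero part of a
      graded module \<open>M\<close>, and the test map, read on \<open>M\<close>, is extended to a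
      graded map \<open>b\<close> to which \<open>ker\<close> can be applied.\<close>
    obtain M e where M: "graded_right_module A M" and e: "is_isomorphism (Mod_cat (degree_zero A)) (degree_part M) W e"
      using degree_part_surj[OF W U small] by (auto simp: isomorphic_in_def)
    interpret M: graded_right_module A M by (rule M)
    have eh: "e \<in> rmodule_hom (degree_zero A) (degree_part M) W" using e by (simp add: is_isomorphism_def)
    have ae: "compose (mhomog M 0) a e \<in> rmodule_hom (degree_zero A) (degree_part M) (degree_part X)"
      using rmodule_hom_compose[OF right_module_degree_part[OF M] eh a] by simp
    then obtain b where b: "b \<in> chom (Gr_cat A) M X" and be: "restrict b (mhomog M 0) = compose (mhomog M 0) a e"
      using degree_part_full[OF M X ae] by blast
    have bae: "b w = a (e w)" if "w \<in> mhomog M 0" for w using fun_cong[OF be, of w] that by (simp add: compose_eq)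
    \<comment> \<open>Vanishing of \<open>f b\<close> is known in degree 0 and spreads to all
      degrees by faithfulness.\<close>
    have "compose (carrier M) f b = zero_map M Y"
    proof (rule degree_part_faithful[OF M Y])
      show "compose (carrier M) f b \<in> chom (Gr_cat A) M Y"
        using category.comp_closed[OF category_Gr_cat[of A], of M X Y b f] M X Y b fh by (simp del: Gr_cat_simps(2))
      show "compose (carrier M) f b w = zero_map M Y w" if w: "w \<in> mhomog M 0" for w
      proof -
        have ew: "e w \<in> carrier W" using rmodule_hom_closed[OF eh] w by simp
        have "a (e w) \<in> mhomog X 0" using rmodule_hom_closed[OF a ew] by simp
        then show ?thesis using z[OF ew] bae[OF w] M.G.D_carrier[OF w] by (simp add: compose_eq zero_map_def)
      qed
    qed (rule zero_map_hom[OF M Y])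
    note bz = ker[OF M b this]
    show "\<forall>x \<in> carrier W. a x = \<zero>\<^bsub>X\<^esub>"
    proof
      fix x assume "x \<in> carrier W"
      then obtain w where w: "w \<in> mhomog M 0" "x = e w" using iso_bij[OF e] by blast
      then show "a x = \<zero>\<^bsub>X\<^esub>" using bz[OF M.G.D_carrier[OF w(1)]] bae[OF w(1)] by simp
    qed
  qed
  have surj: "?f ` mhomog X 0 = mhomog Y 0"
  proof (rule rmodule_hom_surjI[OF right_module_degree_part[OF X] right_module_degree_part[OF Y] f0, unfolded degree_part_simps])
    fix W a assume W: "right_module (degree_zero A) (W :: ('a, 'u) rmodule)"
      and a: "a \<in> rmodule_hom (degree_zero A) (degree_part Y) W"
      and z: "\<And>x. x \<in> mhomog X 0 \<Longrightarrow> a (?f x) = \<zero>\<^bsub>W\<^esub>"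
    obtain M where M: "graded_right_module A M" and "isomorphic_in (Mod_cat (degree_zero A)) (degree_part M) W"
      using degree_part_surj[OF W U small] by blast
    \<comment> \<open>The isomorphism is reversed in comparison with the injective case: the test
      map now ends in \<open>W\<close> and has to be continued into the degree-zero part of
      \<open>M\<close>.\<close>
    then have "isomorphic_in (Mod_cat (degree_zero A)) W (degree_part M)"
      using category.isomorphic_sym[OF category_Mod_cat[of "degree_zero A"], of "degree_part M" W] W right_module_degree_part[OF M] by simp
    then obtain e where e: "is_isomorphism (Mod_cat (degree_zero A)) W (degree_part M) e" by (auto simp: isomorphic_in_def)
    interpret M: graded_right_module A M by (rule M)
    have eh: "e \<in> rmodule_hom (degree_zero A) W (degree_part M)" using e by (simp add: is_isomorphism_def)
    obtain e' where e': "e' \<in> rmodule_hom (degree_zero A) (degree_part M) W" "compose (carrier W) e' e = (\<lambda>x \<in> carrier W. x)"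
      using e unfolding is_isomorphism_def by auto
    have ea: "compose (mhomog Y 0) e a \<in> rmodule_hom (degree_zero A) (degree_part Y) (degree_part M)"
      using rmodule_hom_compose[OF right_module_degree_part[OF Y] a eh] by simp
    then obtain b where b: "b \<in> chom (Gr_cat A) Y M" and be: "restrict b (mhomog Y 0) = compose (mhomog Y 0) e a"
      using degree_part_full[OF Y M ea] by blast
    have bea: "b y = e (a y)" if "y \<in> mhomog Y 0" for y using fun_cong[OF be, of y] that by (simp add: compose_eq)
    have e0: "e \<zero>\<^bsub>W\<^esub> = \<zero>\<^bsub>M\<^esub>" using rmodule_hom_zero[OF W right_module_degree_part[OF M] eh] by simp
    have e'0: "e' \<zero>\<^bsub>M\<^esub> = \<zero>\<^bsub>W\<^esub>" using rmodule_hom_zero[OF right_module_degree_part[OF M] W e'(1)] by simp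
    have "compose (carrier X) b f = zero_map X M"
    proof (rule degree_part_faithful[OF X M])
      show "compose (carrier X) b f \<in> chom (Gr_cat A) X M"
        using category.comp_closed[OF category_Gr_cat[of A], of X Y M f b] M X Y b fh by (simp del: Gr_cat_simps(2))
      show "compose (carrier X) b f x = zero_map X M x" if x: "x \<in> mhomog X 0" for x
      proof -
        have "f x \<in> mhomog Y 0" using fh x by auto
        then show ?thesis using z[OF x] x bea[of "f x"] X.G.D_carrier[OF x] e0 by (simp add: compose_eq zero_map_def)
      qed
    qed (rule zero_map_hom[OF X M])
    note bz = cok[OF M b this]
    show "\<forall>y \<in> mhomog Y 0. a y = \<zero>\<^bsub>W\<^esub>"
    proof
      fix y assume y: "y \<in> mhomog Y 0"
      have "a y \<in> carrier W" using rmodule_hom_closed[OF a] y by simp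
      then have "e' (e (a y)) = a y" using fun_cong[OF e'(2), of "a y"] by (simp add: compose_eq)
      then show "a y = \<zero>\<^bsub>W\<^esub>" using bz[OF Y.G.D_carrier[OF y]] bea[OF y] e'0 by simp
    qed
  qed
  have "is_isomorphism (Mod_cat (degree_zero A)) (degree_part X) (degree_part Y) ?f"
    by (rule Mod_cat_isoI[OF right_module_degree_part[OF X] f0]) (use inj surj in \<open>simp add: bij_betw_def\<close>)
  then show ?thesis using F.reflects_iso[of X Y f] X Y fh by simp
qed

lemma iso_quotient_Tors:
  assumes "infinite (UNIV :: 'u set)" "carrier A \<lesssim> (UNIV :: 'u set)"
  shows "iso_quotient (Gr_cat A :: (('a, 'u) grmodule, 'u \<Rightarrow> 'u) cat) (Tors A)"
  unfolding iso_quotient_def iso_quotient_axioms_def Tors_eq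
  using iso_inverted inverted_iso[OF assms] by (auto simp: category_Gr_cat simp del: Gr_cat_simps(2))

lemma is_equivalence_degree_part:
  assumes "infinite (UNIV :: 'u set)" "carrier A \<lesssim> (UNIV :: 'u set)"
  shows "is_equivalence (Gr_cat A :: (('a, 'u) grmodule, 'u \<Rightarrow> 'u) cat) (Mod_cat (degree_zero A)) degree_part_functor"
proof -
  interpret F: fully_faithful "Gr_cat A :: (('a, 'u) grmodule, 'u \<Rightarrow> 'u) cat" "Mod_cat (degree_zero A)" degree_part_functor
    by (rule fully_faithful_degree_part)
  show ?thesis
    by (rule F.is_equivalence) (use degree_part_surj[OF _ assms] in auto)
qed

end

section \<open>The shift functor and the regular module\<close>

lemma shift_functor_simps [simp]:
  "fobj shift_functor M = M\<lparr>mhomog := (\<lambda>n. mhomog M (n + 1))\<rparr>" "fmap shift_functor M N f = f"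
  by (simp_all add: shift_functor_def)

lemma graded_right_module_shift:
  assumes "graded_right_module A M"
  shows "graded_right_module A (M\<lparr>mhomog := (\<lambda>n. mhomog M (n + 1))\<rparr>)" (is "graded_right_module A ?S")
proof (rule graded_right_moduleI)
  interpret M: graded_right_module A M by fact
  have ag: "abelian_group ?S"
    by (rule abelian_groupI) (auto simp: M.M.a_ac intro: M.M.l_neg)
  show "right_module A ?S"
    by (intro right_module.intro right_module_axioms.intro M.R.ring_axioms ag)
      (auto simp: M.ract_closed M.ract_add_left M.ract_add_right M.ract_mult M.ract_one)
  interpret S: abelian_group ?S by (rule ag)
  have inv: "\<ominus>\<^bsub>?S\<^esub> x = \<ominus>\<^bsub>M\<^esub> x" if "x \<in> carrier M" for x
    by (rule S.minus_equality) (use that in \<open>simp_all add: M.M.l_neg\<close>)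
  show "graded_group ?S (mhomog ?S)"
  proof (rule graded_groupI[where p = "\<lambda>n x. component M (mhomog M) x (n + 1)"])
    show "subgroup (mhomog ?S n) (add_monoid ?S)" for n
    proof
      show "inv\<^bsub>add_monoid ?S\<^esub> x \<in> mhomog ?S n" if "x \<in> mhomog ?S n" for x
        using inv[of x] that M.G.D_minus[of x "n + 1"] M.G.D_carrier[of x "n + 1"] by (simp add: a_inv_def)
    qed (auto simp: M.G.D_carrier M.G.D_add M.G.D_zero)
    show "x \<in> generate (add_monoid ?S) (\<Union>n. mhomog ?S n)" if "x \<in> carrier ?S" for x
    proof -
      have "x \<in> carrier M" using that by simp
      then show ?thesis
      proof (induction rule: M.G.graded_induct)
        case (homog n x)
        then have "x \<in> mhomog ?S (n - 1)" by simp
        then show ?case by (intro generate.incl) blast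
      next
        case (add x y) then show ?case using generate.eng[OF add.IH] by simp
      qed
    qed
  qed (auto simp: ag M.G.component_homog M.G.component_add M.G.component_of_homog)
  show "ract ?S x a \<in> mhomog ?S (n + k)" if "x \<in> mhomog ?S n" "a \<in> homog A k" for x a n k
    using M.homog_act[of x "n + 1" a k] that by (simp add: ac_simps)
qed

lemma cat_functor_shift: "cat_functor (Gr_cat A) (Gr_cat A) shift_functor"
proof -
  interpret category "Gr_cat A" by (rule category_Gr_cat)
  show ?thesis
    by unfold_locales (auto simp: graded_right_module_shift rmodule_hom_def)
qed

context strongly_graded
begin

lemma graded_action_regular: "graded_action A (regular_rmodule A) (homog A)"
proof -
  interpret r: right_module A "regular_rmodule A" by (rule right_module_regular[OF R.ring_axioms])
  have [simp]: "carrier (regular_rmodule A) = carrier A" "zero (regular_rmodule A) = zero A"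
    "add (regular_rmodule A) = add A" "ract (regular_rmodule A) = mult A"
    by (simp_all add: regular_rmodule_def)
  have inv: "\<ominus>\<^bsub>regular_rmodule A\<^esub> x = \<ominus>\<^bsub>A\<^esub> x" if "x \<in> carrier A" for x
    by (rule r.M.minus_equality) (use that in \<open>simp_all add: R.l_neg\<close>)
  have "graded_group (regular_rmodule A) (homog A)"
  proof (rule graded_groupI[where p = "\<lambda>n x. component A (homog A) x n"])
    show "subgroup (homog A n) (add_monoid (regular_rmodule A))" for n
    proof
      show "inv\<^bsub>add_monoid (regular_rmodule A)\<^esub> x \<in> homog A n" if "x \<in> homog A n" for x
        using inv[of x] that D_minus[of x n] D_carrier[of x n] by (simp add: a_inv_def)
    qed (auto simp: D_carrier D_add D_zero)
    show "x \<in> generate (add_monoid (regular_rmodule A)) (\<Union>n. homog A n)" if "x \<in> carrier (regular_rmodule A)" for x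
    proof -
      have "x \<in> carrier A" using that by simp
      then show ?thesis
      proof (induction rule: graded_induct)
        case (homog n x) then show ?case by (intro generate.incl) blast
      next
        case (add x y) then show ?case using generate.eng[OF add.IH] by simp
      qed
    qed
  qed (auto simp: r.M.abelian_group_axioms component_homog component_add component_of_homog)
  then show ?thesis
    using D_carrier homog_mult by (intro graded_action.intro graded_action_axioms.intro r.right_module_axioms) auto
qed

lemma graded_right_module_small_regular:
  assumes "carrier A \<lesssim> (UNIV :: 'u set)"
  shows "graded_right_module A (small_regular A :: ('a, 'u) grmodule)"
proof -
  interpret r: graded_action A "regular_rmodule A" "homog A" by (rule graded_action_regular)
  have c: "carrier (regular_rmodule A) = carrier A" by (simp add: regular_rmodule_def)
  then have "inj_on (small_inj (carrier A) :: 'a \<Rightarrow> 'u) (carrier (regular_rmodule A))" using small_inj[OF assms] by simp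
  from r.graded_right_module_copy[OF this] show ?thesis
    by (simp add: small_regular_def small_copy_eq c)
qed

text \<open>
  In the strongly graded case \<open>Tors\<^sub>I(A) = 0\<close>, so that \<open>proj A\<close> is \<open>Gr-A\<close> with its shift.
\<close>

lemma triple_equiv_Gr_proj:
  assumes U: "infinite (UNIV :: 'u set)" "carrier A \<lesssim> (UNIV :: 'u set)"
  shows "triple_equiv (Gr_cat A :: (('a, 'u) grmodule, 'u \<Rightarrow> 'u) cat, small_regular A, shift_functor) (proj TYPE('u) A)"
proof -
  interpret iso_quotient "Gr_cat A :: (('a, 'u) grmodule, 'u \<Rightarrow> 'u) cat" "Tors A"
    by (rule iso_quotient_Tors[OF U])
  show ?thesis
    using triple_equiv_quotient[OF cat_functor_shift, of "small_regular A"] graded_right_module_small_regular[OF U(2)]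
    by (simp add: proj_def QGr_def)
qed

end

section \<open>Tensor products\<close>

locale bimod = R: ring R + S: ring S
  for R :: "('r, 'y) ring_scheme" and S :: "('s, 'z) ring_scheme" +
  fixes B :: "('r, 's, 'b) bimodule"
  assumes add_closed: "\<lbrakk>b \<in> carrier B; c \<in> carrier B\<rbrakk> \<Longrightarrow> b \<oplus>\<^bsub>B\<^esub> c \<in> carrier B"
    and lact_closed: "\<lbrakk>r \<in> carrier R; b \<in> carrier B\<rbrakk> \<Longrightarrow> lact B r b \<in> carrier B"
    and ract_closed: "\<lbrakk>b \<in> carrier B; s \<in> carrier S\<rbrakk> \<Longrightarrow> ract B b s \<in> carrier B"
    and lact_ract: "\<lbrakk>r \<in> carrier R; b \<in> carrier B; s \<in> carrier S\<rbrakk>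
      \<Longrightarrow> lact B r (ract B b s) = ract B (lact B r b) s"
    and ract_add_left: "\<lbrakk>b \<in> carrier B; c \<in> carrier B; s \<in> carrier S\<rbrakk>
      \<Longrightarrow> ract B (b \<oplus>\<^bsub>B\<^esub> c) s = ract B b s \<oplus>\<^bsub>B\<^esub> ract B c s"
    and ract_add_right: "\<lbrakk>b \<in> carrier B; s \<in> carrier S; s' \<in> carrier S\<rbrakk>
      \<Longrightarrow> ract B b (s \<oplus>\<^bsub>S\<^esub> s') = ract B b s \<oplus>\<^bsub>B\<^esub> ract B b s'"
    and ract_mult: "\<lbrakk>b \<in> carrier B; s \<in> carrier S; s' \<in> carrier S\<rbrakk>
      \<Longrightarrow> ract B b (s \<otimes>\<^bsub>S\<^esub> s') = ract B (ract B b s) s'"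
    and ract_one: "b \<in> carrier B \<Longrightarrow> ract B b \<one>\<^bsub>S\<^esub> = b"

locale tensor = bimod R S B + N: right_module R N
  for R :: "('r, 'y) ring_scheme" and S :: "('s, 'z) ring_scheme" and B :: "('r, 's, 'b) bimodule"
    and N :: "('r, 'n) rmodule"
begin

definition F :: "('n \<times> 'b \<Rightarrow>\<^sub>0 int) set" where
  "F = {x. Poly_Mapping.keys x \<subseteq> carrier N \<times> carrier B}"
abbreviation "G \<equiv> tensor_free N B"
abbreviation "K \<equiv> tensor_kernel R N B"
abbreviation "T \<equiv> tensor_product R N B"
abbreviation "cls \<equiv> tensor_class R N B"

definition tens :: "'n \<Rightarrow> 'b \<Rightarrow> ('n \<times> 'b \<Rightarrow>\<^sub>0 int) set" where "tens n b = cls (frag_of (n, b))"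

lemma F_closed [simp]: "0 \<in> F" "x \<in> F \<Longrightarrow> - x \<in> F"
  and F_add: "\<lbrakk>x \<in> F; y \<in> F\<rbrakk> \<Longrightarrow> x + y \<in> F" and F_diff: "\<lbrakk>x \<in> F; y \<in> F\<rbrakk> \<Longrightarrow> x - y \<in> F"
  and F_of: "\<lbrakk>n \<in> carrier N; b \<in> carrier B\<rbrakk> \<Longrightarrow> frag_of (n, b) \<in> F"
  using keys_add[of x y] keys_diff[of x y] by (auto simp: F_def)

lemma carrier_G: "carrier G = F"
  by (auto simp: tensor_free_def F_def)

lemma comm_group_G: "comm_group G"
  by (simp add: tensor_free_def abelian_free_Abelian_group)

lemma relations_F: "tensor_relations R N B \<subseteq> F"
proof
  fix x assume "x \<in> tensor_relations R N B"
  then show "x \<in> F"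
    unfolding tensor_relations_def
    by (elim UnE CollectE exE conjE; hypsubst; intro F_diff F_of; simp add: add_closed lact_closed N.ract_closed)
qed

interpretation G: comm_group G by (rule comm_group_G)

lemma subgroup_K: "subgroup K G"
  unfolding tensor_kernel_def by (rule G.generate_is_subgroup) (simp add: carrier_G relations_F)

lemma normal_K: "K \<lhd> G"
  by (rule G.normal_iff_subgroup[THEN iffD2, OF subgroup_K])

lemma mult_G: "x \<otimes>\<^bsub>G\<^esub> y = x + y" and one_G: "\<one>\<^bsub>G\<^esub> = 0"
  by (simp_all add: tensor_free_def)

lemma inv_G: "x \<in> F \<Longrightarrow> inv\<^bsub>G\<^esub> x = - x"
  by (simp add: tensor_free_def F_def)

lemma K_F: "K \<subseteq> F"
  using subgroup.subset[OF subgroup_K] by (simp add: carrier_G)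

lemma mem_cls: "x \<in> F \<Longrightarrow> x \<in> cls x"
  using G.rcos_self[OF _ subgroup_K, of x] by (simp add: tensor_class_def carrier_G)

lemma cls_eqI:
  assumes x: "x \<in> F" and y: "y \<in> F" and d: "x - y \<in> K" shows "cls x = cls y"
proof -
  have "x \<in> K #>\<^bsub>G\<^esub> y"
    unfolding r_coset_def using d by (auto simp: mult_G intro!: bexI[of _ "x - y"])
  then show ?thesis
    unfolding tensor_class_def using G.repr_independence[OF _ _ subgroup_K, of x y] y by (simp add: carrier_G)
qed

lemma cls_mem:
  assumes y: "y \<in> F" and x: "x \<in> cls y" shows "x \<in> F" "cls x = cls y" "x - y \<in> K"
proof -
  obtain k where k: "k \<in> K" "x = k + y" using x by (auto simp: tensor_class_def r_coset_def mult_G)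
  then show "x - y \<in> K" by simp
  show F: "x \<in> F" using k K_F y F_add by blast
  show "cls x = cls y" by (rule cls_eqI[OF F y]) fact
qed

lemma cls_eqD: "\<lbrakk>x \<in> F; y \<in> F; cls x = cls y\<rbrakk> \<Longrightarrow> x - y \<in> K"
  using mem_cls[of x] cls_mem(3)[of y x] by simp

lemma carrier_T: "carrier T = cls ` F"
  by (auto simp: tensor_product_def Let_def FactGroup_def RCOSETS_def tensor_class_def carrier_G)

lemma add_T: "\<lbrakk>x \<in> F; y \<in> F\<rbrakk> \<Longrightarrow> cls x \<oplus>\<^bsub>T\<^esub> cls y = cls (x + y)"
  using normal.rcos_sum[OF normal_K, of x y]
  by (simp add: tensor_product_def Let_def FactGroup_def tensor_class_def carrier_G mult_G)

lemma zero_T: "\<zero>\<^bsub>T\<^esub> = cls 0"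
  using G.coset_mult_one[of K] K_F
  by (simp add: tensor_product_def Let_def FactGroup_def tensor_class_def one_G carrier_G)

lemma abelian_group_T: "abelian_group T"
proof (rule abelian_groupI)
  show "\<exists>y\<in>carrier T. y \<oplus>\<^bsub>T\<^esub> x = \<zero>\<^bsub>T\<^esub>" if x: "x \<in> carrier T" for x
  proof -
    obtain u where u: "u \<in> F" "x = cls u" using x by (auto simp: carrier_T)
    then show ?thesis
      by (intro bexI[of _ "cls (- u)"]) (simp_all add: add_T zero_T carrier_T)
  qed
qed (auto simp: carrier_T add_T zero_T F_add ac_simps)

sublocale T: abelian_group T by (rule abelian_group_T)

lemma neg_T: "x \<in> F \<Longrightarrow> \<ominus>\<^bsub>T\<^esub> cls x = cls (- x)"
  by (rule T.minus_equality) (simp_all add: add_T zero_T carrier_T)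

lemma tens_closed: "\<lbrakk>n \<in> carrier N; b \<in> carrier B\<rbrakk> \<Longrightarrow> tens n b \<in> carrier T"
  using F_of by (auto simp: tens_def carrier_T)

lemma rel_K: "\<lbrakk>x - y \<in> tensor_relations R N B; x \<in> F; y \<in> F\<rbrakk> \<Longrightarrow> cls x = cls y"
  by (rule cls_eqI) (auto simp: tensor_kernel_def intro: generate.incl)

lemma tens_add_left:
  assumes "n \<in> carrier N" "n' \<in> carrier N" "b \<in> carrier B"
  shows "tens (n \<oplus>\<^bsub>N\<^esub> n') b = tens n b \<oplus>\<^bsub>T\<^esub> tens n' b"
proof -
  have "cls (frag_of (n \<oplus>\<^bsub>N\<^esub> n', b)) = cls (frag_of (n, b) + frag_of (n', b))"
    by (rule rel_K) (use assms in \<open>auto simp: tensor_relations_def diff_diff_eq[symmetric] F_of F_add intro!: CollectI\<close>)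
  then show ?thesis using assms by (simp add: tens_def add_T F_of)
qed

lemma tens_add_right:
  assumes "n \<in> carrier N" "b \<in> carrier B" "c \<in> carrier B"
  shows "tens n (b \<oplus>\<^bsub>B\<^esub> c) = tens n b \<oplus>\<^bsub>T\<^esub> tens n c"
proof -
  have "cls (frag_of (n, b \<oplus>\<^bsub>B\<^esub> c)) = cls (frag_of (n, b) + frag_of (n, c))"
    by (rule rel_K) (use assms add_closed in \<open>auto simp: tensor_relations_def diff_diff_eq[symmetric] F_of F_add intro!: CollectI\<close>)
  then show ?thesis using assms by (simp add: tens_def add_T F_of)
qed

lemma tens_balanced:
  assumes "n \<in> carrier N" "r \<in> carrier R" "b \<in> carrier B"
  shows "tens (ract N n r) b = tens n (lact B r b)"
  unfolding tens_def
  by (rule rel_K) (use assms lact_closed N.ract_closed in \<open>auto simp: tensor_relations_def F_of intro!: CollectI\<close>)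

lemma tensor_induct [consumes 1, case_names zero tens add neg]:
  assumes c: "c \<in> carrier T" and zero: "P \<zero>\<^bsub>T\<^esub>"
    and tens: "\<And>n b. \<lbrakk>n \<in> carrier N; b \<in> carrier B\<rbrakk> \<Longrightarrow> P (tens n b)"
    and add: "\<And>c d. \<lbrakk>c \<in> carrier T; d \<in> carrier T; P c; P d\<rbrakk> \<Longrightarrow> P (c \<oplus>\<^bsub>T\<^esub> d)"
    and neg: "\<And>c. \<lbrakk>c \<in> carrier T; P c\<rbrakk> \<Longrightarrow> P (\<ominus>\<^bsub>T\<^esub> c)"
  shows "P c"
proof -
  obtain x where x: "x \<in> F" "c = cls x" using c by (auto simp: carrier_T)
  have "P (cls x)"
  proof (rule free_Abelian_group_induct[of x "carrier N \<times> carrier B"])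
    show "P (cls 0)" using zero by (simp add: zero_T)
    fix u v assume "Poly_Mapping.keys u \<subseteq> carrier N \<times> carrier B" "Poly_Mapping.keys v \<subseteq> carrier N \<times> carrier B"
      and P: "P (cls u)" "P (cls v)"
    then have u: "u \<in> F" and v: "v \<in> F" by (auto simp: F_def)
    have "P (\<ominus>\<^bsub>T\<^esub> cls v)" using v P(2) by (intro neg) (auto simp: carrier_T)
    then have "P (cls u \<oplus>\<^bsub>T\<^esub> \<ominus>\<^bsub>T\<^esub> cls v)" using u v P(1) by (intro add T.a_inv_closed) (auto simp: carrier_T)
    then show "P (cls (u - v))" using u v by (simp add: neg_T add_T)
  qed (use x tens in \<open>auto simp: tens_def F_def\<close>)
  then show ?thesis using x by simp
qed

lemma tensor_hom_zero:
  assumes "abelian_group P" "\<And>c. c \<in> carrier T \<Longrightarrow> h c \<in> carrier P"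
    "\<And>c d. \<lbrakk>c \<in> carrier T; d \<in> carrier T\<rbrakk> \<Longrightarrow> h (c \<oplus>\<^bsub>T\<^esub> d) = h c \<oplus>\<^bsub>P\<^esub> h d"
  shows "h \<zero>\<^bsub>T\<^esub> = \<zero>\<^bsub>P\<^esub>" "c \<in> carrier T \<Longrightarrow> h (\<ominus>\<^bsub>T\<^esub> c) = \<ominus>\<^bsub>P\<^esub> h c"
proof -
  interpret P: abelian_group P by fact
  interpret h: abelian_group_hom T P h
    by (rule abelian_group_homI[OF abelian_group_T assms(1)])
      (use assms in \<open>auto simp: group_hom_def group_hom_axioms_def hom_def T.a_group P.a_group\<close>)
  show "h \<zero>\<^bsub>T\<^esub> = \<zero>\<^bsub>P\<^esub>" "c \<in> carrier T \<Longrightarrow> h (\<ominus>\<^bsub>T\<^esub> c) = \<ominus>\<^bsub>P\<^esub> h c" by simp_all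
qed

text \<open>Module axioms, functoriality and naturality for tensor products are all reduced to
  elementary tensors by this comparison.\<close>

lemma tensor_hom_unique:
  assumes P: "abelian_group P" and h: "\<And>c. c \<in> carrier T \<Longrightarrow> h c \<in> carrier P"
    "\<And>c d. \<lbrakk>c \<in> carrier T; d \<in> carrier T\<rbrakk> \<Longrightarrow> h (c \<oplus>\<^bsub>T\<^esub> d) = h c \<oplus>\<^bsub>P\<^esub> h d"
    and k: "\<And>c. c \<in> carrier T \<Longrightarrow> k c \<in> carrier P"
    "\<And>c d. \<lbrakk>c \<in> carrier T; d \<in> carrier T\<rbrakk> \<Longrightarrow> k (c \<oplus>\<^bsub>T\<^esub> d) = k c \<oplus>\<^bsub>P\<^esub> k d"
    and eq: "\<And>n b. \<lbrakk>n \<in> carrier N; b \<in> carrier B\<rbrakk> \<Longrightarrow> h (tens n b) = k (tens n b)"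
    and c: "c \<in> carrier T"
  shows "h c = k c"
  using c
proof (induction rule: tensor_induct)
  case zero then show ?case using tensor_hom_zero(1)[OF P h] tensor_hom_zero(1)[OF P k] by simp
next
  case (neg c) then show ?case using tensor_hom_zero(2)[OF P h] tensor_hom_zero(2)[OF P k] by simp
qed (simp_all add: eq h k)

text \<open>The additive extension \<open>g\<close> of \<open>\<beta>\<close> to the free group
  kills the relations and hence the subgroup \<open>K\<close> that they generate. Its value is thus
  the same at all representatives of a class, and \<open>h\<close> takes it at a chosen one.\<close>

lemma tensor_universal:
  fixes P :: "('p, 'q) ring_scheme"
  assumes P: "abelian_group P"
    and \<beta>: "\<And>n b. \<lbrakk>n \<in> carrier N; b \<in> carrier B\<rbrakk> \<Longrightarrow> \<beta> n b \<in> carrier P"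
      "\<And>n n' b. \<lbrakk>n \<in> carrier N; n' \<in> carrier N; b \<in> carrier B\<rbrakk> \<Longrightarrow> \<beta> (n \<oplus>\<^bsub>N\<^esub> n') b = \<beta> n b \<oplus>\<^bsub>P\<^esub> \<beta> n' b"
      "\<And>n b c. \<lbrakk>n \<in> carrier N; b \<in> carrier B; c \<in> carrier B\<rbrakk> \<Longrightarrow> \<beta> n (b \<oplus>\<^bsub>B\<^esub> c) = \<beta> n b \<oplus>\<^bsub>P\<^esub> \<beta> n c"
      "\<And>n r b. \<lbrakk>n \<in> carrier N; r \<in> carrier R; b \<in> carrier B\<rbrakk> \<Longrightarrow> \<beta> (ract N n r) b = \<beta> n (lact B r b)"
  shows "\<exists>h. (\<forall>c \<in> carrier T. h c \<in> carrier P) \<and>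
    (\<forall>c \<in> carrier T. \<forall>d \<in> carrier T. h (c \<oplus>\<^bsub>T\<^esub> d) = h c \<oplus>\<^bsub>P\<^esub> h d) \<and>
    (\<forall>n \<in> carrier N. \<forall>b \<in> carrier B. h (tens n b) = \<beta> n b)"
proof -
  interpret P: abelian_group P by fact
  have "(\<lambda>(n, b). \<beta> n b) ` (carrier N \<times> carrier B) \<subseteq> carrier (add_monoid P)" using \<beta>(1) by auto
  then obtain g where g: "g \<in> hom (free_Abelian_group (carrier N \<times> carrier B)) (add_monoid P)"
    and gf: "\<And>x. x \<in> carrier N \<times> carrier B \<Longrightarrow> g (frag_of x) = (\<lambda>(n, b). \<beta> n b) x"
    using comm_group.free_Abelian_group_universal[OF P.a_comm_group] by metis
  have g_closed: "g x \<in> carrier P" if "x \<in> F" for x using hom_in_carrier[OF g, of x] that by (simp add: F_def)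
  have g_add: "g (x + y) = g x \<oplus>\<^bsub>P\<^esub> g y" if "x \<in> F" "y \<in> F" for x y using hom_mult[OF g, of x y] that by (simp add: F_def)
  have g_diff: "g (x - y) = \<zero>\<^bsub>P\<^esub>" if x: "x \<in> F" and y: "y \<in> F" and "g x = g y" for x y
  proof -
    have "g (x - y) \<oplus>\<^bsub>P\<^esub> g y = g y"
      using g_add[of "x - y" y] F_diff[OF x y] y \<open>g x = g y\<close> by simp
    then show ?thesis using P.add.r_cancel_one[OF g_closed[OF y] g_closed[OF F_diff[OF x y]]] by simp
  qed
  have g0: "g 0 = \<zero>\<^bsub>P\<^esub>" using g_diff[of 0 0] by simp
  have g_rel: "g x = \<zero>\<^bsub>P\<^esub>" if x: "x \<in> tensor_relations R N B" for x
    using x unfolding tensor_relations_def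
  proof (elim UnE CollectE exE conjE)
    fix n n' b assume e: "x = frag_of (n \<oplus>\<^bsub>N\<^esub> n', b) - frag_of (n, b) - frag_of (n', b)"
      and c: "n \<in> carrier N" "n' \<in> carrier N" "b \<in> carrier B"
    show ?thesis unfolding e diff_diff_eq
      by (rule g_diff) (use c in \<open>simp_all add: g_add F_of F_add gf \<beta>\<close>)
  next
    fix n b b' assume e: "x = frag_of (n, b \<oplus>\<^bsub>B\<^esub> b') - frag_of (n, b) - frag_of (n, b')"
      and c: "n \<in> carrier N" "b \<in> carrier B" "b' \<in> carrier B"
    show ?thesis unfolding e diff_diff_eq
      by (rule g_diff) (use c in \<open>simp_all add: g_add F_of F_add gf \<beta> add_closed\<close>)
  next
    fix n r b assume e: "x = frag_of (ract N n r, b) - frag_of (n, lact B r b)"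
      and c: "n \<in> carrier N" "r \<in> carrier R" "b \<in> carrier B"
    show ?thesis unfolding e
      by (rule g_diff) (use c in \<open>simp_all add: F_of gf \<beta> lact_closed N.ract_closed\<close>)
  qed
  have g_K: "g x = \<zero>\<^bsub>P\<^esub>" if "x \<in> K" for x
    using that unfolding tensor_kernel_def
  proof induction
    case one show ?case by (simp add: one_G g0)
  next
    case (incl h) then show ?case by (rule g_rel)
  next
    case (inv h)
    then have h: "h \<in> F" using relations_F by blast
    have "g (0 - h) = \<zero>\<^bsub>P\<^esub>" by (rule g_diff[OF _ h]) (simp_all add: g0 g_rel[OF inv])
    then show ?case using inv_G[OF h] by simp
  next
    case (eng h k)
    then have "h \<in> F" "k \<in> F" using K_F by (auto simp: tensor_kernel_def)
    then show ?case using eng by (simp add: mult_G g_add)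
  qed
  define h where "h c = g (SOME x. x \<in> F \<and> cls x = c)" for c
  have h: "h (cls x) = g x" if x: "x \<in> F" for x
  proof -
    define y where "y = (SOME y. y \<in> F \<and> cls y = cls x)"
    have yx: "y \<in> F \<and> cls y = cls x"
      unfolding y_def by (rule someI[of "\<lambda>y. y \<in> F \<and> cls y = cls x" x]) (use x in simp)
    have y: "y \<in> F" "x - y \<in> K" using yx cls_eqD[OF x _ sym, of y] by blast+
    have "g x = g (x - y) \<oplus>\<^bsub>P\<^esub> g y" using g_add[OF F_diff[OF x y(1)] y(1)] by simp
    then have "g x = g y" using g_K[OF y(2)] g_closed[OF y(1)] by simp
    then show ?thesis by (simp add: h_def y_def)
  qed
  show ?thesis
  proof (intro exI[of _ h] conjI ballI)
    show "h c \<in> carrier P" if "c \<in> carrier T" for c using that g_closed h by (auto simp: carrier_T)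
    show "h (c \<oplus>\<^bsub>T\<^esub> d) = h c \<oplus>\<^bsub>P\<^esub> h d" if cd: "c \<in> carrier T" "d \<in> carrier T" for c d
    proof -
      obtain x y where "x \<in> F" "c = cls x" "y \<in> F" "d = cls y" using cd by (auto simp: carrier_T)
      then show ?thesis by (simp add: add_T h g_add F_add)
    qed
    show "h (tens n b) = \<beta> n b" if "n \<in> carrier N" "b \<in> carrier B" for n b
      using that h[OF F_of[OF that]] gf by (simp add: tens_def)
  qed
qed

text \<open>The group is generated by elementary tensors, and these are indexed by the product of
  two sets that are no larger than the universe.\<close>

lemma tensor_lepoll:
  assumes U: "infinite (UNIV :: 'u set)" "carrier N \<lesssim> (UNIV :: 'u set)" "carrier B \<lesssim> (UNIV :: 'u set)"
  shows "carrier T \<lesssim> (UNIV :: 'u set)"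
proof -
  let ?X = "(\<lambda>(n, b). tens n b) ` (carrier N \<times> carrier B)"
  have "?X \<lesssim> (UNIV :: 'u set)"
    using times_lepoll_infinite[OF U(2,3,1)] image_lepoll lepoll_trans by blast
  moreover have X: "?X \<subseteq> carrier T" using tens_closed by auto
  ultimately have "generate (add_monoid T) ?X \<lesssim> (UNIV :: 'u set)"
    using group.generate_lepoll[OF T.a_group, of ?X] U(1) by simp
  moreover have "carrier T \<subseteq> generate (add_monoid T) ?X"
  proof
    have g: "subgroup (generate (add_monoid T) ?X) (add_monoid T)"
      using group.generate_is_subgroup[OF T.a_group] X by simp
    fix c assume "c \<in> carrier T"
    then show "c \<in> generate (add_monoid T) ?X"
    proof (induction rule: tensor_induct)
      case zero then show ?case using subgroup.one_closed[OF g] by simp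
    next
      case (add c d) then show ?case using subgroup.m_closed[OF g] by simp
    next
      case (neg c) then show ?case using subgroup.m_inv_closed[OF g] by (simp add: a_inv_def)
    qed (auto intro!: generate.incl)
  qed
  ultimately show ?thesis using subset_imp_lepoll lepoll_trans by meson
qed

end

text \<open>
  The unions over representatives in the definitions of the action and of the functorial maps are
  evaluated by comparison with the additive map given by the universal property.
\<close>

lemma tensor_union_map:
  assumes T: "tensor R S B N" and T': "tensor R S B N'"
    and h: "\<And>c. c \<in> carrier (tensor_product R N B) \<Longrightarrow> h c \<in> carrier (tensor_product R N' B)"
    "\<And>c d. \<lbrakk>c \<in> carrier (tensor_product R N B); d \<in> carrier (tensor_product R N B)\<rbrakk>
      \<Longrightarrow> h (c \<oplus>\<^bsub>tensor_product R N B\<^esub> d) = h c \<oplus>\<^bsub>tensor_product R N' B\<^esub> h d"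
    and g: "\<And>n b. \<lbrakk>n \<in> carrier N; b \<in> carrier B\<rbrakk> \<Longrightarrow> h (tensor.tens R B N n b) = tensor.tens R B N' (ga n) (gb b)"
    "\<And>n. n \<in> carrier N \<Longrightarrow> ga n \<in> carrier N'" "\<And>b. b \<in> carrier B \<Longrightarrow> gb b \<in> carrier B"
    and c: "c \<in> carrier (tensor_product R N B)"
  shows "(\<Union>x \<in> c. tensor_class R N' B (frag_extend (\<lambda>(n, b). frag_of (ga n, gb b)) x)) = h c"
proof -
  interpret T: tensor R S B N by fact
  interpret T': tensor R S B N' by fact
  let ?\<phi> = "frag_extend (\<lambda>(n, b). frag_of (ga n, gb b))"
  have "?\<phi> x \<in> T'.F \<and> T'.cls (?\<phi> x) = h (T.cls x)" if "x \<in> T.F" for x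
  proof (rule free_Abelian_group_induct[of x "carrier N \<times> carrier B"])
    show "Poly_Mapping.keys x \<subseteq> carrier N \<times> carrier B" using that by (simp add: T.F_def)
    show "?\<phi> 0 \<in> T'.F \<and> T'.cls (?\<phi> 0) = h (T.cls 0)"
      using T.tensor_hom_zero(1)[OF T'.abelian_group_T h] by (simp add: T.zero_T T'.zero_T)
    show "?\<phi> (frag_of a) \<in> T'.F \<and> T'.cls (?\<phi> (frag_of a)) = h (T.cls (frag_of a))"
      if "a \<in> carrier N \<times> carrier B" for a
      using that g by (auto simp: T.tens_def T'.tens_def T'.F_def)
  next
    fix u v :: "_ \<Rightarrow>\<^sub>0 int" assume "Poly_Mapping.keys u \<subseteq> carrier N \<times> carrier B" "Poly_Mapping.keys v \<subseteq> carrier N \<times> carrier B"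
    then have u: "u \<in> T.F" and v: "v \<in> T.F" by (auto simp: T.F_def)
    have uc: "T.cls u \<in> carrier T.T" and vc: "T.cls v \<in> carrier T.T" using u v by (auto simp: T.carrier_T)
    assume "?\<phi> u \<in> T'.F \<and> T'.cls (?\<phi> u) = h (T.cls u)" and "?\<phi> v \<in> T'.F \<and> T'.cls (?\<phi> v) = h (T.cls v)"
    then have pu: "?\<phi> u \<in> T'.F" "T'.cls (?\<phi> u) = h (T.cls u)" and pv: "?\<phi> v \<in> T'.F" "T'.cls (?\<phi> v) = h (T.cls v)" by auto
    have "T'.cls (?\<phi> (u - v)) = T'.cls (?\<phi> u) \<oplus>\<^bsub>T'.T\<^esub> \<ominus>\<^bsub>T'.T\<^esub> T'.cls (?\<phi> v)"
      using pu(1) pv(1) by (simp add: frag_extend_diff T'.neg_T T'.add_T)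
    also have "\<dots> = h (T.cls u \<oplus>\<^bsub>T.T\<^esub> \<ominus>\<^bsub>T.T\<^esub> T.cls v)"
      using uc vc T.tensor_hom_zero(2)[OF T'.abelian_group_T h vc] by (simp add: pu pv h)
    also have "T.cls u \<oplus>\<^bsub>T.T\<^esub> \<ominus>\<^bsub>T.T\<^esub> T.cls v = T.cls (u - v)"
      using u v by (simp add: T.neg_T T.add_T)
    finally show "?\<phi> (u - v) \<in> T'.F \<and> T'.cls (?\<phi> (u - v)) = h (T.cls (u - v))"
      using T'.F_diff[OF pu(1) pv(1)] by (simp add: frag_extend_diff)
  qed
  then have *: "T'.cls (?\<phi> x) = h (T.cls x)" if "x \<in> T.F" for x using that by blast
  obtain y where y: "y \<in> T.F" "c = T.cls y" using c by (auto simp: T.carrier_T)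
  have "T'.cls (?\<phi> x) = h c" if "x \<in> c" for x
    using *[OF T.cls_mem(1)[OF y(1)]] T.cls_mem(2)[OF y(1)] that y(2) by metis
  moreover have "y \<in> c" using T.mem_cls y by simp
  ultimately show ?thesis by blast
qed

context tensor
begin

lemma ract_hom_ex:
  assumes s: "s \<in> carrier S"
  shows "(\<forall>c \<in> carrier T. ract T c s \<in> carrier T) \<and>
    (\<forall>c \<in> carrier T. \<forall>d \<in> carrier T. ract T (c \<oplus>\<^bsub>T\<^esub> d) s = ract T c s \<oplus>\<^bsub>T\<^esub> ract T d s) \<and>
    (\<forall>n \<in> carrier N. \<forall>b \<in> carrier B. ract T (tens n b) s = tens n (ract B b s))"
proof -
  have "\<exists>h. (\<forall>c \<in> carrier T. h c \<in> carrier T) \<and>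
    (\<forall>c \<in> carrier T. \<forall>d \<in> carrier T. h (c \<oplus>\<^bsub>T\<^esub> d) = h c \<oplus>\<^bsub>T\<^esub> h d) \<and>
    (\<forall>n \<in> carrier N. \<forall>b \<in> carrier B. h (tens n b) = tens n (ract B b s))"
    by (rule tensor_universal[OF abelian_group_T])
      (use s in \<open>simp_all add: tens_closed ract_closed tens_add_left ract_add_left tens_add_right tens_balanced lact_ract\<close>)
  then obtain h where h: "\<And>c. c \<in> carrier T \<Longrightarrow> h c \<in> carrier T"
    "\<And>c d. \<lbrakk>c \<in> carrier T; d \<in> carrier T\<rbrakk> \<Longrightarrow> h (c \<oplus>\<^bsub>T\<^esub> d) = h c \<oplus>\<^bsub>T\<^esub> h d"
    "\<And>n b. \<lbrakk>n \<in> carrier N; b \<in> carrier B\<rbrakk> \<Longrightarrow> h (tens n b) = tens n (ract B b s)"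
    by blast
  have "ract T c s = h c" if "c \<in> carrier T" for c
    using tensor_union_map[OF tensor_axioms tensor_axioms h(1,2) h(3) _ _ that] s
    by (simp add: tensor_product_def Let_def ract_closed)
  then show ?thesis using h by (simp add: tens_closed)
qed

lemma ract_T_closed: "\<lbrakk>c \<in> carrier T; s \<in> carrier S\<rbrakk> \<Longrightarrow> ract T c s \<in> carrier T"
  and ract_T_add: "\<lbrakk>c \<in> carrier T; d \<in> carrier T; s \<in> carrier S\<rbrakk>
    \<Longrightarrow> ract T (c \<oplus>\<^bsub>T\<^esub> d) s = ract T c s \<oplus>\<^bsub>T\<^esub> ract T d s"
  and ract_tens: "\<lbrakk>n \<in> carrier N; b \<in> carrier B; s \<in> carrier S\<rbrakk> \<Longrightarrow> ract T (tens n b) s = tens n (ract B b s)"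
  using ract_hom_ex by blast+

lemma right_module_T: "right_module S T"
proof (intro right_module.intro right_module_axioms.intro S.ring_axioms abelian_group_T)
  show "ract T c (s \<oplus>\<^bsub>S\<^esub> s') = ract T c s \<oplus>\<^bsub>T\<^esub> ract T c s'"
    if c: "c \<in> carrier T" and s: "s \<in> carrier S" "s' \<in> carrier S" for c s s'
    by (rule tensor_hom_unique[OF abelian_group_T _ _ _ _ _ c])
      (use s in \<open>simp_all add: ract_T_closed ract_T_add ract_tens ract_add_right tens_add_right ract_closed T.a_ac\<close>)
  show "ract T c (s \<otimes>\<^bsub>S\<^esub> s') = ract T (ract T c s) s'"
    if c: "c \<in> carrier T" and s: "s \<in> carrier S" "s' \<in> carrier S" for c s s'
    by (rule tensor_hom_unique[OF abelian_group_T _ _ _ _ _ c])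
      (use s in \<open>simp_all add: ract_T_closed ract_T_add ract_tens ract_mult ract_closed\<close>)
  show "ract T c \<one>\<^bsub>S\<^esub> = c" if c: "c \<in> carrier T" for c
    by (rule tensor_hom_unique[OF abelian_group_T _ _ _ _ _ c])
      (simp_all add: ract_T_closed ract_T_add ract_tens ract_one)
qed (auto simp: ract_T_closed ract_T_add)

end

section \<open>Functoriality of the tensor product\<close>

context bimod
begin

lemma tensorI: "right_module R N \<Longrightarrow> tensor R S B N"
  by (intro tensor.intro bimod_axioms)

lemma tensor_map_hom:
  assumes N: "right_module R N" and N': "right_module R N'" and f: "f \<in> rmodule_hom R N N'"
  shows "(\<forall>c \<in> carrier (tensor_product R N B). tensor_map R B N' f c \<in> carrier (tensor_product R N' B)) \<and>
    (\<forall>c \<in> carrier (tensor_product R N B). \<forall>d \<in> carrier (tensor_product R N B).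
      tensor_map R B N' f (c \<oplus>\<^bsub>tensor_product R N B\<^esub> d)
        = tensor_map R B N' f c \<oplus>\<^bsub>tensor_product R N' B\<^esub> tensor_map R B N' f d) \<and>
    (\<forall>n \<in> carrier N. \<forall>b \<in> carrier B. tensor_map R B N' f (tensor.tens R B N n b) = tensor.tens R B N' (f n) b)"
proof -
  interpret T: tensor R S B N by (rule tensorI[OF N])
  interpret T': tensor R S B N' by (rule tensorI[OF N'])
  note f' = rmodule_hom_closed[OF f] rmodule_hom_add[OF f] rmodule_hom_act[OF f]
  have "\<exists>h. (\<forall>c \<in> carrier T.T. h c \<in> carrier T'.T) \<and>
    (\<forall>c \<in> carrier T.T. \<forall>d \<in> carrier T.T. h (c \<oplus>\<^bsub>T.T\<^esub> d) = h c \<oplus>\<^bsub>T'.T\<^esub> h d) \<and>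
    (\<forall>n \<in> carrier N. \<forall>b \<in> carrier B. h (T.tens n b) = T'.tens (f n) b)"
    by (rule T.tensor_universal[OF T'.abelian_group_T])
      (simp_all add: f' T'.tens_closed T'.tens_add_left T'.tens_add_right T'.tens_balanced)
  then obtain h where h: "\<And>c. c \<in> carrier T.T \<Longrightarrow> h c \<in> carrier T'.T"
    "\<And>c d. \<lbrakk>c \<in> carrier T.T; d \<in> carrier T.T\<rbrakk> \<Longrightarrow> h (c \<oplus>\<^bsub>T.T\<^esub> d) = h c \<oplus>\<^bsub>T'.T\<^esub> h d"
    "\<And>n b. \<lbrakk>n \<in> carrier N; b \<in> carrier B\<rbrakk> \<Longrightarrow> h (T.tens n b) = T'.tens (f n) b"
    by blast
  have "tensor_map R B N' f c = h c" if "c \<in> carrier T.T" for c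
    using tensor_union_map[where ga = f and gb = "\<lambda>b. b", OF T.tensor_axioms T'.tensor_axioms h(1,2) h(3) _ _ that] f'
    by (simp add: tensor_map_def)
  then show ?thesis using h by (simp add: T.tens_closed)
qed

lemma tensor_map_act:
  assumes N: "right_module R N" and N': "right_module R N'" and f: "f \<in> rmodule_hom R N N'"
    and c: "c \<in> carrier (tensor_product R N B)" and s: "s \<in> carrier S"
  shows "tensor_map R B N' f (ract (tensor_product R N B) c s) = ract (tensor_product R N' B) (tensor_map R B N' f c) s"
proof -
  interpret T: tensor R S B N by (rule tensorI[OF N])
  interpret T': tensor R S B N' by (rule tensorI[OF N'])
  note m = tensor_map_hom[OF N N' f]
  show ?thesis
    by (rule T.tensor_hom_unique[OF T'.abelian_group_T _ _ _ _ _ c])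
      (use m s rmodule_hom_closed[OF f] in \<open>simp_all add: T.ract_T_closed T'.ract_T_closed T.ract_T_add T'.ract_T_add T.ract_tens T'.ract_tens ract_closed\<close>)
qed

lemma fobj_tensor_functor: "fobj (tensor_functor R B) N = small_copy (tensor_product R N B)"
  by (simp add: tensor_functor_def)

lemma fmap_tensor_functor:
  assumes "inj_on (small_inj (carrier (tensor_product R N B)) :: _ \<Rightarrow> 'u) (carrier (tensor_product R N B))"
    and "c \<in> carrier (tensor_product R N B)"
  shows "fmap (tensor_functor R B) N N' f (small_inj (carrier (tensor_product R N B)) c :: 'u)
    = small_inj (carrier (tensor_product R N' B)) (tensor_map R B N' f c)"
  using assms by (simp add: tensor_functor_def Let_def)

lemma cat_functor_tensor:
  assumes U: "infinite (UNIV :: 'u set)" "carrier B \<lesssim> (UNIV :: 'u set)"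
  shows "cat_functor (Mod_cat R :: (('r, 'u) rmodule, 'u \<Rightarrow> 'u) cat) (Mod_cat S) (tensor_functor R B)"
proof -
  interpret C: category "Mod_cat R :: (('r, 'u) rmodule, 'u \<Rightarrow> 'u) cat" by (rule category_Mod_cat)
  interpret D: category "Mod_cat S :: (('s, 'u) rmodule, 'u \<Rightarrow> 'u) cat" by (rule category_Mod_cat)
  let ?T = "\<lambda>N :: ('r, 'u) rmodule. tensor_product R N B"
  let ?j = "\<lambda>N :: ('r, 'u) rmodule. small_inj (carrier (?T N)) :: _ \<Rightarrow> 'u"
  let ?F = "tensor_functor R B :: (('r, 'u) rmodule, 'u \<Rightarrow> 'u, ('s, 'u) rmodule, 'u \<Rightarrow> 'u) functr"
  have small: "carrier (?T N) \<lesssim> (UNIV :: 'u set)" if "right_module R N" for N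
    using tensor.tensor_lepoll[OF tensorI[OF that] U(1) subset_imp_lepoll[OF subset_UNIV] U(2)] .
  have inj: "inj_on (?j N) (carrier (?T N))" if "right_module R N" for N using small_inj[OF small[OF that]] .
  have im: "image_module S (?T N) (?j N)" if "right_module R N" for N
    using image_module_small[OF tensor.right_module_T[OF tensorI[OF that]] small[OF that]] .
  have ext: "fmap ?F N N' f \<in> extensional (?j N ` carrier (?T N))" for N N' f
    by (auto simp: tensor_functor_def Let_def)
  note fm = fmap_tensor_functor[OF inj]
  have hom: "fmap ?F N N' f \<in> rmodule_hom S (fobj ?F N) (fobj ?F N')"
    if N: "right_module R N" and N': "right_module R N'" and f: "f \<in> rmodule_hom R N N'" for N N' f
  proof -
    interpret i: image_module S "?T N" "?j N" by (rule im[OF N])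
    interpret i': image_module S "?T N'" "?j N'" by (rule im[OF N'])
    note m = tensor_map_hom[OF N N' f] tensor_map_act[OF N N' f]
    show ?thesis
      unfolding fobj_tensor_functor small_copy_eq
      by (rule rmodule_homI)
        (use ext[of N N' f] m in \<open>auto simp: i.add_image_copy i'.add_image_copy i.ract_image_copy i'.ract_image_copy fm[OF N]
            i.ract_closed\<close>)
  qed
  show ?thesis
  proof
    show "fobj ?F X \<in> cobj (Mod_cat S)" if "X \<in> cobj (Mod_cat R)" for X
      using image_module.right_module_image_copy[OF im[of X]] that by (simp add: fobj_tensor_functor small_copy_eq)
    show "fmap ?F X Y f \<in> chom (Mod_cat S) (fobj ?F X) (fobj ?F Y)"
      if "X \<in> cobj (Mod_cat R)" "Y \<in> cobj (Mod_cat R)" "f \<in> chom (Mod_cat R) X Y" for X Y f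
      using hom[of X Y f] that by simp
    show "fmap ?F X X (cid (Mod_cat R) X) = cid (Mod_cat S) (fobj ?F X)" if X: "X \<in> cobj (Mod_cat R)" for X
    proof (rule extensionalityI)
      show "fmap ?F X X (cid (Mod_cat R) X) \<in> extensional (?j X ` carrier (?T X))" by (rule ext)
      show "cid (Mod_cat S) (fobj ?F X) \<in> extensional (?j X ` carrier (?T X))"
        by (simp add: fobj_tensor_functor small_copy_eq)
      have X': "right_module R X" using X by simp
      interpret T: tensor R S B X by (rule tensorI[OF X'])
      define e where "e = (\<lambda>x \<in> carrier X. x)"
      have e: "e \<in> rmodule_hom R X X" "\<And>n. n \<in> carrier X \<Longrightarrow> e n = n"
        using rmodule_hom_id[OF X'] by (simp_all add: e_def)
      have "tensor_map R B X e c = c" if c: "c \<in> carrier (?T X)" for c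
        by (rule T.tensor_hom_unique[OF T.abelian_group_T _ _ _ _ _ c])
          (use tensor_map_hom[OF X' X' e(1)] e(2) in simp_all)
      then have "tensor_map R B X (\<lambda>x \<in> carrier X. x) c = c" if "c \<in> carrier (?T X)" for c
        using that by (simp only: e_def)
      then have 1: "fmap ?F X X (cid (Mod_cat R) X) y = y" if "y \<in> ?j X ` carrier (?T X)" for y
        using that by (auto simp: fm[OF X'] simp del: restrict_apply restrict_apply')
      have 2: "cid (Mod_cat S) (fobj ?F X) y = y" if "y \<in> ?j X ` carrier (?T X)" for y
        using that by (simp add: fobj_tensor_functor small_copy_eq)
      show "fmap ?F X X (cid (Mod_cat R) X) y = cid (Mod_cat S) (fobj ?F X) y"
        if "y \<in> ?j X ` carrier (?T X)" for y
        by (rule trans[OF 1[OF that] 2[OF that, symmetric]])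
    qed
    show "fmap ?F X Z (ccomp (Mod_cat R) X Y Z g f)
        = ccomp (Mod_cat S) (fobj ?F X) (fobj ?F Y) (fobj ?F Z) (fmap ?F Y Z g) (fmap ?F X Y f)"
      if "X \<in> cobj (Mod_cat R)" "Y \<in> cobj (Mod_cat R)" "Z \<in> cobj (Mod_cat R)"
        "f \<in> chom (Mod_cat R) X Y" "g \<in> chom (Mod_cat R) Y Z" for X Y Z f g
    proof (rule extensionalityI)
      show "fmap ?F X Z (ccomp (Mod_cat R) X Y Z g f) \<in> extensional (?j X ` carrier (?T X))" by (rule ext)
      show "ccomp (Mod_cat S) (fobj ?F X) (fobj ?F Y) (fobj ?F Z) (fmap ?F Y Z g) (fmap ?F X Y f)
          \<in> extensional (?j X ` carrier (?T X))"
        by (simp add: fobj_tensor_functor small_copy_eq compose_def)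
      have X: "right_module R X" and Y: "right_module R Y" and Z: "right_module R Z"
        and f: "f \<in> rmodule_hom R X Y" and g: "g \<in> rmodule_hom R Y Z" using that by simp_all
      interpret T: tensor R S B X by (rule tensorI[OF X])
      interpret T': tensor R S B Z by (rule tensorI[OF Z])
      note m = tensor_map_hom[OF X Z rmodule_hom_compose[OF X f g]] tensor_map_hom[OF X Y f] tensor_map_hom[OF Y Z g]
      have eq: "tensor_map R B Z (compose (carrier X) g f) c = tensor_map R B Z g (tensor_map R B Y f c)"
        if c: "c \<in> carrier (?T X)" for c
        by (rule T.tensor_hom_unique[OF T'.abelian_group_T _ _ _ _ _ c])
          (use m rmodule_hom_closed[OF f] in \<open>simp_all add: compose_eq\<close>)
      show "fmap ?F X Z (ccomp (Mod_cat R) X Y Z g f) y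
        = ccomp (Mod_cat S) (fobj ?F X) (fobj ?F Y) (fobj ?F Z) (fmap ?F Y Z g) (fmap ?F X Y f) y"
        if "y \<in> ?j X ` carrier (?T X)" for y
        using that m(2) by (auto simp: fm[OF X] fm[OF Y] fobj_tensor_functor small_copy_eq compose_eq eq)
    qed
  qed
qed

end

section \<open>The shift functor as a tensor product\<close>

lemma homog_bimodule_simps [simp]:
  "carrier (homog_bimodule L n) = homog L n" "add (homog_bimodule L n) = add L"
  "lact (homog_bimodule L n) = mult L" "ract (homog_bimodule L n) = mult L"
  by (simp_all add: homog_bimodule_def)

lemma (in graded_ring) bimod_homog: "bimod (degree_zero A) (degree_zero A) (homog_bimodule A n)"
proof (intro bimod.intro bimod_axioms.intro ring_degree_zero)
  show "lact (homog_bimodule A n) r b \<in> carrier (homog_bimodule A n)"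
    if "r \<in> carrier (degree_zero A)" "b \<in> carrier (homog_bimodule A n)" for r b
    using homog_mult[of r 0 b n] that by simp
  show "ract (homog_bimodule A n) b s \<in> carrier (homog_bimodule A n)"
    if "b \<in> carrier (homog_bimodule A n)" "s \<in> carrier (degree_zero A)" for b s
    using homog_mult[of b n s 0] that by simp
qed (auto simp: D_add D_carrier R.m_assoc R.l_distr R.r_distr)

text \<open>
  The degree-zero part of a graded \<open>A\<close>-module is regarded as a module over \<open>L\<^sub>0\<close> through \<open>\<psi>\<close>, and
  \<open>\<psi>\<close> identifies \<open>L\<^sub>1\<close> with \<open>A\<^sub>1\<close> up to twisting the right action by \<open>\<gamma>\<close>.
\<close>

locale comparison = L: graded_ring L + A: strongly_graded A
  for L A :: "('k, 'a) galgebra" +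
  fixes \<psi> \<gamma> :: "'a \<Rightarrow> 'a"
  assumes psi_hom: "\<psi> \<in> ring_hom (degree_zero L) (degree_zero A)"
    and psi_bij0: "bij_betw \<psi> (homog L 0) (homog A 0)"
    and psi_bij1: "bij_betw \<psi> (homog L 1) (homog A 1)"
    and psi_add: "\<lbrakk>v \<in> homog L 1; w \<in> homog L 1\<rbrakk> \<Longrightarrow> \<psi> (v \<oplus>\<^bsub>L\<^esub> w) = \<psi> v \<oplus>\<^bsub>A\<^esub> \<psi> w"
    and psi_left: "\<lbrakk>r \<in> homog L 0; v \<in> homog L 1\<rbrakk> \<Longrightarrow> \<psi> (r \<otimes>\<^bsub>L\<^esub> v) = \<psi> r \<otimes>\<^bsub>A\<^esub> \<psi> v"
    and psi_right: "\<lbrakk>v \<in> homog L 1; s \<in> homog L 0\<rbrakk> \<Longrightarrow> \<psi> (v \<otimes>\<^bsub>L\<^esub> \<gamma> s) = \<psi> v \<otimes>\<^bsub>A\<^esub> \<psi> s"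
    and gamma_hom: "\<gamma> \<in> ring_hom (degree_zero L) (degree_zero L)"
begin

abbreviation "R\<^sub>0 \<equiv> degree_zero L"
abbreviation "V \<equiv> homog_bimodule L 1"
abbreviation "\<Psi> \<equiv> comp_functr (pullback_functor \<psi>) degree_part_functor"
abbreviation "\<Theta> \<equiv> comp_functr (pullback_functor \<gamma>) (tensor_functor R\<^sub>0 V)"

lemma gamma_closed: "s \<in> homog L 0 \<Longrightarrow> \<gamma> s \<in> homog L 0"
  using ring_hom_closed[OF gamma_hom, of s] by simp

lemma psi_closed: "r \<in> homog L 0 \<Longrightarrow> \<psi> r \<in> homog A 0" "v \<in> homog L 1 \<Longrightarrow> \<psi> v \<in> homog A 1"
  using psi_bij0 psi_bij1 by (auto simp: bij_betw_def)

lemma psi_carrier: "r \<in> homog L 0 \<Longrightarrow> \<psi> r \<in> carrier A" "v \<in> homog L 1 \<Longrightarrow> \<psi> v \<in> carrier A"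
  using psi_closed A.D_carrier by blast+

lemma psi_surj: "a \<in> homog A 0 \<Longrightarrow> \<exists>r \<in> homog L 0. a = \<psi> r" "b \<in> homog A 1 \<Longrightarrow> \<exists>v \<in> homog L 1. b = \<psi> v"
  using psi_bij0 psi_bij1 by (auto simp: bij_betw_def)

abbreviation "\<phi> \<equiv> inv_into (homog L 1) \<psi>"

lemma phi: "b \<in> homog A 1 \<Longrightarrow> \<phi> b \<in> homog L 1" "b \<in> homog A 1 \<Longrightarrow> \<psi> (\<phi> b) = b"
    "v \<in> homog L 1 \<Longrightarrow> \<phi> (\<psi> v) = v"
  using psi_bij1 by (auto simp: bij_betw_def inv_into_into f_inv_into_f)

lemma phi_add: "\<lbrakk>b \<in> homog A 1; c \<in> homog A 1\<rbrakk> \<Longrightarrow> \<phi> (b \<oplus>\<^bsub>A\<^esub> c) = \<phi> b \<oplus>\<^bsub>L\<^esub> \<phi> c"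
  using psi_add[of "\<phi> b" "\<phi> c"] phi phi(3)[of "\<phi> b \<oplus>\<^bsub>L\<^esub> \<phi> c"] L.D_add by simp

lemma ring_R0: "ring R\<^sub>0"
  by (rule L.ring_degree_zero)

lemma is_equivalence_Psi:
  assumes "infinite (UNIV :: 'u set)" "carrier A \<lesssim> (UNIV :: 'u set)"
  shows "is_equivalence (Gr_cat A :: (('a, 'u) grmodule, 'u \<Rightarrow> 'u) cat) (Mod_cat R\<^sub>0) \<Psi>"
  by (rule is_equivalence_trans[OF A.is_equivalence_degree_part[OF assms]
        is_equivalence_pullback[OF ring_R0 A.ring_degree_zero psi_hom]]) (simp add: psi_bij0)

definition \<Psi>\<^sub>0 :: "('a, 'u) grmodule \<Rightarrow> ('a, 'u) rmodule" where
  "\<Psi>\<^sub>0 M = fobj \<Psi> M"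

lemma fobj_Psi: "fobj \<Psi> M = \<Psi>\<^sub>0 M"
  by (simp only: \<Psi>\<^sub>0_def)

lemma Psi0_simps [simp]: "carrier (\<Psi>\<^sub>0 M) = mhomog M 0" "zero (\<Psi>\<^sub>0 M) = zero M" "add (\<Psi>\<^sub>0 M) = add M"
  "ract (\<Psi>\<^sub>0 M) x r = ract M x (\<psi> r)"
  by (simp_all add: \<Psi>\<^sub>0_def)

lemma right_module_Psi: "graded_right_module A M \<Longrightarrow> right_module R\<^sub>0 (\<Psi>\<^sub>0 M)"
  using right_module_pullback[OF A.right_module_degree_part ring_R0 psi_hom, of M] by (simp add: \<Psi>\<^sub>0_def)

lemma tensor_Psi: "graded_right_module A M \<Longrightarrow> tensor R\<^sub>0 R\<^sub>0 V (\<Psi>\<^sub>0 M)"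
  using bimod.tensorI[OF L.bimod_homog right_module_Psi] .

text \<open>The map \<open>m \<otimes> v \<mapsto> m \<psi>(v)\<close> on
  \<open>M_0 \<otimes> L_1\<close>. The choice is made once for each \<open>M\<close>, so that these
  maps form a family whose naturality can be stated.\<close>

definition mult_map :: "('a, 'u) grmodule \<Rightarrow> ('u \<times> 'a \<Rightarrow>\<^sub>0 int) set \<Rightarrow> 'u" where
  "mult_map M = (SOME h.
     (\<forall>c \<in> carrier (tensor_product R\<^sub>0 (\<Psi>\<^sub>0 M) V). h c \<in> carrier M) \<and>
     (\<forall>c \<in> carrier (tensor_product R\<^sub>0 (\<Psi>\<^sub>0 M) V). \<forall>d \<in> carrier (tensor_product R\<^sub>0 (\<Psi>\<^sub>0 M) V).
        h (c \<oplus>\<^bsub>tensor_product R\<^sub>0 (\<Psi>\<^sub>0 M) V\<^esub> d) = h c \<oplus>\<^bsub>M\<^esub> h d) \<and>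
     (\<forall>m \<in> mhomog M 0. \<forall>v \<in> homog L 1. h (tensor.tens R\<^sub>0 V (\<Psi>\<^sub>0 M) m v) = ract M m (\<psi> v)))"

end

section \<open>Multiplication as an isomorphism from \<open>M_0 \<otimes> L_1\<close> to
  \<open>M_1\<close>\<close>

locale comparison_module = comparison L A \<psi> \<gamma> + M: graded_right_module A M
  for L A :: "('k, 'a) galgebra" and \<psi> \<gamma> and M :: "('a, 'u) grmodule"
begin

sublocale T: tensor R\<^sub>0 R\<^sub>0 V "\<Psi>\<^sub>0 M"
  by (rule tensor_Psi[OF M.graded_right_module_axioms])

abbreviation "\<mu> \<equiv> mult_map M"

lemma act_closed: "m \<in> mhomog M 0 \<Longrightarrow> v \<in> homog L 1 \<Longrightarrow> ract M m (\<psi> v) \<in> mhomog M 1"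
  using M.homog_act[OF _ psi_closed(2), of m 0 v] by simp

lemma mult_map: "c \<in> carrier T.T \<Longrightarrow> \<mu> c \<in> carrier M"
    "\<lbrakk>c \<in> carrier T.T; d \<in> carrier T.T\<rbrakk> \<Longrightarrow> \<mu> (c \<oplus>\<^bsub>T.T\<^esub> d) = \<mu> c \<oplus>\<^bsub>M\<^esub> \<mu> d"
    "\<lbrakk>m \<in> mhomog M 0; v \<in> homog L 1\<rbrakk> \<Longrightarrow> \<mu> (T.tens m v) = ract M m (\<psi> v)"
proof -
  have "\<exists>h. (\<forall>c \<in> carrier T.T. h c \<in> carrier M) \<and>
     (\<forall>c \<in> carrier T.T. \<forall>d \<in> carrier T.T. h (c \<oplus>\<^bsub>T.T\<^esub> d) = h c \<oplus>\<^bsub>M\<^esub> h d) \<and>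
     (\<forall>m \<in> carrier (\<Psi>\<^sub>0 M). \<forall>v \<in> carrier V. h (T.tens m v) = ract M m (\<psi> v))"
    by (rule T.tensor_universal[OF M.M.abelian_group_axioms])
      (auto simp: M.G.D_carrier psi_carrier psi_add psi_left M.ract_closed M.ract_add_left
        M.ract_add_right M.ract_mult)
  from someI_ex[OF this]
  have h: "(\<forall>c \<in> carrier T.T. \<mu> c \<in> carrier M) \<and>
     (\<forall>c \<in> carrier T.T. \<forall>d \<in> carrier T.T. \<mu> (c \<oplus>\<^bsub>T.T\<^esub> d) = \<mu> c \<oplus>\<^bsub>M\<^esub> \<mu> d) \<and>
     (\<forall>m \<in> mhomog M 0. \<forall>v \<in> homog L 1. \<mu> (T.tens m v) = ract M m (\<psi> v))"
    by (simp add: mult_map_def)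
  then show "c \<in> carrier T.T \<Longrightarrow> \<mu> c \<in> carrier M"
    "\<lbrakk>c \<in> carrier T.T; d \<in> carrier T.T\<rbrakk> \<Longrightarrow> \<mu> (c \<oplus>\<^bsub>T.T\<^esub> d) = \<mu> c \<oplus>\<^bsub>M\<^esub> \<mu> d"
    "\<lbrakk>m \<in> mhomog M 0; v \<in> homog L 1\<rbrakk> \<Longrightarrow> \<mu> (T.tens m v) = ract M m (\<psi> v)" by blast+
qed

lemma mult_map_homog: "c \<in> carrier T.T \<Longrightarrow> \<mu> c \<in> mhomog M 1"
proof (induction rule: T.tensor_induct)
  case zero then show ?case
    using T.tensor_hom_zero(1)[OF M.M.abelian_group_axioms mult_map(1,2)] M.G.D_zero by simp
next
  case (neg c) then show ?case
    using T.tensor_hom_zero(2)[OF M.M.abelian_group_axioms mult_map(1,2)] M.G.D_minus by simp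
qed (auto simp: mult_map M.G.D_add act_closed)

text \<open>On elementary tensors this is \<open>\<psi> (v \<gamma>(s)) = \<psi> v \<psi> s\<close>.
  It says that \<open>\<mu>\<close> is linear on the pullback of the tensor product along
  \<open>\<gamma>\<close>, which is how the automorphism gets into the shift functor.\<close>

lemma mult_map_act:
  assumes c: "c \<in> carrier T.T" and s: "s \<in> homog L 0"
  shows "\<mu> (ract T.T c (\<gamma> s)) = ract M (\<mu> c) (\<psi> s)"
proof (rule T.tensor_hom_unique[OF M.M.abelian_group_axioms _ _ _ _ _ c])
  show "\<mu> (ract T.T (T.tens m v) (\<gamma> s)) = ract M (\<mu> (T.tens m v)) (\<psi> s)"
    if "m \<in> carrier (\<Psi>\<^sub>0 M)" "v \<in> carrier V" for m v
    using that s L.homog_mult[of v 1 "\<gamma> s" 0] T.ract_tens[of m v "\<gamma> s"]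
    by (simp add: gamma_closed mult_map(3) psi_right M.ract_mult M.G.D_carrier psi_carrier)
qed (use s in \<open>simp_all add: T.ract_T_closed T.ract_T_add gamma_closed mult_map(1,2) psi_carrier
      M.ract_closed M.ract_add_left\<close>)

text \<open>Write \<open>x = \<Sum> (x y) z\<close> with \<open>y\<close> of degree -1: then
  \<open>x y\<close> lies in \<open>M_0\<close>, and \<open>z\<close> has degree 1, so it comes from
  \<open>L_1\<close> through \<open>\<psi>\<close>.\<close>

lemma mult_map_surj:
  assumes x: "x \<in> mhomog M 1" shows "\<exists>c \<in> carrier T.T. \<mu> c = x"
proof -
  note xc = M.G.D_carrier[OF x]
  have "\<exists>c \<in> carrier T.T. \<mu> c = ract M x \<one>\<^bsub>A\<^esub>"
  proof (rule A.unit_induct[where n = "- 1"])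
    fix y z assume y: "y \<in> homog A (- 1)" and z: "z \<in> homog A (- (- 1))"
    have xy: "ract M x y \<in> mhomog M 0" using M.homog_act[OF x y] by simp
    obtain v where v: "v \<in> homog L 1" "z = \<psi> v" using psi_surj(2)[of z] z by auto
    have "\<mu> (T.tens (ract M x y) v) = ract M x (y \<otimes>\<^bsub>A\<^esub> z)"
      using mult_map(3)[OF xy v(1)] v(2) xc A.D_carrier[OF y] A.D_carrier[OF z] by (simp add: M.ract_mult)
    moreover have "T.tens (ract M x y) v \<in> carrier T.T" using xy v by (intro T.tens_closed) auto
    ultimately show "\<exists>c \<in> carrier T.T. \<mu> c = ract M x (y \<otimes>\<^bsub>A\<^esub> z)" by blast
  next
    fix u v assume uv: "u \<in> homog A 0" "v \<in> homog A 0"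
      and "\<exists>c \<in> carrier T.T. \<mu> c = ract M x u" "\<exists>c \<in> carrier T.T. \<mu> c = ract M x v"
    then obtain c d where "c \<in> carrier T.T" "\<mu> c = ract M x u" "d \<in> carrier T.T" "\<mu> d = ract M x v" by blast
    then show "\<exists>c \<in> carrier T.T. \<mu> c = ract M x (u \<oplus>\<^bsub>A\<^esub> v)"
      using uv xc by (intro bexI[of _ "c \<oplus>\<^bsub>T.T\<^esub> d"]) (simp_all add: mult_map(2) M.ract_add_right A.D_carrier)
  qed
  then show ?thesis using xc by (simp add: M.ract_one)
qed

text \<open>For \<open>u = y z\<close> with \<open>z\<close> of degree \<open>1\<close> a map \<open>\<nu>\<close> as below is \<open>x \<mapsto> x y \<otimes> z\<close>; at \<open>u = 1\<close> it inverts \<open>\<mu>\<close>.\<close>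

lemma mult_map_left_inverse:
  "\<exists>\<nu>. (\<forall>x \<in> mhomog M 1. \<nu> x \<in> carrier T.T) \<and>
    (\<forall>x \<in> mhomog M 1. \<forall>y \<in> mhomog M 1. \<nu> (x \<oplus>\<^bsub>M\<^esub> y) = \<nu> x \<oplus>\<^bsub>T.T\<^esub> \<nu> y) \<and>
    (\<forall>m \<in> mhomog M 0. \<forall>v \<in> homog L 1. \<nu> (ract M m (\<psi> v)) = T.tens m (\<phi> (\<psi> v \<otimes>\<^bsub>A\<^esub> \<one>\<^bsub>A\<^esub>)))"
    (is "?P \<one>\<^bsub>A\<^esub>")
proof (rule A.unit_induct[where n = "- 1"])
  fix y z assume y: "y \<in> homog A (- 1)" and "z \<in> homog A (- (- 1))"
  then have z: "z \<in> homog A 1" by simp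
  have xy: "ract M x y \<in> mhomog M 0" if "x \<in> mhomog M 1" for x using M.homog_act[OF that y] by simp
  show "?P (y \<otimes>\<^bsub>A\<^esub> z)"
  proof (intro exI[of _ "\<lambda>x. T.tens (ract M x y) (\<phi> z)"] conjI ballI)
    fix x assume x: "x \<in> mhomog M 1"
    then show "T.tens (ract M x y) (\<phi> z) \<in> carrier T.T" using xy phi(1)[OF z] by (intro T.tens_closed) auto
    fix x' assume x': "x' \<in> mhomog M 1"
    show "T.tens (ract M (x \<oplus>\<^bsub>M\<^esub> x') y) (\<phi> z) = T.tens (ract M x y) (\<phi> z) \<oplus>\<^bsub>T.T\<^esub> T.tens (ract M x' y) (\<phi> z)"
      using T.tens_add_left[of "ract M x y" "ract M x' y" "\<phi> z"] xy[OF x] xy[OF x'] phi(1)[OF z]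
      by (simp add: M.ract_add_left M.G.D_carrier[OF x] M.G.D_carrier[OF x'] A.D_carrier[OF y])
  next
    fix m v assume m: "m \<in> mhomog M 0" and v: "v \<in> homog L 1"
    note vc = psi_closed(2)[OF v]
    have "\<psi> v \<otimes>\<^bsub>A\<^esub> y \<in> homog A 0" using A.homog_mult[OF vc y] by simp
    \<comment> \<open>The product of \<open>\<psi> v\<close> and \<open>y\<close> has degree 0, so
      it is \<open>\<psi> r\<close> for some \<open>r\<close> in \<open>L_0\<close>. Balancing moves
      \<open>r\<close> from the left tensor factor to the right one.\<close>
    then obtain r where r: "r \<in> homog L 0" "\<psi> v \<otimes>\<^bsub>A\<^esub> y = \<psi> r" using psi_surj(1) by blast
    have rz: "r \<otimes>\<^bsub>L\<^esub> \<phi> z \<in> homog L 1" using L.homog_mult[OF r(1) phi(1)[OF z]] by simp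
    have "\<psi> v \<otimes>\<^bsub>A\<^esub> (y \<otimes>\<^bsub>A\<^esub> z) = \<psi> r \<otimes>\<^bsub>A\<^esub> z"
      using r(2) A.D_carrier[OF vc] A.D_carrier[OF y] A.D_carrier[OF z] by (simp add: A.R.m_assoc[symmetric])
    also have "\<dots> = \<psi> (r \<otimes>\<^bsub>L\<^esub> \<phi> z)" using psi_left[OF r(1) phi(1)[OF z]] phi(2)[OF z] by simp
    finally have "\<phi> (\<psi> v \<otimes>\<^bsub>A\<^esub> (y \<otimes>\<^bsub>A\<^esub> z)) = r \<otimes>\<^bsub>L\<^esub> \<phi> z" using phi(3)[OF rz] by simp
    moreover have "ract M (ract M m (\<psi> v)) y = ract M m (\<psi> r)"
      using r(2) M.ract_mult[of m "\<psi> v" y] M.G.D_carrier[OF m] A.D_carrier[OF vc] A.D_carrier[OF y] by simp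
    ultimately show "T.tens (ract M (ract M m (\<psi> v)) y) (\<phi> z) = T.tens m (\<phi> (\<psi> v \<otimes>\<^bsub>A\<^esub> (y \<otimes>\<^bsub>A\<^esub> z)))"
      using T.tens_balanced[of m r "\<phi> z"] m r(1) phi(1)[OF z] by simp
  qed
next
  fix u u' assume u: "u \<in> homog A 0" and u': "u' \<in> homog A 0" and P: "?P u" "?P u'"
  obtain \<nu> where v1: "\<forall>x \<in> mhomog M 1. \<nu> x \<in> carrier T.T"
    and v2: "\<forall>x \<in> mhomog M 1. \<forall>y \<in> mhomog M 1. \<nu> (x \<oplus>\<^bsub>M\<^esub> y) = \<nu> x \<oplus>\<^bsub>T.T\<^esub> \<nu> y"
    and v3: "\<forall>m \<in> mhomog M 0. \<forall>v \<in> homog L 1. \<nu> (ract M m (\<psi> v)) = T.tens m (\<phi> (\<psi> v \<otimes>\<^bsub>A\<^esub> u))"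
    using P(1) by (elim exE conjE) (rule that)
  note \<nu> = v1[rule_format] v2[rule_format] v3[rule_format]
  obtain \<nu>' where v1: "\<forall>x \<in> mhomog M 1. \<nu>' x \<in> carrier T.T"
    and v2: "\<forall>x \<in> mhomog M 1. \<forall>y \<in> mhomog M 1. \<nu>' (x \<oplus>\<^bsub>M\<^esub> y) = \<nu>' x \<oplus>\<^bsub>T.T\<^esub> \<nu>' y"
    and v3: "\<forall>m \<in> mhomog M 0. \<forall>v \<in> homog L 1. \<nu>' (ract M m (\<psi> v)) = T.tens m (\<phi> (\<psi> v \<otimes>\<^bsub>A\<^esub> u'))"
    using P(2) by (elim exE conjE) (rule that)
  note \<nu>' = v1[rule_format] v2[rule_format] v3[rule_format]
  show "?P (u \<oplus>\<^bsub>A\<^esub> u')"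
  proof (intro exI[of _ "\<lambda>x. \<nu> x \<oplus>\<^bsub>T.T\<^esub> \<nu>' x"] conjI ballI)
    fix m v assume m: "m \<in> mhomog M 0" and v: "v \<in> homog L 1"
    note vc = psi_closed(2)[OF v]
    have c: "\<psi> v \<otimes>\<^bsub>A\<^esub> u \<in> homog A 1" "\<psi> v \<otimes>\<^bsub>A\<^esub> u' \<in> homog A 1"
      using A.homog_mult[OF vc u] A.homog_mult[OF vc u'] by simp_all
    show "\<nu> (ract M m (\<psi> v)) \<oplus>\<^bsub>T.T\<^esub> \<nu>' (ract M m (\<psi> v)) = T.tens m (\<phi> (\<psi> v \<otimes>\<^bsub>A\<^esub> (u \<oplus>\<^bsub>A\<^esub> u')))"
      using T.tens_add_right[of m "\<phi> (\<psi> v \<otimes>\<^bsub>A\<^esub> u)" "\<phi> (\<psi> v \<otimes>\<^bsub>A\<^esub> u')"] m c phi(1)[OF c(1)] phi(1)[OF c(2)]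
        A.D_carrier[OF vc] A.D_carrier[OF u] A.D_carrier[OF u']
      by (simp add: \<nu>(3)[OF m v] \<nu>'(3)[OF m v] A.R.r_distr phi_add)
  qed (simp_all add: \<nu>(1,2) \<nu>'(1,2) T.T.a_ac)
qed

text \<open>At the unit, the map \<open>\<nu>\<close> of the preceding lemma undoes
  \<open>\<mu>\<close> on elementary tensors and hence everywhere. This gives injectivity.\<close>

lemma mult_map_bij: "bij_betw \<mu> (carrier T.T) (mhomog M 1)"
proof -
  obtain \<nu> where v1: "\<forall>x \<in> mhomog M 1. \<nu> x \<in> carrier T.T"
    and v2: "\<forall>x \<in> mhomog M 1. \<forall>y \<in> mhomog M 1. \<nu> (x \<oplus>\<^bsub>M\<^esub> y) = \<nu> x \<oplus>\<^bsub>T.T\<^esub> \<nu> y"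
    and v3: "\<forall>m \<in> mhomog M 0. \<forall>v \<in> homog L 1. \<nu> (ract M m (\<psi> v)) = T.tens m (\<phi> (\<psi> v \<otimes>\<^bsub>A\<^esub> \<one>\<^bsub>A\<^esub>))"
    using mult_map_left_inverse by (elim exE conjE) (rule that)
  note \<nu> = v1[rule_format] v2[rule_format] v3[rule_format]
  have "\<nu> (\<mu> c) = c" if c: "c \<in> carrier T.T" for c
  proof (rule T.tensor_hom_unique[OF T.abelian_group_T _ _ _ _ _ c])
    show "\<nu> (\<mu> (T.tens m v)) = T.tens m v" if "m \<in> carrier (\<Psi>\<^sub>0 M)" "v \<in> carrier V" for m v
      using that \<nu>(3)[of m v] A.D_carrier[OF psi_closed(2)[of v]] by (simp add: mult_map(3) phi(3))
  qed (simp_all add: \<nu>(1,2) mult_map(2) mult_map_homog)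
  then have "inj_on \<mu> (carrier T.T)" by (rule inj_on_inverseI)
  then show ?thesis
    using mult_map_homog mult_map_surj unfolding bij_betw_def by blast
qed

lemma small_T:
  assumes "infinite (UNIV :: 'u set)" "carrier L \<lesssim> (UNIV :: 'u set)"
  shows "carrier T.T \<lesssim> (UNIV :: 'u set)"
proof (rule T.tensor_lepoll[OF assms(1)])
  show "carrier V \<lesssim> (UNIV :: 'u set)"
    using lepoll_trans[OF subset_imp_lepoll assms(2), of "homog L 1"] L.D_carrier by auto
qed (auto intro: subset_imp_lepoll)

end

context comparison
begin

definition mult_iso :: "('a, 'u) grmodule \<Rightarrow> 'u \<Rightarrow> 'u" where
  "mult_iso M = (let X = carrier (tensor_product R\<^sub>0 (\<Psi>\<^sub>0 M) V) in
     (\<lambda>y \<in> small_inj X ` X. mult_map M (inv_into X (small_inj X) y)))"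

lemma cat_functor_Theta:
  assumes "infinite (UNIV :: 'u set)" "carrier L \<lesssim> (UNIV :: 'u set)"
  shows "cat_functor (Mod_cat R\<^sub>0 :: (('a, 'u) rmodule, 'u \<Rightarrow> 'u) cat) (Mod_cat R\<^sub>0) \<Theta>"
proof (rule cat_functor_comp[OF bimod.cat_functor_tensor[OF L.bimod_homog assms(1)] cat_functor_pullback[OF ring_R0 gamma_hom]])
  show "carrier V \<lesssim> (UNIV :: 'u set)"
    using lepoll_trans[OF subset_imp_lepoll assms(2), of "homog L 1"] L.D_carrier by auto
qed

text \<open>Naturality comes down to \<open>f (m \<psi>(v)) = f(m) \<psi>(v)\<close> for a graded
  linear map \<open>f\<close>. The rest transports \<open>\<mu>\<close> along the injections that
  make tensor products small modules.\<close>

lemma nat_isomorphic_shift: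
  assumes U: "infinite (UNIV :: 'u set)" "carrier L \<lesssim> (UNIV :: 'u set)"
  shows "nat_isomorphic (Gr_cat A :: (('a, 'u) grmodule, 'u \<Rightarrow> 'u) cat) (Mod_cat R\<^sub>0)
    (comp_functr \<Theta> \<Psi>) (comp_functr \<Psi> shift_functor)"
  unfolding nat_isomorphic_def
proof (rule exI[of _ mult_iso], intro conjI ballI)
  fix M :: "('a, 'u) grmodule" assume "M \<in> cobj (Gr_cat A)"
  then have M: "graded_right_module A M" by simp
  interpret M: comparison_module L A \<psi> \<gamma> M by (intro comparison_module.intro comparison_axioms M)
  let ?j = "small_inj (carrier M.T.T) :: _ \<Rightarrow> 'u"
  have jinj: "inj_on ?j (carrier M.T.T)" using small_inj[OF M.small_T[OF U]] .
  interpret j: image_module R\<^sub>0 M.T.T ?j by (rule image_module_inj[OF M.T.right_module_T jinj])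
  have \<Theta>obj: "fobj (comp_functr \<Theta> \<Psi>) M = (image_copy ?j M.T.T)\<lparr>ract := (\<lambda>x b. ract (image_copy ?j M.T.T) x (\<gamma> b))\<rparr>"
    by (subst fobj_comp_functr, subst fobj_Psi) (simp add: tensor_functor_def small_copy_eq)
  have shobj: "fobj (comp_functr \<Psi> shift_functor) K = \<Psi>\<^sub>0 (fobj shift_functor K)" for K :: "('a, 'u) grmodule"
    by (simp only: fobj_comp_functr \<Psi>\<^sub>0_def)
  have iso_app: "mult_iso M (?j c) = M.\<mu> c" if "c \<in> carrier M.T.T" for c
    using that jinj by (simp add: mult_iso_def Let_def)
  show "is_isomorphism (Mod_cat R\<^sub>0) (fobj (comp_functr \<Theta> \<Psi>) M) (fobj (comp_functr \<Psi> shift_functor) M) (mult_iso M)"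
    unfolding \<Theta>obj shobj
  proof (rule Mod_cat_isoI)
    show "right_module R\<^sub>0 ((image_copy ?j M.T.T)\<lparr>ract := (\<lambda>x b. ract (image_copy ?j M.T.T) x (\<gamma> b))\<rparr>)"
      by (rule right_module_pullback[OF j.right_module_image_copy ring_R0 gamma_hom])
    show "mult_iso M \<in> rmodule_hom R\<^sub>0 ((image_copy ?j M.T.T)\<lparr>ract := (\<lambda>x b. ract (image_copy ?j M.T.T) x (\<gamma> b))\<rparr>)
        (\<Psi>\<^sub>0 (fobj shift_functor M))"
    proof (rule rmodule_homI)
      show "mult_iso M \<in> extensional (carrier ((image_copy ?j M.T.T)\<lparr>ract := (\<lambda>x b. ract (image_copy ?j M.T.T) x (\<gamma> b))\<rparr>))"
        by (simp add: mult_iso_def Let_def)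
    qed (auto simp: iso_app M.mult_map_homog j.add_image_copy j.ract_image_copy M.mult_map(2) M.mult_map_act
        M.T.ract_T_closed gamma_closed)
    have "bij_betw (inv_into (carrier M.T.T) ?j) (?j ` carrier M.T.T) (carrier M.T.T)"
      using jinj by (intro bij_betw_inv_into) (simp add: bij_betw_def)
    from bij_betw_trans[OF this M.mult_map_bij]
    have "bij_betw (mult_iso M) (?j ` carrier M.T.T) (mhomog M 1)"
      by (rule bij_betw_cong[THEN iffD1, rotated]) (simp add: mult_iso_def Let_def)
    then show "bij_betw (mult_iso M) (carrier ((image_copy ?j M.T.T)\<lparr>ract := (\<lambda>x b. ract (image_copy ?j M.T.T) x (\<gamma> b))\<rparr>))
        (carrier (\<Psi>\<^sub>0 (fobj shift_functor M)))"
      by simp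
  qed
  fix N :: "('a, 'u) grmodule" and f assume "N \<in> cobj (Gr_cat A)" and f: "f \<in> chom (Gr_cat A) M N"
  then have N: "graded_right_module A N" by simp
  interpret N: comparison_module L A \<psi> \<gamma> N by (intro comparison_module.intro comparison_axioms N)
  let ?k = "small_inj (carrier N.T.T) :: _ \<Rightarrow> 'u"
  have kinj: "inj_on ?k (carrier N.T.T)" using small_inj[OF N.small_T[OF U]] .
  have iso_app': "mult_iso N (?k c) = N.\<mu> c" if "c \<in> carrier N.T.T" for c
    using that kinj by (simp add: mult_iso_def Let_def)
  define f' where "f' = restrict f (mhomog M 0)"
  have f': "f' x = f x" if "x \<in> mhomog M 0" for x using that by (simp add: f'_def)
  have f0: "f' \<in> rmodule_hom R\<^sub>0 (\<Psi>\<^sub>0 M) (\<Psi>\<^sub>0 N)"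
    using A.degree_part_hom[OF M f] psi_closed(1) by (auto simp: rmodule_hom_def f'_def)
  note m = bimod.tensor_map_hom[OF L.bimod_homog[of 1] right_module_Psi[OF M] right_module_Psi[OF N] f0]
  have fh: "f \<in> rmodule_hom A M N" and fdeg: "\<And>n x. x \<in> mhomog M n \<Longrightarrow> f x \<in> mhomog N n" using f by auto
  have key: "N.\<mu> (tensor_map R\<^sub>0 V (\<Psi>\<^sub>0 N) f' c) = f (M.\<mu> c)" if c: "c \<in> carrier M.T.T" for c
  proof (rule M.T.tensor_hom_unique[OF N.M.M.abelian_group_axioms _ _ _ _ _ c])
    show "N.\<mu> (tensor_map R\<^sub>0 V (\<Psi>\<^sub>0 N) f' (M.T.tens n b)) = f (M.\<mu> (M.T.tens n b))"
      if "n \<in> carrier (\<Psi>\<^sub>0 M)" "b \<in> carrier V" for n b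
      using that m fdeg[of n 0] rmodule_hom_act[OF fh, of n "\<psi> b"] M.M.G.D_carrier[of n 0] psi_carrier(2)[of b]
      by (simp add: M.mult_map(3) N.mult_map(3) f')
  qed (use m in \<open>simp_all add: M.mult_map(1,2) N.mult_map(1,2) rmodule_hom_closed[OF fh] rmodule_hom_add[OF fh]\<close>)
  have fm: "fmap (tensor_functor R\<^sub>0 V) (\<Psi>\<^sub>0 M) (\<Psi>\<^sub>0 N) f' (?j c) = ?k (tensor_map R\<^sub>0 V (\<Psi>\<^sub>0 N) f' c)"
    if "c \<in> carrier M.T.T" for c
    using bimod.fmap_tensor_functor[OF L.bimod_homog jinj that] .
  show "ccomp (Mod_cat R\<^sub>0) (fobj (comp_functr \<Theta> \<Psi>) M) (fobj (comp_functr \<Theta> \<Psi>) N) (fobj (comp_functr \<Psi> shift_functor) N)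
        (mult_iso N) (fmap (comp_functr \<Theta> \<Psi>) M N f)
      = ccomp (Mod_cat R\<^sub>0) (fobj (comp_functr \<Theta> \<Psi>) M) (fobj (comp_functr \<Psi> shift_functor) M) (fobj (comp_functr \<Psi> shift_functor) N)
        (fmap (comp_functr \<Psi> shift_functor) M N f) (mult_iso M)"
  proof
    fix y
    have carr: "carrier (fobj (comp_functr \<Theta> \<Psi>) M) = ?j ` carrier M.T.T"
      using \<Theta>obj by simp
    have fT: "fmap (comp_functr \<Theta> \<Psi>) M N f = fmap (tensor_functor R\<^sub>0 V) (\<Psi>\<^sub>0 M) (\<Psi>\<^sub>0 N) f'"
      by (simp add: \<Psi>\<^sub>0_def f'_def)
    show "ccomp (Mod_cat R\<^sub>0) (fobj (comp_functr \<Theta> \<Psi>) M) (fobj (comp_functr \<Theta> \<Psi>) N) (fobj (comp_functr \<Psi> shift_functor) N)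
        (mult_iso N) (fmap (comp_functr \<Theta> \<Psi>) M N f) y
      = ccomp (Mod_cat R\<^sub>0) (fobj (comp_functr \<Theta> \<Psi>) M) (fobj (comp_functr \<Psi> shift_functor) M) (fobj (comp_functr \<Psi> shift_functor) N)
        (fmap (comp_functr \<Psi> shift_functor) M N f) (mult_iso M) y"
    proof (cases "y \<in> ?j ` carrier M.T.T")
      case True
      then obtain c where c: "c \<in> carrier M.T.T" "y = ?j c" by blast
      have tc: "tensor_map R\<^sub>0 V (\<Psi>\<^sub>0 N) f' c \<in> carrier N.T.T" using m c(1) by blast
      show ?thesis
        unfolding ccomp_Mod_cat compose_def carr fT
        using True iso_app'[OF tc] key[OF c(1)] M.mult_map_homog[OF c(1)]
        by (simp add: c(2) fm[OF c(1)] iso_app[OF c(1)] del: fobj_comp_functr fmap_comp_functr)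
          (simp add: iso_app[OF c(1)])
    next
      case False
      then show ?thesis unfolding ccomp_Mod_cat compose_def carr by simp
    qed
  qed
qed

text \<open>The degree-zero part of the copy of \<open>A\<close> and the copy of \<open>L_0\<close>
  sit in the universe along unrelated injections. Read through both, \<open>\<psi>\<close> is an
  isomorphism because it is a bijective ring homomorphism in degree 0; it is built from the side of
  \<open>L_0\<close> and then reversed.\<close>

lemma regular_isomorphic:
  assumes small: "carrier A \<lesssim> (UNIV :: 'u set)" "carrier L \<lesssim> (UNIV :: 'u set)"
  shows "isomorphic_in (Mod_cat R\<^sub>0 :: (('a, 'u) rmodule, 'u \<Rightarrow> 'u) cat) (\<Psi>\<^sub>0 (small_regular A)) (small_copy (regular_rmodule R\<^sub>0))"
proof -
  interpret r: right_module R\<^sub>0 "regular_rmodule R\<^sub>0" by (rule right_module_regular[OF ring_R0])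
  interpret s: right_module A "regular_rmodule A" by (rule right_module_regular[OF A.R.ring_axioms])
  have rc: "carrier (regular_rmodule R\<^sub>0) = homog L 0" "add (regular_rmodule R\<^sub>0) = add L" "ract (regular_rmodule R\<^sub>0) = mult L"
    and sc: "carrier (regular_rmodule A) = carrier A" "add (regular_rmodule A) = add A" "ract (regular_rmodule A) = mult A"
    by (simp_all add: regular_rmodule_def)
  let ?j = "small_inj (homog L 0) :: _ \<Rightarrow> 'u" and ?k = "small_inj (carrier A) :: _ \<Rightarrow> 'u"
  have "homog L 0 \<lesssim> (UNIV :: 'u set)"
    using lepoll_trans[OF subset_imp_lepoll small(2), of "homog L 0"] L.D_carrier by auto
  then have j: "inj_on ?j (homog L 0)" by (rule small_inj)
  have k: "inj_on ?k (carrier A)" by (rule small_inj[OF small(1)])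
  interpret j: image_module R\<^sub>0 "regular_rmodule R\<^sub>0" ?j
    by (rule image_module_inj[OF r.right_module_axioms]) (simp add: rc j)
  interpret k: image_module A "regular_rmodule A" ?k
    by (rule image_module_inj[OF s.right_module_axioms]) (simp add: sc k)
  let ?M = "\<Psi>\<^sub>0 (small_regular A :: ('a, 'u) grmodule)" and ?N = "small_copy (regular_rmodule R\<^sub>0) :: ('a, 'u) rmodule"
  have N: "?N = image_copy ?j (regular_rmodule R\<^sub>0)" by (simp add: small_copy_eq rc)
  have Mc: "carrier ?M = ?k ` homog A 0" "add ?M = add (image_copy ?k (regular_rmodule A))"
    "ract ?M = (\<lambda>x b. ract (image_copy ?k (regular_rmodule A)) x (\<psi> b))"
    by (simp_all add: \<Psi>\<^sub>0_def small_regular_def small_copy_eq sc)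
  let ?e = "\<lambda>x \<in> ?j ` homog L 0. ?k (\<psi> (inv_into (homog L 0) ?j x))"
  have e: "?e (?j r) = ?k (\<psi> r)" if "r \<in> homog L 0" for r using that j by simp
  have mc: "r \<otimes>\<^bsub>L\<^esub> s \<in> homog L 0" if "r \<in> homog L 0" "s \<in> homog L 0" for r s using L.homog_mult[OF that] by simp
  have ph: "\<psi> (r \<otimes>\<^bsub>L\<^esub> s) = \<psi> r \<otimes>\<^bsub>A\<^esub> \<psi> s" "\<psi> (r \<oplus>\<^bsub>L\<^esub> s) = \<psi> r \<oplus>\<^bsub>A\<^esub> \<psi> s"
    if "r \<in> homog L 0" "s \<in> homog L 0" for r s
    using ring_hom_mult[OF psi_hom, of r s] ring_hom_add[OF psi_hom, of r s] that by simp_all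
  have pc: "\<psi> r \<in> carrier A" if "r \<in> homog L 0" for r using A.D_carrier[OF psi_closed(1)[OF that]] .
  have "is_isomorphism (Mod_cat R\<^sub>0) ?N ?M ?e"
  proof (rule Mod_cat_isoI)
    show "right_module R\<^sub>0 ?N" using j.right_module_image_copy by (simp add: N)
    show "?e \<in> rmodule_hom R\<^sub>0 ?N ?M"
    proof (rule rmodule_homI)
      fix x y assume "x \<in> carrier ?N" "y \<in> carrier ?N"
      then obtain r s where rs: "r \<in> homog L 0" "x = ?j r" "s \<in> homog L 0" "y = ?j s" by (auto simp: N rc)
      show "?e (x \<oplus>\<^bsub>?N\<^esub> y) = ?e x \<oplus>\<^bsub>?M\<^esub> ?e y"
        using j.add_image_copy[of r s] k.add_image_copy[of "\<psi> r" "\<psi> s"] rs e[OF rs(1)] e[OF rs(3)] e[OF L.D_add[OF rs(1,3)]]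
          ph(2)[OF rs(1,3)] pc
        by (simp only: N Mc rc sc)
    next
      fix x a assume "x \<in> carrier ?N" and a: "a \<in> carrier R\<^sub>0"
      then obtain r where r: "r \<in> homog L 0" "x = ?j r" by (auto simp: N rc)
      have a': "a \<in> homog L 0" using a by simp
      show "?e (ract ?N x a) = ract ?M (?e x) a"
        using j.ract_image_copy[of r a] k.ract_image_copy[of "\<psi> r" "\<psi> a"] r a' e[OF r(1)] e[OF mc[OF r(1) a']]
          ph(1)[OF r(1) a'] pc
        by (simp only: N Mc rc sc degree_zero_simps)
    next
      fix x assume "x \<in> carrier ?N"
      then obtain r where r: "r \<in> homog L 0" "x = ?j r" by (auto simp: N rc)
      have "?k (\<psi> r) \<in> carrier ?M" unfolding Mc using psi_closed(1)[OF r(1)] by blast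
      then show "?e x \<in> carrier ?M" by (simp only: r(2) e[OF r(1)])
    qed (simp add: N rc)
    have "bij_betw (inv_into (homog L 0) ?j) (?j ` homog L 0) (homog L 0)"
      using j by (intro bij_betw_inv_into) (simp add: bij_betw_def)
    moreover have "bij_betw ?k (homog A 0) (?k ` homog A 0)"
      using inj_on_subset[OF k, of "homog A 0"] A.D_carrier by (auto simp: bij_betw_def)
    ultimately have "bij_betw (?k \<circ> (\<psi> \<circ> inv_into (homog L 0) ?j)) (?j ` homog L 0) (?k ` homog A 0)"
      using psi_bij0 by (meson bij_betw_trans)
    then have "bij_betw ?e (?j ` homog L 0) (?k ` homog A 0)"
      by (rule bij_betw_cong[THEN iffD1, rotated]) simp
    then show "bij_betw ?e (carrier ?N) (carrier ?M)" by (simp only: N Mc carrier_image_copy rc)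
  qed
  then have "isomorphic_in (Mod_cat R\<^sub>0) ?N ?M" by (auto simp: isomorphic_in_def)
  moreover have "right_module R\<^sub>0 ?N" using j.right_module_image_copy by (simp add: N)
  moreover have "right_module R\<^sub>0 ?M" by (rule right_module_Psi[OF A.graded_right_module_small_regular[OF small(1)]])
  ultimately show ?thesis using category.isomorphic_sym[OF category_Mod_cat[of R\<^sub>0], of ?N ?M] by simp
qed

text \<open>The triple on the right depends on \<open>A\<close> only through
  \<open>\<gamma>\<close>. Algebras that are compared with the same \<open>L\<close> can therefore
  differ at most by the pullback in the shift.\<close>

theorem triple_equiv_proj:
  assumes U: "infinite (UNIV :: 'u set)" and small: "carrier A \<lesssim> (UNIV :: 'u set)" "carrier L \<lesssim> (UNIV :: 'u set)"
  shows "triple_equiv (proj TYPE('u) A) (Mod_cat R\<^sub>0 :: (('a, 'u) rmodule, 'u \<Rightarrow> 'u) cat, small_copy (regular_rmodule R\<^sub>0), \<Theta>)"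
proof -
  have G: "is_equivalence (Gr_cat A :: (('a, 'u) grmodule, 'u \<Rightarrow> 'u) cat) (Mod_cat R\<^sub>0) \<Psi>"
    by (rule is_equivalence_Psi[OF U small(1)])
  then have cG: "cat_functor (Gr_cat A :: (('a, 'u) grmodule, 'u \<Rightarrow> 'u) cat) (Mod_cat R\<^sub>0) \<Psi>"
    by (simp add: is_equivalence_def)
  have nat: "nat_isomorphic (Gr_cat A :: (('a, 'u) grmodule, 'u \<Rightarrow> 'u) cat) (Mod_cat R\<^sub>0)
      (comp_functr \<Psi> shift_functor) (comp_functr \<Theta> \<Psi>)"
    by (rule nat_iso_sym[OF cat_functor_comp[OF cG cat_functor_Theta[OF U small(2)]]
          cat_functor_comp[OF cat_functor_shift cG] nat_isomorphic_shift[OF U small(2)]])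
  have reg: "right_module R\<^sub>0 (small_copy (regular_rmodule R\<^sub>0) :: ('a, 'u) rmodule)"
  proof -
    have "carrier (regular_rmodule R\<^sub>0) \<lesssim> (UNIV :: 'u set)"
      using lepoll_trans[OF subset_imp_lepoll small(2), of "homog L 0"] L.D_carrier by (auto simp: regular_rmodule_def)
    from image_module.right_module_image_copy[OF image_module_small[OF right_module_regular[OF ring_R0] this]]
    show ?thesis by (simp add: small_copy_eq)
  qed
  have "triple_equiv (Gr_cat A :: (('a, 'u) grmodule, 'u \<Rightarrow> 'u) cat, small_regular A, shift_functor)
      (Mod_cat R\<^sub>0 :: (('a, 'u) rmodule, 'u \<Rightarrow> 'u) cat, small_copy (regular_rmodule R\<^sub>0), \<Theta>)"
    using G nat reg regular_isomorphic[OF small, folded fobj_Psi] A.graded_right_module_small_regular[OF small(1)]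
      cat_functor_shift[of A] cat_functor_Theta[OF U small(2)]
    by (auto simp: triple_equiv_def is_triple_def simp del: fobj_comp_functr)
  with triple_equiv_sym[OF A.triple_equiv_Gr_proj[OF U small(1)]] show ?thesis
    by (rule triple_equiv_trans)
qed

end

section \<open>The free algebra\<close>

lemma poly_mapping_sum_single:
  fixes p :: "'w \<Rightarrow>\<^sub>0 'k::comm_monoid_add"
  shows "p = (\<Sum>w \<in> Poly_Mapping.keys p. Poly_Mapping.single w (Poly_Mapping.lookup p w))"
proof (rule poly_mapping_eqI)
  fix k
  have "(\<Sum>w \<in> Poly_Mapping.keys p. Poly_Mapping.lookup (Poly_Mapping.single w (Poly_Mapping.lookup p w)) k)
      = (\<Sum>w \<in> Poly_Mapping.keys p. if w = k then Poly_Mapping.lookup p k else 0)"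
    by (intro sum.cong) (auto simp: lookup_single when_def)
  also have "\<dots> = Poly_Mapping.lookup p k"
    by (auto simp: sum.delta in_keys_iff)
  finally show "Poly_Mapping.lookup p k
      = Poly_Mapping.lookup (\<Sum>w \<in> Poly_Mapping.keys p. Poly_Mapping.single w (Poly_Mapping.lookup p w)) k"
    by (simp add: lookup_sum)
qed

lemma poly_mapping_single_induct [consumes 1, case_names zero single add]:
  fixes p :: "'w \<Rightarrow>\<^sub>0 'k::comm_monoid_add"
  assumes "Poly_Mapping.keys p \<subseteq> S" and zero: "P 0"
    and single: "\<And>w c. w \<in> S \<Longrightarrow> P (Poly_Mapping.single w c)"
    and add: "\<And>p q. \<lbrakk>Poly_Mapping.keys p \<subseteq> S; Poly_Mapping.keys q \<subseteq> S; P p; P q\<rbrakk> \<Longrightarrow> P (p + q)"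
  shows "P p"
proof -
  have "Poly_Mapping.keys (\<Sum>w \<in> A. Poly_Mapping.single w (Poly_Mapping.lookup p w)) \<subseteq> S \<and>
      P (\<Sum>w \<in> A. Poly_Mapping.single w (Poly_Mapping.lookup p w))"
    if "finite A" "A \<subseteq> S" for A
    using that
  proof induction
    case (insert w A)
    let ?a = "Poly_Mapping.single w (Poly_Mapping.lookup p w)"
    let ?b = "\<Sum>w \<in> A. Poly_Mapping.single w (Poly_Mapping.lookup p w)"
    have a: "Poly_Mapping.keys ?a \<subseteq> S" "P ?a" using insert.prems single by auto
    have b: "Poly_Mapping.keys ?b \<subseteq> S" "P ?b" using insert by auto
    have "Poly_Mapping.keys (?a + ?b) \<subseteq> S" using keys_add[of ?a ?b] a(1) b(1) by blast
    then show ?case using add[OF a(1) b(1) a(2) b(2)] insert.hyps by simp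
  qed (simp add: zero)
  from this[OF finite_keys assms(1)] show ?thesis using poly_mapping_sum_single[of p] by simp
qed

text \<open>The additive extension of a map given on monomials \<open>c w\<close>. The coefficient
  is an argument of \<open>F\<close>, so that projection to a degree (\<open>homog_part\<close>) and
  rewriting of words (\<open>word_map\<close>) are both instances.\<close>

definition lin :: "('w \<Rightarrow> 'k \<Rightarrow> 'b) \<Rightarrow> ('w \<Rightarrow>\<^sub>0 'k::zero) \<Rightarrow> 'b::comm_monoid_add" where
  "lin F p = (\<Sum>w \<in> Poly_Mapping.keys p. F w (Poly_Mapping.lookup p w))"

locale additive_family =
  fixes F :: "'w \<Rightarrow> 'k::comm_monoid_add \<Rightarrow> 'b::comm_monoid_add"
  assumes F_zero [simp]: "F w 0 = 0" and F_add: "F w (a + b) = F w a + F w b"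
begin

lemma lin_superset:
  "\<lbrakk>finite A; Poly_Mapping.keys p \<subseteq> A\<rbrakk> \<Longrightarrow> lin F p = (\<Sum>w \<in> A. F w (Poly_Mapping.lookup p w))"
  unfolding lin_def by (intro sum.mono_neutral_left) (auto simp: in_keys_iff)

lemma lin_zero [simp]: "lin F 0 = 0"
  by (simp add: lin_def)

lemma lin_single [simp]: "lin F (Poly_Mapping.single w c) = F w c"
  by (simp add: lin_def)

lemma lin_add: "lin F (p + q) = lin F p + lin F q"
proof -
  let ?A = "Poly_Mapping.keys p \<union> Poly_Mapping.keys q"
  have "lin F (p + q) = (\<Sum>w \<in> ?A. F w (Poly_Mapping.lookup (p + q) w))"
    by (rule lin_superset) (auto dest: subsetD[OF keys_add])
  also have "\<dots> = (\<Sum>w \<in> ?A. F w (Poly_Mapping.lookup p w)) + (\<Sum>w \<in> ?A. F w (Poly_Mapping.lookup q w))"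
    by (simp add: lookup_add F_add sum.distrib)
  also have "\<dots> = lin F p + lin F q" by (simp add: lin_superset[of ?A])
  finally show ?thesis .
qed

end

lemma lin_minus:
  fixes F :: "'w \<Rightarrow> 'k::ab_group_add \<Rightarrow> 'b::ab_group_add"
  assumes "additive_family F" shows "lin F (- p) = - lin F p" "lin F (p - q) = lin F p - lin F q"
proof -
  interpret additive_family F by fact
  have neg: "lin F (- p) = - lin F p" for p
    using lin_add[of p "- p"] by (simp add: eq_neg_iff_add_eq_0 add.commute)
  show "lin F (- p) = - lin F p" by (rule neg)
  show "lin F (p - q) = lin F p - lin F q" using lin_add[of p "- q"] neg[of q] by simp
qed

lemma letters_plus [simp]: "letters (u + v) = letters u @ letters v"
  and letters_zero [simp]: "letters 0 = []"
  by (simp_all add: plus_word_def zero_word_def)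

lemma word_eqI: "letters u = letters v \<Longrightarrow> u = v"
  by (cases u; cases v) simp

lemma word_degree_plus [simp]: "word_degree (u + v) = word_degree u + word_degree v"
  by (simp add: word_degree_def)

lemma word_degree_zero [simp]: "word_degree 0 = 0"
  by (simp add: word_degree_def)

lemma word_degree_single [simp]: "word_degree (Word [g]) = gen_degree g"
  by (simp add: word_degree_def)

text \<open>Scalars are the multiples of the empty word. Scaling thereby becomes a product with a
  monomial of degree 0 and falls under the rules for products.\<close>

lemma scale_elem_eq: "scale_elem c p = Poly_Mapping.single 0 c * p"
proof -
  have scale: "Poly_Mapping.lookup (scale_elem c p) w = c * Poly_Mapping.lookup p w" for w and p :: "('a, 'b, 'c) free_elem"
    by (simp add: scale_elem_def map.rep_eq when_def)
  have add: "scale_elem c (p + q) = scale_elem c p + scale_elem c q" for p q :: "('a, 'b, 'c) free_elem"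
    by (rule poly_mapping_eqI) (simp add: scale lookup_add distrib_left)
  have "Poly_Mapping.keys p \<subseteq> UNIV" by simp
  then show ?thesis
  proof (induction rule: poly_mapping_single_induct)
    case zero show ?case by (rule poly_mapping_eqI) (simp add: scale)
  next
    case (single w d)
    show ?case by (rule poly_mapping_eqI) (simp add: scale mult_single lookup_single when_def)
  qed (simp add: add distrib_left)
qed

lemma single_zero_commute:
  fixes p :: "'g word \<Rightarrow>\<^sub>0 'k::field"
  shows "p * Poly_Mapping.single 0 c = Poly_Mapping.single 0 c * p"
proof -
  have "Poly_Mapping.keys p \<subseteq> UNIV" by simp
  then show ?thesis
    by (induction rule: poly_mapping_single_induct)
      (simp_all add: mult_single mult.commute distrib_left distrib_right)
qed

definition homog_part :: "int \<Rightarrow> ('v, 'e, 'k::field) free_elem \<Rightarrow> ('v, 'e, 'k) free_elem" where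
  "homog_part n = lin (\<lambda>w c. if word_degree w = n then Poly_Mapping.single w c else 0)"

interpretation homog_part: additive_family "\<lambda>w c. if word_degree w = n then Poly_Mapping.single w c else 0"
  by standard (simp_all add: single_add)

lemma homog_part_simps [simp]: "homog_part n 0 = 0"
  "homog_part n (Poly_Mapping.single w c) = (if word_degree w = n then Poly_Mapping.single w c else 0)"
  "homog_part n (p + q) = homog_part n p + homog_part n q"
  "homog_part n (p - q) = homog_part n p - homog_part n q"
  using homog_part.lin_add lin_minus[OF homog_part.additive_family_axioms] by (simp_all add: homog_part_def)

lemma lookup_homog_part:
  "Poly_Mapping.lookup (homog_part n p) w = (if word_degree w = n then Poly_Mapping.lookup p w else 0)"
proof -
  have "Poly_Mapping.keys p \<subseteq> UNIV" by simp
  then show ?thesis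
    by (induction rule: poly_mapping_single_induct) (auto simp: lookup_add lookup_single when_def)
qed

lemma keys_homog_part: "Poly_Mapping.keys (homog_part n p) = {w \<in> Poly_Mapping.keys p. word_degree w = n}"
  by (auto simp: in_keys_iff lookup_homog_part split: if_splits)

lemma homog_part_eq_self: "(\<And>w. w \<in> Poly_Mapping.keys p \<Longrightarrow> word_degree w = n) \<Longrightarrow> homog_part n p = p"
  by (rule poly_mapping_eqI) (auto simp: lookup_homog_part in_keys_iff)

lemma homog_part_eq_zero:
  "(\<And>w. w \<in> Poly_Mapping.keys p \<Longrightarrow> word_degree w = m) \<Longrightarrow> m \<noteq> n \<Longrightarrow> homog_part n p = 0"
  by (rule poly_mapping_eqI) (auto simp: lookup_homog_part in_keys_iff)

lemma homog_part_mult_single_left: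
  "homog_part n (Poly_Mapping.single w c * p) = Poly_Mapping.single w c * homog_part (n - word_degree w) p"
proof -
  have "Poly_Mapping.keys p \<subseteq> UNIV" by simp
  then show ?thesis
    by (induction rule: poly_mapping_single_induct) (auto simp: mult_single distrib_left)
qed

lemma homog_part_mult_single_right:
  "homog_part n (p * Poly_Mapping.single w c) = homog_part (n - word_degree w) p * Poly_Mapping.single w c"
proof -
  have "Poly_Mapping.keys p \<subseteq> UNIV" by simp
  then show ?thesis
    by (induction rule: poly_mapping_single_induct) (auto simp: mult_single distrib_right)
qed

section \<open>Leavitt path algebras\<close>

definition gen_words :: "('v, 'e) pre_digraph \<Rightarrow> ('v, 'e) gen word set" where
  "gen_words E = {w. letters w \<noteq> [] \<and> set (letters w) \<subseteq> generators E}"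

lemma free_alg_iff: "p \<in> free_alg E \<longleftrightarrow> Poly_Mapping.keys p \<subseteq> gen_words E"
  by (auto simp: free_alg_def gen_words_def)

lemma free_alg_zero [simp]: "0 \<in> free_alg E"
  and free_alg_add: "\<lbrakk>p \<in> free_alg E; q \<in> free_alg E\<rbrakk> \<Longrightarrow> p + q \<in> free_alg E"
  and free_alg_uminus: "p \<in> free_alg E \<Longrightarrow> - p \<in> free_alg E"
  and free_alg_diff: "\<lbrakk>p \<in> free_alg E; q \<in> free_alg E\<rbrakk> \<Longrightarrow> p - q \<in> free_alg E"
  and free_alg_single: "w \<in> gen_words E \<Longrightarrow> Poly_Mapping.single w c \<in> free_alg E"
  using keys_add[of p q] keys_diff[of p q] by (auto simp: free_alg_iff)

lemma free_alg_mult: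
  assumes "p \<in> free_alg E" "q \<in> free_alg E" shows "p * q \<in> free_alg E"
  using assms keys_mult[of p q] by (fastforce simp: free_alg_iff gen_words_def)

lemma free_alg_sum: "(\<And>i. i \<in> A \<Longrightarrow> f i \<in> free_alg E) \<Longrightarrow> sum f A \<in> free_alg E"
  by (induction A rule: infinite_finite_induct) (auto intro: free_alg_add)

lemma free_alg_gen: "g \<in> generators E \<Longrightarrow> gen_elem g \<in> free_alg E"
  by (auto simp: gen_elem_def gen_words_def intro!: free_alg_single)

lemma free_alg_homog_part: "p \<in> free_alg E \<Longrightarrow> homog_part n p \<in> free_alg E"
  by (auto simp: free_alg_iff keys_homog_part)

lemma free_alg_induct [consumes 1, case_names zero single add]:
  assumes "p \<in> free_alg E" "P 0" "\<And>w c. w \<in> gen_words E \<Longrightarrow> P (Poly_Mapping.single w c)"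
    "\<And>p q. \<lbrakk>p \<in> free_alg E; q \<in> free_alg E; P p; P q\<rbrakk> \<Longrightarrow> P (p + q)"
  shows "P p"
  using assms by (auto simp: free_alg_iff intro: poly_mapping_single_induct[of p "gen_words E" P])

lemma leavitt_ideal_uminus: "p \<in> leavitt_ideal E \<Longrightarrow> - p \<in> leavitt_ideal E"
  using leavitt_ideal.scale[of p E "- 1"] by (simp add: scale_elem_eq single_uminus)

text \<open>The closure rules of the ideal concern factors from the nonunital free algebra. A
  monomial on the empty word is not among them, but it acts by scaling.\<close>

lemma leavitt_ideal_single:
  assumes "set (letters w) \<subseteq> generators E" and p: "p \<in> leavitt_ideal E"
  shows "Poly_Mapping.single w c * p \<in> leavitt_ideal E" "p * Poly_Mapping.single w c \<in> leavitt_ideal E"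
proof -
  have "Poly_Mapping.single w c * p \<in> leavitt_ideal E \<and> p * Poly_Mapping.single w c \<in> leavitt_ideal E"
  proof (cases "letters w = []")
    case True
    then have "w = 0" by (intro word_eqI) simp
    then show ?thesis using leavitt_ideal.scale[OF p, of c] by (simp add: scale_elem_eq single_zero_commute)
  next
    case False
    then have "Poly_Mapping.single w c \<in> free_alg E" using assms by (intro free_alg_single) (simp add: gen_words_def)
    then show ?thesis using leavitt_ideal.left leavitt_ideal.right p by blast
  qed
  then show "Poly_Mapping.single w c * p \<in> leavitt_ideal E" "p * Poly_Mapping.single w c \<in> leavitt_ideal E" by auto
qed

locale leavitt_path_algebra = fin_digraph E for E :: "('v, 'e) pre_digraph" +
  fixes K :: "'k::field itself"
begin

abbreviation "Fr \<equiv> free_alg E :: ('v, 'e, 'k) free_elem set"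
abbreviation "I \<equiv> leavitt_ideal E :: ('v, 'e, 'k) free_elem set"
abbreviation "LP \<equiv> leavitt K E"

definition cl :: "('v, 'e, 'k) free_elem \<Rightarrow> ('v, 'e, 'k) free_elem set" where
  "cl p = leavitt_rel E `` {p}"

lemma gens [simp]: "v \<in> verts E \<Longrightarrow> Vert v \<in> generators E" "e \<in> arcs E \<Longrightarrow> Edge e \<in> generators E"
  "e \<in> arcs E \<Longrightarrow> Ghost e \<in> generators E"
  by (auto simp: generators_def)

lemma free_gens [simp]: "v \<in> verts E \<Longrightarrow> vx v \<in> Fr" "e \<in> arcs E \<Longrightarrow> ex e \<in> Fr" "e \<in> arcs E \<Longrightarrow> gx e \<in> Fr"
  by (auto intro: free_alg_gen)

lemma equiv_rel: "equiv Fr (leavitt_rel E)"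
proof (rule equivI)
  show "leavitt_rel E \<subseteq> Fr \<times> Fr" by (auto simp: leavitt_rel_def)
  show "refl_on Fr (leavitt_rel E)" by (auto simp: refl_on_def leavitt_rel_def leavitt_ideal.zero)
  show "sym (leavitt_rel E)"
    by (rule symI) (use leavitt_ideal_uminus in \<open>force simp: leavitt_rel_def\<close>)
  show "trans (leavitt_rel E)"
    by (rule transI) (use leavitt_ideal.add in \<open>force simp: leavitt_rel_def\<close>)
qed

lemma cl_eq_iff: "\<lbrakk>p \<in> Fr; q \<in> Fr\<rbrakk> \<Longrightarrow> cl p = cl q \<longleftrightarrow> p - q \<in> I"
  unfolding cl_def using eq_equiv_class_iff[OF equiv_rel, of p q] by (simp add: leavitt_rel_def)

lemma carrier_LP: "carrier LP = cl ` Fr"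
  by (auto simp: leavitt_def quotient_def cl_def)

lemma cl_closed: "p \<in> Fr \<Longrightarrow> cl p \<in> carrier LP"
  by (simp add: carrier_LP)

lemma carrierE:
  assumes "x \<in> carrier LP" obtains p where "p \<in> Fr" "x = cl p"
  using assms by (auto simp: carrier_LP)

lemma zero_LP: "\<zero>\<^bsub>LP\<^esub> = cl 0" and one_LP: "\<one>\<^bsub>LP\<^esub> = cl (\<Sum>v \<in> verts E. vx v)"
  by (simp_all add: leavitt_def cl_def)

text \<open>The operations of \<open>leavitt\<close> are unions over representatives. Where a map is
  invariant modulo the ideal, the union collapses to its value at one representative.\<close>

lemma union_cl:
  assumes "p \<in> Fr" "\<And>q. \<lbrakk>q \<in> Fr; q - p \<in> I\<rbrakk> \<Longrightarrow> h q = h p"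
  shows "(\<Union>q \<in> cl p. h q) = h p"
proof -
  have "h q = h p" if "q \<in> cl p" for q
    using that leavitt_ideal_uminus[of "p - q" E] by (intro assms(2)) (auto simp: cl_def leavitt_rel_def)
  moreover have "p \<in> cl p" using assms(1) by (simp add: cl_def leavitt_rel_def leavitt_ideal.zero)
  ultimately show ?thesis by blast
qed

lemma add_cl: "\<lbrakk>p \<in> Fr; q \<in> Fr\<rbrakk> \<Longrightarrow> cl p \<oplus>\<^bsub>LP\<^esub> cl q = cl (p + q)"
proof -
  assume p: "p \<in> Fr" and q: "q \<in> Fr"
  have "(\<Union>q' \<in> cl q. cl (p' + q')) = cl (p' + q)" if "p' \<in> Fr" for p'
    by (rule union_cl[OF q]) (use that q in \<open>simp add: cl_eq_iff free_alg_add\<close>)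
  moreover have "(\<Union>p' \<in> cl p. cl (p' + q)) = cl (p + q)"
    by (rule union_cl[OF p]) (use p q in \<open>simp add: cl_eq_iff free_alg_add\<close>)
  moreover have "p' \<in> Fr" if "p' \<in> cl p" for p' using that by (simp add: cl_def leavitt_rel_def)
  ultimately show ?thesis by (simp add: leavitt_def cl_def[symmetric])
qed

lemma mult_cl: "\<lbrakk>p \<in> Fr; q \<in> Fr\<rbrakk> \<Longrightarrow> cl p \<otimes>\<^bsub>LP\<^esub> cl q = cl (p * q)"
proof -
  assume p: "p \<in> Fr" and q: "q \<in> Fr"
  have "(\<Union>q' \<in> cl q. cl (p' * q')) = cl (p' * q)" if "p' \<in> Fr" for p'
    by (rule union_cl[OF q])
      (use that q in \<open>simp add: cl_eq_iff free_alg_mult right_diff_distrib[symmetric] leavitt_ideal.left\<close>)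
  moreover have "(\<Union>p' \<in> cl p. cl (p' * q)) = cl (p * q)"
    by (rule union_cl[OF p])
      (use p q in \<open>simp add: cl_eq_iff free_alg_mult left_diff_distrib[symmetric] leavitt_ideal.right\<close>)
  moreover have "p' \<in> Fr" if "p' \<in> cl p" for p' using that by (simp add: cl_def leavitt_rel_def)
  ultimately show ?thesis by (simp add: leavitt_def cl_def[symmetric])
qed

lemma homog_LP: "homog LP n = cl ` {p \<in> Fr. \<forall>w \<in> Poly_Mapping.keys p. word_degree w = n}"
  by (auto simp: leavitt_def cl_def)

lemma cl_homog: "\<lbrakk>p \<in> Fr; \<And>w. w \<in> Poly_Mapping.keys p \<Longrightarrow> word_degree w = n\<rbrakk> \<Longrightarrow> cl p \<in> homog LP n"
  by (auto simp: homog_LP)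

lemma homogE:
  assumes "x \<in> homog LP n"
  obtains p where "p \<in> Fr" "x = cl p" "\<And>w. w \<in> Poly_Mapping.keys p \<Longrightarrow> word_degree w = n"
  using assms by (auto simp: homog_LP)

subsection \<open>The unit\<close>

text \<open>With ghost edges running backwards, \<open>src\<close> and \<open>tgt\<close> let the
  relations at vertices, edges and ghost edges be used in one form: modulo the ideal, each generator
  absorbs its source vertex on the left and its target vertex on the right.\<close>

definition src :: "('v, 'e) gen \<Rightarrow> 'v" where
  "src g = (case g of Vert v \<Rightarrow> v | Edge e \<Rightarrow> tail E e | Ghost e \<Rightarrow> head E e)"

definition tgt :: "('v, 'e) gen \<Rightarrow> 'v" where
  "tgt g = (case g of Vert v \<Rightarrow> v | Edge e \<Rightarrow> head E e | Ghost e \<Rightarrow> tail E e)"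

lemma src_tgt_verts: "g \<in> generators E \<Longrightarrow> src g \<in> verts E" "g \<in> generators E \<Longrightarrow> tgt g \<in> verts E"
  by (auto simp: generators_def src_def tgt_def)

lemma rel_vv: "\<lbrakk>v \<in> verts E; w \<in> verts E\<rbrakk> \<Longrightarrow> vx v * vx w - (if v = w then vx v else 0) \<in> I"
  by (rule leavitt_ideal.rel) (auto simp: leavitt_relations_def)

lemma edge_rels:
  assumes "e \<in> arcs E"
  shows "vx (tail E e) * ex e - ex e \<in> I" "ex e * vx (head E e) - ex e \<in> I"
    "gx e * vx (tail E e) - gx e \<in> I" "vx (head E e) * gx e - gx e \<in> I"
  by (rule leavitt_ideal.rel, use assms in \<open>auto simp: leavitt_relations_def\<close>)+

lemma rel_v: "v \<in> verts E \<Longrightarrow> vx v * vx v - vx v \<in> I"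
  using rel_vv[of v v] by simp

lemma src_gen: "g \<in> generators E \<Longrightarrow> vx (src g) * gen_elem g - gen_elem g \<in> I"
  and gen_tgt: "g \<in> generators E \<Longrightarrow> gen_elem g * vx (tgt g) - gen_elem g \<in> I"
  by (auto simp: generators_def src_def tgt_def rel_v edge_rels)

lemma rel_ghost_edge: "\<lbrakk>e \<in> arcs E; f \<in> arcs E\<rbrakk> \<Longrightarrow> gx e * ex f - (if e = f then vx (head E e) else 0) \<in> I"
  by (rule leavitt_ideal.rel) (auto simp: leavitt_relations_def)

lemma rel_regular: "is_regular E v \<Longrightarrow> vx v - (\<Sum>e \<in> out_arcs E v. ex e * gx e) \<in> I"
  by (rule leavitt_ideal.rel) (auto simp: leavitt_relations_def)

lemma cl_eqI: "\<lbrakk>p - q \<in> I; p \<in> Fr; q \<in> Fr\<rbrakk> \<Longrightarrow> cl p = cl q"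
  by (simp add: cl_eq_iff)

lemma cl_mult_cong: "\<lbrakk>cl p = cl p'; cl q = cl q'; p \<in> Fr; p' \<in> Fr; q \<in> Fr; q' \<in> Fr\<rbrakk> \<Longrightarrow> cl (p * q) = cl (p' * q')"
  by (metis mult_cl)

lemma cl_add_cong: "\<lbrakk>cl p = cl p'; cl q = cl q'; p \<in> Fr; p' \<in> Fr; q \<in> Fr; q' \<in> Fr\<rbrakk> \<Longrightarrow> cl (p + q) = cl (p' + q')"
  by (metis add_cl)

lemma cl_sum_cong:
  "\<lbrakk>\<And>i. i \<in> A \<Longrightarrow> cl (f i) = cl (g i); \<And>i. i \<in> A \<Longrightarrow> f i \<in> Fr; \<And>i. i \<in> A \<Longrightarrow> g i \<in> Fr\<rbrakk> \<Longrightarrow> cl (sum f A) = cl (sum g A)"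
proof (induction A rule: infinite_finite_induct)
  case (insert i A)
  have "cl (f i + sum f A) = cl (g i + sum g A)"
    by (rule cl_add_cong) (use insert in \<open>auto intro: free_alg_sum\<close>)
  then show ?case using insert.hyps by simp
qed auto

abbreviation "unit_elem \<equiv> (\<Sum>v \<in> verts E. vx v) :: ('v, 'e, 'k) free_elem"

lemma unit_free: "unit_elem \<in> Fr"
  by (auto intro: free_alg_sum)

text \<open>Of all vertices \<open>v\<close> just one survives on each side, because
  \<open>v g = v (src g) g\<close> and distinct vertices are orthogonal; likewise with
  \<open>tgt g\<close> on the right.\<close>

lemma cl_unit_gen:
  assumes g: "g \<in> generators E"
  shows "cl (unit_elem * gen_elem g) = cl (gen_elem g)" "cl (gen_elem g * unit_elem) = cl (gen_elem g)"
proof -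
  note gf = free_alg_gen[OF g] and s = src_tgt_verts[OF g]
  have delta: "cl (vx v * vx w) = cl (if v = w then vx v else 0)" if "v \<in> verts E" "w \<in> verts E" for v w
    using that by (intro cl_eqI[OF rel_vv]) (auto intro: free_alg_mult)
  have 1: "cl (vx (src g) * gen_elem g) = cl (gen_elem g)"
    using s gf by (intro cl_eqI[OF src_gen[OF g]]) (auto intro: free_alg_mult)
  have 2: "cl (gen_elem g * vx (tgt g)) = cl (gen_elem g)"
    using s gf by (intro cl_eqI[OF gen_tgt[OF g]]) (auto intro: free_alg_mult)
  have a: "cl (vx v * gen_elem g) = cl (if v = src g then gen_elem g else 0)" if v: "v \<in> verts E" for v
  proof -
    have "cl (vx v * gen_elem g) = cl (vx v * (vx (src g) * gen_elem g))"
      using v s gf 1 by (intro cl_mult_cong) (auto intro: free_alg_mult)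
    also have "\<dots> = cl (vx v * vx (src g) * gen_elem g)" by (simp add: mult.assoc)
    also have "\<dots> = cl ((if v = src g then vx v else 0) * gen_elem g)"
      using v s gf delta[OF v s(1)] by (intro cl_mult_cong) (auto intro: free_alg_mult)
    finally show ?thesis using 1 by auto
  qed
  have b: "cl (gen_elem g * vx v) = cl (if v = tgt g then gen_elem g else 0)" if v: "v \<in> verts E" for v
  proof -
    have "cl (gen_elem g * vx v) = cl (gen_elem g * vx (tgt g) * vx v)"
      using v s gf 2 by (intro cl_mult_cong) (auto intro: free_alg_mult)
    also have "\<dots> = cl (gen_elem g * (vx (tgt g) * vx v))" by (simp add: mult.assoc)
    also have "\<dots> = cl (gen_elem g * (if tgt g = v then vx (tgt g) else 0))"
      using v s gf delta[OF s(2) v] by (intro cl_mult_cong) (auto intro: free_alg_mult)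
    finally show ?thesis using 2 by auto
  qed
  have "cl (unit_elem * gen_elem g) = cl (\<Sum>v \<in> verts E. if v = src g then gen_elem g else 0)"
    unfolding sum_distrib_right using gf by (intro cl_sum_cong a) (auto intro: free_alg_mult)
  also have "(\<Sum>v \<in> verts E. if v = src g then gen_elem g else 0) = (gen_elem g :: ('v, 'e, 'k) free_elem)"
    using s(1) by (simp add: sum.delta)
  finally show "cl (unit_elem * gen_elem g) = cl (gen_elem g)" .
  have "cl (gen_elem g * unit_elem) = cl (\<Sum>v \<in> verts E. if v = tgt g then gen_elem g else 0)"
    unfolding sum_distrib_left using gf by (intro cl_sum_cong b) (auto intro: free_alg_mult)
  also have "(\<Sum>v \<in> verts E. if v = tgt g then gen_elem g else 0) = (gen_elem g :: ('v, 'e, 'k) free_elem)"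
    using s(2) by (simp add: sum.delta)
  finally show "cl (gen_elem g * unit_elem) = cl (gen_elem g)" .
qed

text \<open>The words are nonempty, so each has a first letter that absorbs the unit on the left and
  a last letter that absorbs it on the right.\<close>

lemma cl_unit:
  assumes "p \<in> Fr" shows "cl (unit_elem * p) = cl p" "cl (p * unit_elem) = cl p"
proof -
  have "unit_elem * p - p \<in> I \<and> p * unit_elem - p \<in> I"
    using assms
  proof (induction rule: free_alg_induct)
    case zero show ?case by (simp add: leavitt_ideal.zero)
  next
    case (single w c)
    then obtain g u where w: "letters w = g # u" by (cases "letters w") (auto simp: gen_words_def)
    obtain u' h where w': "letters w = u' @ [h]" using w by (metis append_butlast_last_id list.distinct(1))
    have G: "set (letters w) \<subseteq> generators E" using single by (simp add: gen_words_def)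
    have g: "g \<in> generators E" "set u \<subseteq> generators E" using G unfolding w by simp_all
    have h: "h \<in> generators E" "set u' \<subseteq> generators E" using G unfolding w' by simp_all
    have e1: "w = Word [g] + Word u" and e2: "w = Word u' + Word [h]" using w w' by (auto intro: word_eqI)
    have s1: "Poly_Mapping.single w c = gen_elem g * Poly_Mapping.single (Word u) c"
      and s2: "Poly_Mapping.single w c = Poly_Mapping.single (Word u') c * gen_elem h"
      by (simp_all add: gen_elem_def mult_single e1[symmetric] e2[symmetric])
    have ug: "unit_elem * gen_elem g - gen_elem g \<in> I" and hu: "gen_elem h * unit_elem - gen_elem h \<in> I"
      using cl_unit_gen(1)[OF g(1)] cl_unit_gen(2)[OF h(1)]
      by (simp_all add: cl_eq_iff free_alg_mult unit_free free_alg_gen g h)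
    have "(unit_elem * gen_elem g - gen_elem g) * Poly_Mapping.single (Word u) c \<in> I"
      by (rule leavitt_ideal_single(2)[OF _ ug]) (use g in simp)
    moreover have "Poly_Mapping.single (Word u') c * (gen_elem h * unit_elem - gen_elem h) \<in> I"
      by (rule leavitt_ideal_single(1)[OF _ hu]) (use h in simp)
    moreover have "unit_elem * Poly_Mapping.single w c - Poly_Mapping.single w c
        = (unit_elem * gen_elem g - gen_elem g) * Poly_Mapping.single (Word u) c"
      unfolding s1 by (simp only: left_diff_distrib mult.assoc)
    moreover have "Poly_Mapping.single w c * unit_elem - Poly_Mapping.single w c
        = Poly_Mapping.single (Word u') c * (gen_elem h * unit_elem - gen_elem h)"
      unfolding s2 by (simp only: right_diff_distrib mult.assoc)
    ultimately show ?case by (simp only:)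
  next
    case (add p q)
    have "unit_elem * (p + q) - (p + q) = (unit_elem * p - p) + (unit_elem * q - q)"
      "(p + q) * unit_elem - (p + q) = (p * unit_elem - p) + (q * unit_elem - q)"
      by (simp_all add: algebra_simps)
    then show ?case using add.IH leavitt_ideal.add by metis
  qed
  then show "cl (unit_elem * p) = cl p" "cl (p * unit_elem) = cl p"
    using assms by (simp_all add: cl_eq_iff free_alg_mult unit_free)
qed

lemma ring_LP: "ring LP"
proof (rule ringI)
  show "abelian_group LP"
  proof (rule abelian_groupI)
    fix x assume "x \<in> carrier LP"
    then obtain p where p: "p \<in> Fr" "x = cl p" by (rule carrierE)
    then show "\<exists>y\<in>carrier LP. y \<oplus>\<^bsub>LP\<^esub> x = \<zero>\<^bsub>LP\<^esub>"
      by (intro bexI[of _ "cl (- p)"]) (auto simp: add_cl zero_LP cl_closed free_alg_uminus)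
  qed (auto simp: carrier_LP add_cl zero_LP free_alg_add ac_simps)
  show "monoid LP"
    by (rule monoidI) (auto simp: carrier_LP mult_cl one_LP unit_free free_alg_mult cl_unit mult.assoc)
qed (auto simp: carrier_LP add_cl mult_cl free_alg_add free_alg_mult distrib_left distrib_right)

subsection \<open>The grading\<close>

text \<open>The relations between vertices, between ghost edges and edges, and at regular vertices
  have degree 0; those for edges and their end points have degree 1, and those for ghost edges
  degree -1.\<close>

lemma relations_homog:
  assumes "(p :: ('v, 'e, 'k) free_elem) \<in> leavitt_relations E" shows "\<exists>m. \<forall>w \<in> Poly_Mapping.keys p. word_degree w = m"
proof -
  define H where "H m = {p :: ('v, 'e, 'k) free_elem. \<forall>w \<in> Poly_Mapping.keys p. word_degree w = m}" for m
  have gen: "gen_elem g \<in> H (gen_degree g)" for g by (auto simp: H_def gen_elem_def)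
  have zero: "0 \<in> H m" for m by (simp add: H_def)
  have diff: "p - q \<in> H m" if "p \<in> H m" "q \<in> H m" for p q m
    using that keys_diff[of p q] by (auto simp: H_def)
  have add: "p + q \<in> H m" if "p \<in> H m" "q \<in> H m" for p q m
    using that keys_add[of p q] by (auto simp: H_def)
  have mult: "p * q \<in> H k" if "p \<in> H m" "q \<in> H n" "k = m + n" for p q m n k
    using that keys_mult[of p q] by (fastforce simp: H_def)
  have sum: "sum f A \<in> H m" if "\<And>i. i \<in> A \<Longrightarrow> f i \<in> H m" for f m and A :: "'e set"
    using that by (induction A rule: infinite_finite_induct) (auto intro: zero add)
  have v: "vx v \<in> H 0" and e: "ex e \<in> H 1" and g: "gx e \<in> H (- 1)" for v e
    using gen[of "Vert v"] gen[of "Edge e"] gen[of "Ghost e"] by simp_all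
  have ite: "(if b then vx v else 0) \<in> H 0" for b v using v zero by simp
  from assms have "p \<in> H 0 \<union> H 1 \<union> H (- 1)"
    unfolding leavitt_relations_def
  proof (elim UnE)
    assume "p \<in> {vx v * vx w - (if v = w then vx v else 0) | v w. v \<in> verts E \<and> w \<in> verts E}"
    then show ?thesis using diff[OF mult[OF v v, of 0] ite] by auto
  next
    assume "p \<in> (\<Union>e \<in> arcs E. {vx (tail E e) * ex e - ex e, ex e * vx (head E e) - ex e,
        gx e * vx (tail E e) - gx e, vx (head E e) * gx e - gx e})"
    then show ?thesis
      using diff[OF mult[OF v e, of 1] e] diff[OF mult[OF e v, of 1] e]
        diff[OF mult[OF v g, of "- 1"] g] diff[OF mult[OF g v, of "- 1"] g] by auto
  next
    assume "p \<in> {gx e * ex f - (if e = f then vx (head E e) else 0) | e f. e \<in> arcs E \<and> f \<in> arcs E}"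
    then show ?thesis using diff[OF mult[OF g e, of 0] ite] by auto
  next
    assume "p \<in> {vx v - (\<Sum>e \<in> out_arcs E v. ex e * gx e) | v. is_regular E v}"
    then show ?thesis using diff[OF v sum[OF mult[OF e g, of 0]]] by auto
  qed
  then show ?thesis unfolding H_def by blast
qed

text \<open>The ideal is homogeneous. A general factor mixes the degrees, so in the product cases it
  is broken up into monomials, which shift the degree by a constant.\<close>

lemma ideal_homog_part: "p \<in> I \<Longrightarrow> homog_part n p \<in> I"
proof (induction arbitrary: n rule: leavitt_ideal.induct)
  case zero show ?case by (simp add: leavitt_ideal.zero)
next
  case (rel p)
  obtain m where m: "\<And>w. w \<in> Poly_Mapping.keys p \<Longrightarrow> word_degree w = m" using relations_homog[OF rel] by blast
  show ?case
    using homog_part_eq_self[where p = p, OF m] homog_part_eq_zero[where n = n and p = p, OF m] leavitt_ideal.rel[OF rel] leavitt_ideal.zero[of E]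
    by (cases "m = n") auto
next
  case (add p q) then show ?case by (simp add: leavitt_ideal.add)
next
  case (scale p k)
  then show ?case using leavitt_ideal_single(1)[of 0 E "homog_part n p" k]
    by (simp add: scale_elem_eq homog_part_mult_single_left)
next
  case (left a p)
  from left.hyps(1) show ?case
  proof (induction rule: free_alg_induct)
    case (single w c)
    then show ?case using left.IH
      by (simp add: homog_part_mult_single_left leavitt_ideal_single gen_words_def)
  qed (simp_all add: leavitt_ideal.zero distrib_right leavitt_ideal.add)
next
  case (right p a)
  from right.hyps(2) show ?case
  proof (induction rule: free_alg_induct)
    case (single w c)
    then show ?case using right.IH
      by (simp add: homog_part_mult_single_right leavitt_ideal_single gen_words_def)
  qed (simp_all add: leavitt_ideal.zero distrib_left leavitt_ideal.add)
qed

text \<open>Taking homogeneous parts descends to classes because the ideal is homogeneous; these are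
  the projections that \<open>graded_groupI\<close> asks for.\<close>

definition proj_part :: "int \<Rightarrow> ('v, 'e, 'k) free_elem set \<Rightarrow> ('v, 'e, 'k) free_elem set" where
  "proj_part n c = (\<Union>p \<in> c. cl (homog_part n p))"

lemma proj_part_cl: "p \<in> Fr \<Longrightarrow> proj_part n (cl p) = cl (homog_part n p)"
  unfolding proj_part_def
  by (rule union_cl) (auto simp: cl_eq_iff free_alg_homog_part homog_part_simps(4)[symmetric] ideal_homog_part
      simp del: homog_part_simps)

lemma graded_group_LP: "graded_group LP (homog LP)"
proof (rule graded_groupI[where p = proj_part])
  interpret R: ring LP by (rule ring_LP)
  show "abelian_group LP" by (rule R.abelian_group_axioms)
  have neg: "\<ominus>\<^bsub>LP\<^esub> cl p = cl (- p)" if "p \<in> Fr" for p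
    by (rule R.minus_equality) (use that in \<open>auto simp: add_cl zero_LP cl_closed free_alg_uminus\<close>)
  show "subgroup (homog LP n) (add_monoid LP)" for n
  proof
    show "homog LP n \<subseteq> carrier (add_monoid LP)" by (auto simp: homog_LP cl_closed)
    fix x assume "x \<in> homog LP n"
    then obtain p where p: "p \<in> Fr" "x = cl p" "\<And>w. w \<in> Poly_Mapping.keys p \<Longrightarrow> word_degree w = n" by (rule homogE) blast
    have "\<ominus>\<^bsub>LP\<^esub> x \<in> homog LP n" using p by (simp add: neg) (intro cl_homog free_alg_uminus; simp)
    then show "inv\<^bsub>add_monoid LP\<^esub> x \<in> homog LP n" by (simp add: a_inv_def)
    fix y assume "y \<in> homog LP n"
    then obtain q where q: "q \<in> Fr" "y = cl q" "\<And>w. w \<in> Poly_Mapping.keys q \<Longrightarrow> word_degree w = n" by (rule homogE) blast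
    have "cl (p + q) \<in> homog LP n"
      using p q keys_add[of p q] by (intro cl_homog free_alg_add) auto
    then show "x \<otimes>\<^bsub>add_monoid LP\<^esub> y \<in> homog LP n" using p q by (simp add: add_cl)
  qed (auto simp: zero_LP intro!: cl_homog)
  show "proj_part n x \<in> homog LP n" if "x \<in> carrier LP" for n x
    using that by (auto simp: carrier_LP proj_part_cl keys_homog_part intro!: cl_homog free_alg_homog_part)
  show "proj_part n (x \<oplus>\<^bsub>LP\<^esub> y) = proj_part n x \<oplus>\<^bsub>LP\<^esub> proj_part n y" if "x \<in> carrier LP" "y \<in> carrier LP" for n x y
    using that by (auto simp: carrier_LP proj_part_cl add_cl free_alg_add free_alg_homog_part)
  show "proj_part n x = (if n = m then x else \<zero>\<^bsub>LP\<^esub>)" if x: "x \<in> homog LP m" for n m x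
  proof -
    obtain p where p: "p \<in> Fr" "x = cl p" "\<And>w. w \<in> Poly_Mapping.keys p \<Longrightarrow> word_degree w = m" using x by (rule homogE) blast
    show ?thesis
      using p(1,2) homog_part_eq_self[where p = p, OF p(3)] homog_part_eq_zero[where n = n and p = p, OF p(3)] by (auto simp: proj_part_cl zero_LP)
  qed
  show "x \<in> generate (add_monoid LP) (\<Union>n. homog LP n)" if x: "x \<in> carrier LP" for x
  proof -
    obtain p where p: "p \<in> Fr" "x = cl p" using x by (rule carrierE)
    have "cl p \<in> generate (add_monoid LP) (\<Union>n. homog LP n)" using p(1)
    proof (induction rule: free_alg_induct)
      case zero then show ?case using generate.one[of "add_monoid LP"] by (simp add: zero_LP)
    next
      case (single w c)
      then have "cl (Poly_Mapping.single w c) \<in> homog LP (word_degree w)"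
        by (intro cl_homog free_alg_single) (auto split: if_splits)
      then show ?case by (intro generate.incl) blast
    next
      case (add p q)
      then show ?case using generate.eng[OF add.IH] by (simp add: add_cl)
    qed
    then show ?thesis using p by simp
  qed
qed

lemma graded_ring_LP: "graded_ring LP"
proof (intro graded_ring.intro ring_LP graded_group_LP graded_ring_axioms.intro)
  fix a b m n assume "a \<in> homog LP m" "b \<in> homog LP n"
  then obtain p q where p: "p \<in> Fr" "a = cl p" "\<And>w. w \<in> Poly_Mapping.keys p \<Longrightarrow> word_degree w = m"
    and q: "q \<in> Fr" "b = cl q" "\<And>w. w \<in> Poly_Mapping.keys q \<Longrightarrow> word_degree w = n"
    by (elim homogE) blast
  have "word_degree w = m + n" if "w \<in> Poly_Mapping.keys (p * q)" for w
    using subsetD[OF keys_mult that] p(3) q(3) by auto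
  then have "cl (p * q) \<in> homog LP (m + n)" using p(1) q(1) by (intro cl_homog free_alg_mult)
  then show "a \<otimes>\<^bsub>LP\<^esub> b \<in> homog LP (m + n)" using p q by (simp add: mult_cl)
next
  have "word_degree w = 0" if "w \<in> Poly_Mapping.keys unit_elem" for w
    using subsetD[OF keys_sum that] by (auto simp: gen_elem_def)
  then show "\<one>\<^bsub>LP\<^esub> \<in> homog LP 0" unfolding one_LP by (intro cl_homog unit_free)
qed

text \<open>A finite graph has countably many words, and the classes of the monomials
  \<open>c w\<close> generate the algebra additively. An infinite universe that is at least as large
  as the field therefore has room for it.\<close>

lemma LP_lepoll:
  assumes U: "infinite (UNIV :: 'u set)" and small: "(UNIV :: 'k set) \<lesssim> (UNIV :: 'u set)"
  shows "carrier LP \<lesssim> (UNIV :: 'u set)"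
proof -
  interpret R: ring LP by (rule ring_LP)
  let ?X = "(\<lambda>(w, c). cl (Poly_Mapping.single (Word w) c)) ` ({w \<in> lists (generators E). w \<noteq> []} \<times> (UNIV :: 'k set))"
  have "finite (generators E)" by (simp add: generators_def)
  then have "countable (lists (generators E))" by (intro countable_lists countable_finite)
  then have "lists (generators E) \<lesssim> (UNIV :: nat set)"
    by (auto simp: countable_def lepoll_def)
  also have "\<dots> \<lesssim> (UNIV :: 'u set)" using U by (simp add: infinite_le_lepoll)
  finally have "{w \<in> lists (generators E). w \<noteq> []} \<lesssim> (UNIV :: 'u set)"
    by (rule lepoll_trans[OF subset_imp_lepoll, rotated]) auto
  then have "?X \<lesssim> (UNIV :: 'u set)"
    using times_lepoll_infinite[OF _ small U] image_lepoll lepoll_trans by blast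
  moreover have X: "?X \<subseteq> carrier LP"
    by (auto intro!: cl_closed free_alg_single simp: gen_words_def)
  ultimately have "generate (add_monoid LP) ?X \<lesssim> (UNIV :: 'u set)"
    using group.generate_lepoll[OF R.a_group, of ?X] U by simp
  moreover have "carrier LP \<subseteq> generate (add_monoid LP) ?X"
  proof
    fix x assume "x \<in> carrier LP"
    then obtain p where p: "p \<in> Fr" "x = cl p" by (rule carrierE)
    have "cl p \<in> generate (add_monoid LP) ?X" using p(1)
    proof (induction rule: free_alg_induct)
      case zero then show ?case using generate.one[of "add_monoid LP"] by (simp add: zero_LP)
    next
      case (single w c)
      then show ?case
        by (cases w) (auto intro!: generate.incl image_eqI[of _ _ "(letters w, c)"] simp: gen_words_def)
    next
      case (add p q)
      then show ?case using generate.eng[OF add.IH] by (simp add: add_cl)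
    qed
    then show "x \<in> generate (add_monoid LP) ?X" using p by simp
  qed
  ultimately show ?thesis using subset_imp_lepoll lepoll_trans by meson
qed

subsection \<open>Strong grading\<close>

text \<open>The set \<open>reach n\<close> consists of the vertices at which some path of length
  \<open>n\<close> ends.\<close>

fun reach :: "nat \<Rightarrow> 'v set" where
  "reach 0 = verts E"
| "reach (Suc n) = head E ` {e \<in> arcs E. tail E e \<in> reach n}"

lemma reach_verts: "reach n \<subseteq> verts E"
  by (cases n) auto

text \<open>Deleting the first edge of a path of length \<open>n + 1\<close> leaves a path of length
  \<open>n\<close> with the same end.\<close>

lemma reach_Suc: "reach (Suc n) \<subseteq> reach n"
proof (induction n)
  case 0 show ?case using reach_verts[of 1] by simp
next
  case (Suc n) then show ?case by (subst (1 2) reach.simps) blast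
qed

text \<open>Otherwise the sets would shrink strictly at every step, which a finite set of vertices
  does not allow.\<close>

lemma reach_stable: "\<exists>n. reach (Suc n) = reach n"
proof (rule ccontr)
  assume "\<nexists>n. reach (Suc n) = reach n"
  then have lt: "card (reach (Suc n)) < card (reach n)" for n
    using reach_Suc[of n] finite_subset[OF reach_verts finite_verts] by (intro psubset_card_mono) auto
  have "card (reach n) + n \<le> card (verts E)" for n
  proof (induction n)
    case (Suc n) then show ?case using lt[of n] by simp
  qed simp
  from this[of "Suc (card (verts E))"] show False by simp
qed

lemma edge_homog: "e \<in> arcs E \<Longrightarrow> cl (ex e) \<in> homog LP 1"
  and ghost_homog: "e \<in> arcs E \<Longrightarrow> cl (gx e) \<in> homog LP (- 1)"
  and vertex_homog: "v \<in> verts E \<Longrightarrow> cl (vx v) \<in> homog LP 0"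
  by (rule cl_homog, simp, simp add: gen_elem_def)+

lemma mult_vertex_edge:
  "e \<in> arcs E \<Longrightarrow> cl (gx e) \<otimes>\<^bsub>LP\<^esub> cl (ex e) = cl (vx (head E e))"
  "e \<in> arcs E \<Longrightarrow> cl (vx (tail E e)) \<otimes>\<^bsub>LP\<^esub> cl (ex e) = cl (ex e)"
  "e \<in> arcs E \<Longrightarrow> cl (ex e) \<otimes>\<^bsub>LP\<^esub> cl (vx (head E e)) = cl (ex e)"
  "v \<in> verts E \<Longrightarrow> cl (vx v) \<otimes>\<^bsub>LP\<^esub> cl (vx v) = cl (vx v)"
  using rel_ghost_edge[of e e] edge_rels[of e] rel_v[of v]
  by (simp_all add: mult_cl cl_eq_iff free_alg_mult)

text \<open>If \<open>q\<close> is a path of length \<open>n\<close> that ends in \<open>w\<close>,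
  then \<open>q\<^sup>* q = w\<close>. The induction appends the last edge \<open>e\<close> to
  \<open>q\<close> and its ghost to \<open>q\<^sup>*\<close>.\<close>

lemma reach_factor:
  "w \<in> reach n \<Longrightarrow> \<exists>a \<in> homog LP (- int n). \<exists>b \<in> homog LP (int n). a \<otimes>\<^bsub>LP\<^esub> b = cl (vx w)"
proof (induction n arbitrary: w)
  case 0
  then show ?case using vertex_homog[of w] mult_vertex_edge(4)[of w]
    by (intro bexI[of _ "cl (vx w)"]) simp_all
next
  case (Suc n)
  interpret R: graded_ring LP by (rule graded_ring_LP)
  obtain e where e: "e \<in> arcs E" "tail E e \<in> reach n" "w = head E e" using Suc.prems by auto
  obtain a b where ab: "a \<in> homog LP (- int n)" "b \<in> homog LP (int n)" "a \<otimes>\<^bsub>LP\<^esub> b = cl (vx (tail E e))"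
    using Suc.IH[OF e(2)] by blast
  note c = R.D_carrier[OF ab(1)] R.D_carrier[OF ab(2)] R.D_carrier[OF edge_homog[OF e(1)]] R.D_carrier[OF ghost_homog[OF e(1)]]
  have "(cl (gx e) \<otimes>\<^bsub>LP\<^esub> a) \<otimes>\<^bsub>LP\<^esub> (b \<otimes>\<^bsub>LP\<^esub> cl (ex e)) = cl (gx e) \<otimes>\<^bsub>LP\<^esub> ((a \<otimes>\<^bsub>LP\<^esub> b) \<otimes>\<^bsub>LP\<^esub> cl (ex e))"
    using c by (simp add: R.R.m_assoc)
  also have "\<dots> = cl (vx w)" using e by (simp add: ab(3) mult_vertex_edge)
  finally have "(cl (gx e) \<otimes>\<^bsub>LP\<^esub> a) \<otimes>\<^bsub>LP\<^esub> (b \<otimes>\<^bsub>LP\<^esub> cl (ex e)) = cl (vx w)" .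
  moreover have "cl (gx e) \<otimes>\<^bsub>LP\<^esub> a \<in> homog LP (- int (Suc n))" "b \<otimes>\<^bsub>LP\<^esub> cl (ex e) \<in> homog LP (int (Suc n))"
    using R.homog_mult[OF ghost_homog[OF e(1)] ab(1)] R.homog_mult[OF ab(2) edge_homog[OF e(1)]]
    by (simp_all add: ac_simps)
  ultimately show ?case by blast
qed

lemma cl_sum_closed:
  assumes "\<And>x y. \<lbrakk>x \<in> S; y \<in> S\<rbrakk> \<Longrightarrow> x \<oplus>\<^bsub>LP\<^esub> y \<in> S" "\<zero>\<^bsub>LP\<^esub> \<in> S"
    and "finite A" "\<And>i. i \<in> A \<Longrightarrow> cl (f i) \<in> S" "\<And>i. i \<in> A \<Longrightarrow> f i \<in> Fr"
  shows "cl (sum f A) \<in> S"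
  using assms(3-5)
proof induction
  case empty then show ?case using assms(2) by (simp add: zero_LP)
next
  case (insert i A)
  then show ?case using assms(1)[of "cl (f i)" "cl (sum f A)"] by (simp add: add_cl free_alg_sum)
qed

end

locale sinkless_leavitt_path_algebra = leavitt_path_algebra +
  assumes no_sink: "v \<in> verts E \<Longrightarrow> \<not> is_sink E v"
begin

lemma regular: "v \<in> verts E \<Longrightarrow> is_regular E v"
  using no_sink by (auto simp: is_sink_def is_regular_def)

lemma cl_vertex: "v \<in> verts E \<Longrightarrow> cl (vx v) = cl (\<Sum>e \<in> out_arcs E v. ex e * gx e)"
  by (rule cl_eqI[OF rel_regular[OF regular]]) (auto intro!: free_alg_sum free_alg_mult)

text \<open>
  Summing over the paths \<open>p\<close> of a length \<open>n\<close> at which \<open>reach\<close> is stable, \<open>1 = \<Sum> p p\<^sup>*\<close> and the end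
  of each \<open>p\<close> is \<open>q\<^sup>* q\<close> for a path \<open>q\<close> of length \<open>n + 1\<close>, whence \<open>1 = \<Sum> (p q\<^sup>*) (q p\<^sup>*)\<close>.
\<close>

lemma strongly_graded_LP: "strongly_graded LP"
proof -
  interpret R: graded_ring LP by (rule graded_ring_LP)
  let ?S = "\<lambda>n. homog_span LP n"
  have S_add: "x \<oplus>\<^bsub>LP\<^esub> y \<in> generate (add_monoid LP) X"
    if "x \<in> generate (add_monoid LP) X" "y \<in> generate (add_monoid LP) X" for x y X
    using generate.eng[OF that] by simp
  have S_zero: "\<zero>\<^bsub>LP\<^esub> \<in> generate (add_monoid LP) X" for X
    using generate.one[of "add_monoid LP" X] by simp
  have pos: "\<one>\<^bsub>LP\<^esub> \<in> ?S 1"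
    unfolding one_LP homog_span_def
  proof (rule cl_sum_closed[OF S_add S_zero])
    fix v assume v: "v \<in> verts E"
    have "cl (\<Sum>e \<in> out_arcs E v. ex e * gx e)
      \<in> generate (add_monoid LP) {x \<otimes>\<^bsub>LP\<^esub> y |x y. x \<in> homog LP 1 \<and> y \<in> homog LP (- 1)}"
    proof (rule cl_sum_closed[OF S_add S_zero])
      fix e assume "e \<in> out_arcs E v"
      then have e: "e \<in> arcs E" by simp
      then have "cl (ex e * gx e) = cl (ex e) \<otimes>\<^bsub>LP\<^esub> cl (gx e)" by (simp add: mult_cl)
      then show "cl (ex e * gx e) \<in> generate (add_monoid LP) {x \<otimes>\<^bsub>LP\<^esub> y |x y. x \<in> homog LP 1 \<and> y \<in> homog LP (- 1)}"
        using edge_homog[OF e] ghost_homog[OF e] by (intro generate.incl) auto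
    qed (auto intro: free_alg_mult)
    then show "cl (vx v) \<in> generate (add_monoid LP) {x \<otimes>\<^bsub>LP\<^esub> y |x y. x \<in> homog LP 1 \<and> y \<in> homog LP (- 1)}"
      using cl_vertex[OF v] by simp
  qed auto
  \<comment> \<open>The products \<open>x w y\<close> generalize the terms
    \<open>p p\<^sup>*\<close> of the sum over paths of length \<open>n\<close>: the vertex
    \<open>w\<close> in the middle is the end of some such path.\<close>
  define P where "P n = {x \<otimes>\<^bsub>LP\<^esub> cl (vx w) \<otimes>\<^bsub>LP\<^esub> y | x w y. w \<in> reach n \<and> x \<in> homog LP (int n) \<and> y \<in> homog LP (- int n)}" for n
  \<comment> \<open>Paths are prolonged by one edge: since \<open>w\<close> is not a sink, it equals
    the sum of \<open>e r(e) e\<^sup>*\<close> over the edges \<open>e\<close> leaving it, and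
    \<open>r(e)\<close> lies in \<open>reach (n + 1)\<close>.\<close>
  have path: "x \<otimes>\<^bsub>LP\<^esub> cl (vx w) \<otimes>\<^bsub>LP\<^esub> y \<in> generate (add_monoid LP) (P (Suc n))"
    if w: "w \<in> reach n" and x: "x \<in> homog LP (int n)" and y: "y \<in> homog LP (- int n)" for x w y n
  proof -
    have wv: "w \<in> verts E" using w reach_verts by blast
    have "x \<otimes>\<^bsub>LP\<^esub> cl (\<Sum>e \<in> A. ex e * gx e) \<otimes>\<^bsub>LP\<^esub> y \<in> generate (add_monoid LP) (P (Suc n))"
      if "finite A" "A \<subseteq> out_arcs E w" for A
      using that
    proof induction
      case empty
      have "x \<otimes>\<^bsub>LP\<^esub> cl 0 \<otimes>\<^bsub>LP\<^esub> y = \<zero>\<^bsub>LP\<^esub>"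
        unfolding zero_LP[symmetric] using R.D_carrier[OF x] R.D_carrier[OF y] by simp
      then show ?case using S_zero by simp
    next
      case (insert e A)
      then have e: "e \<in> arcs E" "tail E e = w" by auto
      have A: "(\<Sum>e \<in> A. ex e * gx e) \<in> Fr" using insert.prems by (auto intro!: free_alg_sum free_alg_mult)
      note c = R.D_carrier[OF x] R.D_carrier[OF y] R.D_carrier[OF edge_homog[OF e(1)]]
        R.D_carrier[OF ghost_homog[OF e(1)]] R.D_carrier[OF vertex_homog[OF head_in_verts[OF e(1)]]]
      have "cl (ex e * gx e) = cl (ex e) \<otimes>\<^bsub>LP\<^esub> cl (vx (head E e)) \<otimes>\<^bsub>LP\<^esub> cl (gx e)"
        using e(1) by (simp add: mult_vertex_edge) (simp add: mult_cl)
      then have "x \<otimes>\<^bsub>LP\<^esub> cl (ex e * gx e) \<otimes>\<^bsub>LP\<^esub> y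
          = (x \<otimes>\<^bsub>LP\<^esub> cl (ex e)) \<otimes>\<^bsub>LP\<^esub> cl (vx (head E e)) \<otimes>\<^bsub>LP\<^esub> (cl (gx e) \<otimes>\<^bsub>LP\<^esub> y)"
        using c by (simp add: R.R.m_assoc)
      moreover have "head E e \<in> reach (Suc n)" using e w by auto
      moreover have "x \<otimes>\<^bsub>LP\<^esub> cl (ex e) \<in> homog LP (int (Suc n))" "cl (gx e) \<otimes>\<^bsub>LP\<^esub> y \<in> homog LP (- int (Suc n))"
        using R.homog_mult[OF x edge_homog[OF e(1)]] R.homog_mult[OF ghost_homog[OF e(1)] y] by (simp_all add: ac_simps)
      ultimately have "x \<otimes>\<^bsub>LP\<^esub> cl (ex e * gx e) \<otimes>\<^bsub>LP\<^esub> y \<in> generate (add_monoid LP) (P (Suc n))"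
        unfolding P_def by (intro generate.incl) blast
      moreover have "x \<otimes>\<^bsub>LP\<^esub> cl (\<Sum>e \<in> A. ex e * gx e) \<otimes>\<^bsub>LP\<^esub> y \<in> generate (add_monoid LP) (P (Suc n))"
        using insert by auto
      moreover have "x \<otimes>\<^bsub>LP\<^esub> cl (\<Sum>e \<in> insert e A. ex e * gx e) \<otimes>\<^bsub>LP\<^esub> y
          = x \<otimes>\<^bsub>LP\<^esub> cl (ex e * gx e) \<otimes>\<^bsub>LP\<^esub> y \<oplus>\<^bsub>LP\<^esub> x \<otimes>\<^bsub>LP\<^esub> cl (\<Sum>e \<in> A. ex e * gx e) \<otimes>\<^bsub>LP\<^esub> y"
        using insert.hyps e(1) A c cl_closed[OF A] cl_closed[of "ex e * gx e"]
        by (simp add: add_cl[symmetric] free_alg_mult R.R.l_distr R.R.r_distr)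
      ultimately show ?case using S_add by simp
    qed
    moreover have "finite (out_arcs E w)" by (rule finite_subset[OF _ finite_arcs]) auto
    ultimately have "x \<otimes>\<^bsub>LP\<^esub> cl (\<Sum>e \<in> out_arcs E w. ex e * gx e) \<otimes>\<^bsub>LP\<^esub> y \<in> generate (add_monoid LP) (P (Suc n))"
      by blast
    then show ?thesis using cl_vertex[OF wv] by simp
  qed
  have mono: "generate (add_monoid LP) (P n) \<subseteq> generate (add_monoid LP) (P (Suc n))" for n
  proof
    fix z assume "z \<in> generate (add_monoid LP) (P n)"
    then show "z \<in> generate (add_monoid LP) (P (Suc n))"
    proof induction
      case one show ?case by (rule generate.one)
    next
      case (incl h) then show ?case using path unfolding P_def by blast
    next
      case (inv h)
      then obtain x w y where h: "h = x \<otimes>\<^bsub>LP\<^esub> cl (vx w) \<otimes>\<^bsub>LP\<^esub> y" "w \<in> reach n" "x \<in> homog LP (int n)" "y \<in> homog LP (- int n)"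
        unfolding P_def by blast
      have wc: "cl (vx w) \<in> carrier LP" using h(2) reach_verts R.D_carrier[OF vertex_homog] by blast
      have "\<ominus>\<^bsub>LP\<^esub> h = (\<ominus>\<^bsub>LP\<^esub> x) \<otimes>\<^bsub>LP\<^esub> cl (vx w) \<otimes>\<^bsub>LP\<^esub> y"
        using h wc by (simp add: R.R.l_minus R.D_carrier)
      then have "\<ominus>\<^bsub>LP\<^esub> h \<in> generate (add_monoid LP) (P (Suc n))"
        using path[OF h(2) R.D_minus[OF h(3)] h(4)] by simp
      then show ?case by (simp add: a_inv_def)
    next
      case (eng h k) show ?case by (rule generate.eng[OF eng.IH])
    qed
  qed
  have one_P: "\<one>\<^bsub>LP\<^esub> \<in> generate (add_monoid LP) (P n)" for n
  proof (induction n)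
    case 0
    show ?case unfolding one_LP
    proof (rule cl_sum_closed[OF S_add S_zero])
      fix v assume v: "v \<in> verts E"
      have "cl (vx v) = cl (vx v) \<otimes>\<^bsub>LP\<^esub> cl (vx v) \<otimes>\<^bsub>LP\<^esub> cl (vx v)" using v by (simp add: mult_vertex_edge)
      then have "cl (vx v) \<in> P 0" unfolding P_def using v vertex_homog[OF v] by force
      then show "cl (vx v) \<in> generate (add_monoid LP) (P 0)" by (rule generate.incl)
    qed auto
  next
    case (Suc n) then show ?case using mono by blast
  qed
  obtain N where N: "reach (Suc N) = reach N" using reach_stable by blast
  have "P N \<subseteq> {x \<otimes>\<^bsub>LP\<^esub> y |x y. x \<in> homog LP (- 1) \<and> y \<in> homog LP (- (- 1))}"
  proof
    fix z assume "z \<in> P N"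
    then obtain x w y where z: "z = x \<otimes>\<^bsub>LP\<^esub> cl (vx w) \<otimes>\<^bsub>LP\<^esub> y" "w \<in> reach N" "x \<in> homog LP (int N)" "y \<in> homog LP (- int N)"
      unfolding P_def by blast
    \<comment> \<open>Stability puts \<open>w\<close> also into \<open>reach (N + 1)\<close>, so it
      splits in degrees \<open>-(N + 1)\<close> and \<open>N + 1\<close>. This is one more than the
      degrees \<open>N\<close> and \<open>-N\<close> of \<open>x\<close> and \<open>y\<close>, and
      regrouping leaves factors of degrees -1 and 1.\<close>
    obtain a b where ab: "a \<in> homog LP (- int (Suc N))" "b \<in> homog LP (int (Suc N))" "a \<otimes>\<^bsub>LP\<^esub> b = cl (vx w)"
      using reach_factor[of w "Suc N"] z(2) N by blast
    have "z = (x \<otimes>\<^bsub>LP\<^esub> a) \<otimes>\<^bsub>LP\<^esub> (b \<otimes>\<^bsub>LP\<^esub> y)"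
      unfolding z(1) ab(3)[symmetric]
      using R.D_carrier[OF z(3)] R.D_carrier[OF z(4)] R.D_carrier[OF ab(1)] R.D_carrier[OF ab(2)]
      by (simp add: R.R.m_assoc)
    moreover have "x \<otimes>\<^bsub>LP\<^esub> a \<in> homog LP (- 1)" "b \<otimes>\<^bsub>LP\<^esub> y \<in> homog LP (- (- 1))"
      using R.homog_mult[OF z(3) ab(1)] R.homog_mult[OF ab(2) z(4)] by simp_all
    ultimately show "z \<in> {x \<otimes>\<^bsub>LP\<^esub> y |x y. x \<in> homog LP (- 1) \<and> y \<in> homog LP (- (- 1))}" by blast
  qed
  from group.mono_generate[OF R.R.a_group this] one_P[of N] have neg: "\<one>\<^bsub>LP\<^esub> \<in> ?S (- 1)"
    unfolding homog_span_def by blast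
  show ?thesis
    by (intro strongly_graded.intro graded_ring_LP strongly_graded_axioms.intro pos neg)
qed

end

section \<open>Integer powers of bijections\<close>

lemma aut_power_zero [simp]: "aut_power X \<tau> 0 = id"
  by (simp add: aut_power_def)

lemma aut_power_one [simp]: "aut_power X \<tau> 1 = \<tau>"
  by (simp add: aut_power_def fun_eq_iff)

lemma aut_power_closed:
  assumes b: "bij_betw \<tau> X X" and x: "x \<in> X" shows "aut_power X \<tau> n x \<in> X"
proof -
  have "(\<tau> ^^ k) x \<in> X" "(inv_into X \<tau> ^^ k) x \<in> X" for k
    using x b bij_betw_inv_into[OF b] by (induction k) (auto simp: bij_betw_def)
  then show ?thesis by (simp add: aut_power_def)
qed

lemma aut_power_Suc:
  assumes b: "bij_betw \<tau> X X" and x: "x \<in> X" shows "aut_power X \<tau> (n + 1) x = \<tau> (aut_power X \<tau> n x)"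
proof (cases "0 \<le> n")
  case True
  then have "nat (n + 1) = Suc (nat n)" by simp
  with True show ?thesis by (simp add: aut_power_def)
next
  case False
  define k where "k = nat (- (n + 1))"
  then have k: "nat (- n) = Suc k" "nat (- (n + 1)) = k" using False by simp_all
  have "(inv_into X \<tau> ^^ k) x \<in> X" using x bij_betw_inv_into[OF b] by (induction k) (auto simp: bij_betw_def)
  then have *: "\<tau> (inv_into X \<tau> ((inv_into X \<tau> ^^ k) x)) = (inv_into X \<tau> ^^ k) x"
    using b by (simp add: bij_betw_def f_inv_into_f)
  show ?thesis
  \<comment> \<open>For this value \<open>n + 1 = 0\<close> falls under the other branch of
    \<open>aut_power\<close>.\<close>
  proof (cases "n = - 1")
    case True
    then show ?thesis using * k(1) k_def by (simp add: aut_power_def)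
  next
    case n: False
    then show ?thesis using False * k by (simp add: aut_power_def)
  qed
qed

lemma aut_power_add:
  assumes b: "bij_betw \<tau> X X" and x: "x \<in> X"
  shows "aut_power X \<tau> (m + n) x = aut_power X \<tau> m (aut_power X \<tau> n x)"
proof (induction m rule: int_induct[where k = 0])
  case base show ?case by simp
next
  case (step1 i)
  then show ?case
    using aut_power_Suc[OF b x, of "i + n"] aut_power_Suc[OF b aut_power_closed[OF b x], of i n]
    by (simp add: ac_simps)
next
  case (step2 i)
  \<comment> \<open>The downward step is verified after applying \<open>\<tau>\<close>, which is
    injective on \<open>X\<close>.\<close>
  have "\<tau> (aut_power X \<tau> (i - 1 + n) x) = \<tau> (aut_power X \<tau> (i - 1) (aut_power X \<tau> n x))"
    using aut_power_Suc[OF b x, of "i - 1 + n"] aut_power_Suc[OF b aut_power_closed[OF b x], of "i - 1" n] step2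
    by (simp add: algebra_simps)
  then show ?case
    using b aut_power_closed[OF b x] aut_power_closed[OF b aut_power_closed[OF b x]]
    by (meson bij_betw_def inj_onD)
qed

section \<open>Graph automorphisms and twisted words\<close>

definition word_map :: "(('v, 'e) gen list \<Rightarrow> ('v, 'e) gen list) \<Rightarrow> ('v, 'e, 'k::field) free_elem \<Rightarrow> ('v, 'e, 'k) free_elem" where
  "word_map f = lin (\<lambda>w. Poly_Mapping.single (Word (f (letters w))))"

interpretation word_map: additive_family "\<lambda>w. Poly_Mapping.single (Word (f (letters w)))"
  by standard (simp_all add: single_add)

lemma word_map_simps [simp]: "word_map f 0 = 0"
  "word_map f (Poly_Mapping.single w c) = Poly_Mapping.single (Word (f (letters w))) c"
  "word_map f (p + q) = word_map f p + word_map f q"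
  "word_map f (p - q) = word_map f p - word_map f q"
  using word_map.lin_add lin_minus[OF word_map.additive_family_axioms] by (simp_all add: word_map_def)

lemma word_map_sum: "word_map f (sum g A) = (\<Sum>i \<in> A. word_map f (g i))"
  by (induction A rule: infinite_finite_induct) simp_all

lemma word_map_comp: "word_map f (word_map g p) = word_map (\<lambda>xs. f (g xs)) p"
proof -
  have "Poly_Mapping.keys p \<subseteq> UNIV" by simp
  then show ?thesis by (induction rule: poly_mapping_single_induct) simp_all
qed

lemma word_map_id: "(\<And>xs. f xs = xs) \<Longrightarrow> word_map f p = p"
proof -
  assume f: "\<And>xs. f xs = xs"
  have "Poly_Mapping.keys p \<subseteq> UNIV" by simp
  then show ?thesis by (induction rule: poly_mapping_single_induct) (simp_all add: f)
qed

lemma keys_word_map: "Poly_Mapping.keys (word_map f p) \<subseteq> (\<lambda>w. Word (f (letters w))) ` Poly_Mapping.keys p"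
  unfolding word_map_def lin_def using keys_sum by (fastforce split: if_splits)

lemma word_map_cong:
  "(\<And>w. w \<in> Poly_Mapping.keys p \<Longrightarrow> f (letters w) = g (letters w)) \<Longrightarrow> word_map f p = word_map g p"
  by (simp add: word_map_def lin_def)

lemma map_word_eq: "map_word h w = Word (map h (letters w))"
  by (cases w) simp

lemma free_map_eq: "free_map a b = word_map (map (map_gen a b))"
  by (simp add: free_map_def word_map_def lin_def fun_eq_iff map_word_eq)

lemma word_map_mult:
  assumes "\<And>xs ys. f (xs @ ys) = f xs @ f ys"
  shows "word_map f (p * q) = word_map f p * word_map f q"
proof -
  have 1: "word_map f (Poly_Mapping.single w c * q) = word_map f (Poly_Mapping.single w c) * word_map f q" for w c
  proof -
    have "Poly_Mapping.keys q \<subseteq> UNIV" by simp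
    then show ?thesis
      by (induction rule: poly_mapping_single_induct)
        (simp_all add: mult_single distrib_left assms plus_word_def)
  qed
  have "Poly_Mapping.keys p \<subseteq> UNIV" by simp
  then show ?thesis
    by (induction rule: poly_mapping_single_induct) (simp_all only: 1 distrib_right word_map_simps(1,3) mult_zero_left)
qed

lemma gen_degree_map_gen [simp]: "gen_degree (map_gen a b x) = gen_degree x"
  by (cases x) simp_all

text \<open>The permutations are those of whole types, so that integer powers compose and cancel
  without reference to a carrier. A graph automorphism is brought into this form by
  \<open>extend_perm\<close>.\<close>

locale perm_pair =
  fixes s\<^sub>0 :: "'v \<Rightarrow> 'v" and s\<^sub>1 :: "'e \<Rightarrow> 'e"
  assumes bij0: "bij s\<^sub>0" and bij1: "bij s\<^sub>1"
begin

definition z\<^sub>0 :: "int \<Rightarrow> 'v \<Rightarrow> 'v" where "z\<^sub>0 n = aut_power UNIV s\<^sub>0 n"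
definition z\<^sub>1 :: "int \<Rightarrow> 'e \<Rightarrow> 'e" where "z\<^sub>1 n = aut_power UNIV s\<^sub>1 n"
definition zp :: "int \<Rightarrow> ('v, 'e) gen \<Rightarrow> ('v, 'e) gen" where "zp n = map_gen (z\<^sub>0 n) (z\<^sub>1 n)"

lemma z_add: "z\<^sub>0 (m + n) v = z\<^sub>0 m (z\<^sub>0 n v)" "z\<^sub>1 (m + n) e = z\<^sub>1 m (z\<^sub>1 n e)"
  using aut_power_add[OF bij0] aut_power_add[OF bij1] by (simp_all add: z\<^sub>0_def z\<^sub>1_def)

lemma z_0 [simp]: "z\<^sub>0 0 v = v" "z\<^sub>1 0 e = e" and z_1 [simp]: "z\<^sub>0 1 = s\<^sub>0" "z\<^sub>1 1 = s\<^sub>1"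
  by (simp_all add: z\<^sub>0_def z\<^sub>1_def)

lemma z_inverse [simp]: "z\<^sub>0 (- n) (z\<^sub>0 n v) = v" "z\<^sub>1 (- n) (z\<^sub>1 n e) = e"
  "z\<^sub>0 n (z\<^sub>0 (- n) v) = v" "z\<^sub>1 n (z\<^sub>1 (- n) e) = e"
  by (simp_all flip: z_add)

lemma z_inject [simp]: "z\<^sub>0 n v = z\<^sub>0 n w \<longleftrightarrow> v = w" "z\<^sub>1 n e = z\<^sub>1 n f \<longleftrightarrow> e = f"
  by (metis z_inverse(1), metis z_inverse(2))

lemma zp_add: "zp (m + n) x = zp m (zp n x)"
  by (cases x) (simp_all add: zp_def z_add)

lemma zp_simps [simp]: "zp n (Vert v) = Vert (z\<^sub>0 n v)" "zp n (Edge e) = Edge (z\<^sub>1 n e)"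
  "zp n (Ghost e) = Ghost (z\<^sub>1 n e)"
  by (simp_all add: zp_def)

lemma zp_0 [simp]: "zp 0 x = x"
  by (cases x) simp_all

lemma gen_degree_zp [simp]: "gen_degree (zp n x) = gen_degree x"
  by (simp add: zp_def)

definition wm :: "int \<Rightarrow> ('v, 'e, 'k::field) free_elem \<Rightarrow> ('v, 'e, 'k) free_elem" where
  "wm n = word_map (map (zp n))"

lemma wm_mult: "wm n (p * q) = wm n p * wm n q"
  by (simp add: wm_def word_map_mult)

lemma wm_simps [simp]: "wm n 0 = 0" "wm n (p + q) = wm n p + wm n q" "wm n (p - q) = wm n p - wm n q"
  "wm n (Poly_Mapping.single w c) = Poly_Mapping.single (Word (map (zp n) (letters w))) c"
  by (simp_all add: wm_def)

lemma wm_add: "wm (m + n) p = wm m (wm n p)"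
proof -
  have "zp (m + n) = (\<lambda>x. zp m (zp n x))" by (rule ext) (rule zp_add)
  then show ?thesis by (simp add: wm_def word_map_comp comp_def)
qed

lemma wm_0 [simp]: "wm 0 p = p"
  unfolding wm_def by (rule word_map_id) (simp add: map_idI)

lemma wm_gen [simp]: "wm n (gen_elem x) = gen_elem (zp n x)"
  by (simp add: gen_elem_def)

lemma word_degree_zp: "word_degree (Word (map (zp n) (letters w))) = word_degree w"
  by (simp add: word_degree_def comp_def)

lemma wm_degree:
  assumes "\<And>w. w \<in> Poly_Mapping.keys p \<Longrightarrow> word_degree w = m" "w \<in> Poly_Mapping.keys (wm n p)"
  shows "word_degree w = m"
  using subsetD[OF keys_word_map assms(2)[unfolded wm_def]] assms(1) by (auto simp: word_degree_zp)

text \<open>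
  In the Zhang twist a letter \<open>x\<close> preceded by letters of total degree \<open>d\<close> is moved by the \<open>d\<close>-th
  power of the automorphism; a ghost edge \<open>e\<^sup>*\<close> of the twisted graph moreover corresponds to
  \<open>\<sigma>\<^sup>-\<^sup>1(e\<^sup>*)\<close>.  The sign \<open>\<epsilon>\<close> covers the inverse transformation.
\<close>

fun ghost_shift :: "('v, 'e) gen \<Rightarrow> int" where
  "ghost_shift (Ghost e) = - 1"
| "ghost_shift _ = 0"

lemma ghost_shift_zp [simp]: "ghost_shift (zp n x) = ghost_shift x"
  by (cases x) simp_all

fun tw :: "int \<Rightarrow> int \<Rightarrow> ('v, 'e) gen list \<Rightarrow> ('v, 'e) gen list" where
  "tw \<epsilon> d [] = []"
| "tw \<epsilon> d (x # xs) = zp (\<epsilon> * (d + ghost_shift x)) x # tw \<epsilon> (d + gen_degree x) xs"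

text \<open>The exponents depend only on the degrees of the letters and on which of them are ghosts.
  As \<open>zp\<close> changes neither, the second pass meets the same exponents with the opposite
  sign.\<close>

lemma tw_inverse: "tw (- \<epsilon>) d (tw \<epsilon> d xs) = xs"
  by (induction xs arbitrary: d) (simp_all flip: zp_add)

text \<open>Raising the initial degree by \<open>k\<close> adds \<open>\<epsilon> k\<close> to the
  exponent at every letter. Applied to a suffix, with \<open>k\<close> the degree of the prefix,
  this gives the behaviour on concatenations.\<close>

lemma tw_shift: "tw \<epsilon> (d + k) xs = map (zp (\<epsilon> * k)) (tw \<epsilon> d xs)"
proof (induction xs arbitrary: d)
  case (Cons x xs)
  have "tw \<epsilon> (d + k + gen_degree x) xs = tw \<epsilon> (d + gen_degree x + k) xs" by (simp add: ac_simps)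
  then show ?case using Cons[of "d + gen_degree x"] by (simp add: algebra_simps flip: zp_add)
qed simp

lemma tw_append: "tw \<epsilon> d (xs @ ys) = tw \<epsilon> d xs @ map (zp (\<epsilon> * (\<Sum>x \<leftarrow> xs. gen_degree x))) (tw \<epsilon> d ys)"
proof -
  have "tw \<epsilon> d (xs @ ys) = tw \<epsilon> d xs @ tw \<epsilon> (d + (\<Sum>x \<leftarrow> xs. gen_degree x)) ys"
    by (induction xs arbitrary: d) (simp_all add: ac_simps)
  then show ?thesis by (simp add: tw_shift)
qed

lemma tw_zp: "tw \<epsilon> d (map (zp n) xs) = map (zp n) (tw \<epsilon> d xs)"
  by (induction xs arbitrary: d) (simp_all add: ac_simps flip: zp_add)

lemma tw_degree: "(\<Sum>x \<leftarrow> tw \<epsilon> d xs. gen_degree x) = (\<Sum>x \<leftarrow> xs. gen_degree x)"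
  by (induction xs arbitrary: d) simp_all

definition theta :: "int \<Rightarrow> ('v, 'e, 'k::field) free_elem \<Rightarrow> ('v, 'e, 'k) free_elem" where
  "theta \<epsilon> = word_map (tw \<epsilon> 0)"

lemma theta_simps [simp]: "theta \<epsilon> 0 = 0" "theta \<epsilon> (p + q) = theta \<epsilon> p + theta \<epsilon> q"
  "theta \<epsilon> (p - q) = theta \<epsilon> p - theta \<epsilon> q"
  "theta \<epsilon> (Poly_Mapping.single w c) = Poly_Mapping.single (Word (tw \<epsilon> 0 (letters w))) c"
  by (simp_all add: theta_def)

lemma theta_sum: "theta \<epsilon> (sum f A) = (\<Sum>i \<in> A. theta \<epsilon> (f i))"
  by (simp add: theta_def word_map_sum)

lemma theta_inverse: "theta (- \<epsilon>) (theta \<epsilon> p) = p"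
  by (simp add: theta_def word_map_comp tw_inverse word_map_id)

lemma theta_wm: "theta \<epsilon> (wm n p) = wm n (theta \<epsilon> p)"
  by (simp add: theta_def wm_def word_map_comp tw_zp)

lemma theta_degree:
  assumes "\<And>w. w \<in> Poly_Mapping.keys p \<Longrightarrow> word_degree w = m" "w \<in> Poly_Mapping.keys (theta \<epsilon> p)"
  shows "word_degree w = m"
  using subsetD[OF keys_word_map assms(2)[unfolded theta_def]] assms(1) by (auto simp: word_degree_def tw_degree)

text \<open>A left factor of degree \<open>m\<close> moves the word after it by the power
  \<open>\<epsilon> m\<close>. This is the rule of a Zhang product, and it makes sense only for a
  homogeneous left factor.\<close>

lemma theta_mult:
  assumes p: "\<And>w. w \<in> Poly_Mapping.keys p \<Longrightarrow> word_degree w = m"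
  shows "theta \<epsilon> (p * q) = theta \<epsilon> p * wm (\<epsilon> * m) (theta \<epsilon> q)"
proof -
  have 1: "theta \<epsilon> (Poly_Mapping.single w c * q) = theta \<epsilon> (Poly_Mapping.single w c) * wm (\<epsilon> * word_degree w) (theta \<epsilon> q)" for w c
  proof -
    have "Poly_Mapping.keys q \<subseteq> UNIV" by simp
    then show ?thesis
      by (induction rule: poly_mapping_single_induct)
        (simp_all add: mult_single distrib_left tw_append plus_word_def word_degree_def)
  qed
  have "Poly_Mapping.keys p \<subseteq> {w. word_degree w = m}" using p by auto
  then show ?thesis
  proof (induction rule: poly_mapping_single_induct)
    case (single w c)
    then show ?case using 1[of w c] by simp
  qed (simp_all add: distrib_right)
qed

lemma theta_gens:
  "theta \<epsilon> (gen_elem x) = gen_elem (zp (\<epsilon> * ghost_shift x) x)"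
  "theta \<epsilon> (gen_elem x * gen_elem y)
    = gen_elem (zp (\<epsilon> * ghost_shift x) x) * gen_elem (zp (\<epsilon> * (gen_degree x + ghost_shift y)) y)"
  by (simp_all add: gen_elem_def mult_single plus_word_def)

end

lemma homog_part_decomposition:
  "p = (\<Sum>n \<in> word_degree ` Poly_Mapping.keys p. homog_part n p)"
proof (rule poly_mapping_eqI)
  fix w
  have "(\<Sum>n \<in> word_degree ` Poly_Mapping.keys p. Poly_Mapping.lookup (homog_part n p) w) = Poly_Mapping.lookup p w"
    by (cases "w \<in> Poly_Mapping.keys p") (auto simp: lookup_homog_part sum.delta in_keys_iff)
  then show "Poly_Mapping.lookup p w = Poly_Mapping.lookup (\<Sum>n \<in> word_degree ` Poly_Mapping.keys p. homog_part n p) w"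
    by (simp add: lookup_sum)
qed

section \<open>Powers of a graph automorphism and the ideal of relations\<close>

locale graph_perm = leavitt_path_algebra E K + perm_pair s\<^sub>0 s\<^sub>1
  for E :: "('v, 'e) pre_digraph" and K :: "'k::field itself" and s\<^sub>0 :: "'v \<Rightarrow> 'v" and s\<^sub>1 :: "'e \<Rightarrow> 'e" +
  assumes verts_iff: "s\<^sub>0 v \<in> verts E \<longleftrightarrow> v \<in> verts E" and arcs_iff: "s\<^sub>1 e \<in> arcs E \<longleftrightarrow> e \<in> arcs E"
    and tail_s: "e \<in> arcs E \<Longrightarrow> tail E (s\<^sub>1 e) = s\<^sub>0 (tail E e)"
    and head_s: "e \<in> arcs E \<Longrightarrow> head E (s\<^sub>1 e) = s\<^sub>0 (head E e)"
begin

text \<open>For negative exponents the claim at \<open>i - 1\<close> is obtained by applying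
  \<open>s\<^sub>0\<close> and \<open>s\<^sub>1\<close>, which leads to exponent \<open>i\<close>,
  and by cancelling the injective \<open>s\<^sub>0\<close>.\<close>

lemma z_automorphism: "(z\<^sub>0 n v \<in> verts E \<longleftrightarrow> v \<in> verts E) \<and> (z\<^sub>1 n e \<in> arcs E \<longleftrightarrow> e \<in> arcs E) \<and>
    (e \<in> arcs E \<longrightarrow> tail E (z\<^sub>1 n e) = z\<^sub>0 n (tail E e) \<and> head E (z\<^sub>1 n e) = z\<^sub>0 n (head E e))"
proof (induction n arbitrary: v e rule: int_induct[where k = 0])
  case base show ?case by simp
next
  case (step1 i)
  have "z\<^sub>0 (i + 1) v = s\<^sub>0 (z\<^sub>0 i v)" "z\<^sub>1 (i + 1) e = s\<^sub>1 (z\<^sub>1 i e)" for v e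
    using z_add[of 1 i] by (simp_all add: add.commute)
  then show ?case using step1 by (simp add: verts_iff arcs_iff tail_s head_s)
next
  case (step2 i)
  have s: "s\<^sub>0 (z\<^sub>0 (i - 1) v) = z\<^sub>0 i v" "s\<^sub>1 (z\<^sub>1 (i - 1) e) = z\<^sub>1 i e" for v e
    using z_add[of 1 "i - 1"] by simp_all
  have inj: "s\<^sub>0 x = s\<^sub>0 y \<Longrightarrow> x = y" for x y using bij0 by (simp add: bij_def inj_eq)
  have a: "z\<^sub>0 (i - 1) v \<in> verts E \<longleftrightarrow> v \<in> verts E" "z\<^sub>1 (i - 1) e \<in> arcs E \<longleftrightarrow> e \<in> arcs E" for v e
    using step2(2) verts_iff[of "z\<^sub>0 (i - 1) v"] arcs_iff[of "z\<^sub>1 (i - 1) e"] by (simp_all add: s)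
  have "tail E (z\<^sub>1 (i - 1) e) = z\<^sub>0 (i - 1) (tail E e) \<and> head E (z\<^sub>1 (i - 1) e) = z\<^sub>0 (i - 1) (head E e)"
    if e: "e \<in> arcs E"
  proof -
    have "s\<^sub>0 (tail E (z\<^sub>1 (i - 1) e)) = z\<^sub>0 i (tail E e)" "s\<^sub>0 (head E (z\<^sub>1 (i - 1) e)) = z\<^sub>0 i (head E e)"
      using step2(2) e a(2)[of e] by (simp_all flip: tail_s head_s add: s)
    then show ?thesis using inj s(1) by metis
  qed
  then show ?case using a by blast
qed

lemma z_verts [simp]: "z\<^sub>0 n v \<in> verts E \<longleftrightarrow> v \<in> verts E" and z_arcs [simp]: "z\<^sub>1 n e \<in> arcs E \<longleftrightarrow> e \<in> arcs E"
  and tail_z: "e \<in> arcs E \<Longrightarrow> tail E (z\<^sub>1 n e) = z\<^sub>0 n (tail E e)"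
  and head_z: "e \<in> arcs E \<Longrightarrow> head E (z\<^sub>1 n e) = z\<^sub>0 n (head E e)"
  using z_automorphism by blast+

lemma out_arcs_z: "out_arcs E (z\<^sub>0 n v) = z\<^sub>1 n ` out_arcs E v"
proof
  show "z\<^sub>1 n ` out_arcs E v \<subseteq> out_arcs E (z\<^sub>0 n v)" by (auto simp: tail_z)
  show "out_arcs E (z\<^sub>0 n v) \<subseteq> z\<^sub>1 n ` out_arcs E v"
  proof
    fix e assume e: "e \<in> out_arcs E (z\<^sub>0 n v)"
    then have "z\<^sub>1 (- n) e \<in> out_arcs E v" using tail_z[of e "- n"] by simp
    then show "e \<in> z\<^sub>1 n ` out_arcs E v" by (rule image_eqI[rotated]) simp
  qed
qed

lemma zp_generators [simp]: "zp n x \<in> generators E \<longleftrightarrow> x \<in> generators E"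
  by (cases x) (auto simp: generators_def)

lemma wm_free: "p \<in> Fr \<Longrightarrow> wm n p \<in> Fr"
  using keys_word_map[of "map (zp n)" p] by (force simp: free_alg_iff gen_words_def wm_def)

lemma wm_relations:
  assumes "(p :: ('v, 'e, 'k) free_elem) \<in> leavitt_relations E" shows "wm n p \<in> leavitt_relations E"
  using assms[unfolded leavitt_relations_def]
proof (elim UnE)
  assume "p \<in> {vx v * vx w - (if v = w then vx v else 0) | v w. v \<in> verts E \<and> w \<in> verts E}"
  then obtain v w where "v \<in> verts E" "w \<in> verts E" "p = vx v * vx w - (if v = w then vx v else 0)" by blast
  then have "wm n p = vx (z\<^sub>0 n v) * vx (z\<^sub>0 n w) - (if z\<^sub>0 n v = z\<^sub>0 n w then vx (z\<^sub>0 n v) else 0)"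
    "z\<^sub>0 n v \<in> verts E" "z\<^sub>0 n w \<in> verts E" by (simp_all add: wm_mult)
  then show ?thesis unfolding leavitt_relations_def by blast
next
  assume "p \<in> (\<Union>e \<in> arcs E.
       {vx (tail E e) * ex e - ex e, ex e * vx (head E e) - ex e,
        gx e * vx (tail E e) - gx e, vx (head E e) * gx e - gx e})"
  then obtain e where e: "e \<in> arcs E" and p: "p \<in> {vx (tail E e) * ex e - ex e, ex e * vx (head E e) - ex e,
        gx e * vx (tail E e) - gx e, vx (head E e) * gx e - gx e}" by blast
  have "wm n p \<in> {vx (tail E (z\<^sub>1 n e)) * ex (z\<^sub>1 n e) - ex (z\<^sub>1 n e), ex (z\<^sub>1 n e) * vx (head E (z\<^sub>1 n e)) - ex (z\<^sub>1 n e),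
        gx (z\<^sub>1 n e) * vx (tail E (z\<^sub>1 n e)) - gx (z\<^sub>1 n e), vx (head E (z\<^sub>1 n e)) * gx (z\<^sub>1 n e) - gx (z\<^sub>1 n e)}"
    using p e by (auto simp: wm_mult tail_z head_z)
  moreover have "z\<^sub>1 n e \<in> arcs E" using e by simp
  ultimately show ?thesis unfolding leavitt_relations_def by blast
next
  assume "p \<in> {gx e * ex f - (if e = f then vx (head E e) else 0) | e f. e \<in> arcs E \<and> f \<in> arcs E}"
  then obtain e f where "e \<in> arcs E" "f \<in> arcs E" "p = gx e * ex f - (if e = f then vx (head E e) else 0)" by blast
  then have "wm n p = gx (z\<^sub>1 n e) * ex (z\<^sub>1 n f) - (if z\<^sub>1 n e = z\<^sub>1 n f then vx (head E (z\<^sub>1 n e)) else 0)"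
    "z\<^sub>1 n e \<in> arcs E" "z\<^sub>1 n f \<in> arcs E" by (simp_all add: wm_mult head_z)
  then show ?thesis unfolding leavitt_relations_def by blast
next
  assume "p \<in> {vx v - (\<Sum>e \<in> out_arcs E v. ex e * gx e) | v. is_regular E v}"
  then obtain v where v: "is_regular E v" "p = vx v - (\<Sum>e \<in> out_arcs E v. ex e * gx e)" by blast
  have "wm n (\<Sum>e \<in> out_arcs E v. ex e * gx e) = ((\<Sum>e \<in> out_arcs E v. ex (z\<^sub>1 n e) * gx (z\<^sub>1 n e)) :: ('v, 'e, 'k) free_elem)"
    by (simp add: wm_def word_map_sum) (simp add: wm_def[symmetric] wm_mult)
  also have "\<dots> = (\<Sum>e \<in> out_arcs E (z\<^sub>0 n v). ex e * gx e)"
    unfolding out_arcs_z by (simp add: sum.reindex inj_on_def)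
  finally have "wm n p = vx (z\<^sub>0 n v) - (\<Sum>e \<in> out_arcs E (z\<^sub>0 n v). ex e * gx e)" by (simp add: v(2))
  moreover have "is_regular E (z\<^sub>0 n v)" using v(1) by (simp add: is_regular_def out_arcs_z)
  ultimately show ?thesis unfolding leavitt_relations_def by blast
qed

lemma wm_ideal: "p \<in> I \<Longrightarrow> wm n p \<in> I"
proof (induction rule: leavitt_ideal.induct)
  case (scale p k)
  have "wm n (Poly_Mapping.single 0 k * p) = Poly_Mapping.single 0 k * wm n p"
    by (simp add: wm_mult) (simp add: zero_word_def)
  then show ?case using leavitt_ideal.scale[OF scale.IH, of k] by (simp add: scale_elem_eq)
qed (auto simp: wm_mult intro: leavitt_ideal.intros wm_relations wm_free)

end

text \<open>Both directions are covered: \<open>\<epsilon> = 1\<close> goes from the twisted graph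
  to \<open>E\<close>, and \<open>\<epsilon> = - 1\<close> from \<open>E\<close> to the twisted
  graph, where the heads differ by the opposite power.\<close>

locale twisted_pair = E2: graph_perm E\<^sub>2 K s\<^sub>0 s\<^sub>1 + E1: leavitt_path_algebra E\<^sub>1 K
  for E\<^sub>1 E\<^sub>2 :: "('v, 'e) pre_digraph" and K :: "'k::field itself" and s\<^sub>0 :: "'v \<Rightarrow> 'v" and s\<^sub>1 :: "'e \<Rightarrow> 'e" +
  fixes \<epsilon> :: int
  assumes eps: "\<epsilon> * \<epsilon> = 1"
    and verts_eq: "verts E\<^sub>1 = verts E\<^sub>2" and arcs_eq: "arcs E\<^sub>1 = arcs E\<^sub>2" and tail_eq: "tail E\<^sub>1 = tail E\<^sub>2"
    and head_eq: "e \<in> arcs E\<^sub>2 \<Longrightarrow> head E\<^sub>1 e = E2.z\<^sub>0 (- \<epsilon>) (head E\<^sub>2 e)"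
begin

abbreviation "\<theta> \<equiv> E2.theta \<epsilon> :: ('v, 'e, 'k) free_elem \<Rightarrow> ('v, 'e, 'k) free_elem"

lemma generators_eq: "generators E\<^sub>1 = generators E\<^sub>2"
  by (simp add: generators_def verts_eq arcs_eq)

lemma free_eq: "free_alg E\<^sub>1 = free_alg E\<^sub>2"
  by (simp add: free_alg_def generators_eq)

lemma set_tw: "set xs \<subseteq> generators E\<^sub>2 \<Longrightarrow> set (E2.tw \<epsilon>' d xs) \<subseteq> generators E\<^sub>2"
  by (induction xs arbitrary: d) auto

lemma tw_Nil: "E2.tw \<epsilon>' d xs = [] \<longleftrightarrow> xs = []"
  by (cases xs) auto

lemma theta_free: "p \<in> E2.Fr \<Longrightarrow> E2.theta \<epsilon>' p \<in> E2.Fr"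
  using keys_word_map[of "E2.tw \<epsilon>' 0" p] set_tw
  by (force simp: free_alg_iff gen_words_def E2.theta_def tw_Nil)

text \<open>The exponents are made for this. A vertex after an edge stands at degree 1 and is moved
  by the power \<open>\<epsilon>\<close>, which undoes the change of heads. The ghost of
  \<open>e\<close> becomes the ghost of \<open>z\<^sub>1 (- \<epsilon>) e\<close>, whose head in
  \<open>E\<^sub>2\<close> is the head of \<open>e\<close> in \<open>E\<^sub>1\<close>. In
  \<open>ex e * gx e\<close> the degree of the edge and the ghost shift cancel, so the relation at a
  regular vertex keeps its form.\<close>

lemma theta_relations:
  assumes "(p :: ('v, 'e, 'k) free_elem) \<in> leavitt_relations E\<^sub>1" shows "\<theta> p \<in> leavitt_ideal E\<^sub>2"
proof -
  note g = E2.theta_gens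
  have z: "E2.z\<^sub>0 \<epsilon> (E2.z\<^sub>0 (- \<epsilon>) v) = v" for v by simp
  show ?thesis
    using assms unfolding leavitt_relations_def
  proof (elim UnE)
    assume "p \<in> {vx v * vx w - (if v = w then vx v else 0) | v w. v \<in> verts E\<^sub>1 \<and> w \<in> verts E\<^sub>1}"
    then obtain v w where "v \<in> verts E\<^sub>2" "w \<in> verts E\<^sub>2" "p = vx v * vx w - (if v = w then vx v else 0)"
      unfolding verts_eq by blast
    then show ?thesis using E2.rel_vv[of v w] by (auto simp: g)
  next
    assume "p \<in> (\<Union>e \<in> arcs E\<^sub>1.
       {vx (tail E\<^sub>1 e) * ex e - ex e, ex e * vx (head E\<^sub>1 e) - ex e,
        gx e * vx (tail E\<^sub>1 e) - gx e, vx (head E\<^sub>1 e) * gx e - gx e})"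
    then obtain e where e: "e \<in> arcs E\<^sub>2" and p: "p \<in> {vx (tail E\<^sub>2 e) * ex e - ex e, ex e * vx (head E\<^sub>1 e) - ex e,
        gx e * vx (tail E\<^sub>2 e) - gx e, vx (head E\<^sub>1 e) * gx e - gx e}" unfolding arcs_eq tail_eq by blast
    have e': "E2.z\<^sub>1 (- \<epsilon>) e \<in> arcs E\<^sub>2" using e by simp
    show ?thesis
      using p E2.edge_rels[OF e] E2.edge_rels[OF e']
      by (auto simp: g head_eq[OF e] E2.tail_z[OF e] E2.head_z[OF e])
  next
    assume "p \<in> {gx e * ex f - (if e = f then vx (head E\<^sub>1 e) else 0) | e f. e \<in> arcs E\<^sub>1 \<and> f \<in> arcs E\<^sub>1}"
    then obtain e f where e: "e \<in> arcs E\<^sub>2" and f: "f \<in> arcs E\<^sub>2"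
      and p: "p = gx e * ex f - (if e = f then vx (head E\<^sub>1 e) else 0)" unfolding arcs_eq by blast
    have "E2.z\<^sub>1 (- \<epsilon>) e \<in> arcs E\<^sub>2" "E2.z\<^sub>1 (- \<epsilon>) f \<in> arcs E\<^sub>2" using e f by simp_all
    from E2.rel_ghost_edge[OF this] show ?thesis
      by (auto simp: p g head_eq[OF f] E2.head_z[OF f])
  next
    assume "p \<in> {vx v - (\<Sum>e \<in> out_arcs E\<^sub>1 v. ex e * gx e) | v. is_regular E\<^sub>1 v}"
    then obtain v where v: "is_regular E\<^sub>1 v" "p = vx v - (\<Sum>e \<in> out_arcs E\<^sub>1 v. ex e * gx e)" by blast
    have o: "out_arcs E\<^sub>1 v = out_arcs E\<^sub>2 v" by (simp add: out_arcs_def arcs_eq tail_eq)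
    have r: "is_regular E\<^sub>2 v" using v(1) by (simp add: is_regular_def o verts_eq)
    have "\<theta> p = vx v - (\<Sum>e \<in> out_arcs E\<^sub>2 v. ex e * gx e)"
      by (simp add: v(2) o E2.theta_sum g)
    then show ?thesis using E2.rel_regular[OF r] by simp
  qed
qed

text \<open>The rule for products holds for homogeneous left factors, whereas a generic element of
  the ideal is not homogeneous. The induction therefore speaks about all homogeneous parts at once,
  and outer factors are reduced to monomials.\<close>

lemma theta_ideal_homog: "p \<in> E1.I \<Longrightarrow> \<theta> (homog_part n p) \<in> leavitt_ideal E\<^sub>2"
proof (induction arbitrary: n rule: leavitt_ideal.induct)
  case zero show ?case by (simp add: leavitt_ideal.zero)
next
  case (rel p)
  obtain m where m: "\<And>w. w \<in> Poly_Mapping.keys p \<Longrightarrow> word_degree w = m" using E1.relations_homog[OF rel] by blast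
  show ?case
    using homog_part_eq_self[where p = p, OF m] homog_part_eq_zero[where n = n and p = p, OF m]
      theta_relations[OF rel] leavitt_ideal.zero[of E\<^sub>2]
    by (cases "m = n") auto
next
  case (add p q) then show ?case by (simp add: leavitt_ideal.add)
next
  case (scale p k)
  have zero: "word_degree w = 0" if "w \<in> Poly_Mapping.keys (Poly_Mapping.single 0 k)" for w
    using that by (simp split: if_splits)
  have "\<theta> (Poly_Mapping.single 0 k) = Poly_Mapping.single 0 k" by simp (simp add: zero_word_def)
  then have "\<theta> (Poly_Mapping.single 0 k * homog_part n p) = Poly_Mapping.single 0 k * \<theta> (homog_part n p)"
    using E2.theta_mult[where p = "Poly_Mapping.single 0 k" and q = "homog_part n p" and \<epsilon> = \<epsilon>, OF zero] by simp
  then show ?case using leavitt_ideal.scale[OF scale.IH[of n], of k]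
    by (simp add: scale_elem_eq homog_part_mult_single_left)
next
  case (left a p)
  from left.hyps(1) show ?case unfolding free_eq
  proof (induction rule: free_alg_induct)
    case (single w c)
    have "\<theta> (Poly_Mapping.single w c * homog_part (n - word_degree w) p)
        = \<theta> (Poly_Mapping.single w c) * E2.wm (\<epsilon> * word_degree w) (\<theta> (homog_part (n - word_degree w) p))"
      by (rule E2.theta_mult) (simp split: if_splits)
    moreover have "\<theta> (Poly_Mapping.single w c) \<in> E2.Fr" using single by (intro theta_free free_alg_single)
    ultimately show ?case using E2.wm_ideal[OF left.IH] by (simp add: homog_part_mult_single_left leavitt_ideal.left del: E2.theta_simps)
  qed (simp_all add: leavitt_ideal.zero distrib_right leavitt_ideal.add)
next
  case (right p a)
  from right.hyps(2) show ?case unfolding free_eq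
  proof (induction rule: free_alg_induct)
    case (single w c)
    let ?m = "n - word_degree w"
    have "\<theta> (homog_part ?m p * Poly_Mapping.single w c)
        = \<theta> (homog_part ?m p) * E2.wm (\<epsilon> * ?m) (\<theta> (Poly_Mapping.single w c))"
      by (rule E2.theta_mult) (simp add: keys_homog_part)
    moreover have "E2.wm (\<epsilon> * ?m) (\<theta> (Poly_Mapping.single w c)) \<in> E2.Fr"
      using single by (intro E2.wm_free theta_free free_alg_single)
    ultimately show ?case using right.IH by (simp add: homog_part_mult_single_right leavitt_ideal.right del: E2.theta_simps E2.wm_simps)
  qed (simp_all add: leavitt_ideal.zero distrib_left leavitt_ideal.add)
qed

lemma theta_ideal: "p \<in> E1.I \<Longrightarrow> \<theta> p \<in> leavitt_ideal E\<^sub>2"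
proof -
  assume p: "p \<in> E1.I"
  have "(\<Sum>n \<in> A. \<theta> (homog_part n p)) \<in> leavitt_ideal E\<^sub>2" for A
    by (induction A rule: infinite_finite_induct)
      (auto intro: leavitt_ideal.zero leavitt_ideal.add theta_ideal_homog[OF p])
  then show ?thesis by (subst homog_part_decomposition) (simp only: E2.theta_sum)
qed

end

section \<open>Zhang twists of Leavitt path algebras\<close>

text \<open>The automorphism is prescribed on the graph only; taking the identity elsewhere makes it
  a permutation of the whole type.\<close>

definition extend_perm :: "'x set \<Rightarrow> ('x \<Rightarrow> 'x) \<Rightarrow> 'x \<Rightarrow> 'x" where
  "extend_perm X f x = (if x \<in> X then f x else x)"

lemma bij_extend_perm:
  assumes "bij_betw f X X" shows "bij (extend_perm X f)"
proof -
  have "bij_betw (extend_perm X f) X X"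
    using assms by (subst bij_betw_cong[where g = f]) (simp_all add: extend_perm_def)
  moreover have "bij_betw (extend_perm X f) (- X) (- X)"
    by (subst bij_betw_cong[where g = id]) (simp_all add: extend_perm_def)
  ultimately show ?thesis using bij_betw_combine by (metis Compl_disjoint Compl_partition)
qed

lemma extend_perm_in [simp]: "x \<in> X \<Longrightarrow> extend_perm X f x = f x"
  by (simp add: extend_perm_def)

lemma extend_perm_mem_iff: "bij_betw f X X \<Longrightarrow> extend_perm X f x \<in> X \<longleftrightarrow> x \<in> X"
  by (auto simp: extend_perm_def bij_betw_def)

text \<open>Each ring axiom is an equation that can be checked after the injective
  \<open>\<psi>\<close>, and there it holds in \<open>B\<close>. It is used for the Zhang product,
  whose associativity is read off in the algebra of the twisted graph.\<close>

lemma ring_transport: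
  assumes Z: "abelian_group Z" and B: "ring B"
    and \<psi>: "inj_on \<psi> (carrier Z)" "\<psi> ` carrier Z \<subseteq> carrier B"
    and one: "\<one>\<^bsub>Z\<^esub> \<in> carrier Z" "\<psi> \<one>\<^bsub>Z\<^esub> = \<one>\<^bsub>B\<^esub>"
    and mult: "\<And>x y. \<lbrakk>x \<in> carrier Z; y \<in> carrier Z\<rbrakk> \<Longrightarrow> x \<otimes>\<^bsub>Z\<^esub> y \<in> carrier Z"
      "\<And>x y. \<lbrakk>x \<in> carrier Z; y \<in> carrier Z\<rbrakk> \<Longrightarrow> \<psi> (x \<otimes>\<^bsub>Z\<^esub> y) = \<psi> x \<otimes>\<^bsub>B\<^esub> \<psi> y"
    and add: "\<And>x y. \<lbrakk>x \<in> carrier Z; y \<in> carrier Z\<rbrakk> \<Longrightarrow> \<psi> (x \<oplus>\<^bsub>Z\<^esub> y) = \<psi> x \<oplus>\<^bsub>B\<^esub> \<psi> y"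
  shows "ring Z"
proof -
  interpret Z: abelian_group Z by (rule Z)
  interpret B: ring B by (rule B)
  have c: "x \<in> carrier Z \<Longrightarrow> \<psi> x \<in> carrier B" for x using \<psi>(2) by blast
  show ?thesis
  proof (rule ringI[OF Z])
    show "monoid Z"
    proof (rule monoidI)
      show "x \<otimes>\<^bsub>Z\<^esub> y \<otimes>\<^bsub>Z\<^esub> z = x \<otimes>\<^bsub>Z\<^esub> (y \<otimes>\<^bsub>Z\<^esub> z)"
        if "x \<in> carrier Z" "y \<in> carrier Z" "z \<in> carrier Z" for x y z
        by (rule inj_onD[OF \<psi>(1)]) (simp_all add: that c mult B.m_assoc)
      show "\<one>\<^bsub>Z\<^esub> \<otimes>\<^bsub>Z\<^esub> x = x" "x \<otimes>\<^bsub>Z\<^esub> \<one>\<^bsub>Z\<^esub> = x" if "x \<in> carrier Z" for x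
        by (rule inj_onD[OF \<psi>(1)]; simp add: that c one mult)+
    qed (simp_all add: one mult)
  qed (rule inj_onD[OF \<psi>(1)]; simp add: c mult add B.l_distr B.r_distr)+
qed

locale leavitt_twist = sinkless_leavitt_path_algebra E K
  for E :: "('v, 'e) pre_digraph" and K :: "'k::field itself" +
  fixes \<sigma>\<^sub>0 :: "'v \<Rightarrow> 'v" and \<sigma>\<^sub>1 :: "'e \<Rightarrow> 'e"
  assumes automorphism: "graph_automorphism E \<sigma>\<^sub>0 \<sigma>\<^sub>1"
begin

abbreviation "E' \<equiv> twisted_graph E \<sigma>\<^sub>0"
abbreviation "\<tau> \<equiv> leavitt_aut E \<sigma>\<^sub>0 \<sigma>\<^sub>1 :: ('v, 'e, 'k) free_elem set \<Rightarrow> ('v, 'e, 'k) free_elem set"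
abbreviation "Z \<equiv> zhang_twist LP \<tau>"
abbreviation "s\<^sub>0 \<equiv> extend_perm (verts E) \<sigma>\<^sub>0"
abbreviation "s\<^sub>1 \<equiv> extend_perm (arcs E) \<sigma>\<^sub>1"

lemma sigma_bij: "bij_betw \<sigma>\<^sub>0 (verts E) (verts E)" "bij_betw \<sigma>\<^sub>1 (arcs E) (arcs E)"
  using automorphism by (auto simp: graph_automorphism_def)

lemma twisted_graph_simps [simp]: "verts E' = verts E" "arcs E' = arcs E" "tail E' = tail E"
  "head E' e = inv_into (verts E) \<sigma>\<^sub>0 (head E e)" "out_arcs E' v = out_arcs E v"
  by (simp_all add: twisted_graph_def out_arcs_def)

lemma inv_sigma: "v \<in> verts E \<Longrightarrow> inv_into (verts E) \<sigma>\<^sub>0 v \<in> verts E"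
  "v \<in> verts E \<Longrightarrow> \<sigma>\<^sub>0 (inv_into (verts E) \<sigma>\<^sub>0 v) = v" "v \<in> verts E \<Longrightarrow> inv_into (verts E) \<sigma>\<^sub>0 (\<sigma>\<^sub>0 v) = v"
  using sigma_bij(1) by (auto simp: bij_betw_def inv_into_into f_inv_into_f)

lemma sinkless_E': "sinkless_leavitt_path_algebra E'"
proof (intro sinkless_leavitt_path_algebra.intro leavitt_path_algebra.intro sinkless_leavitt_path_algebra_axioms.intro)
  show "fin_digraph E'" by unfold_locales (simp_all add: inv_sigma)
  show "\<not> is_sink E' v" if "v \<in> verts E'" for v using no_sink[of v] that by (simp add: is_sink_def)
qed

end

sublocale leavitt_twist \<subseteq> graph_perm E K "extend_perm (verts E) \<sigma>\<^sub>0" "extend_perm (arcs E) \<sigma>\<^sub>1"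
proof
  show "bij s\<^sub>0" "bij s\<^sub>1" using sigma_bij by (auto intro: bij_extend_perm)
  show "s\<^sub>0 v \<in> verts E \<longleftrightarrow> v \<in> verts E" "s\<^sub>1 e \<in> arcs E \<longleftrightarrow> e \<in> arcs E" for v e
    using sigma_bij by (auto simp: extend_perm_mem_iff)
  show "tail E (s\<^sub>1 e) = s\<^sub>0 (tail E e)" "head E (s\<^sub>1 e) = s\<^sub>0 (head E e)" if "e \<in> arcs E" for e
    using automorphism that by (simp_all add: graph_automorphism_def)
qed

sublocale leavitt_twist \<subseteq> T: sinkless_leavitt_path_algebra "twisted_graph E \<sigma>\<^sub>0" K
  by (rule sinkless_E')

sublocale leavitt_twist \<subseteq> A: strongly_graded "leavitt K E"
  by (rule strongly_graded_LP)

sublocale leavitt_twist \<subseteq> B: strongly_graded "leavitt K (twisted_graph E \<sigma>\<^sub>0)"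
  by (rule T.strongly_graded_LP)

context leavitt_twist
begin

lemma head_E': "e \<in> arcs E \<Longrightarrow> head E' e = z\<^sub>0 (- 1) (head E e)" "e \<in> arcs E \<Longrightarrow> head E e = s\<^sub>0 (head E' e)"
proof -
  assume e: "e \<in> arcs E"
  show *: "head E e = s\<^sub>0 (head E' e)" using e by (simp add: inv_sigma)
  have "z\<^sub>0 (- 1) (s\<^sub>0 (head E' e)) = head E' e" using z_inverse(1)[of 1] by simp
  then show "head E' e = z\<^sub>0 (- 1) (head E e)" by (simp only: *)
qed

lemma twisted_forward: "twisted_pair E' E s\<^sub>0 s\<^sub>1 1"
  by unfold_locales (simp_all add: head_E'(1) del: twisted_graph_simps(4))

lemma graph_perm_E': "graph_perm E' s\<^sub>0 s\<^sub>1"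
proof
  fix e assume e: "e \<in> arcs E'"
  show "tail E' (s\<^sub>1 e) = s\<^sub>0 (tail E' e)" using e tail_s by simp
  have "s\<^sub>0 (head E' (s\<^sub>1 e)) = head E (s\<^sub>1 e)" using e arcs_iff[of e] by (intro head_E'(2)[symmetric]) simp
  also have "\<dots> = s\<^sub>0 (head E e)" using e by (intro head_s) simp
  also have "\<dots> = s\<^sub>0 (s\<^sub>0 (head E' e))" by (rule arg_cong[OF head_E'(2)]) (use e in simp)
  finally show "head E' (s\<^sub>1 e) = s\<^sub>0 (head E' e)" using bij0 by (simp add: bij_def inj_eq)
qed (simp_all add: verts_iff arcs_iff)

lemma twisted_backward: "twisted_pair E E' s\<^sub>0 s\<^sub>1 (- 1)"
proof (intro twisted_pair.intro graph_perm_E' leavitt_path_algebra_axioms twisted_pair_axioms.intro)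
  show "head E e = z\<^sub>0 (- (- 1)) (head E' e)" if "e \<in> arcs E'" for e
    using that head_E'(2)[of e] unfolding minus_minus z_1 twisted_graph_simps(2) by blast
qed simp_all

lemma Fr_E': "T.Fr = Fr"
  by (rule twisted_pair.free_eq[OF twisted_forward])

lemma theta_free: "p \<in> Fr \<Longrightarrow> theta \<epsilon> p \<in> Fr"
  by (rule twisted_pair.theta_free[OF twisted_forward])

lemma theta_ideal: "p \<in> I \<Longrightarrow> theta (- 1) p \<in> T.I" "p \<in> T.I \<Longrightarrow> theta 1 p \<in> I"
  using twisted_pair.theta_ideal[OF twisted_forward] twisted_pair.theta_ideal[OF twisted_backward] by auto

subsection \<open>The induced automorphism\<close>

lemma free_map_wm: "p \<in> Fr \<Longrightarrow> free_map \<sigma>\<^sub>0 \<sigma>\<^sub>1 p = wm 1 p"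
  unfolding free_map_eq wm_def
proof (rule word_map_cong, rule map_cong[OF refl])
  fix w x assume "p \<in> Fr" "w \<in> Poly_Mapping.keys p" "x \<in> set (letters w)"
  then have "x \<in> generators E" by (auto simp: free_alg_def)
  then show "map_gen \<sigma>\<^sub>0 \<sigma>\<^sub>1 x = zp 1 x" by (auto simp: generators_def)
qed

lemma tau_cl: "p \<in> Fr \<Longrightarrow> \<tau> (cl p) = cl (wm 1 p)"
proof -
  assume p: "p \<in> Fr"
  have "(\<Union>q \<in> cl p. cl (free_map \<sigma>\<^sub>0 \<sigma>\<^sub>1 q)) = cl (free_map \<sigma>\<^sub>0 \<sigma>\<^sub>1 p)"
  proof (rule union_cl[OF p])
    fix q assume q: "q \<in> Fr" "q - p \<in> I"
    have "wm 1 q - wm 1 p \<in> I" using wm_ideal[OF q(2), of 1] by simp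
    then show "cl (free_map \<sigma>\<^sub>0 \<sigma>\<^sub>1 q) = cl (free_map \<sigma>\<^sub>0 \<sigma>\<^sub>1 p)"
      using p q(1) by (simp add: free_map_wm cl_eq_iff wm_free)
  qed
  then show ?thesis using p by (simp add: leavitt_aut_def cl_def[symmetric] free_map_wm)
qed

lemma tau_bij: "bij_betw \<tau> (carrier LP) (carrier LP)"
proof (rule bij_betw_imageI)
  show "inj_on \<tau> (carrier LP)"
  proof (rule inj_onI)
    fix x y assume "x \<in> carrier LP" "y \<in> carrier LP" and eq: "\<tau> x = \<tau> y"
    then obtain p q where pq: "p \<in> Fr" "x = cl p" "q \<in> Fr" "y = cl q" by (elim carrierE) blast
    then have "wm 1 p - wm 1 q \<in> I" using eq by (simp add: tau_cl cl_eq_iff wm_free)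
    from wm_ideal[OF this, of "- 1"] have "p - q \<in> I" by (simp flip: wm_add)
    then show "x = y" using pq by (simp add: cl_eq_iff)
  qed
  show "\<tau> ` carrier LP = carrier LP"
  proof
    show "\<tau> ` carrier LP \<subseteq> carrier LP" by (auto simp: carrier_LP tau_cl wm_free)
    show "carrier LP \<subseteq> \<tau> ` carrier LP"
    proof
      fix x assume "x \<in> carrier LP"
      then obtain p where p: "p \<in> Fr" "x = cl p" by (rule carrierE)
      then have "\<tau> (cl (wm (- 1) p)) = x" by (simp add: tau_cl wm_free flip: wm_add)
      then show "x \<in> \<tau> ` carrier LP" using cl_closed[OF wm_free[OF p(1)]] by blast
    qed
  qed
qed

abbreviation "\<tau>p \<equiv> aut_power (carrier LP) \<tau>"

lemma tau_power_cl:
  assumes p: "p \<in> Fr" shows "\<tau>p n (cl p) = cl (wm n p)"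
proof (induction n rule: int_induct[where k = 0])
  case base show ?case by simp
next
  case (step1 i)
  have "wm (i + 1) p = wm 1 (wm i p)" by (simp add: add.commute flip: wm_add)
  then show ?case using step1 p aut_power_Suc[OF tau_bij cl_closed[OF p], of i] by (simp add: tau_cl wm_free)
next
  case (step2 i)
  have "\<tau> (\<tau>p (i - 1) (cl p)) = \<tau>p i (cl p)" using aut_power_Suc[OF tau_bij cl_closed[OF p], of "i - 1"] by simp
  also have "\<dots> = \<tau> (cl (wm (i - 1) p))" using step2 p by (simp add: tau_cl wm_free flip: wm_add)
  finally show ?case
    using inj_onD[OF bij_betw_imp_inj_on[OF tau_bij]] aut_power_closed[OF tau_bij cl_closed[OF p]] cl_closed[OF wm_free[OF p]]
    by blast
qed

lemma tau_power_closed: "x \<in> carrier LP \<Longrightarrow> \<tau>p n x \<in> carrier LP"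
  by (rule aut_power_closed[OF tau_bij])

lemma tau_power_homog:
  assumes "x \<in> homog LP m" shows "\<tau>p n x \<in> homog LP m"
proof -
  obtain p where p: "p \<in> Fr" "x = cl p" "\<And>w. w \<in> Poly_Mapping.keys p \<Longrightarrow> word_degree w = m"
    using assms by (rule homogE) blast
  have "cl (wm n p) \<in> homog LP m" by (rule cl_homog[OF wm_free[OF p(1)]]) (rule wm_degree[where p = p, OF p(3)])
  then show ?thesis using p by (simp add: tau_power_cl)
qed

lemma tau_hom: "\<tau> \<in> ring_hom LP LP"
proof (rule ring_hom_memI)
  have "bij_betw s\<^sub>0 (verts E) (verts E)"
    using sigma_bij(1) by (subst bij_betw_cong[where g = \<sigma>\<^sub>0]) simp_all
  from sum.reindex_bij_betw[OF this, of vx] have "wm 1 unit_elem = unit_elem"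
    by (simp add: wm_def word_map_sum) (simp flip: wm_def)
  then show "\<tau> \<one>\<^bsub>LP\<^esub> = \<one>\<^bsub>LP\<^esub>" by (simp add: one_LP tau_cl unit_free)
qed (auto simp: carrier_LP tau_cl wm_free mult_cl add_cl free_alg_mult free_alg_add wm_mult)

subsection \<open>The Zhang twist\<close>

lemma zhang_simps [simp]: "carrier Z = carrier LP" "add Z = add LP" "zero Z = zero LP" "one Z = one LP"
  "smult Z = smult LP" "homog Z = homog LP" "add_monoid Z = add_monoid LP"
  by (simp_all add: zhang_twist_def)

lemma zhang_mult_homog:
  assumes a: "a \<in> homog LP m" and b: "b \<in> carrier LP"
  shows "a \<otimes>\<^bsub>Z\<^esub> b = a \<otimes>\<^bsub>LP\<^esub> \<tau>p m b"
proof (cases "a = \<zero>\<^bsub>LP\<^esub>")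
  case True
  then show ?thesis using b by (simp add: zhang_twist_def A.component_zero tau_power_closed)
next
  case False
  then have "{n. component LP (homog LP) a n \<noteq> \<zero>\<^bsub>LP\<^esub>} = {m}" using A.component_of_homog[OF a] by auto
  then show ?thesis using a b A.component_of_homog[OF a] by (simp add: zhang_twist_def A.D_carrier tau_power_closed)
qed

text \<open>Products with different left factors become comparable once they are summed over a
  common finite set of degrees, as additivity on the left requires.\<close>

lemma zhang_mult_support:
  assumes a: "a \<in> carrier LP" and b: "b \<in> carrier LP"
    and S: "finite S" "{n. component LP (homog LP) a n \<noteq> \<zero>\<^bsub>LP\<^esub>} \<subseteq> S"
  shows "a \<otimes>\<^bsub>Z\<^esub> b = (\<Oplus>\<^bsub>LP\<^esub>n \<in> S. component LP (homog LP) a n \<otimes>\<^bsub>LP\<^esub> \<tau>p n b)"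
  unfolding zhang_twist_def using a b S tau_power_closed[OF b]
  by simp (intro A.R.add.finprod_mono_neutral_cong_left; auto simp: A.component_closed)

lemma zhang_mult_add:
  assumes a: "a \<in> carrier LP" "a' \<in> carrier LP" and b: "b \<in> carrier LP"
  shows "(a \<oplus>\<^bsub>LP\<^esub> a') \<otimes>\<^bsub>Z\<^esub> b = a \<otimes>\<^bsub>Z\<^esub> b \<oplus>\<^bsub>LP\<^esub> a' \<otimes>\<^bsub>Z\<^esub> b"
proof -
  let ?c = "component LP (homog LP)"
  let ?S = "{n. ?c a n \<noteq> \<zero>\<^bsub>LP\<^esub>} \<union> {n. ?c a' n \<noteq> \<zero>\<^bsub>LP\<^esub>}"
  have fin: "finite ?S"
    using A.decompositionD(2)[OF A.component_decomposition] a by simp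
  have "{n. ?c (a \<oplus>\<^bsub>LP\<^esub> a') n \<noteq> \<zero>\<^bsub>LP\<^esub>} \<subseteq> ?S" using a by (auto simp: A.component_add)
  then show ?thesis
    using a b fin tau_power_closed[OF b]
    by (subst (1 2 3) zhang_mult_support[where S = ?S])
      (auto simp: A.component_add A.component_closed A.R.l_distr A.R.finsum_addf Pi_def)
qed

lemma zhang_mult_cl:
  assumes p: "p \<in> Fr" "\<And>w. w \<in> Poly_Mapping.keys p \<Longrightarrow> word_degree w = m" and q: "q \<in> Fr"
  shows "cl p \<otimes>\<^bsub>Z\<^esub> cl q = cl (p * wm m q)"
  using zhang_mult_homog[OF cl_homog[OF p] cl_closed[OF q]] p q by (simp add: tau_power_cl mult_cl wm_free)

text \<open>The rule \<open>theta 1\<close> leads from words of the twisted graph to the Zhang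
  twist. The map \<open>\<psi>\<close> goes the other way, from the Zhang twist to the algebra of
  the twisted graph, hence the sign.\<close>

definition \<psi> :: "('v, 'e, 'k) free_elem set \<Rightarrow> ('v, 'e, 'k) free_elem set" where
  "\<psi> c = (\<Union>p \<in> c. T.cl (theta (- 1) p))"

lemma psi_cl: "p \<in> Fr \<Longrightarrow> \<psi> (cl p) = T.cl (theta (- 1) p)"
  unfolding \<psi>_def
proof (rule union_cl)
  fix q assume "p \<in> Fr" "q \<in> Fr" "q - p \<in> I"
  then show "T.cl (theta (- 1) q) = T.cl (theta (- 1) p)"
    using theta_ideal(1)[of "q - p"] by (simp add: T.cl_eq_iff Fr_E' theta_free)
qed

lemma psi_homog:
  assumes "x \<in> homog LP n" shows "\<psi> x \<in> homog T.LP n"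
proof -
  obtain p where p: "p \<in> Fr" "x = cl p" "\<And>w. w \<in> Poly_Mapping.keys p \<Longrightarrow> word_degree w = n"
    using assms by (rule homogE) blast
  have "T.cl (theta (- 1) p) \<in> homog T.LP n"
    by (rule T.cl_homog) (simp add: Fr_E' theta_free p(1), rule theta_degree[where p = p, OF p(3)])
  then show ?thesis using p by (simp add: psi_cl)
qed

lemma theta_inverse': "theta 1 (theta (- 1) p) = p" "theta (- 1) (theta 1 p) = p"
  using theta_inverse[of "- 1"] theta_inverse[of 1] by auto

lemma psi_inj: "inj_on \<psi> (carrier LP)"
proof (rule inj_onI)
  fix x y assume "x \<in> carrier LP" "y \<in> carrier LP" and eq: "\<psi> x = \<psi> y"
  then obtain p q where pq: "p \<in> Fr" "x = cl p" "q \<in> Fr" "y = cl q" by (elim carrierE) blast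
  then have "theta (- 1) p - theta (- 1) q \<in> T.I" using eq by (simp add: psi_cl T.cl_eq_iff Fr_E' theta_free)
  from theta_ideal(2)[OF this] have "p - q \<in> I" by (simp add: theta_inverse')
  then show "x = y" using pq by (simp add: cl_eq_iff)
qed

lemma psi_bij_homog: "bij_betw \<psi> (homog LP n) (homog T.LP n)"
proof (rule bij_betw_imageI)
  show "inj_on \<psi> (homog LP n)" using inj_on_subset[OF psi_inj] A.D_carrier by blast
  show "\<psi> ` homog LP n = homog T.LP n"
  proof
    show "\<psi> ` homog LP n \<subseteq> homog T.LP n" using psi_homog by blast
    show "homog T.LP n \<subseteq> \<psi> ` homog LP n"
    proof
      fix x assume "x \<in> homog T.LP n"
      then obtain p where p: "p \<in> Fr" "x = T.cl p" "\<And>w. w \<in> Poly_Mapping.keys p \<Longrightarrow> word_degree w = n"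
        by (rule T.homogE) (simp add: Fr_E')
      have "cl (theta 1 p) \<in> homog LP n" by (rule cl_homog[OF theta_free[OF p(1)]]) (rule theta_degree[where p = p, OF p(3)])
      moreover have "\<psi> (cl (theta 1 p)) = x" using p by (simp add: psi_cl theta_free theta_inverse')
      ultimately show "x \<in> \<psi> ` homog LP n" by blast
    qed
  qed
qed

lemma psi_add: "\<lbrakk>x \<in> carrier LP; y \<in> carrier LP\<rbrakk> \<Longrightarrow> \<psi> (x \<oplus>\<^bsub>LP\<^esub> y) = \<psi> x \<oplus>\<^bsub>T.LP\<^esub> \<psi> y"
  by (auto simp: carrier_LP psi_cl add_cl free_alg_add T.add_cl Fr_E' theta_free)

lemma psi_closed: "x \<in> carrier LP \<Longrightarrow> \<psi> x \<in> carrier T.LP"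
  by (auto simp: carrier_LP psi_cl T.carrier_LP Fr_E' theta_free)

lemma psi_one: "\<psi> \<one>\<^bsub>LP\<^esub> = \<one>\<^bsub>T.LP\<^esub>"
  by (simp add: one_LP T.one_LP psi_cl unit_free theta_sum theta_gens)

lemma zhang_closed: "\<lbrakk>a \<in> carrier LP; b \<in> carrier LP\<rbrakk> \<Longrightarrow> a \<otimes>\<^bsub>Z\<^esub> b \<in> carrier LP"
proof (induction rule: A.graded_induct)
  case (homog n x)
  then show ?case by (simp add: zhang_mult_homog A.D_carrier tau_power_closed)
qed (simp add: zhang_mult_add)

text \<open>For \<open>p\<close> of degree \<open>n\<close> the Zhang product of \<open>p\<close>
  and \<open>q\<close> is \<open>p \<sigma>^n(q)\<close>. The rule for \<open>theta (- 1)\<close>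
  moves the second factor by \<open>\<sigma>^(-n)\<close>, and the two powers cancel.\<close>

lemma psi_mult: "\<lbrakk>a \<in> carrier LP; b \<in> carrier LP\<rbrakk> \<Longrightarrow> \<psi> (a \<otimes>\<^bsub>Z\<^esub> b) = \<psi> a \<otimes>\<^bsub>T.LP\<^esub> \<psi> b"
proof (induction rule: A.graded_induct)
  case (homog n x)
  obtain p where p: "p \<in> Fr" "x = cl p" "\<And>w. w \<in> Poly_Mapping.keys p \<Longrightarrow> word_degree w = n"
    using homog(1) by (rule homogE) blast
  obtain q where q: "q \<in> Fr" "b = cl q" using homog(2) by (rule carrierE)
  have "theta (- 1) (p * wm n q) = theta (- 1) p * wm (- 1 * n) (theta (- 1) (wm n q))"
    by (rule theta_mult[OF p(3)])
  also have "\<dots> = theta (- 1) p * theta (- 1) q" by (simp add: theta_wm flip: wm_add)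
  finally show ?case using p q
    by (simp add: zhang_mult_cl psi_cl free_alg_mult wm_free T.mult_cl Fr_E' theta_free)
next
  case (add x y)
  then show ?case by (simp add: zhang_mult_add psi_add zhang_closed psi_closed B.R.l_distr)
qed

text \<open>The ring axioms are carried back along \<open>\<psi>\<close>. Strong grading is
  inherited because \<open>\<sigma>^n\<close> permutes the elements of degree \<open>-n\<close>, so
  the Zhang products of degrees \<open>n\<close> and \<open>-n\<close> form the same set as the
  original ones.\<close>

lemma strongly_graded_Z: "strongly_graded Z"
proof -
  have ab: "abelian_group Z"
    using A.R.abelian_group_axioms
    by (simp add: abelian_group_def abelian_monoid_def abelian_group_axioms_def)
  have ring: "ring Z"
    by (rule ring_transport[OF ab T.ring_LP, of \<psi>])
      (use psi_inj psi_closed psi_one psi_mult psi_add zhang_closed in auto)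
  have "graded_group Z (homog Z)"
    using A.D_subgroup A.D_decomposition ab
    by (simp add: graded_group_def graded_group_axioms_def is_decomposition_def finsum_def)
  moreover have mult: "a \<otimes>\<^bsub>Z\<^esub> b \<in> homog LP (m + n)" if "a \<in> homog LP m" "b \<in> homog LP n" for a b m n
    using that by (simp add: zhang_mult_homog A.D_carrier A.homog_mult tau_power_homog)
  ultimately have gr: "graded_ring Z"
    using ring by (intro graded_ring.intro graded_ring_axioms.intro) (simp_all add: A.homog_one)
  have "{x \<otimes>\<^bsub>Z\<^esub> y |x y. x \<in> homog LP n \<and> y \<in> homog LP (- n)}
      = {x \<otimes>\<^bsub>LP\<^esub> y |x y. x \<in> homog LP n \<and> y \<in> homog LP (- n)}" for n
  proof (intro equalityI subsetI)
    fix u assume "u \<in> {x \<otimes>\<^bsub>Z\<^esub> y |x y. x \<in> homog LP n \<and> y \<in> homog LP (- n)}"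
    then obtain x y where xy: "u = x \<otimes>\<^bsub>Z\<^esub> y" "x \<in> homog LP n" "y \<in> homog LP (- n)" by blast
    have "u = x \<otimes>\<^bsub>LP\<^esub> \<tau>p n y" using xy A.D_carrier by (simp add: zhang_mult_homog)
    then show "u \<in> {x \<otimes>\<^bsub>LP\<^esub> y |x y. x \<in> homog LP n \<and> y \<in> homog LP (- n)}"
      using xy tau_power_homog by blast
  next
    fix u assume "u \<in> {x \<otimes>\<^bsub>LP\<^esub> y |x y. x \<in> homog LP n \<and> y \<in> homog LP (- n)}"
    then obtain x y where xy: "u = x \<otimes>\<^bsub>LP\<^esub> y" "x \<in> homog LP n" "y \<in> homog LP (- n)" by blast
    have "\<tau>p n (\<tau>p (- n) y) = y"
      using aut_power_add[OF tau_bij A.D_carrier[OF xy(3)], of n "- n"] by simp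
    then have "u = x \<otimes>\<^bsub>Z\<^esub> \<tau>p (- n) y"
      using xy A.D_carrier by (simp add: zhang_mult_homog tau_power_closed)
    then show "u \<in> {x \<otimes>\<^bsub>Z\<^esub> y |x y. x \<in> homog LP n \<and> y \<in> homog LP (- n)}"
      using xy tau_power_homog by blast
  qed
  then have "homog_span Z n = homog_span LP n" for n by (simp add: homog_span_def)
  then show ?thesis using gr A.one_span by (simp add: strongly_graded_def strongly_graded_axioms_def)
qed

abbreviation "\<tau>\<^sub>0 \<equiv> restrict \<tau> (homog LP 0)"

lemma tau0_hom: "\<tau>\<^sub>0 \<in> ring_hom (degree_zero LP) (degree_zero LP)"
proof (rule ring_hom_memI)
  show "\<tau>\<^sub>0 x \<in> carrier (degree_zero LP)" if "x \<in> carrier (degree_zero LP)" for x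
    using tau_power_homog[of x 0 1] that by simp
qed (use A.homog_mult[of _ 0 _ 0] A.D_add A.homog_one in
    \<open>auto simp: A.D_carrier ring_hom_mult[OF tau_hom] ring_hom_add[OF tau_hom] ring_hom_one[OF tau_hom]\<close>)

lemma zhang_mult_tau0: "\<lbrakk>v \<in> homog LP 1; s \<in> homog LP 0\<rbrakk> \<Longrightarrow> v \<otimes>\<^bsub>LP\<^esub> \<tau>\<^sub>0 s = v \<otimes>\<^bsub>Z\<^esub> s"
  by (simp add: zhang_mult_homog A.D_carrier)

lemma zhang_mult_zero: "\<lbrakk>r \<in> homog LP 0; v \<in> carrier LP\<rbrakk> \<Longrightarrow> r \<otimes>\<^bsub>Z\<^esub> v = r \<otimes>\<^bsub>LP\<^esub> v"
  by (simp add: zhang_mult_homog)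

lemma comparison_LP: "comparison LP LP (\<lambda>x. x) (\<lambda>x. x)"
  by unfold_locales (auto simp: ring_hom_def bij_betw_def A.homog_one A.D_add A.homog_mult[of _ 0 _ 0, simplified])

text \<open>In degree 1 the Zhang product is \<open>v \<star> s = v \<sigma>(s)\<close>, so the
  identity map respects right actions with \<open>\<gamma> = \<sigma>\<close>. A left factor of
  degree 0 multiplies as before.\<close>

lemma comparison_Z: "comparison LP Z (\<lambda>x. x) \<tau>\<^sub>0"
proof (intro comparison.intro comparison_axioms.intro A.graded_ring_axioms strongly_graded_Z tau0_hom)
  show "(\<lambda>x. x) \<in> ring_hom (degree_zero LP) (degree_zero Z)"
    by (rule ring_hom_memI) (simp_all add: zhang_mult_zero A.D_carrier)
  show "v \<otimes>\<^bsub>LP\<^esub> \<tau>\<^sub>0 s = v \<otimes>\<^bsub>Z\<^esub> s" if "v \<in> homog LP 1" "s \<in> homog LP 0" for v s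
    by (rule zhang_mult_tau0[OF that])
qed (simp_all add: bij_betw_def zhang_mult_zero A.D_carrier)

text \<open>The map \<open>\<psi>\<close> is multiplicative for the Zhang product, and the products
  in question are those of the preceding comparison; so the same \<open>\<gamma>\<close>
  occurs.\<close>

lemma comparison_E': "comparison LP T.LP \<psi> \<tau>\<^sub>0"
proof (intro comparison.intro comparison_axioms.intro A.graded_ring_axioms B.strongly_graded_axioms tau0_hom psi_bij_homog)
  have m: "\<psi> (r \<otimes>\<^bsub>LP\<^esub> v) = \<psi> r \<otimes>\<^bsub>T.LP\<^esub> \<psi> v" if "r \<in> homog LP 0" "v \<in> carrier LP" for r v
    using psi_mult[OF A.D_carrier[OF that(1)] that(2)] that by (simp add: zhang_mult_zero)
  show "\<psi> \<in> ring_hom (degree_zero LP) (degree_zero T.LP)"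
    by (rule ring_hom_memI) (simp_all add: psi_homog psi_add psi_one m A.D_carrier)
  show "\<psi> (r \<otimes>\<^bsub>LP\<^esub> v) = \<psi> r \<otimes>\<^bsub>T.LP\<^esub> \<psi> v" if "r \<in> homog LP 0" "v \<in> homog LP 1" for r v
    using m that A.D_carrier by blast
  show "\<psi> (v \<otimes>\<^bsub>LP\<^esub> \<tau>\<^sub>0 s) = \<psi> v \<otimes>\<^bsub>T.LP\<^esub> \<psi> s" if "v \<in> homog LP 1" "s \<in> homog LP 0" for v s
    using that by (simp only: zhang_mult_tau0 psi_mult A.D_carrier)
qed (simp add: psi_add A.D_carrier)

text \<open>The power \<open>\<sigma>^0\<close> is the identity, so on degree 0 the twisted and the
  original product coincide and the identity map is an isomorphism.\<close>

lemma degree_zero_zhang_isomorphic: "algebra_isomorphic (degree_zero Z) (degree_zero LP)"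
proof -
  have "(\<lambda>x. x) \<in> ring_iso (degree_zero Z) (degree_zero LP)"
    unfolding ring_iso_def
    by (auto simp: bij_betw_def zhang_mult_zero A.D_carrier intro!: ring_hom_memI)
  then show ?thesis by (auto simp: algebra_isomorphic_def)
qed

end

text \<open>For the untwisted algebra \<open>\<gamma>\<close> is the identity, and the pullback in
  the shift functor disappears.\<close>

lemma comp_pullback_id: "comp_functr (pullback_functor (\<lambda>x. x)) F = F"
  by (simp add: comp_functr_def pullback_functor_def)

theorem corollary3p5:
  fixes E :: "('v, 'e) pre_digraph" and \<sigma>\<^sub>0 :: "'v \<Rightarrow> 'v" and \<sigma>\<^sub>1 :: "'e \<Rightarrow> 'e"
  assumes "fin_digraph E"
    and "\<forall>v \<in> verts E. \<not> is_sink E v"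
    and "graph_automorphism E \<sigma>\<^sub>0 \<sigma>\<^sub>1"
    and "infinite (UNIV :: 'u set)"
    and "(UNIV :: 'k::field set) \<lesssim> (UNIV :: 'u set)"
  shows
    "let L = leavitt TYPE('k) E;
         \<tau> = leavitt_aut E \<sigma>\<^sub>0 \<sigma>\<^sub>1;
         L\<^sub>0 = degree_zero L;
         \<tau>\<^sub>0 = restrict \<tau> (carrier L\<^sub>0);
         ModL = (Mod_cat L\<^sub>0 :: ((('v, 'e, 'k) free_elem set, 'u) rmodule, 'u \<Rightarrow> 'u) cat);
         reg = small_copy (regular_rmodule L\<^sub>0);
         tensor = tensor_functor L\<^sub>0 (homog_bimodule L 1)
     in algebra_isomorphic (degree_zero (zhang_twist L \<tau>)) L\<^sub>0 \<and>
        triple_equiv (proj TYPE('u) (leavitt TYPE('k) (twisted_graph E \<sigma>\<^sub>0)))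
          (proj TYPE('u) (zhang_twist L \<tau>)) \<and>
        triple_equiv (proj TYPE('u) (zhang_twist L \<tau>))
          (ModL, reg, comp_functr (pullback_functor \<tau>\<^sub>0) tensor) \<and>
        triple_equiv (proj TYPE('u) L) (ModL, reg, tensor) \<and>
        pair_equiv (underlying_pair (proj TYPE('u) L))
          (underlying_pair (proj TYPE('u) (zhang_twist L \<tau>)))"
proof -
  interpret leavitt_twist E "TYPE('k)" \<sigma>\<^sub>0 \<sigma>\<^sub>1
    using assms(1-3)
    by (intro leavitt_twist.intro leavitt_twist_axioms.intro sinkless_leavitt_path_algebra.intro
        sinkless_leavitt_path_algebra_axioms.intro leavitt_path_algebra.intro) auto
  note U = assms(4) and small = LP_lepoll[OF assms(4,5)] T.LP_lepoll[OF assms(4,5)]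
  have small_Z: "carrier Z \<lesssim> (UNIV :: 'u set)" using small(1) by simp
  \<comment> \<open>One comparison theorem with the pair \<open>(\<psi>, \<gamma>)\<close> equal to
    (identity, identity), (identity, \<sigma>) and (\<open>\<psi>\<close>, \<sigma>). The last two
    end in the same triple, which links the twisted graph with the Zhang twist.\<close>
  note L = comparison.triple_equiv_proj[OF comparison_LP U small(1,1), unfolded comp_pullback_id]
    and Z = comparison.triple_equiv_proj[OF comparison_Z U small_Z small(1)]
    and E' = comparison.triple_equiv_proj[OF comparison_E' U small(2,1)]
  \<comment> \<open>The targets for \<open>L\<close> and for its Zhang twist differ only in the
    shift functor, so they have the same underlying pair, through which the two are linked.\<close>
  have "pair_equiv (underlying_pair (proj TYPE('u) LP))
      (underlying_pair (Mod_cat (degree_zero LP) :: ((('v, 'e, 'k) free_elem set, 'u) rmodule, 'u \<Rightarrow> 'u) cat,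
        small_copy (regular_rmodule (degree_zero LP)), tensor_functor (degree_zero LP) (homog_bimodule LP 1)))"
    by (rule triple_equiv_pair_equiv[OF L])
  from pair_equiv_trans[OF this]
  have pair: "pair_equiv (underlying_pair (proj TYPE('u) LP)) (underlying_pair (proj TYPE('u) Z))"
    using triple_equiv_pair_equiv[OF triple_equiv_sym[OF Z]] by (simp add: underlying_pair_def)
  show ?thesis
    unfolding Let_def degree_zero_simps
    by (intro conjI degree_zero_zhang_isomorphic triple_equiv_trans[OF E' triple_equiv_sym[OF Z]] Z L pair)
qed

end
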